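(* Let $H$ be a braided bialgebra. Consider the product $\underline m:H'\otimes H'\to H'$ defined by $\langle\underline m(f\otimes g),a\rangle:=\langle\langle f\otimes g,\Psi_{HH}^{-1}(\Delta(a))\rangle\rangle$ for $a\in H$, $f,g\in H'$ (its unit is $\varepsilon$). Let $U\subset H'$ be a non-degenerate subspace which is a unital subalgebra of $(H',\underline m,\varepsilon)$ and also a subcoalgebra of $H^{\underline\circ}$ for the coproduct $\underline\Delta$. (1) If $\Psi_{UU}$ and $\Psi_{UH}^\circ$ are bijective, then $U$ (with product $\underline m$, unit $\varepsilon$, coproduct $\underline\Delta$ and counit $f\mapsto f(1)$) is a braided bialgebra with respect to the braiding $\Psi_{UU}$, and the canonical pairing $\langle\cdot,\cdot\rangle:U\otimes H\to\mathbb K$ is a dual pairing between braided bialgebras with respect to the braiding $\Psi_{UH}^\circ$, so that $U$ becomes a left dual of $H$. (2) If $\Psi_{UU}$ and $\Psi_{HU}^\circ$ are bijective, then $U$ (with the same structure) is a braided bialgebra with respect to $\Psi_{UU}$, and the canonical pairing $\langle\cdot,\cdot\rangle:H\otimes U\to\mathbb K$ is a dual pairing between braided bialgebras with respect to the braiding $\Psi_{HU}^\circ$, so that $U$ becomes a right dual of $H$. (3) If, in (1) or (2), $H$ is moreover a braided Hopf algebra with antipode $S$ and $f\circ S\in U$ for all $f\in U$, then $U$ is a braided Hopf algebra with antipode $S(f):=f\circ S$.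
   Context: All vector spaces are over a fixed field $\mathbb K$, $\otimes$ is the algebraic tensor product, $X'$ is the full linear dual of $X$, and composition of maps is written by juxtaposition. A braiding on $V$ is a bijective linear map $\Psi_{VV}:V\otimes V\to V\otimes V$ with $(\Psi_{VV}\otimes\mathrm{id})(\mathrm{id}\otimes\Psi_{VV})(\Psi_{VV}\otimes\mathrm{id})=(\mathrm{id}\otimes\Psi_{VV})(\Psi_{VV}\otimes\mathrm{id})(\mathrm{id}\otimes\Psi_{VV})$; $V$ is then a braided vector space. Let $\Psi_{VW}:V\otimes W\to W\otimes V$ be bijective and linear. If $V$ is braided, $W$ is a left $V$-braided vector space if $(\Psi_{VW}\otimes\mathrm{id})(\mathrm{id}\otimes\Psi_{VW})(\Psi_{VV}\otimes\mathrm{id})=(\mathrm{id}\otimes\Psi_{VV})(\Psi_{VW}\otimes\mathrm{id})(\mathrm{id}\otimes\Psi_{VW})$. If $W$ is braided, $V$ is a right $W$-braided vector space if $(\mathrm{id}\otimes\Psi_{VW})(\Psi_{VW}\otimes\mathrm{id})(\mathrm{id}\otimes\Psi_{WW})=(\Psi_{WW}\otimes\mathrm{id})(\mathrm{id}\otimes\Psi_{VW})(\Psi_{VW}\otimes\mathrm{id})$. Compatibility of $\Psi=\Psi_{VW}$: with the multiplication of an algebra $V$: $\Psi(m_V\otimes\mathrm{id})=(\mathrm{id}\otimes m_V)(\Psi\otimes\mathrm{id})(\mathrm{id}\otimes\Psi)$ and $\Psi(1\otimes w)=w\otimes1$ if $1\in V$; with the multiplication of an algebra $W$: $\Psi(\mathrm{id}\otimes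 m_W)=(m_W\otimes\mathrm{id})(\mathrm{id}\otimes\Psi)(\Psi\otimes\mathrm{id})$ and $\Psi(v\otimes1)=1\otimes v$ if $1\in W$; with the comultiplication of a coalgebra $V$: $(\mathrm{id}\otimes\Delta)\Psi=(\Psi\otimes\mathrm{id})(\mathrm{id}\otimes\Psi)(\Delta\otimes\mathrm{id})$ and $(\mathrm{id}\otimes\varepsilon)\Psi=\varepsilon\otimes\mathrm{id}$; with the comultiplication of a coalgebra $W$: $(\Delta\otimes\mathrm{id})\Psi=(\mathrm{id}\otimes\Psi)(\Psi\otimes\mathrm{id})(\mathrm{id}\otimes\Delta)$ and $(\varepsilon\otimes\mathrm{id})\Psi=\mathrm{id}\otimes\varepsilon$. A braided (co)algebra is a (co)algebra with a braiding satisfying both compatibility conditions with its (co)multiplication. A braided bialgebra is a unital algebra $(H,m)$ with a coalgebra structure $(\Delta,\varepsilon)$ and a braiding $\Psi_{HH}$ making it a braided algebra and a braided coalgebra, such that the coproduct is an algebra homomorphism from $H$ to $H\otimes H$ equipped with the product $(m\otimes m)(\mathrm{id}\otimes\Psi_{HH}\otimes\mathrm{id})$, i.e. $\Delta m=(m\otimes m)(\mathrm{id}\otimes\Psi_{HH}\otimes\mathrm{id})(\Delta\otimes\Delta)$. It is a braided Hopf algebra if the identity map has a convolution inverse $S:H\to H$ (antipode), i.e. $m(S\otimes\mathrm{id})\Delta=1\varepsilon=m(\mathrm{id}\otimes S)\Delta$. Dual pairing: let $U,H$ be braided bialgebras and $\Upsilon_{UH}:U\otimes H\to H\otimes U$ a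 bijective linear map via which $H$ is left $U$-braided and $U$ is right $H$-braided, compatible with the multiplications and comultiplications of $U$ and $H$. A dual pairing between $U$ and $H$ (with respect to $\Upsilon_{UH}$) is a linear map $\langle\cdot,\cdot\rangle:U\otimes H\to\mathbb K$ with $\langle\cdot,\cdot\rangle(m\otimes\mathrm{id})=(\langle\cdot,\cdot\rangle\otimes\langle\cdot,\cdot\rangle)(\mathrm{id}\otimes\Upsilon_{UH}\otimes\mathrm{id})(\mathrm{id}\otimes\mathrm{id}\otimes\Delta)$, $\langle\cdot,\cdot\rangle(\mathrm{id}\otimes m)=(\langle\cdot,\cdot\rangle\otimes\langle\cdot,\cdot\rangle)(\mathrm{id}\otimes\Upsilon_{UH}\otimes\mathrm{id})(\Delta\otimes\mathrm{id}\otimes\mathrm{id})$, $\langle1,a\rangle=\varepsilon(a)$, $\langle h,1\rangle=\varepsilon(h)$ for $a\in H$, $h\in U$ (for a dual pairing between braided Hopf algebras one additionally requires $\langle\cdot,\cdot\rangle(S\otimes\mathrm{id})=\langle\cdot,\cdot\rangle(\mathrm{id}\otimes S)$). If it is non-degenerate, $U$ is called a left dual of $H$ and $H$ a right dual of $U$. Duality notation: $\langle f,a\rangle=\langle a,f\rangle=f(a)$ for $f\in H'$, $a\in H$. $U\subset H'$ is non-degenerate if it separates the points of $H$. Put $\langle\langle\xi\otimes\eta,x\otimes y\rangle\rangle:=\langle\xi,y\rangle\langle\eta,x\rangle$. Tensor products of spaces are embedded into duals by $(\xi\otimes\eta)(x\otimes y)=\langle\xi,x\rangle\langle\eta,y\rangle$,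 e.g. $U\otimes U\subset(H\otimes H)'$, $H\otimes U\subset(H'\otimes H)'$, $U\otimes H\subset(H\otimes H')'$. For $f,g\in U$ (or $H'$ for test elements) and $a,b\in H$ define $\Psi_{UU}(f\otimes g)(b\otimes a):=\langle\langle f\otimes g,\Psi_{HH}(a\otimes b)\rangle\rangle$, $\Psi_{UH}^\circ(g\otimes a)(f\otimes b):=\langle\langle f\otimes g,\Psi_{HH}^{-1}(a\otimes b)\rangle\rangle$ ($f\in H'$), $\Psi_{HU}^\circ(b\otimes f)(a\otimes g):=\langle\langle f\otimes g,\Psi_{HH}^{-1}(a\otimes b)\rangle\rangle$ ($g\in H'$), a priori with values in $(H\otimes H)'$, $(H'\otimes H)'$, $(H\otimes H')'$. Saying that they are bijective means that they are bijections $U\otimes U\to U\otimes U$, $U\otimes H\to H\otimes U$, $H\otimes U\to U\otimes H$, respectively. The coproduct $\underline\Delta$: for $f\in H'$, $\underline\Delta(f)$ is determined by $\langle\langle\underline\Delta(f),a\otimes b\rangle\rangle=f(m(\Psi_{HH}(a\otimes b)))$; for a subspace $C\subset H'$, $\underline\Delta(f)\in C\otimes C$ means that there is $t\in C\otimes C$ with $\langle\langle t,a\otimes b\rangle\rangle=f(m\Psi_{HH}(a\otimes b))$ for all $a,b\in H$. $H^{\underline\circ}\subset H'$ is the largest coalgebra in $H'$ with coproduct $\underline\Delta$ and counit $f\mapsto f(1)$. *)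

theory Defs
  imports Complex_Main "HOL-Library.Function_Algebras"
begin

section \<open>Vector spaces, linear maps, duals\<close>

text \<open>
  A vector space over the field \<open>'k\<close> is a subspace \<open>vset V\<close> of a type that is a vector space via
  \<open>vscale V\<close>.  Explicit carriers are needed because the tensor product and the dual below are proper
  subspaces of function types, and because the theorem is about a subspace of a dual.
  Maps between spaces are total functions of which only the values on the carrier matter.
\<close>

record ('k, 'a) vsp =
  vset :: "'a set"
  vscale :: "'k \<Rightarrow> 'a \<Rightarrow> 'a"

definition vspace :: "('k::field, 'a::ab_group_add) vsp \<Rightarrow> bool" where
  "vspace V \<longleftrightarrow> vector_space (vscale V) \<and> module.subspace (vscale V) (vset V)"

definition subsp :: "('k::field, 'a::ab_group_add) vsp \<Rightarrow> ('k, 'a) vsp \<Rightarrow> bool" where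
  "subsp U V \<longleftrightarrow> vscale U = vscale V \<and> vset U \<subseteq> vset V \<and> module.subspace (vscale V) (vset U)"

definition lin :: "('k::field, 'a::ab_group_add) vsp \<Rightarrow> ('k, 'b::ab_group_add) vsp \<Rightarrow> ('a \<Rightarrow> 'b) \<Rightarrow> bool" where
  "lin V W f \<longleftrightarrow> (\<forall>x\<in>vset V. f x \<in> vset W)
     \<and> (\<forall>x\<in>vset V. \<forall>y\<in>vset V. f (x + y) = f x + f y)
     \<and> (\<forall>c. \<forall>x\<in>vset V. f (vscale V c x) = vscale W c (f x))"

definition base :: "('k::field, 'k) vsp" where
  "base = \<lparr>vset = UNIV, vscale = (*)\<rparr>"

definition fscale :: "'k::field \<Rightarrow> ('x \<Rightarrow> 'k) \<Rightarrow> 'x \<Rightarrow> 'k" where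
  "fscale c f = (\<lambda>x. c * f x)"

definition zext :: "('k::field, 'a::ab_group_add) vsp \<Rightarrow> ('a \<Rightarrow> 'k) \<Rightarrow> 'a \<Rightarrow> 'k" where
  "zext V f = (\<lambda>x. if x \<in> vset V then f x else 0)"

text \<open>The full linear dual; a functional is represented by its extension by 0 off the carrier,
  so that equal functionals are equal functions.\<close>

definition dual :: "('k::field, 'a::ab_group_add) vsp \<Rightarrow> ('k, 'a \<Rightarrow> 'k) vsp" where
  "dual V = \<lparr>vset = {f. lin V base f \<and> zext V f = f}, vscale = fscale\<rparr>"

section \<open>Algebraic tensor products\<close>

text \<open>
  Over a field, a tensor is determined by the values that the functionals induced by bilinear
  forms take on it.  Accordingly \<open>v \<otimes> w\<close> is encoded as the evaluation \<open>\<beta> \<mapsto> \<beta> v w\<close> of bilinear forms,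
  and \<open>V \<otimes> W\<close> is the span of these evaluations.  That this is a tensor product (its universal
  property) is lemma \<open>tensor_universal\<close> below.  In particular, for a bilinear form \<open>\<beta>\<close> on \<open>V \<times> W\<close>, the
  functional on \<open>V \<otimes> W\<close> induced by \<open>\<beta>\<close> is simply \<open>t \<mapsto> t \<beta>\<close>; this is used freely to define maps on
  tensors by their values on \<open>v \<otimes> w\<close>.
\<close>

type_synonym ('k, 'a, 'b) tens = "('a \<Rightarrow> 'b \<Rightarrow> 'k) \<Rightarrow> 'k"

definition bil :: "('k::field, 'a::ab_group_add) vsp \<Rightarrow> ('k, 'b::ab_group_add) vsp \<Rightarrow> ('a \<Rightarrow> 'b \<Rightarrow> 'k) set" where
  "bil V W = {\<beta>. (\<forall>v\<in>vset V. lin W base (\<beta> v)) \<and> (\<forall>w\<in>vset W. lin V base (\<lambda>v. \<beta> v w))}"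

definition pure :: "('k::field, 'a::ab_group_add) vsp \<Rightarrow> ('k, 'b::ab_group_add) vsp \<Rightarrow> 'a \<Rightarrow> 'b \<Rightarrow> ('k, 'a, 'b) tens" where
  "pure V W v w = (\<lambda>\<beta>. if \<beta> \<in> bil V W then \<beta> v w else 0)"

definition tensor :: "('k::field, 'a::ab_group_add) vsp \<Rightarrow> ('k, 'b::ab_group_add) vsp \<Rightarrow> ('k, ('k, 'a, 'b) tens) vsp"
    (infixr "\<otimes>" 70) where
  "V \<otimes> W = \<lparr>vset = module.span fscale {pure V W v w | v w. v \<in> vset V \<and> w \<in> vset W},
            vscale = fscale\<rparr>"

text \<open>\<open>tmap V W f g\<close> is \<open>f \<otimes> g\<close>, for linear \<open>f\<close> and \<open>g\<close> with \<^emph>\<open>codomains\<close> \<open>V\<close> and \<open>W\<close>.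
  The maps \<open>assoc\<close>, \<open>associ\<close>, \<open>lunit\<close>, \<open>runit\<close> are the identifications
  \<open>(A \<otimes> B) \<otimes> C = A \<otimes> (B \<otimes> C)\<close> and \<open>K \<otimes> V = V = V \<otimes> K\<close>, usually suppressed in writing.\<close>

definition tmap :: "('k::field, 'a2::ab_group_add) vsp \<Rightarrow> ('k, 'b2::ab_group_add) vsp
    \<Rightarrow> ('a \<Rightarrow> 'a2) \<Rightarrow> ('b \<Rightarrow> 'b2) \<Rightarrow> ('k, 'a, 'b) tens \<Rightarrow> ('k, 'a2, 'b2) tens" where
  "tmap V W f g t = (\<lambda>\<beta>. if \<beta> \<in> bil V W then t (\<lambda>v w. \<beta> (f v) (g w)) else 0)"

definition assoc :: "('k::field, 'a::ab_group_add) vsp \<Rightarrow> ('k, 'b::ab_group_add) vsp \<Rightarrow> ('k, 'c::ab_group_add) vsp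
    \<Rightarrow> ('k, ('k, 'a, 'b) tens, 'c) tens \<Rightarrow> ('k, 'a, ('k, 'b, 'c) tens) tens" where
  "assoc A B C t =
     (\<lambda>\<beta>. if \<beta> \<in> bil A (B \<otimes> C) then t (\<lambda>s c. s (\<lambda>a b. \<beta> a (pure B C b c))) else 0)"

definition associ :: "('k::field, 'a::ab_group_add) vsp \<Rightarrow> ('k, 'b::ab_group_add) vsp \<Rightarrow> ('k, 'c::ab_group_add) vsp
    \<Rightarrow> ('k, 'a, ('k, 'b, 'c) tens) tens \<Rightarrow> ('k, ('k, 'a, 'b) tens, 'c) tens" where
  "associ A B C t =
     (\<lambda>\<beta>. if \<beta> \<in> bil (A \<otimes> B) C then t (\<lambda>a s. s (\<lambda>b c. \<beta> (pure A B a b) c)) else 0)"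

definition lunit :: "('k::field, 'a::ab_group_add) vsp \<Rightarrow> ('k, 'k, 'a) tens \<Rightarrow> 'a" where
  "lunit V = inv_into (vset V) (\<lambda>v. pure base V 1 v)"

definition runit :: "('k::field, 'a::ab_group_add) vsp \<Rightarrow> ('k, 'a, 'k) tens \<Rightarrow> 'a" where
  "runit V = inv_into (vset V) (\<lambda>v. pure V base v 1)"

text \<open>\<open>\<Psi> \<otimes> id\<close> and \<open>id \<otimes> \<Psi>\<close> on the right-nested \<open>A \<otimes> B \<otimes> C\<close>, for \<open>\<Psi> : A \<otimes> B \<rightarrow> B \<otimes> A\<close> and
  \<open>\<Psi> : B \<otimes> C \<rightarrow> C \<otimes> B\<close> respectively, and
  \<open>id \<otimes> \<Psi> \<otimes> id : (A \<otimes> B) \<otimes> (C \<otimes> D) \<rightarrow> (A \<otimes> C) \<otimes> (B \<otimes> D)\<close>.\<close>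

definition braidL :: "('k::field, 'a::ab_group_add) vsp \<Rightarrow> ('k, 'b::ab_group_add) vsp \<Rightarrow> ('k, 'c::ab_group_add) vsp
    \<Rightarrow> (('k, 'a, 'b) tens \<Rightarrow> ('k, 'b, 'a) tens)
    \<Rightarrow> ('k, 'a, ('k, 'b, 'c) tens) tens \<Rightarrow> ('k, 'b, ('k, 'a, 'c) tens) tens" where
  "braidL A B C \<Psi> t = assoc B A C (tmap (B \<otimes> A) C \<Psi> id (associ A B C t))"

definition braidR :: "('k::field, 'a::ab_group_add) vsp \<Rightarrow> ('k, 'b::ab_group_add) vsp \<Rightarrow> ('k, 'c::ab_group_add) vsp
    \<Rightarrow> (('k, 'b, 'c) tens \<Rightarrow> ('k, 'c, 'b) tens)
    \<Rightarrow> ('k, 'a, ('k, 'b, 'c) tens) tens \<Rightarrow> ('k, 'a, ('k, 'c, 'b) tens) tens" where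
  "braidR A B C \<Psi> t = tmap A (C \<otimes> B) id \<Psi> t"

definition braidM :: "('k::field, 'a::ab_group_add) vsp \<Rightarrow> ('k, 'b::ab_group_add) vsp
    \<Rightarrow> ('k, 'c::ab_group_add) vsp \<Rightarrow> ('k, 'd::ab_group_add) vsp
    \<Rightarrow> (('k, 'b, 'c) tens \<Rightarrow> ('k, 'c, 'b) tens)
    \<Rightarrow> ('k, ('k, 'a, 'b) tens, ('k, 'c, 'd) tens) tens
    \<Rightarrow> ('k, ('k, 'a, 'c) tens, ('k, 'b, 'd) tens) tens" where
  "braidM A B C D \<Psi> t =
     associ A C (B \<otimes> D) (tmap A (C \<otimes> B \<otimes> D) id (braidL B C D \<Psi>) (assoc A B (C \<otimes> D) t))"

section \<open>Braided vector spaces\<close>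

definition bij_lin :: "('k::field, 'a::ab_group_add) vsp \<Rightarrow> ('k, 'b::ab_group_add) vsp \<Rightarrow> ('a \<Rightarrow> 'b) \<Rightarrow> bool" where
  "bij_lin V W f \<longleftrightarrow> lin V W f \<and> bij_betw f (vset V) (vset W)"

definition braided_space :: "('k::field, 'a::ab_group_add) vsp \<Rightarrow> (('k, 'a, 'a) tens \<Rightarrow> ('k, 'a, 'a) tens) \<Rightarrow> bool" where
  "braided_space V \<Psi> \<longleftrightarrow> vspace V \<and> bij_lin (V \<otimes> V) (V \<otimes> V) \<Psi> \<and>
     (\<forall>t\<in>vset (V \<otimes> V \<otimes> V).
        braidL V V V \<Psi> (braidR V V V \<Psi> (braidL V V V \<Psi> t)) =
        braidR V V V \<Psi> (braidL V V V \<Psi> (braidR V V V \<Psi> t)))"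

text \<open>\<open>left_braided V \<Psi>V W \<Psi>\<close>: the space \<open>W\<close> is left \<open>(V, \<Psi>V)\<close>-braided via \<open>\<Psi> : V \<otimes> W \<rightarrow> W \<otimes> V\<close>;
  \<open>right_braided V W \<Psi>W \<Psi>\<close>: the space \<open>V\<close> is right \<open>(W, \<Psi>W)\<close>-braided via \<open>\<Psi>\<close>.\<close>

definition left_braided :: "('k::field, 'a::ab_group_add) vsp \<Rightarrow> (('k, 'a, 'a) tens \<Rightarrow> ('k, 'a, 'a) tens)
    \<Rightarrow> ('k, 'b::ab_group_add) vsp \<Rightarrow> (('k, 'a, 'b) tens \<Rightarrow> ('k, 'b, 'a) tens) \<Rightarrow> bool" where
  "left_braided V \<Psi>V W \<Psi> \<longleftrightarrow> braided_space V \<Psi>V \<and> vspace W \<and> bij_lin (V \<otimes> W) (W \<otimes> V) \<Psi> \<and>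
     (\<forall>t\<in>vset (V \<otimes> V \<otimes> W).
        braidL V W V \<Psi> (braidR V V W \<Psi> (braidL V V W \<Psi>V t)) =
        braidR W V V \<Psi>V (braidL V W V \<Psi> (braidR V V W \<Psi> t)))"

definition right_braided :: "('k::field, 'a::ab_group_add) vsp \<Rightarrow> ('k, 'b::ab_group_add) vsp
    \<Rightarrow> (('k, 'b, 'b) tens \<Rightarrow> ('k, 'b, 'b) tens) \<Rightarrow> (('k, 'a, 'b) tens \<Rightarrow> ('k, 'b, 'a) tens) \<Rightarrow> bool" where
  "right_braided V W \<Psi>W \<Psi> \<longleftrightarrow> braided_space W \<Psi>W \<and> vspace V \<and> bij_lin (V \<otimes> W) (W \<otimes> V) \<Psi> \<and>
     (\<forall>t\<in>vset (V \<otimes> W \<otimes> W).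
        braidR W V W \<Psi> (braidL V W W \<Psi> (braidR V W W \<Psi>W t)) =
        braidL W W V \<Psi>W (braidR W V W \<Psi> (braidL V W W \<Psi> t)))"

section \<open>Braided bialgebras and Hopf algebras\<close>

definition unital_algebra :: "('k::field, 'a::ab_group_add) vsp \<Rightarrow> (('k, 'a, 'a) tens \<Rightarrow> 'a) \<Rightarrow> 'a \<Rightarrow> bool" where
  "unital_algebra V m e \<longleftrightarrow> vspace V \<and> lin (V \<otimes> V) V m \<and> e \<in> vset V \<and>
     (\<forall>t\<in>vset (V \<otimes> V \<otimes> V). m (tmap V V m id (associ V V V t)) = m (tmap V V id m t)) \<and>
     (\<forall>v\<in>vset V. m (pure V V e v) = v \<and> m (pure V V v e) = v)"

definition coalgebra :: "('k::field, 'a::ab_group_add) vsp \<Rightarrow> ('a \<Rightarrow> ('k, 'a, 'a) tens) \<Rightarrow> ('a \<Rightarrow> 'k) \<Rightarrow> bool" where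
  "coalgebra V \<Delta> \<epsilon> \<longleftrightarrow> vspace V \<and> lin V (V \<otimes> V) \<Delta> \<and> lin V base \<epsilon> \<and>
     (\<forall>v\<in>vset V. assoc V V V (tmap (V \<otimes> V) V \<Delta> id (\<Delta> v)) = tmap V (V \<otimes> V) id \<Delta> (\<Delta> v)) \<and>
     (\<forall>v\<in>vset V. lunit V (tmap base V \<epsilon> id (\<Delta> v)) = v \<and> runit V (tmap V base id \<epsilon> (\<Delta> v)) = v)"

text \<open>Compatibility of \<open>\<Psi> : V \<otimes> W \<rightarrow> W \<otimes> V\<close> with the (unital) multiplication, respectively the
  comultiplication, of \<open>V\<close> (suffix \<open>1\<close>) and of \<open>W\<close> (suffix \<open>2\<close>).\<close>

definition compat_mult1 :: "('k::field, 'a::ab_group_add) vsp \<Rightarrow> (('k, 'a, 'a) tens \<Rightarrow> 'a) \<Rightarrow> 'a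
    \<Rightarrow> ('k, 'b::ab_group_add) vsp \<Rightarrow> (('k, 'a, 'b) tens \<Rightarrow> ('k, 'b, 'a) tens) \<Rightarrow> bool" where
  "compat_mult1 V m e W \<Psi> \<longleftrightarrow>
     (\<forall>t\<in>vset (V \<otimes> V \<otimes> W).
        \<Psi> (tmap V W m id (associ V V W t)) =
        tmap W V id m (braidL V W V \<Psi> (braidR V V W \<Psi> t))) \<and>
     (\<forall>w\<in>vset W. \<Psi> (pure V W e w) = pure W V w e)"

definition compat_mult2 :: "('k::field, 'a::ab_group_add) vsp \<Rightarrow> ('k, 'b::ab_group_add) vsp
    \<Rightarrow> (('k, 'b, 'b) tens \<Rightarrow> 'b) \<Rightarrow> 'b \<Rightarrow> (('k, 'a, 'b) tens \<Rightarrow> ('k, 'b, 'a) tens) \<Rightarrow> bool" where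
  "compat_mult2 V W m e \<Psi> \<longleftrightarrow>
     (\<forall>t\<in>vset (V \<otimes> W \<otimes> W).
        \<Psi> (tmap V W id m t) =
        tmap W V m id (associ W W V (braidR W V W \<Psi> (braidL V W W \<Psi> t)))) \<and>
     (\<forall>v\<in>vset V. \<Psi> (pure V W v e) = pure W V e v)"

definition compat_comult1 :: "('k::field, 'a::ab_group_add) vsp \<Rightarrow> ('a \<Rightarrow> ('k, 'a, 'a) tens) \<Rightarrow> ('a \<Rightarrow> 'k)
    \<Rightarrow> ('k, 'b::ab_group_add) vsp \<Rightarrow> (('k, 'a, 'b) tens \<Rightarrow> ('k, 'b, 'a) tens) \<Rightarrow> bool" where
  "compat_comult1 V \<Delta> \<epsilon> W \<Psi> \<longleftrightarrow>
     (\<forall>t\<in>vset (V \<otimes> W).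
        tmap W (V \<otimes> V) id \<Delta> (\<Psi> t) =
        braidL V W V \<Psi> (braidR V V W \<Psi> (assoc V V W (tmap (V \<otimes> V) W \<Delta> id t)))) \<and>
     (\<forall>t\<in>vset (V \<otimes> W). runit W (tmap W base id \<epsilon> (\<Psi> t)) = lunit W (tmap base W \<epsilon> id t))"

definition compat_comult2 :: "('k::field, 'a::ab_group_add) vsp \<Rightarrow> ('k, 'b::ab_group_add) vsp
    \<Rightarrow> ('b \<Rightarrow> ('k, 'b, 'b) tens) \<Rightarrow> ('b \<Rightarrow> 'k) \<Rightarrow> (('k, 'a, 'b) tens \<Rightarrow> ('k, 'b, 'a) tens) \<Rightarrow> bool" where
  "compat_comult2 V W \<Delta> \<epsilon> \<Psi> \<longleftrightarrow>
     (\<forall>t\<in>vset (V \<otimes> W).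
        assoc W W V (tmap (W \<otimes> W) V \<Delta> id (\<Psi> t)) =
        braidR W V W \<Psi> (braidL V W W \<Psi> (tmap V (W \<otimes> W) id \<Delta> t))) \<and>
     (\<forall>t\<in>vset (V \<otimes> W). lunit V (tmap base V \<epsilon> id (\<Psi> t)) = runit V (tmap V base id \<epsilon> t))"

definition braided_algebra :: "('k::field, 'a::ab_group_add) vsp \<Rightarrow> (('k, 'a, 'a) tens \<Rightarrow> 'a) \<Rightarrow> 'a
    \<Rightarrow> (('k, 'a, 'a) tens \<Rightarrow> ('k, 'a, 'a) tens) \<Rightarrow> bool" where
  "braided_algebra V m e \<Psi> \<longleftrightarrow> unital_algebra V m e \<and> braided_space V \<Psi> \<and>
     compat_mult1 V m e V \<Psi> \<and> compat_mult2 V V m e \<Psi>"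

definition braided_coalgebra :: "('k::field, 'a::ab_group_add) vsp \<Rightarrow> ('a \<Rightarrow> ('k, 'a, 'a) tens) \<Rightarrow> ('a \<Rightarrow> 'k)
    \<Rightarrow> (('k, 'a, 'a) tens \<Rightarrow> ('k, 'a, 'a) tens) \<Rightarrow> bool" where
  "braided_coalgebra V \<Delta> \<epsilon> \<Psi> \<longleftrightarrow> coalgebra V \<Delta> \<epsilon> \<and> braided_space V \<Psi> \<and>
     compat_comult1 V \<Delta> \<epsilon> V \<Psi> \<and> compat_comult2 V V \<Delta> \<epsilon> \<Psi>"

text \<open>That the coproduct is an algebra homomorphism means precisely
  \<open>\<Delta> m = (m \<otimes> m)(id \<otimes> \<Psi> \<otimes> id)(\<Delta> \<otimes> \<Delta>)\<close>; no further conditions (such as \<open>\<Delta> 1 = 1 \<otimes> 1\<close> or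
  multiplicativity of \<open>\<epsilon>\<close>) are part of the notion used here.\<close>

definition braided_bialgebra :: "('k::field, 'a::ab_group_add) vsp \<Rightarrow> (('k, 'a, 'a) tens \<Rightarrow> 'a) \<Rightarrow> 'a
    \<Rightarrow> ('a \<Rightarrow> ('k, 'a, 'a) tens) \<Rightarrow> ('a \<Rightarrow> 'k) \<Rightarrow> (('k, 'a, 'a) tens \<Rightarrow> ('k, 'a, 'a) tens) \<Rightarrow> bool" where
  "braided_bialgebra H m e \<Delta> \<epsilon> \<Psi> \<longleftrightarrow>
     braided_algebra H m e \<Psi> \<and> braided_coalgebra H \<Delta> \<epsilon> \<Psi> \<and>
     (\<forall>t\<in>vset (H \<otimes> H).
        \<Delta> (m t) = tmap H H m m (braidM H H H H \<Psi> (tmap (H \<otimes> H) (H \<otimes> H) \<Delta> \<Delta> t)))"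

definition antipode :: "('k::field, 'a::ab_group_add) vsp \<Rightarrow> (('k, 'a, 'a) tens \<Rightarrow> 'a) \<Rightarrow> 'a
    \<Rightarrow> ('a \<Rightarrow> ('k, 'a, 'a) tens) \<Rightarrow> ('a \<Rightarrow> 'k) \<Rightarrow> ('a \<Rightarrow> 'a) \<Rightarrow> bool" where
  "antipode H m e \<Delta> \<epsilon> S \<longleftrightarrow> lin H H S \<and>
     (\<forall>a\<in>vset H. m (tmap H H S id (\<Delta> a)) = vscale H (\<epsilon> a) e \<and>
                 m (tmap H H id S (\<Delta> a)) = vscale H (\<epsilon> a) e)"

definition braided_hopf_algebra :: "('k::field, 'a::ab_group_add) vsp \<Rightarrow> (('k, 'a, 'a) tens \<Rightarrow> 'a) \<Rightarrow> 'a
    \<Rightarrow> ('a \<Rightarrow> ('k, 'a, 'a) tens) \<Rightarrow> ('a \<Rightarrow> 'k) \<Rightarrow> (('k, 'a, 'a) tens \<Rightarrow> ('k, 'a, 'a) tens)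
    \<Rightarrow> ('a \<Rightarrow> 'a) \<Rightarrow> bool" where
  "braided_hopf_algebra H m e \<Delta> \<epsilon> \<Psi> S \<longleftrightarrow>
     braided_bialgebra H m e \<Delta> \<epsilon> \<Psi> \<and> antipode H m e \<Delta> \<epsilon> S"

section \<open>Dual pairings\<close>

text \<open>A pairing is a linear functional \<open>p\<close> on \<open>U \<otimes> H\<close>; \<open>(p \<otimes> p) t\<close> is \<open>t (\<lambda>s s'. p s * p s')\<close>.\<close>

definition dual_pairing :: "
    ('k::field, 'u::ab_group_add) vsp \<Rightarrow> (('k, 'u, 'u) tens \<Rightarrow> 'u) \<Rightarrow> 'u
    \<Rightarrow> ('u \<Rightarrow> ('k, 'u, 'u) tens) \<Rightarrow> ('u \<Rightarrow> 'k) \<Rightarrow> (('k, 'u, 'u) tens \<Rightarrow> ('k, 'u, 'u) tens)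
    \<Rightarrow> ('k, 'h::ab_group_add) vsp \<Rightarrow> (('k, 'h, 'h) tens \<Rightarrow> 'h) \<Rightarrow> 'h
    \<Rightarrow> ('h \<Rightarrow> ('k, 'h, 'h) tens) \<Rightarrow> ('h \<Rightarrow> 'k) \<Rightarrow> (('k, 'h, 'h) tens \<Rightarrow> ('k, 'h, 'h) tens)
    \<Rightarrow> (('k, 'u, 'h) tens \<Rightarrow> ('k, 'h, 'u) tens) \<Rightarrow> (('k, 'u, 'h) tens \<Rightarrow> 'k) \<Rightarrow> bool" where
  "dual_pairing U mU eU \<Delta>U \<epsilon>U \<Psi>U H mH eH \<Delta>H \<epsilon>H \<Psi>H \<Upsilon> p \<longleftrightarrow>
     braided_bialgebra U mU eU \<Delta>U \<epsilon>U \<Psi>U \<and> braided_bialgebra H mH eH \<Delta>H \<epsilon>H \<Psi>H \<and>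
     left_braided U \<Psi>U H \<Upsilon> \<and> right_braided U H \<Psi>H \<Upsilon> \<and>
     compat_mult1 U mU eU H \<Upsilon> \<and> compat_mult2 U H mH eH \<Upsilon> \<and>
     compat_comult1 U \<Delta>U \<epsilon>U H \<Upsilon> \<and> compat_comult2 U H \<Delta>H \<epsilon>H \<Upsilon> \<and>
     lin (U \<otimes> H) base p \<and>
     (\<forall>t\<in>vset ((U \<otimes> U) \<otimes> H).
        p (tmap U H mU id t) =
        braidM U U H H \<Upsilon> (tmap (U \<otimes> U) (H \<otimes> H) id \<Delta>H t) (\<lambda>s s'. p s * p s')) \<and>
     (\<forall>t\<in>vset (U \<otimes> (H \<otimes> H)).
        p (tmap U H id mH t) =
        braidM U U H H \<Upsilon> (tmap (U \<otimes> U) (H \<otimes> H) \<Delta>U id t) (\<lambda>s s'. p s * p s')) \<and>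
     (\<forall>a\<in>vset H. p (pure U H eU a) = \<epsilon>H a) \<and>
     (\<forall>h\<in>vset U. p (pure U H h eH) = \<epsilon>U h)"

definition nondegenerate :: "('k::field, 'u::ab_group_add) vsp \<Rightarrow> ('k, 'h::ab_group_add) vsp
    \<Rightarrow> (('k, 'u, 'h) tens \<Rightarrow> 'k) \<Rightarrow> bool" where
  "nondegenerate U H p \<longleftrightarrow>
     (\<forall>u\<in>vset U. (\<forall>h\<in>vset H. p (pure U H u h) = 0) \<longrightarrow> u = 0) \<and>
     (\<forall>h\<in>vset H. (\<forall>u\<in>vset U. p (pure U H u h) = 0) \<longrightarrow> h = 0)"

section \<open>Structures on subspaces of the dual\<close>

text \<open>\<open>dpair t x\<close> is \<open>\<langle>\<langle>t, x\<rangle>\<rangle>\<close>, i.e. \<open>\<langle>\<langle>\<xi> \<otimes> \<eta>, x \<otimes> y\<rangle>\<rangle> = \<langle>\<xi>, y\<rangle>\<langle>\<eta>, x\<rangle>\<close>.\<close>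

definition dpair :: "('k::field, 'h \<Rightarrow> 'k, 'h \<Rightarrow> 'k) tens \<Rightarrow> ('k, 'h, 'h) tens \<Rightarrow> 'k" where
  "dpair t x = t (\<lambda>\<xi> \<eta>. x (\<lambda>a b. \<xi> b * \<eta> a))"

definition ev :: "('h \<Rightarrow> 'k) \<Rightarrow> 'h \<Rightarrow> 'k" where "ev f a = f a"
definition ve :: "'h \<Rightarrow> ('h \<Rightarrow> 'k) \<Rightarrow> 'k" where "ve a f = f a"

text \<open>The embedding of tensors into \<open>(X \<otimes> Y)'\<close>: \<open>(\<xi> \<otimes> \<eta>)(x \<otimes> y) = p \<xi> x * q \<eta> y\<close>, where \<open>p\<close> and
  \<open>q\<close> are the evaluation pairings \<open>ev\<close> or \<open>ve\<close>.\<close>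

definition temb :: "('k::field, 'x::ab_group_add) vsp \<Rightarrow> ('k, 'y::ab_group_add) vsp
    \<Rightarrow> ('v \<Rightarrow> 'x \<Rightarrow> 'k) \<Rightarrow> ('w \<Rightarrow> 'y \<Rightarrow> 'k) \<Rightarrow> ('k, 'v, 'w) tens \<Rightarrow> ('k, 'x, 'y) tens \<Rightarrow> 'k" where
  "temb X Y p q t = zext (X \<otimes> Y) (\<lambda>s. t (\<lambda>\<xi> \<eta>. s (\<lambda>x y. p \<xi> x * q \<eta> y)))"

definition emb_UU :: "('k::field, 'h::ab_group_add) vsp
    \<Rightarrow> ('k, 'h \<Rightarrow> 'k, 'h \<Rightarrow> 'k) tens \<Rightarrow> ('k, 'h, 'h) tens \<Rightarrow> 'k" where
  "emb_UU H = temb H H ev ev"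

definition emb_HU :: "('k::field, 'h::ab_group_add) vsp
    \<Rightarrow> ('k, 'h, 'h \<Rightarrow> 'k) tens \<Rightarrow> ('k, 'h \<Rightarrow> 'k, 'h) tens \<Rightarrow> 'k" where
  "emb_HU H = temb (dual H) H ve ev"

definition emb_UH :: "('k::field, 'h::ab_group_add) vsp
    \<Rightarrow> ('k, 'h \<Rightarrow> 'k, 'h) tens \<Rightarrow> ('k, 'h, 'h \<Rightarrow> 'k) tens \<Rightarrow> 'k" where
  "emb_UH H = temb H (dual H) ev ve"

definition tinv :: "('k::field, 'h::ab_group_add) vsp \<Rightarrow> (('k, 'h, 'h) tens \<Rightarrow> ('k, 'h, 'h) tens)
    \<Rightarrow> ('k, 'h, 'h) tens \<Rightarrow> ('k, 'h, 'h) tens" where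
  "tinv H \<Psi> = inv_into (vset (H \<otimes> H)) \<Psi>"

text \<open>The maps \<open>\<Psi>\<^bsub>UU\<^esub>\<close>, \<open>\<Psi>\<^bsub>UH\<^esub>\<degree>\<close>, \<open>\<Psi>\<^bsub>HU\<^esub>\<degree>\<close> with their a priori values in \<open>(H \<otimes> H)'\<close>,
  \<open>(H' \<otimes> H)'\<close>, \<open>(H \<otimes> H')'\<close>:
  \<open>\<Psi>\<^bsub>UU\<^esub>(t)(b \<otimes> a) = \<langle>\<langle>t, \<Psi>(a \<otimes> b)\<rangle>\<rangle>\<close>,
  \<open>\<Psi>\<^bsub>UH\<^esub>\<degree>(g \<otimes> a)(f \<otimes> b) = \<langle>\<langle>f \<otimes> g, \<Psi>\<^sup>-\<^sup>1(a \<otimes> b)\<rangle>\<rangle> = \<Psi>\<^bsub>HU\<^esub>\<degree>(b \<otimes> f)(a \<otimes> g)\<close>.\<close>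

definition Psi_UU :: "('k::field, 'h::ab_group_add) vsp \<Rightarrow> (('k, 'h, 'h) tens \<Rightarrow> ('k, 'h, 'h) tens)
    \<Rightarrow> ('k, 'h \<Rightarrow> 'k, 'h \<Rightarrow> 'k) tens \<Rightarrow> ('k, 'h, 'h) tens \<Rightarrow> 'k" where
  "Psi_UU H \<Psi> t = zext (H \<otimes> H) (\<lambda>s. s (\<lambda>b a. dpair t (\<Psi> (pure H H a b))))"

definition Psi_UH :: "('k::field, 'h::ab_group_add) vsp \<Rightarrow> (('k, 'h, 'h) tens \<Rightarrow> ('k, 'h, 'h) tens)
    \<Rightarrow> ('k, 'h \<Rightarrow> 'k) vsp \<Rightarrow> ('k, 'h \<Rightarrow> 'k, 'h) tens \<Rightarrow> ('k, 'h \<Rightarrow> 'k, 'h) tens \<Rightarrow> 'k" where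
  "Psi_UH H \<Psi> U t = zext (dual H \<otimes> H)
     (\<lambda>s. s (\<lambda>f b. t (\<lambda>g a. dpair (pure (dual H) U f g) (tinv H \<Psi> (pure H H a b)))))"

definition Psi_HU :: "('k::field, 'h::ab_group_add) vsp \<Rightarrow> (('k, 'h, 'h) tens \<Rightarrow> ('k, 'h, 'h) tens)
    \<Rightarrow> ('k, 'h \<Rightarrow> 'k) vsp \<Rightarrow> ('k, 'h, 'h \<Rightarrow> 'k) tens \<Rightarrow> ('k, 'h, 'h \<Rightarrow> 'k) tens \<Rightarrow> 'k" where
  "Psi_HU H \<Psi> U t = zext (H \<otimes> dual H)
     (\<lambda>s. s (\<lambda>a g. t (\<lambda>b f. dpair (pure U (dual H) f g) (tinv H \<Psi> (pure H H a b)))))"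

text \<open>Bijectivity refers to the images of \<open>U \<otimes> U\<close>, \<open>H \<otimes> U\<close>, \<open>U \<otimes> H\<close> under the embeddings above; once
  it holds, \<open>braid_UU\<close>, \<open>braid_UH\<close>, \<open>braid_HU\<close> are the same maps with values in these tensor
  products themselves.\<close>

definition Psi_UU_bij where
  "Psi_UU_bij H \<Psi> U \<longleftrightarrow> bij_betw (Psi_UU H \<Psi>) (vset (U \<otimes> U)) (emb_UU H ` vset (U \<otimes> U))"

definition Psi_UH_bij where
  "Psi_UH_bij H \<Psi> U \<longleftrightarrow> bij_betw (Psi_UH H \<Psi> U) (vset (U \<otimes> H)) (emb_HU H ` vset (H \<otimes> U))"

definition Psi_HU_bij where
  "Psi_HU_bij H \<Psi> U \<longleftrightarrow> bij_betw (Psi_HU H \<Psi> U) (vset (H \<otimes> U)) (emb_UH H ` vset (U \<otimes> H))"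

definition braid_UU where
  "braid_UU H \<Psi> U t = inv_into (vset (U \<otimes> U)) (emb_UU H) (Psi_UU H \<Psi> t)"

definition braid_UH where
  "braid_UH H \<Psi> U t = inv_into (vset (H \<otimes> U)) (emb_HU H) (Psi_UH H \<Psi> U t)"

definition braid_HU where
  "braid_HU H \<Psi> U t = inv_into (vset (U \<otimes> H)) (emb_UH H) (Psi_HU H \<Psi> U t)"

text \<open>The product \<open>\<langle>m'(f \<otimes> g), a\<rangle> = \<langle>\<langle>f \<otimes> g, \<Psi>\<^sup>-\<^sup>1(\<Delta> a)\<rangle>\<rangle>\<close>, for tensors over \<open>H'\<close> or over a subspace.\<close>

definition dual_mult :: "('k::field, 'h::ab_group_add) vsp \<Rightarrow> ('h \<Rightarrow> ('k, 'h, 'h) tens)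
    \<Rightarrow> (('k, 'h, 'h) tens \<Rightarrow> ('k, 'h, 'h) tens) \<Rightarrow> ('k, 'h \<Rightarrow> 'k, 'h \<Rightarrow> 'k) tens \<Rightarrow> 'h \<Rightarrow> 'k" where
  "dual_mult H \<Delta> \<Psi> t = zext H (\<lambda>a. dpair t (tinv H \<Psi> (\<Delta> a)))"

text \<open>\<open>is_dual_comult H m \<Psi> C f t\<close>: the tensor \<open>t \<in> C \<otimes> C\<close> is the coproduct of \<open>f\<close>, i.e.
  \<open>\<langle>\<langle>t, a \<otimes> b\<rangle>\<rangle> = f(m(\<Psi>(a \<otimes> b)))\<close>.\<close>

definition is_dual_comult :: "('k::field, 'h::ab_group_add) vsp \<Rightarrow> (('k, 'h, 'h) tens \<Rightarrow> 'h)
    \<Rightarrow> (('k, 'h, 'h) tens \<Rightarrow> ('k, 'h, 'h) tens) \<Rightarrow> ('k, 'h \<Rightarrow> 'k) vsp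
    \<Rightarrow> ('h \<Rightarrow> 'k) \<Rightarrow> ('k, 'h \<Rightarrow> 'k, 'h \<Rightarrow> 'k) tens \<Rightarrow> bool" where
  "is_dual_comult H m \<Psi> C f t \<longleftrightarrow> t \<in> vset (C \<otimes> C) \<and>
     (\<forall>a\<in>vset H. \<forall>b\<in>vset H. dpair t (pure H H a b) = f (m (\<Psi> (pure H H a b))))"

definition dual_comult :: "('k::field, 'h::ab_group_add) vsp \<Rightarrow> (('k, 'h, 'h) tens \<Rightarrow> 'h)
    \<Rightarrow> (('k, 'h, 'h) tens \<Rightarrow> ('k, 'h, 'h) tens) \<Rightarrow> ('k, 'h \<Rightarrow> 'k) vsp
    \<Rightarrow> ('h \<Rightarrow> 'k) \<Rightarrow> ('k, 'h \<Rightarrow> 'k, 'h \<Rightarrow> 'k) tens" where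
  "dual_comult H m \<Psi> C f = (THE t. is_dual_comult H m \<Psi> C f t)"

definition dual_counit :: "'h \<Rightarrow> ('h \<Rightarrow> 'k) \<Rightarrow> 'k" where
  "dual_counit e f = f e"

definition dual_coalgebra where
  "dual_coalgebra H m e \<Psi> C \<longleftrightarrow> subsp C (dual H) \<and>
     (\<forall>f\<in>vset C. \<exists>t. is_dual_comult H m \<Psi> C f t) \<and>
     coalgebra C (dual_comult H m \<Psi> C) (dual_counit e)"

definition H_circ :: "('k::field, 'h::ab_group_add) vsp \<Rightarrow> (('k, 'h, 'h) tens \<Rightarrow> 'h) \<Rightarrow> 'h
    \<Rightarrow> (('k, 'h, 'h) tens \<Rightarrow> ('k, 'h, 'h) tens) \<Rightarrow> ('h \<Rightarrow> 'k) set" where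
  "H_circ H m e \<Psi> = (GREATEST C. dual_coalgebra H m e \<Psi> \<lparr>vset = C, vscale = fscale\<rparr>)"

definition subcoalgebra_H_circ where
  "subcoalgebra_H_circ H m e \<Psi> U \<longleftrightarrow> subsp U \<lparr>vset = H_circ H m e \<Psi>, vscale = fscale\<rparr> \<and>
     (\<forall>f\<in>vset U. \<exists>t. is_dual_comult H m \<Psi> U f t)"

definition unital_subalgebra_dual where
  "unital_subalgebra_dual H \<Delta> \<epsilon> \<Psi> U \<longleftrightarrow> subsp U (dual H) \<and> zext H \<epsilon> \<in> vset U \<and>
     (\<forall>f\<in>vset U. \<forall>g\<in>vset U. dual_mult H \<Delta> \<Psi> (pure (dual H) (dual H) f g) \<in> vset U)"

definition separates_points where
  "separates_points U H \<longleftrightarrow>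
     (\<forall>a\<in>vset H. \<forall>b\<in>vset H. a \<noteq> b \<longrightarrow> (\<exists>f\<in>vset U. f a \<noteq> f b))"

text \<open>The canonical pairings \<open>U \<otimes> H \<rightarrow> K\<close> and \<open>H \<otimes> U \<rightarrow> K\<close>.\<close>

definition pair_UH :: "('k, 'h \<Rightarrow> 'k, 'h) tens \<Rightarrow> 'k" where
  "pair_UH t = t ev"

definition pair_HU :: "('k, 'h, 'h \<Rightarrow> 'k) tens \<Rightarrow> 'k" where
  "pair_HU t = t ve"

section \<open>The universal property of the tensor product\<close>

lemma vector_space_fscale: "vector_space (fscale :: 'k::field \<Rightarrow> ('x \<Rightarrow> 'k) \<Rightarrow> _)"
  by unfold_locales (auto simp: fscale_def fun_eq_iff algebra_simps)

interpretation fs: vector_space "fscale :: 'k::field \<Rightarrow> ('x \<Rightarrow> 'k) \<Rightarrow> _"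
  by (rule vector_space_fscale)

lemma vspace_dual: "vspace (dual V)"
  unfolding vspace_def dual_def
  by (auto simp: vector_space_fscale fs.subspace_def lin_def base_def zext_def fscale_def
      fun_eq_iff algebra_simps)

lemma vspace_tensor: "vspace (V \<otimes> W)"
  unfolding vspace_def tensor_def by (simp add: vector_space_fscale fs.subspace_span)

lemma pure_in_tensor: "v \<in> vset V \<Longrightarrow> w \<in> vset W \<Longrightarrow> pure V W v w \<in> vset (V \<otimes> W)"
  unfolding tensor_def by (auto intro!: fs.span_base)

lemma pure_bilinear:
  assumes "v \<in> vset V" "v' \<in> vset V" "w \<in> vset W" "w' \<in> vset W"
  shows "pure V W (v + v') w = pure V W v w + pure V W v' w"
    and "pure V W v (w + w') = pure V W v w + pure V W v w'"
    and "pure V W (vscale V c v) w = fscale c (pure V W v w)"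
    and "pure V W v (vscale W c w) = fscale c (pure V W v w)"
  using assms by (auto simp: pure_def fun_eq_iff bil_def lin_def fscale_def base_def)

lemma linD:
  assumes "lin V W f" "x \<in> vset V"
  shows "f x \<in> vset W" "y \<in> vset V \<Longrightarrow> f (x + y) = f x + f y" "f (vscale V c x) = vscale W c (f x)"
  using assms by (auto simp: lin_def)

lemma functional_separates:
  assumes V: "vspace V" and x: "x \<in> vset V" "x \<noteq> 0"
  shows "\<exists>\<phi>. lin V base \<phi> \<and> \<phi> x \<noteq> 0"
proof -
  interpret V: vector_space "vscale V" using V by (simp add: vspace_def)
  interpret K: vector_space "(*) :: 'a \<Rightarrow> 'a \<Rightarrow> 'a"
    by unfold_locales (auto simp: algebra_simps)
  interpret P: vector_space_pair "vscale V" "(*) :: 'a \<Rightarrow> 'a \<Rightarrow> 'a" ..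
  have "V.independent {x}" using x by simp
  from P.linear_independent_extend[OF this, of "\<lambda>_. 1"]
  obtain g where g: "Vector_Spaces.linear (vscale V) (*) g" "g x = 1" by auto
  interpret g: Vector_Spaces.linear "vscale V" "(*)" g by (rule g)
  have "lin V base g" by (auto simp: lin_def base_def g.add g.scale)
  with g(2) show ?thesis by auto
qed

text \<open>Every bilinear map \<open>V \<times> W \<rightarrow> X\<close> factors through \<open>V \<otimes> W\<close> by a linear map, which is
  unique by \<open>tensor_universal_unique\<close>.\<close>

theorem tensor_universal:
  fixes V :: "('k::field, 'a::ab_group_add) vsp" and W :: "('k, 'b::ab_group_add) vsp"
    and X :: "('k, 'c::ab_group_add) vsp"
  assumes X: "vspace X"
    and f1: "\<And>v. v \<in> vset V \<Longrightarrow> lin W X (f v)"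
    and f2: "\<And>w. w \<in> vset W \<Longrightarrow> lin V X (\<lambda>v. f v w)"
  shows "\<exists>F. lin (V \<otimes> W) X F \<and> (\<forall>v\<in>vset V. \<forall>w\<in>vset W. F (pure V W v w) = f v w)"
proof -
  interpret X: vector_space "vscale X" using X by (simp add: vspace_def)
  have sX: "X.subspace (vset X)" using X by (simp add: vspace_def)
  define B where "B = {pure V W v w | v w. v \<in> vset V \<and> w \<in> vset W}"
  have T: "vset (V \<otimes> W) = fs.span B" "vscale (V \<otimes> W) = fscale"
    by (simp_all add: tensor_def B_def)
  have sT: "fs.subspace (vset (V \<otimes> W))" by (simp add: T fs.subspace_span)
  define R where "R t x \<longleftrightarrow> x \<in> vset X \<and>
      (\<forall>\<phi>. lin X base \<phi> \<longrightarrow> \<phi> x = t (\<lambda>v w. \<phi> (f v w)))" for t :: "('k,'a,'b) tens" and x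
  have ex: "\<exists>x. R t x" if "t \<in> fs.span B" for t
    using that
  proof (induction rule: fs.span_induct_alt)
    case base
    have "R 0 0" unfolding R_def
    proof (intro conjI allI impI)
      show "0 \<in> vset X" using sX by (simp add: X.subspace_0)
      fix \<phi> assume "lin X base \<phi>"
      hence "\<phi> (vscale X 0 0) = 0 * \<phi> 0" using \<open>0 \<in> vset X\<close> unfolding lin_def base_def
        by (simp del: X.scale_zero_left X.scale_zero_right mult_zero_left)
      thus "\<phi> 0 = 0 (\<lambda>v w. \<phi> (f v w))" by (simp only: X.scale_zero_left) simp
    qed
    thus ?case by blast
  next
    case (step c b y)
    from step(1) obtain v w where vw: "b = pure V W v w" "v \<in> vset V" "w \<in> vset W"
      by (auto simp: B_def)
    from step(2) obtain x where x: "R y x" by blast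
    have fx: "f v w \<in> vset X" "x \<in> vset X"
      using f1[OF vw(2)] vw(3) x by (auto simp: lin_def R_def)
    have "R (fscale c b + y) (vscale X c (f v w) + x)" unfolding R_def
    proof (intro conjI allI impI)
      show "vscale X c (f v w) + x \<in> vset X"
        using sX fx by (simp add: X.subspace_add X.subspace_scale)
      fix \<phi> assume p: "lin X base \<phi>"
      have sc: "vscale X c (f v w) \<in> vset X" using sX fx by (simp add: X.subspace_scale)
      have bl: "(\<lambda>v w. \<phi> (f v w)) \<in> bil V W"
        using f1 f2 p unfolding bil_def lin_def base_def by auto
      have "\<phi> (vscale X c (f v w) + x) = c * \<phi> (f v w) + \<phi> x"
        using p fx sc unfolding lin_def base_def by auto
      also have "\<phi> x = y (\<lambda>v w. \<phi> (f v w))" using x p by (simp add: R_def)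
      finally show "\<phi> (vscale X c (f v w) + x) = (fscale c b + y) (\<lambda>v w. \<phi> (f v w))"
        using bl by (simp add: vw(1) fscale_def pure_def)
    qed
    thus ?case by blast
  qed
  have uniq: "x = x'" if "R t x" "R t x'" for t x x'
  proof (rule ccontr)
    assume "x \<noteq> x'"
    have m: "x \<in> vset X" "x' \<in> vset X" "x - x' \<in> vset X" "x - x' \<noteq> 0"
      using that sX \<open>x \<noteq> x'\<close> by (auto simp: R_def X.subspace_diff)
    obtain \<phi> where p: "lin X base \<phi>" "\<phi> (x - x') \<noteq> 0"
      using functional_separates[OF X m(3,4)] by blast
    have "\<phi> x = \<phi> ((x - x') + x')" by simp
    also have "\<dots> = \<phi> (x - x') + \<phi> x'" using p(1) m unfolding lin_def by blast
    finally show False using p that by (auto simp: R_def)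
  qed
  define F where "F t = (THE x. R t x)" for t
  have RF: "R t (F t)" if "t \<in> fs.span B" for t
    unfolding F_def using ex[OF that] uniq by (metis theI)
  have FI: "F t = x" if "R t x" for t x
    unfolding F_def using that uniq by blast
  have "lin (V \<otimes> W) X F" unfolding lin_def T
  proof (intro conjI ballI allI)
    fix s t :: "('k,'a,'b) tens" and c
    assume s: "s \<in> fs.span B"
    show "F s \<in> vset X" using RF[OF s] by (simp add: R_def)
    show "F (fscale c s) = vscale X c (F s)"
      by (rule FI) (use RF[OF s] sX in \<open>auto simp: R_def lin_def base_def fscale_def X.subspace_scale\<close>)
    assume t: "t \<in> fs.span B"
    show "F (s + t) = F s + F t"
      by (rule FI) (use RF[OF s] RF[OF t] sX in \<open>auto simp: R_def lin_def X.subspace_add\<close>)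
  qed
  moreover have "F (pure V W v w) = f v w" if "v \<in> vset V" "w \<in> vset W" for v w
  proof (rule FI)
    show "R (pure V W v w) (f v w)" unfolding R_def
    proof (intro conjI allI impI)
      show "f v w \<in> vset X" using f1[OF that(1)] that by (auto simp: lin_def)
      fix \<phi> assume p: "lin X base \<phi>"
      have "(\<lambda>v w. \<phi> (f v w)) \<in> bil V W"
        using f1 f2 p unfolding bil_def lin_def base_def by auto
      thus "\<phi> (f v w) = pure V W v w (\<lambda>v w. \<phi> (f v w))" by (simp add: pure_def)
    qed
  qed
  ultimately show "\<exists>F. lin (V \<otimes> W) X F \<and> (\<forall>v\<in>vset V. \<forall>w\<in>vset W. F (pure V W v w) = f v w)"
    by blast
qed

theorem tensor_universal_unique:
  fixes X :: "('k::field, 'c::ab_group_add) vsp"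
  assumes X: "vspace X" and F: "lin (V \<otimes> W) X F" and G: "lin (V \<otimes> W) X G"
    and eq: "\<And>v w. v \<in> vset V \<Longrightarrow> w \<in> vset W \<Longrightarrow> F (pure V W v w) = G (pure V W v w)"
    and t: "t \<in> vset (V \<otimes> W)"
  shows "F t = G t"
proof -
  interpret X: vector_space "vscale X" using X by (simp add: vspace_def)
  define B where "B = {pure V W v w | v w. v \<in> vset V \<and> w \<in> vset W}"
  have T: "vset (V \<otimes> W) = fs.span B" "vscale (V \<otimes> W) = fscale"
    by (simp_all add: tensor_def B_def)
  have "t \<in> fs.span B \<and> F t = G t" using t unfolding T
  proof (induction rule: fs.span_induct_alt)
    case base
    have 0: "0 \<in> fs.span B" by (rule fs.span_zero)
    have "F 0 = vscale X 0 (F 0)" "G 0 = vscale X 0 (G 0)"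
      using linD(3)[OF F, unfolded T, OF 0, of 0] linD(3)[OF G, unfolded T, OF 0, of 0]
      by (simp_all only: fs.scale_zero_right)
    hence "F 0 = G 0" by (simp only: X.scale_zero_left)
    with 0 show ?case by (rule conjI)
  next
    case (step c b y)
    have b: "b \<in> fs.span B" using step by (simp add: fs.span_base)
    have "F b = G b" using step(1) eq by (auto simp: B_def)
    have cb: "fscale c b \<in> fs.span B" using b by (rule fs.span_scale)
    have y: "y \<in> fs.span B" "F y = G y" using step(2) by simp_all
    have "F (fscale c b + y) = vscale X c (F b) + F y"
      using linD(2)[OF F, unfolded T, OF cb y(1)] linD(3)[OF F, unfolded T, OF b] by simp
    also have "\<dots> = G (fscale c b + y)" unfolding \<open>F b = G b\<close> y(2)
      using linD(2)[OF G, unfolded T, OF cb y(1)] linD(3)[OF G, unfolded T, OF b] by simp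
    finally show ?case using fs.span_add[OF cb y(1)] by (rule conjI[rotated])
  qed
  thus ?thesis by simp
qed

lemma tmap_pure:
  assumes "lin V V' f" "lin W W' g" "v \<in> vset V" "w \<in> vset W"
  shows "tmap V' W' f g (pure V W v w) = pure V' W' (f v) (g w)"
proof -
  have "(\<lambda>v w. \<beta> (f v) (g w)) \<in> bil V W" if "\<beta> \<in> bil V' W'" for \<beta>
    using assms that unfolding bil_def lin_def base_def by auto
  thus ?thesis by (auto simp: tmap_def pure_def fun_eq_iff)
qed

lemma vspace_closed:
  assumes "vspace V" "x \<in> vset V" "y \<in> vset V"
  shows "x + y \<in> vset V" "vscale V c x \<in> vset V"
proof -
  interpret V: vector_space "vscale V" using assms(1) by (simp add: vspace_def)
  show "x + y \<in> vset V" "vscale V c x \<in> vset V"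
    using assms by (auto simp: vspace_def V.subspace_add V.subspace_scale)
qed

lemma bilI:
  assumes "\<And>v w w'. v \<in> vset V \<Longrightarrow> w \<in> vset W \<Longrightarrow> w' \<in> vset W \<Longrightarrow> \<beta> v (w + w') = \<beta> v w + \<beta> v w'"
    "\<And>c v w. v \<in> vset V \<Longrightarrow> w \<in> vset W \<Longrightarrow> \<beta> v (vscale W c w) = c * \<beta> v w"
    "\<And>v v' w. v \<in> vset V \<Longrightarrow> v' \<in> vset V \<Longrightarrow> w \<in> vset W \<Longrightarrow> \<beta> (v + v') w = \<beta> v w + \<beta> v' w"
    "\<And>c v w. v \<in> vset V \<Longrightarrow> w \<in> vset W \<Longrightarrow> \<beta> (vscale V c v) w = c * \<beta> v w"
  shows "\<beta> \<in> bil V W"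
  using assms by (auto simp: bil_def lin_def base_def)

lemma bilD:
  assumes "\<beta> \<in> bil V W"
  shows "v \<in> vset V \<Longrightarrow> w \<in> vset W \<Longrightarrow> w' \<in> vset W \<Longrightarrow> \<beta> v (w + w') = \<beta> v w + \<beta> v w'"
    "v \<in> vset V \<Longrightarrow> w \<in> vset W \<Longrightarrow> \<beta> v (vscale W c w) = c * \<beta> v w"
    "v \<in> vset V \<Longrightarrow> v' \<in> vset V \<Longrightarrow> w \<in> vset W \<Longrightarrow> \<beta> (v + v') w = \<beta> v w + \<beta> v' w"
    "v \<in> vset V \<Longrightarrow> w \<in> vset W \<Longrightarrow> \<beta> (vscale V c v) w = c * \<beta> v w"
  using assms by (auto simp: bil_def lin_def base_def)

lemma vscale_tensor: "vscale (V \<otimes> W) = fscale"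
  by (simp add: tensor_def)

lemma tensor_form_linear:
  assumes s: "s \<in> vset (A \<otimes> B)" and bl: "\<beta> \<in> bil A B" "\<beta>1 \<in> bil A B" "\<beta>2 \<in> bil A B"
    and eq: "\<And>a b. a \<in> vset A \<Longrightarrow> b \<in> vset B \<Longrightarrow> \<beta> a b = c * \<beta>1 a b + d * \<beta>2 a b"
  shows "s \<beta> = c * s \<beta>1 + d * s \<beta>2"
proof -
  have "s \<in> fs.span {pure A B v w | v w. v \<in> vset A \<and> w \<in> vset B}"
    using s by (simp add: tensor_def)
  thus ?thesis
  proof (induction rule: fs.span_induct_alt)
    case base
    show ?case by simp
  next
    case (step k x y)
    then obtain v w where "x = pure A B v w" "v \<in> vset A" "w \<in> vset B" by blast
    hence "x \<beta> = c * x \<beta>1 + d * x \<beta>2" using bl eq by (simp add: pure_def)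
    thus ?case using step(2) by (simp add: fscale_def algebra_simps)
  qed
qed

lemma assoc_pure:
  assumes sp: "vspace A" "vspace C"
    and abc: "a \<in> vset A" "b \<in> vset B" "c \<in> vset C"
  shows "assoc A B C (pure (A \<otimes> B) C (pure A B a b) c) = pure A (B \<otimes> C) a (pure B C b c)"
    and "associ A B C (pure A (B \<otimes> C) a (pure B C b c)) = pure (A \<otimes> B) C (pure A B a b) c"
proof -
  have 1: "(\<lambda>a b. \<beta> a (pure B C b c)) \<in> bil A B"
    if "\<beta> \<in> bil A (B \<otimes> C)" "c \<in> vset C" for \<beta> c
    using that bilD[OF that(1), unfolded vscale_tensor]
    by (intro bilI) (simp_all add: pure_bilinear pure_in_tensor)
  have 2: "(\<lambda>s c. s (\<lambda>a b. \<beta> a (pure B C b c))) \<in> bil (A \<otimes> B) C"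
    if \<beta>: "\<beta> \<in> bil A (B \<otimes> C)" for \<beta>
  proof (rule bilI)
    fix s w w' k assume s: "s \<in> vset (A \<otimes> B)" and w: "w \<in> vset C"
    have c: "vscale C k w \<in> vset C" using vspace_closed[OF sp(2)] w by blast
    show "s (\<lambda>a b. \<beta> a (pure B C b (vscale C k w))) = k * s (\<lambda>a b. \<beta> a (pure B C b w))"
      using tensor_form_linear[OF s 1[OF \<beta> c] 1[OF \<beta> w] 1[OF \<beta> w], of k 0] w
        bilD[OF \<beta>, unfolded vscale_tensor] by (simp add: pure_bilinear pure_in_tensor)
    assume w': "w' \<in> vset C"
    have c: "w + w' \<in> vset C" using vspace_closed[OF sp(2)] w w' by blast
    show "s (\<lambda>a b. \<beta> a (pure B C b (w + w'))) =
        s (\<lambda>a b. \<beta> a (pure B C b w)) + s (\<lambda>a b. \<beta> a (pure B C b w'))"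
      using tensor_form_linear[OF s 1[OF \<beta> c] 1[OF \<beta> w] 1[OF \<beta> w'], of 1 1] w w'
        bilD[OF \<beta>, unfolded vscale_tensor] by (simp add: pure_bilinear pure_in_tensor)
  qed (simp_all add: vscale_tensor fscale_def)
  have 3: "(\<lambda>b c. \<beta> (pure A B a b) c) \<in> bil B C"
    if "\<beta> \<in> bil (A \<otimes> B) C" "a \<in> vset A" for \<beta> a
    using that bilD[OF that(1), unfolded vscale_tensor]
    by (intro bilI) (simp_all add: pure_bilinear pure_in_tensor)
  have 4: "(\<lambda>a s. s (\<lambda>b c. \<beta> (pure A B a b) c)) \<in> bil A (B \<otimes> C)"
    if \<beta>: "\<beta> \<in> bil (A \<otimes> B) C" for \<beta>
  proof (rule bilI)
    fix s w w' k assume s: "s \<in> vset (B \<otimes> C)" and w: "w \<in> vset A"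
    have c: "vscale A k w \<in> vset A" using vspace_closed[OF sp(1)] w by blast
    show "s (\<lambda>b c. \<beta> (pure A B (vscale A k w) b) c) = k * s (\<lambda>b c. \<beta> (pure A B w b) c)"
      using tensor_form_linear[OF s 3[OF \<beta> c] 3[OF \<beta> w] 3[OF \<beta> w], of k 0] w
        bilD[OF \<beta>, unfolded vscale_tensor] by (simp add: pure_bilinear pure_in_tensor)
    assume w': "w' \<in> vset A"
    have c: "w + w' \<in> vset A" using vspace_closed[OF sp(1)] w w' by blast
    show "s (\<lambda>b c. \<beta> (pure A B (w + w') b) c) =
        s (\<lambda>b c. \<beta> (pure A B w b) c) + s (\<lambda>b c. \<beta> (pure A B w' b) c)"
      using tensor_form_linear[OF s 3[OF \<beta> c] 3[OF \<beta> w] 3[OF \<beta> w'], of 1 1] w w'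
        bilD[OF \<beta>, unfolded vscale_tensor] by (simp add: pure_bilinear pure_in_tensor)
  qed (simp_all add: vscale_tensor fscale_def)
  show "assoc A B C (pure (A \<otimes> B) C (pure A B a b) c) = pure A (B \<otimes> C) a (pure B C b c)"
    unfolding assoc_def
    by (rule ext) (use 1 2 abc in \<open>simp add: pure_def[of "A \<otimes> B"] pure_def[of A B] pure_def[of A "B \<otimes> C"]\<close>)
  show "associ A B C (pure A (B \<otimes> C) a (pure B C b c)) = pure (A \<otimes> B) C (pure A B a b) c"
    unfolding associ_def
    by (rule ext) (use 3 4 abc in \<open>simp add: pure_def[of A "B \<otimes> C"] pure_def[of B C] pure_def[of "A \<otimes> B"]\<close>)
qed

end

theory Submission
  imports Defs
begin

text \<open>
  The structure of \<open>U\<close> consists of transposes.  For \<open>\<langle>\<langle>f \<otimes> g, x \<otimes> y\<rangle>\<rangle> = f(y) g(x)\<close>, the braiding of \<open>U\<close> is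
  the transpose of \<open>\<Psi>\<close>, its product the transpose of \<open>\<Psi>\<^sup>-\<^sup>1 \<Delta>\<close>, its coproduct the transpose of \<open>m \<Psi>\<close>.
  Since \<open>H \<otimes> \<dots> \<otimes> H\<close> separates the points of \<open>U \<otimes> \<dots> \<otimes> U\<close> (\<open>separating_tensor\<close>), the axioms of a
  braided bialgebra for \<open>U\<close> are the transposes of those for \<open>(H, m \<Psi>, \<Psi>\<^sup>-\<^sup>1 \<Delta>, \<Psi>)\<close>; for instance,
  coassociativity in \<open>U\<close> is the associativity of \<open>m \<Psi>\<close>.  That the opposite product and the coopposite
  coproduct again form a braided bialgebra is proved in two steps.  The coopposite coproduct makes
  \<open>(m, \<Psi>\<^sup>-\<^sup>1 \<Delta>)\<close> a braided bialgebra for the \<^emph>\<open>inverse\<close> braiding, and passing to the opposite product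
  turns \<open>\<Psi>\<^sup>-\<^sup>1\<close> back into \<open>\<Psi>\<close>.  In each step \<open>\<Psi>\<close> or \<open>\<Psi>\<^sup>-\<^sup>1\<close> is carried past two products or two
  coproducts at the price of four crossings, one of which cancels (\<open>cop_comult_mult\<close>,
  \<open>op_comult_mult\<close>), and no calculation in a braid group on four strands is left.

  The braiding \<open>\<Upsilon>\<close> between \<open>U\<close> and \<open>H\<close> is only a partial transpose of \<open>\<Psi>\<^sup>-\<^sup>1\<close>: applying \<open>\<Upsilon>\<close> to
  \<open>f \<otimes> x\<close> and evaluating the factor in \<open>U\<close> at \<open>y\<close> is the same as applying \<open>\<Psi>\<^sup>-\<^sup>1\<close> to \<open>x \<otimes> y\<close> and
  evaluating \<open>f\<close> on the first factor of the result (\<open>rotated_laws\<close>).  Evaluating in this way turns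
  each axiom about \<open>\<Upsilon>\<close> into an axiom about \<open>\<Psi>\<^sup>-\<^sup>1\<close> and \<open>H\<close>, or about \<open>\<Psi>\<^sup>-\<^sup>1\<close> and the opposite and
  coopposite structure.  The pairing on \<open>H \<otimes> U\<close> is the mirror image of the one on \<open>U \<otimes> H\<close>: reversing
  the order of all tensor factors preserves braided bialgebras and exchanges the two mixed braidings
  (\<open>flip_laws\<close>, \<open>flip_transposed\<close>), so both follow from the same lemmas.  For the antipode, \<open>f \<circ> S\<close> is
  the transpose of \<open>S\<close>, and \<open>S\<close> is an antipode for the opposite and coopposite structure because it
  commutes with \<open>\<Psi>\<close>; this is a consequence of the uniqueness of convolution inverses (\<open>SP1\<close>).

  All identities are proved in coordinates.  With bases chosen, a tensor \<open>t\<close> is determined by the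
  finite linear combination \<open>k \<mapsto> \<Sum> t\<^sub>i\<^sub>j k(i, j)\<close> of evaluations at pairs of basis elements, for
  arbitrary functions \<open>k\<close>.  A structure map becomes an operator that takes a basis element and such a
  \<open>k\<close>: \<open>D a (\<lambda>x y. k x y)\<close> stands for the sum of \<open>k\<close> over the Sweedler components of \<open>\<Delta> a\<close>, and
  \<open>P a b (\<lambda>b a. k b a)\<close> for the sum of \<open>k\<close> over the components of \<open>\<Psi>(a \<otimes> b)\<close>.  An axiom is then an
  equation between nested operators for all \<open>k\<close>, in which no associativity isomorphism and no
  linearity condition occurs, and in which operators on different strands commute freely
  (\<open>fin_comb_Fubini\<close>).
\<close>

section \<open>Finite combinations of evaluations\<close>


text \<open>The finite linear combinations of evaluations at points of \<open>I\<close>, as functionals on all functions.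
  Unlike a tensor, which by its encoding is a functional on bilinear forms only, such a functional
  may be applied to any integrand; this is what frees the later calculations of side conditions.\<close>

inductive fin_comb :: "'i set \<Rightarrow> (('i \<Rightarrow> 'k::field) \<Rightarrow> 'k) \<Rightarrow> bool" for I where
  zero: "fin_comb I (\<lambda>k. 0)"
| step: "i \<in> I \<Longrightarrow> fin_comb I \<phi> \<Longrightarrow> fin_comb I (\<lambda>k. c * k i + \<phi> k)"

lemma fin_comb_cong:
  assumes "fin_comb I \<phi>" "\<And>i. i \<in> I \<Longrightarrow> k i = k' i"
  shows "\<phi> k = \<phi> k'"
  using assms(1) by induction (auto simp: assms(2))

lemma fin_comb_add: "fin_comb I \<phi> \<Longrightarrow> \<phi> (\<lambda>i. k i + k' i) = \<phi> k + \<phi> k'"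
  by (induction rule: fin_comb.induct) (auto simp: algebra_simps)

lemma fin_comb_scale: "fin_comb I \<phi> \<Longrightarrow> \<phi> (\<lambda>i. c * k i) = c * \<phi> k"
  by (induction rule: fin_comb.induct) (auto simp: algebra_simps)

lemma fin_comb_zero: "fin_comb I \<phi> \<Longrightarrow> \<phi> (\<lambda>i. 0) = 0"
  by (induction rule: fin_comb.induct) auto

lemma fin_comb_Fubini:
  assumes "fin_comb I \<phi>" "fin_comb J \<psi>"
  shows "\<phi> (\<lambda>i. \<psi> (\<lambda>j. k i j)) = \<psi> (\<lambda>j. \<phi> (\<lambda>i. k i j))"
  using assms(1)
  by induction (simp_all add: fin_comb_zero[OF assms(2)] fin_comb_add[OF assms(2)] fin_comb_scale[OF assms(2)])

lemma fin_comb_single: "i \<in> I \<Longrightarrow> fin_comb I (\<lambda>k. k i)"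
  using fin_comb.step[OF _ fin_comb.zero, of i I 1] by simp

lemma fin_comb_plus:
  assumes "fin_comb I \<phi>" "fin_comb I \<psi>" shows "fin_comb I (\<lambda>k. \<phi> k + \<psi> k)"
  using assms(1) by induction (auto simp: assms(2) add.assoc intro: fin_comb.step)

lemma fin_comb_times:
  assumes "fin_comb I \<phi>" shows "fin_comb I (\<lambda>k. c * \<phi> k)"
  using assms
proof induction
  case zero show ?case by (simp add: fin_comb.zero)
next
  case (step i \<phi> d)
  show ?case using fin_comb.step[OF step.hyps(1) step.IH, of "c * d"] by (simp add: algebra_simps)
qed

lemma fin_comb_bind:
  assumes "fin_comb I \<phi>" "\<And>i. i \<in> I \<Longrightarrow> fin_comb J (\<psi> i)"
  shows "fin_comb J (\<lambda>k. \<phi> (\<lambda>i. \<psi> i k))"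
  using assms(1)
  by induction (simp_all add: fin_comb.zero fin_comb_plus fin_comb_times assms(2))

text \<open>\<open>E v k\<close> is the sum of \<open>v\<^sub>i k(i)\<close> over the coordinates \<open>v\<^sub>i\<close> of \<open>v\<close> with respect to the basis \<open>b\<close>
  indexed by \<open>I\<close>.  In this form coordinates compose along linear maps and tensor products without any
  bookkeeping of supports.\<close>

definition coords ::
  "('k::field, 'v::ab_group_add) vsp \<Rightarrow> 'i set \<Rightarrow> ('i \<Rightarrow> 'v) \<Rightarrow> ('v \<Rightarrow> ('i \<Rightarrow> 'k) \<Rightarrow> 'k) \<Rightarrow> bool" where
  "coords V I b E \<longleftrightarrow> vspace V \<and> (\<forall>i\<in>I. b i \<in> vset V) \<and> (\<forall>k. lin V base (\<lambda>v. E v k)) \<and>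
     (\<forall>v\<in>vset V. fin_comb I (E v)) \<and> (\<forall>i\<in>I. \<forall>k. E (b i) k = k i) \<and>
     (\<forall>\<phi>. lin V base \<phi> \<longrightarrow> (\<forall>v\<in>vset V. \<phi> v = E v (\<lambda>i. \<phi> (b i))))"

lemma coordsD:
  assumes "coords V I b E"
  shows "vspace V" "i \<in> I \<Longrightarrow> b i \<in> vset V" "lin V base (\<lambda>v. E v k)"
    "v \<in> vset V \<Longrightarrow> fin_comb I (E v)" "i \<in> I \<Longrightarrow> E (b i) k = k i"
    "lin V base \<phi> \<Longrightarrow> v \<in> vset V \<Longrightarrow> \<phi> v = E v (\<lambda>i. \<phi> (b i))"
  using assms unfolding coords_def by blast+

lemma lin_comp:
  assumes "lin V W f" "lin W X g" shows "lin V X (\<lambda>v. g (f v))"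
  using assms unfolding lin_def by auto

lemma coords_lin:
  assumes "coords V I b E" "coords W J c F" "lin V W f" "v \<in> vset V"
  shows "F (f v) k = E v (\<lambda>i. F (f (b i)) k)"
  using coordsD(6)[OF assms(1) lin_comp[OF assms(3) coordsD(3)[OF assms(2)]] assms(4)] .

lemma vspace_diff:
  assumes "vspace V" "x \<in> vset V" "y \<in> vset V"
  shows "x - y \<in> vset V"
proof -
  interpret V: vector_space "vscale V" using assms(1) by (simp add: vspace_def)
  show ?thesis using assms by (auto simp: vspace_def V.subspace_diff)
qed

lemma lin_diff:
  assumes "vspace V" "lin V W f" "x \<in> vset V" "y \<in> vset V"
  shows "f (x - y) = f x - f y"
proof -
  have "f ((x - y) + y) = f (x - y) + f y"
    using assms vspace_diff[OF assms(1)] unfolding lin_def by blast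
  thus ?thesis by simp
qed

text \<open>Every linear functional is a combination of coordinates, and functionals separate points.\<close>

lemma coords_ext:
  assumes "coords V I b E" "v \<in> vset V" "w \<in> vset V" "\<And>k. E v k = E w k"
  shows "v = w"
proof (rule ccontr)
  assume "v \<noteq> w"
  have V: "vspace V" by (rule coordsD(1)[OF assms(1)])
  obtain \<phi> where p: "lin V base \<phi>" "\<phi> (v - w) \<noteq> 0"
    using functional_separates[OF V vspace_diff[OF V assms(2,3)]] \<open>v \<noteq> w\<close> by auto
  have "\<phi> v = \<phi> w"
    using coordsD(6)[OF assms(1) p(1)] assms(2-4) by simp
  thus False using p lin_diff[OF V p(1) assms(2,3)] by simp
qed

text \<open>For a basis \<open>B\<close> and a function \<open>k\<close>, the value \<open>E v k\<close> is taken to be \<open>g(v)\<close> for a linear extension \<open>g\<close> of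
  the restriction of \<open>k\<close> to \<open>B\<close>.\<close>

lemma coords_exist:
  assumes "vspace V"
  shows "\<exists>B E. coords V B (\<lambda>x. x) E"
proof -
  interpret V: vector_space "vscale V" using assms by (simp add: vspace_def)
  interpret K: vector_space "(*) :: 'a \<Rightarrow> 'a \<Rightarrow> 'a"
    by unfold_locales (auto simp: algebra_simps)
  interpret P: vector_space_pair "vscale V" "(*) :: 'a \<Rightarrow> 'a \<Rightarrow> 'a" ..
  have sub: "V.subspace (vset V)" using assms by (simp add: vspace_def)
  obtain B where B: "B \<subseteq> vset V" "V.independent B" "vset V \<subseteq> V.span B"
    by (rule V.maximal_independent_subset)
  have span: "V.span B = vset V" using B sub V.span_minimal by blast
  define g where "g k = (SOME g. Vector_Spaces.linear (vscale V) (*) g \<and> (\<forall>x\<in>B. g x = k x))" for k :: "'b \<Rightarrow> 'a"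
  have g: "Vector_Spaces.linear (vscale V) (*) (g k)" "x \<in> B \<Longrightarrow> g k x = k x" for k x
    unfolding g_def using someI_ex[OF P.linear_independent_extend[OF B(2), of k]] by blast+
  have ga: "g k (x + y) = g k x + g k y" "g k (vscale V c x) = c * g k x" for k x y c
    using g(1)[of k] by (auto simp: Vector_Spaces.linear_def module_hom_def module_hom_axioms_def)
  have g0: "g k 0 = 0" for k using ga(1)[of k 0 0] by (metis add_0 add_cancel_right_right)
  have "coords V B (\<lambda>x. x) (\<lambda>v k. g k v)"
    unfolding coords_def
  proof (intro conjI ballI allI impI)
    show "lin V base (g k)" for k by (auto simp: lin_def base_def ga)
    fix v assume "v \<in> vset V"
    hence v: "v \<in> V.span B" using span by simp
    show "fin_comb B (\<lambda>k. g k v)" using v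
    proof (induction rule: V.span_induct_alt)
      case base show ?case by (simp add: g0 fin_comb.zero)
    next
      case (step c x y) thus ?case by (simp add: ga g fin_comb.step)
    qed
    fix \<phi> assume p: "lin V base \<phi>"
    have zV: "0 \<in> vset V" using sub V.subspace_0 by blast
    have "\<phi> (0 + 0) = \<phi> 0 + \<phi> 0" using p zV unfolding lin_def by blast
    hence p0: "\<phi> 0 = 0" by (metis add_0 add_cancel_right_right)
    from v have "v \<in> vset V \<and> \<phi> v = g (\<lambda>i. \<phi> i) v"
    proof (induction rule: V.span_induct_alt)
      case base show ?case by (simp add: p0 g0 zV)
    next
      case (step c x y)
      have x: "x \<in> vset V" using step B by blast
      have cx: "vscale V c x \<in> vset V" using vspace_closed[OF assms x x] by blast
      show ?case using p step x cx vspace_closed(1)[OF assms]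
        by (auto simp: lin_def base_def ga g)
    qed
    thus "\<phi> v = g (\<lambda>i. \<phi> i) v" by simp
  qed (use assms B g in auto)
  thus ?thesis by blast
qed

section \<open>Coordinates on tensor products\<close>

definition tensor_coords :: "('v \<Rightarrow> ('i \<Rightarrow> 'k) \<Rightarrow> 'k) \<Rightarrow> ('w \<Rightarrow> ('j \<Rightarrow> 'k) \<Rightarrow> 'k)
    \<Rightarrow> ('k, 'v, 'w) tens \<Rightarrow> ('i \<times> 'j \<Rightarrow> 'k) \<Rightarrow> 'k" where
  "tensor_coords E F t k = t (\<lambda>v w. E v (\<lambda>i. F w (\<lambda>j. k (i, j))))"

definition tensor_basis where
  "tensor_basis V W b c = (\<lambda>(i, j). pure V W (b i) (c j))"

lemma lin_base_iff:
  "lin V base f \<longleftrightarrow> (\<forall>x\<in>vset V. \<forall>y\<in>vset V. f (x + y) = f x + f y) \<and> (\<forall>c. \<forall>x\<in>vset V. f (vscale V c x) = c * f x)"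
  by (auto simp: lin_def base_def)

lemma lin_fin_comb:
  assumes "fin_comb I \<phi>" "\<And>i. i \<in> I \<Longrightarrow> lin V base (\<lambda>v. f v i)"
  shows "lin V base (\<lambda>v. \<phi> (f v))"
  using assms(1)
proof induction
  case zero show ?case by (simp add: lin_base_iff)
next
  case (step i \<phi> c)
  show ?case using step.IH assms(2)[OF step.hyps(1)] by (simp add: lin_base_iff algebra_simps)
qed

lemma bil_coords:
  assumes "coords V I b E" "coords W J c F"
  shows "(\<lambda>v w. E v (\<lambda>i. F w (\<lambda>j. k (i, j)))) \<in> bil V W"
proof -
  have "lin W base (\<lambda>w. E v (\<lambda>i. F w (\<lambda>j. k (i, j))))" if "v \<in> vset V" for v
    by (rule lin_fin_comb[OF coordsD(4)[OF assms(1) that]]) (rule coordsD(3)[OF assms(2)])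
  thus ?thesis using coordsD(3)[OF assms(1)] by (auto simp: bil_def)
qed

lemma tensor_coords_pure:
  assumes "coords V I b E" "coords W J c F" "v \<in> vset V" "w \<in> vset W"
  shows "tensor_coords E F (pure V W v w) k = E v (\<lambda>i. F w (\<lambda>j. k (i, j)))"
  using bil_coords[OF assms(1,2), of k] by (simp add: tensor_coords_def pure_def)

lemma tensor_cases_induct [consumes 1, case_names zero step]:
  assumes "t \<in> vset (V \<otimes> W)"
    and "P 0"
    and "\<And>c v w t. v \<in> vset V \<Longrightarrow> w \<in> vset W \<Longrightarrow> t \<in> vset (V \<otimes> W) \<Longrightarrow> P t \<Longrightarrow> P (fscale c (pure V W v w) + t)"
  shows "P t"
proof -
  have "t \<in> fs.span {pure V W v w |v w. v \<in> vset V \<and> w \<in> vset W}"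
    using assms(1) by (simp add: tensor_def)
  hence "t \<in> vset (V \<otimes> W) \<and> P t"
  proof (induction rule: fs.span_induct_alt)
    case base
    have "0 \<in> vset (V \<otimes> W)" unfolding tensor_def vsp.simps by (rule fs.span_zero)
    thus ?case using assms(2) by (rule conjI)
  next
    case (step c x y)
    then obtain v w where x: "x = pure V W v w" "v \<in> vset V" "w \<in> vset W" by blast
    have "x \<in> vset (V \<otimes> W)" using x by (simp add: pure_in_tensor)
    hence "fscale c x + y \<in> vset (V \<otimes> W)"
      using step(2) vspace_closed[OF vspace_tensor[of V W]] by (auto simp: vscale_tensor)
    moreover have "P (fscale c x + y)" unfolding x(1) by (rule assms(3)) (use x step(2) in auto)
    ultimately show ?case by (rule conjI)
  qed
  thus ?thesis ..
qed

lemma lin_eval_form: "lin (V \<otimes> W) base (\<lambda>t. t \<beta>)"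
  by (auto simp: lin_base_iff vscale_tensor fscale_def)

text \<open>A functional on \<open>V \<otimes> W\<close> and its expression in coordinates are both linear, so by the universal
  property it suffices to compare them on pure tensors, where coordinates can be taken one factor at a time.\<close>

lemma coords_tensor:
  assumes V: "coords V I b E" and W: "coords W J c F"
  shows "coords (V \<otimes> W) (I \<times> J) (tensor_basis V W b c) (tensor_coords E F)"
  unfolding coords_def
proof (intro conjI ballI allI impI)
  show "vspace (V \<otimes> W)" by (rule vspace_tensor)
  show "lin (V \<otimes> W) base (\<lambda>v. tensor_coords E F v k)" for k
    unfolding tensor_coords_def by (rule lin_eval_form)
  show "tensor_basis V W b c i \<in> vset (V \<otimes> W)" if "i \<in> I \<times> J" for i
    using that coordsD(2)[OF V] coordsD(2)[OF W] by (auto simp: tensor_basis_def pure_in_tensor)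
  show "tensor_coords E F (tensor_basis V W b c i) k = k i" if "i \<in> I \<times> J" for i k
  proof -
    obtain i1 i2 where i: "i = (i1, i2)" "i1 \<in> I" "i2 \<in> J" using \<open>i \<in> I \<times> J\<close> by (cases i) auto
    show ?thesis using i coordsD(2,5)[OF V] coordsD(2,5)[OF W]
      by (simp add: tensor_basis_def tensor_coords_pure[OF V W])
  qed
  fix t assume t: "t \<in> vset (V \<otimes> W)"
  show "fin_comb (I \<times> J) (tensor_coords E F t)" using t
  proof (induction rule: tensor_cases_induct)
    case zero show ?case by (simp add: tensor_coords_def[abs_def] fin_comb.zero)
  next
    case (step a v w t)
    have "tensor_coords E F (fscale a (pure V W v w) + t) = (\<lambda>k. a * tensor_coords E F (pure V W v w) k + tensor_coords E F t k)"
      by (simp add: tensor_coords_def[abs_def] fscale_def)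
    moreover have "fin_comb (I \<times> J) (\<lambda>k. tensor_coords E F (pure V W v w) k)"
      unfolding tensor_coords_pure[OF V W step(1,2)]
    proof (rule fin_comb_bind[OF coordsD(4)[OF V step(1)]])
      fix i assume "i \<in> I"
      have "fin_comb (I \<times> J) (\<lambda>k. F w (\<lambda>j. (\<lambda>k. k (i, j)) k))"
        by (rule fin_comb_bind[OF coordsD(4)[OF W step(2)]]) (use \<open>i \<in> I\<close> in \<open>simp add: fin_comb_single\<close>)
      thus "fin_comb (I \<times> J) (\<lambda>k. F w (\<lambda>j. k (i, j)))" .
    qed
    ultimately show ?case using fin_comb_plus[OF fin_comb_times step(4)] by presburger
  qed
  fix \<phi> assume p: "lin (V \<otimes> W) base \<phi>"
  have bK: "vspace (base :: ('a,'a) vsp)"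
    unfolding vspace_def base_def
    by (auto simp: vector_space_def module.subspace_def module_def algebra_simps)
  show "\<phi> t = tensor_coords E F t (\<lambda>i. \<phi> (tensor_basis V W b c i))"
  proof (rule tensor_universal_unique[OF bK p _ _ t])
    show "lin (V \<otimes> W) base (\<lambda>t. tensor_coords E F t (\<lambda>i. \<phi> (tensor_basis V W b c i)))"
      unfolding tensor_coords_def by (rule lin_eval_form)
    fix v w assume v: "v \<in> vset V" and w: "w \<in> vset W"
    have 1: "lin V base (\<lambda>v. \<phi> (pure V W v w))" if "w \<in> vset W" for w
      using that p vspace_closed[OF coordsD(1)[OF V]]
      by (auto simp: lin_base_iff pure_bilinear vscale_tensor pure_in_tensor)
    have 2: "lin W base (\<lambda>w. \<phi> (pure V W v w))" if "v \<in> vset V" for v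
      using that p vspace_closed[OF coordsD(1)[OF W]]
      by (auto simp: lin_base_iff pure_bilinear vscale_tensor pure_in_tensor)
    have "\<phi> (pure V W v w) = E v (\<lambda>i. \<phi> (pure V W (b i) w))"
      by (rule coordsD(6)[OF V 1[OF w] v])
    also have "\<dots> = E v (\<lambda>i. F w (\<lambda>j. \<phi> (pure V W (b i) (c j))))"
      by (rule fin_comb_cong[OF coordsD(4)[OF V v]])
        (rule coordsD(6)[OF W 2[OF coordsD(2)[OF V]] w])
    finally show "\<phi> (pure V W v w) = tensor_coords E F (pure V W v w) (\<lambda>i. \<phi> (tensor_basis V W b c i))"
      by (simp add: tensor_coords_pure[OF V W v w] tensor_basis_def)
  qed
qed


notation tensor_coords (infixr "\<otimes>\<^sub>c" 70)

text \<open>\<open>V\<close> is spanned by the basis: rebuild from the finite combination \<open>E v\<close> a vector with the same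
  coordinates, which is \<open>v\<close> by extensionality.\<close>

lemma coords_induct [consumes 2, case_names zero step]:
  assumes V: "coords V I b E" and v: "v \<in> vset V"
    and P0: "P 0"
    and Ps: "\<And>c i w. i \<in> I \<Longrightarrow> w \<in> vset V \<Longrightarrow> P w \<Longrightarrow> P (vscale V c (b i) + w)"
  shows "P v"
proof -
  interpret V: vector_space "vscale V" using coordsD(1)[OF V] by (simp add: vspace_def)
  have zV: "0 \<in> vset V" using coordsD(1)[OF V] V.subspace_0 by (auto simp: vspace_def)
  have "\<exists>w\<in>vset V. P w \<and> E w = \<phi>" if "fin_comb I \<phi>" for \<phi>
    using that
  proof induction
    case zero
    have "E (vscale V 0 0) k = 0 * E 0 k" for k
      using coordsD(3)[OF V, of k] zV unfolding lin_base_iff by blast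
    hence "E 0 = (\<lambda>k. 0)" by (simp add: fun_eq_iff)
    thus ?case using P0 zV by blast
  next
    case (step i \<phi> c)
    then obtain w where w: "w \<in> vset V" "P w" "E w = \<phi>" by blast
    have b: "b i \<in> vset V" by (rule coordsD(2)[OF V step.hyps(1)])
    have cb: "vscale V c (b i) \<in> vset V" by (rule vspace_closed[OF coordsD(1)[OF V] b b])
    have "E (vscale V c (b i) + w) k = c * k i + \<phi> k" for k
      using coordsD(3)[OF V, of k] w b cb coordsD(5)[OF V step.hyps(1), of k]
      by (simp add: lin_base_iff)
    thus ?case using Ps[OF step.hyps(1) w(1,2)] vspace_closed(1)[OF coordsD(1)[OF V] cb w(1)] by blast
  qed
  from this[OF coordsD(4)[OF V v]] obtain w where w: "w \<in> vset V" "P w" "E w = E v" by blast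
  have "w = v" by (rule coords_ext[OF V w(1) v]) (simp add: w(3))
  thus ?thesis using w by simp
qed

lemma lin_on_basis:
  assumes V: "coords V I b E" and W: "vspace W"
    and F: "\<And>x y. x \<in> vset V \<Longrightarrow> y \<in> vset V \<Longrightarrow> F (x + y) = F x + F y"
      "\<And>c x. x \<in> vset V \<Longrightarrow> F (vscale V c x) = vscale W c (F x)"
    and b: "\<And>i. i \<in> I \<Longrightarrow> F (b i) \<in> vset W"
  shows "lin V W F"
proof -
  interpret W: vector_space "vscale W" using W by (simp add: vspace_def)
  have zW: "0 \<in> vset W" using W W.subspace_0 by (auto simp: vspace_def)
  interpret V: vector_space "vscale V" using coordsD(1)[OF V] by (simp add: vspace_def)
  have zV: "0 \<in> vset V" using coordsD(1)[OF V] V.subspace_0 by (auto simp: vspace_def)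
  have F0: "F 0 = 0" using F(1)[OF zV zV] by (metis add_0 add_cancel_right_right)
  have "F v \<in> vset W" if "v \<in> vset V" for v
    using V that
  proof (induction rule: coords_induct)
    case zero show ?case using F0 zW by simp
  next
    case (step c i w)
    have "b i \<in> vset V" by (rule coordsD(2)[OF V step(1)])
    hence "F (vscale V c (b i) + w) = vscale W c (F (b i)) + F w"
      using F step(2) vspace_closed(2)[OF coordsD(1)[OF V]] by auto
    thus ?case using vspace_closed[OF W] b[OF step(1)] step(3) by auto
  qed
  thus ?thesis using F by (auto simp: lin_def)
qed

text \<open>A basis of each space and the coordinates with respect to it, fixed once and for all by choice.
  The basis is indexed by its own elements.\<close>

definition bas :: "('k::field, 'v::ab_group_add) vsp \<Rightarrow> 'v set" where
  "bas V = (SOME B. \<exists>E. coords V B (\<lambda>x. x) E)"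

definition crd :: "('k::field, 'v::ab_group_add) vsp \<Rightarrow> 'v \<Rightarrow> ('v \<Rightarrow> 'k) \<Rightarrow> 'k" where
  "crd V = (SOME E. coords V (bas V) (\<lambda>x. x) E)"

lemma coords_bas:
  assumes "vspace V" shows "coords V (bas V) (\<lambda>x. x) (crd V)"
proof -
  have "\<exists>E. coords V (bas V) (\<lambda>x. x) E"
    unfolding bas_def by (rule someI_ex) (rule coords_exist[OF assms])
  thus ?thesis unfolding crd_def by (rule someI_ex)
qed

lemma lin_tmap:
  assumes "vspace V" "vspace W" "lin V V' f" "lin W W' g"
  shows "lin (V \<otimes> W) (V' \<otimes> W') (tmap V' W' f g)"
proof (rule lin_on_basis[OF coords_tensor[OF coords_bas coords_bas] vspace_tensor])
  fix i assume "i \<in> bas V \<times> bas W"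
  then obtain x y where i: "i = (x, y)" "x \<in> vset V" "y \<in> vset W"
    using coordsD(2)[OF coords_bas[OF assms(1)]] coordsD(2)[OF coords_bas[OF assms(2)]] by auto
  thus "tmap V' W' f g (tensor_basis V W (\<lambda>x. x) (\<lambda>x. x) i) \<in> vset (V' \<otimes> W')"
    using assms by (simp add: tensor_basis_def tmap_pure lin_def pure_in_tensor)
qed (use assms in \<open>simp_all add: tmap_def fun_eq_iff vscale_tensor fscale_def\<close>)

lemma coords3R:
  assumes "vspace A" "vspace B" "vspace C"
  shows "coords (A \<otimes> B \<otimes> C) (bas A \<times> bas B \<times> bas C)
    (tensor_basis A (B \<otimes> C) (\<lambda>x. x) (tensor_basis B C (\<lambda>x. x) (\<lambda>x. x))) (crd A \<otimes>\<^sub>c crd B \<otimes>\<^sub>c crd C)"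
  using assms by (intro coords_tensor coords_bas)

lemma coords3L:
  assumes "vspace A" "vspace B" "vspace C"
  shows "coords ((A \<otimes> B) \<otimes> C) ((bas A \<times> bas B) \<times> bas C)
    (tensor_basis (A \<otimes> B) C (tensor_basis A B (\<lambda>x. x) (\<lambda>x. x)) (\<lambda>x. x)) ((crd A \<otimes>\<^sub>c crd B) \<otimes>\<^sub>c crd C)"
  using assms by (intro coords_tensor coords_bas)

lemma lin_assoc:
  assumes "vspace A" "vspace B" "vspace C"
  shows "lin ((A \<otimes> B) \<otimes> C) (A \<otimes> B \<otimes> C) (assoc A B C)"
proof (rule lin_on_basis[OF coords3L[OF assms] vspace_tensor])
  fix i assume "i \<in> (bas A \<times> bas B) \<times> bas C"
  then obtain x y z where i: "i = ((x, y), z)" "x \<in> vset A" "y \<in> vset B" "z \<in> vset C"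
    using assms[THEN coords_bas, THEN coordsD(2)] by auto
  thus "assoc A B C (tensor_basis (A \<otimes> B) C (tensor_basis A B (\<lambda>x. x) (\<lambda>x. x)) (\<lambda>x. x) i) \<in> vset (A \<otimes> B \<otimes> C)"
    using assms by (simp add: tensor_basis_def assoc_pure pure_in_tensor)
qed (simp_all add: assoc_def fun_eq_iff vscale_tensor fscale_def)

lemma lin_associ:
  assumes "vspace A" "vspace B" "vspace C"
  shows "lin (A \<otimes> B \<otimes> C) ((A \<otimes> B) \<otimes> C) (associ A B C)"
proof (rule lin_on_basis[OF coords3R[OF assms] vspace_tensor])
  fix i assume "i \<in> bas A \<times> bas B \<times> bas C"
  then obtain x y z where i: "i = (x, y, z)" "x \<in> vset A" "y \<in> vset B" "z \<in> vset C"
    using assms[THEN coords_bas, THEN coordsD(2)] by auto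
  thus "associ A B C (tensor_basis A (B \<otimes> C) (\<lambda>x. x) (tensor_basis B C (\<lambda>x. x) (\<lambda>x. x)) i) \<in> vset ((A \<otimes> B) \<otimes> C)"
    using assms by (simp add: tensor_basis_def assoc_pure pure_in_tensor)
qed (simp_all add: associ_def fun_eq_iff vscale_tensor fscale_def)

lemma tmap_coords:
  assumes V: "coords V I b E" and W: "coords W J c F" and V': "coords V' I' b' E'" and W': "coords W' J' c' F'"
    and f: "lin V V' f" and g: "lin W W' g" and t: "t \<in> vset (V \<otimes> W)"
  shows "(E' \<otimes>\<^sub>c F') (tmap V' W' f g t) k =
    (E \<otimes>\<^sub>c F) t (\<lambda>(i, j). E' (f (b i)) (\<lambda>i'. F' (g (c j)) (\<lambda>j'. k (i', j'))))"
proof -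
  have "(E' \<otimes>\<^sub>c F') (tmap V' W' f g t) k =
      (E \<otimes>\<^sub>c F) t (\<lambda>i. (E' \<otimes>\<^sub>c F') (tmap V' W' f g (tensor_basis V W b c i)) k)"
    by (rule coords_lin[OF coords_tensor[OF V W] coords_tensor[OF V' W'] lin_tmap[OF coordsD(1)[OF V] coordsD(1)[OF W] f g] t])
  also have "\<dots> = (E \<otimes>\<^sub>c F) t (\<lambda>(i, j). E' (f (b i)) (\<lambda>i'. F' (g (c j)) (\<lambda>j'. k (i', j'))))"
    by (rule fin_comb_cong[OF coordsD(4)[OF coords_tensor[OF V W] t]])
      (use f g coordsD(2)[OF V] coordsD(2)[OF W] in
        \<open>auto simp: tensor_basis_def tmap_pure[OF f g] tensor_coords_pure[OF V' W'] lin_def\<close>)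
  finally show ?thesis .
qed

text \<open>In coordinates the associativity isomorphism only relabels triples.\<close>

lemma assoc_coords:
  assumes A: "coords A I a E" and B: "coords B J b F" and C: "coords C L c G"
    and t: "t \<in> vset ((A \<otimes> B) \<otimes> C)"
  shows "(E \<otimes>\<^sub>c F \<otimes>\<^sub>c G) (assoc A B C t) k = ((E \<otimes>\<^sub>c F) \<otimes>\<^sub>c G) t (\<lambda>((i, j), l). k (i, j, l))"
proof -
  note l = lin_assoc[OF coordsD(1)[OF A] coordsD(1)[OF B] coordsD(1)[OF C]]
  note AB = coords_tensor[OF A B] note BC = coords_tensor[OF B C]
  have "(E \<otimes>\<^sub>c F \<otimes>\<^sub>c G) (assoc A B C t) k = ((E \<otimes>\<^sub>c F) \<otimes>\<^sub>c G) t
     (\<lambda>i. (E \<otimes>\<^sub>c F \<otimes>\<^sub>c G) (assoc A B C (tensor_basis (A \<otimes> B) C (tensor_basis A B a b) c i)) k)"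
    by (rule coords_lin[OF coords_tensor[OF AB C] coords_tensor[OF A BC] l t])
  also have "\<dots> = ((E \<otimes>\<^sub>c F) \<otimes>\<^sub>c G) t (\<lambda>((i, j), l). k (i, j, l))"
  proof (rule fin_comb_cong[OF coordsD(4)[OF coords_tensor[OF AB C] t]])
    fix i assume "i \<in> (I \<times> J) \<times> L"
    then obtain x y z where i: "i = ((x, y), z)" "x \<in> I" "y \<in> J" "z \<in> L" by auto
    note m = coordsD(2)[OF A i(2)] coordsD(2)[OF B i(3)] coordsD(2)[OF C i(4)]
    have "assoc A B C (tensor_basis (A \<otimes> B) C (tensor_basis A B a b) c i) = tensor_basis A (B \<otimes> C) a (tensor_basis B C b c) (x, y, z)"
      using m coordsD(1)[OF A] coordsD(1)[OF C] by (simp add: i(1) tensor_basis_def assoc_pure)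
    thus "(E \<otimes>\<^sub>c F \<otimes>\<^sub>c G) (assoc A B C (tensor_basis (A \<otimes> B) C (tensor_basis A B a b) c i)) k =
        (case i of (x, xa) \<Rightarrow> (case x of (i, j) \<Rightarrow> \<lambda>l. k (i, j, l)) xa)"
      using i coordsD(5)[OF coords_tensor[OF A BC], of "(x,y,z)" k] by simp
  qed
  finally show ?thesis .
qed

lemma associ_coords:
  assumes A: "coords A I a E" and B: "coords B J b F" and C: "coords C L c G"
    and t: "t \<in> vset (A \<otimes> B \<otimes> C)"
  shows "((E \<otimes>\<^sub>c F) \<otimes>\<^sub>c G) (associ A B C t) k = (E \<otimes>\<^sub>c F \<otimes>\<^sub>c G) t (\<lambda>(i, j, l). k ((i, j), l))"
proof -
  note l = lin_associ[OF coordsD(1)[OF A] coordsD(1)[OF B] coordsD(1)[OF C]]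
  note AB = coords_tensor[OF A B] note BC = coords_tensor[OF B C]
  have "((E \<otimes>\<^sub>c F) \<otimes>\<^sub>c G) (associ A B C t) k = (E \<otimes>\<^sub>c F \<otimes>\<^sub>c G) t
     (\<lambda>i. ((E \<otimes>\<^sub>c F) \<otimes>\<^sub>c G) (associ A B C (tensor_basis A (B \<otimes> C) a (tensor_basis B C b c) i)) k)"
    by (rule coords_lin[OF coords_tensor[OF A BC] coords_tensor[OF AB C] l t])
  also have "\<dots> = (E \<otimes>\<^sub>c F \<otimes>\<^sub>c G) t (\<lambda>(i, j, l). k ((i, j), l))"
  proof (rule fin_comb_cong[OF coordsD(4)[OF coords_tensor[OF A BC] t]])
    fix i assume "i \<in> I \<times> J \<times> L"
    then obtain x y z where i: "i = (x, y, z)" "x \<in> I" "y \<in> J" "z \<in> L" by auto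
    note m = coordsD(2)[OF A i(2)] coordsD(2)[OF B i(3)] coordsD(2)[OF C i(4)]
    have "associ A B C (tensor_basis A (B \<otimes> C) a (tensor_basis B C b c) i) = tensor_basis (A \<otimes> B) C (tensor_basis A B a b) c ((x, y), z)"
      using m coordsD(1)[OF A] coordsD(1)[OF C] by (simp add: i(1) tensor_basis_def assoc_pure)
    thus "((E \<otimes>\<^sub>c F) \<otimes>\<^sub>c G) (associ A B C (tensor_basis A (B \<otimes> C) a (tensor_basis B C b c) i)) k =
        (case i of (x, xa, xb) \<Rightarrow> k ((x, xa), xb))"
      using i coordsD(5)[OF coords_tensor[OF AB C], of "((x,y),z)" k] by simp
  qed
  finally show ?thesis .
qed

section \<open>Separating families of forms\<close>

definition separating where
  "separating V E T \<longleftrightarrow> (\<forall>v\<in>vset V. \<forall>w\<in>vset V. (\<forall>k\<in>T. E v k = E w k) \<longrightarrow> v = w)"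

definition prod_forms :: "('i \<Rightarrow> 'k::field) set \<Rightarrow> ('j \<Rightarrow> 'k) set \<Rightarrow> ('i \<times> 'j \<Rightarrow> 'k) set" (infixr "\<otimes>\<^sub>f" 70) where
  "S \<otimes>\<^sub>f T = {\<lambda>(i, j). k i * l j | k l. k \<in> S \<and> l \<in> T}"

lemma separating_UNIV: "coords V I b E \<Longrightarrow> separating V E UNIV"
  unfolding separating_def using coords_ext by blast

lemma fin_comb_support:
  assumes "fin_comb I \<phi>"
  shows "\<exists>F. finite F \<and> F \<subseteq> I \<and> (\<forall>k k'. (\<forall>i\<in>F. k i = k' i) \<longrightarrow> \<phi> k = \<phi> k')"
  using assms
proof induction
  case zero show ?case by (intro exI[of _ "{}"]) auto
next
  case (step i \<phi> c)
  then obtain F where "finite F" "F \<subseteq> I" "\<forall>k k'. (\<forall>i\<in>F. k i = k' i) \<longrightarrow> \<phi> k = \<phi> k'" by blast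
  moreover have "\<forall>k k'. (\<forall>i\<in>insert i F. k i = k' i) \<longrightarrow> c * k i + \<phi> k = c * k' i + \<phi> k'"
    using calculation by (metis insert_iff)
  ultimately show ?case using step.hyps by (intro exI[of _ "insert i F"]) auto
qed

lemma fin_comb_sum:
  assumes "fin_comb I \<phi>" "finite F"
  shows "\<phi> (\<lambda>i. \<Sum>x\<in>F. k x i) = (\<Sum>x\<in>F. \<phi> (k x))"
  using assms(2) by (induction F rule: finite_induct)
    (simp_all add: fin_comb_zero[OF assms(1)] fin_comb_add[OF assms(1)])

text \<open>On the finite support of both functionals every function is a sum of products of indicator
  functions.\<close>

lemma fin_comb_prod_ext:
  assumes "fin_comb (I \<times> J) \<phi>" "fin_comb (I \<times> J) \<psi>"
    and eq: "\<And>k l. \<phi> (\<lambda>(i, j). k i * l j) = \<psi> (\<lambda>(i, j). k i * l j)"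
  shows "\<phi> k = \<psi> k"
proof -
  obtain F where F: "finite F" "\<forall>k k'. (\<forall>i\<in>F. k i = k' i) \<longrightarrow> \<phi> k = \<phi> k'"
    using fin_comb_support[OF assms(1)] by blast
  obtain G where G: "finite G" "\<forall>k k'. (\<forall>i\<in>G. k i = k' i) \<longrightarrow> \<psi> k = \<psi> k'"
    using fin_comb_support[OF assms(2)] by blast
  define d where "d x = (\<lambda>(i, j). (if i = fst x then k x else 0) * (if j = snd x then 1 else 0))" for x
  define k' where "k' i = (\<Sum>x\<in>F \<union> G. d x i)" for i
  have dx: "d x i = (if x = i then k i else 0)" for x i by (auto simp: d_def split: prod.splits)
  have k': "k' i = k i" if "i \<in> F \<union> G" for i
    unfolding k'_def dx using that F G by simp
  have "\<phi> k = \<phi> k'" using F(2) k' by auto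
  also have "\<dots> = (\<Sum>x\<in>F \<union> G. \<phi> (d x))"
    unfolding k'_def using F G by (intro fin_comb_sum[OF assms(1)]) auto
  also have "\<dots> = (\<Sum>x\<in>F \<union> G. \<psi> (d x))"
    unfolding d_def by (intro sum.cong refl) (rule eq)
  also have "\<dots> = \<psi> k'"
    unfolding k'_def using F G by (intro fin_comb_sum[OF assms(2), symmetric]) auto
  also have "\<dots> = \<psi> k" using G(2) k' by auto
  finally show ?thesis .
qed

text \<open>The contraction \<open>v \<otimes> w \<mapsto> k(v) w\<close>, for \<open>k\<close> extended linearly.\<close>

lemma contract_left:
  assumes V: "coords V I b E" and W: "coords W J c F"
  shows "\<exists>G. lin (V \<otimes> W) W G \<and>
    (\<forall>t\<in>vset (V \<otimes> W). \<forall>l. F (G t) l = (E \<otimes>\<^sub>c F) t (\<lambda>(i, j). k i * l j))"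
proof -
  interpret W: vector_space "vscale W" using coordsD(1)[OF W] by (simp add: vspace_def)
  have "\<exists>G. lin (V \<otimes> W) W G \<and> (\<forall>v\<in>vset V. \<forall>w\<in>vset W. G (pure V W v w) = vscale W (E v k) w)"
    by (rule tensor_universal[OF coordsD(1)[OF W]])
      (use coordsD(3)[OF V, of k] vspace_closed[OF coordsD(1)[OF W]] in
        \<open>auto simp: lin_def base_def W.scale_right_distrib W.scale_left_distrib algebra_simps\<close>)
  then obtain G where G: "lin (V \<otimes> W) W G"
    "\<forall>v\<in>vset V. \<forall>w\<in>vset W. G (pure V W v w) = vscale W (E v k) w" by blast
  have "F (G t) l = (E \<otimes>\<^sub>c F) t (\<lambda>(i, j). k i * l j)" if t: "t \<in> vset (V \<otimes> W)" for t l
  proof -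
    have "F (G t) l = (E \<otimes>\<^sub>c F) t (\<lambda>i. F (G (tensor_basis V W b c i)) l)"
      by (rule coords_lin[OF coords_tensor[OF V W] W G(1) t])
    also have "\<dots> = (E \<otimes>\<^sub>c F) t (\<lambda>(i, j). k i * l j)"
      by (rule fin_comb_cong[OF coordsD(4)[OF coords_tensor[OF V W] t]])
        (use G(2) coordsD(2,5)[OF V] coordsD(2,5)[OF W] coordsD(3)[OF W] in
          \<open>auto simp: tensor_basis_def lin_base_iff\<close>)
    finally show ?thesis .
  qed
  thus ?thesis using G(1) by blast
qed

lemma contract_right:
  assumes V: "coords V I b E" and W: "coords W J c F"
  shows "\<exists>G. lin (V \<otimes> W) V G \<and>
    (\<forall>t\<in>vset (V \<otimes> W). \<forall>k. E (G t) k = (E \<otimes>\<^sub>c F) t (\<lambda>(i, j). k i * l j))"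
proof -
  interpret V: vector_space "vscale V" using coordsD(1)[OF V] by (simp add: vspace_def)
  have "\<exists>G. lin (V \<otimes> W) V G \<and> (\<forall>v\<in>vset V. \<forall>w\<in>vset W. G (pure V W v w) = vscale V (F w l) v)"
    by (rule tensor_universal[OF coordsD(1)[OF V]])
      (use coordsD(3)[OF W, of l] vspace_closed[OF coordsD(1)[OF V]] in
        \<open>auto simp: lin_def base_def V.scale_right_distrib V.scale_left_distrib algebra_simps\<close>)
  then obtain G where G: "lin (V \<otimes> W) V G"
    "\<forall>v\<in>vset V. \<forall>w\<in>vset W. G (pure V W v w) = vscale V (F w l) v" by blast
  have "E (G t) k = (E \<otimes>\<^sub>c F) t (\<lambda>(i, j). k i * l j)" if t: "t \<in> vset (V \<otimes> W)" for t k
  proof -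
    have "E (G t) k = (E \<otimes>\<^sub>c F) t (\<lambda>i. E (G (tensor_basis V W b c i)) k)"
      by (rule coords_lin[OF coords_tensor[OF V W] V G(1) t])
    also have "\<dots> = (E \<otimes>\<^sub>c F) t (\<lambda>(i, j). k i * l j)"
      by (rule fin_comb_cong[OF coordsD(4)[OF coords_tensor[OF V W] t]])
        (use G(2) coordsD(2,5)[OF V] coordsD(2,5)[OF W] coordsD(3)[OF V] in
          \<open>auto simp: tensor_basis_def lin_base_iff\<close>)
    finally show ?thesis .
  qed
  thus ?thesis using G(1) by blast
qed

text \<open>Two tensors that agree on all products \<open>k \<otimes> l\<close> with \<open>k \<in> S\<close>, \<open>l \<in> T\<close> have, for each \<open>k \<in> S\<close>, the same
  contraction in \<open>W\<close>, because \<open>T\<close> separates \<open>W\<close>; hence they agree on \<open>k \<otimes> l\<close> for arbitrary \<open>l\<close>.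
  Contracting the other factor removes the restriction on \<open>k\<close> in the same way.\<close>

lemma separating_tensor:
  assumes V: "coords V I b E" and W: "coords W J c F" and S: "separating V E S" and T: "separating W F T"
  shows "separating (V \<otimes> W) (E \<otimes>\<^sub>c F) (S \<otimes>\<^sub>f T)"
  unfolding separating_def
proof (intro ballI impI)
  fix s t assume s: "s \<in> vset (V \<otimes> W)" and t: "t \<in> vset (V \<otimes> W)"
    and eq: "\<forall>k\<in>S \<otimes>\<^sub>f T. (E \<otimes>\<^sub>c F) s k = (E \<otimes>\<^sub>c F) t k"
  have 1: "(E \<otimes>\<^sub>c F) s (\<lambda>(i, j). k i * l j) = (E \<otimes>\<^sub>c F) t (\<lambda>(i, j). k i * l j)" if k: "k \<in> S" for k l
  proof -
    obtain G where G: "lin (V \<otimes> W) W G"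
      "\<forall>t\<in>vset (V \<otimes> W). \<forall>l. F (G t) l = (E \<otimes>\<^sub>c F) t (\<lambda>(i, j). k i * l j)"
      using contract_left[OF V W] by blast
    have "(E \<otimes>\<^sub>c F) s (\<lambda>(i, j). k i * l j) = (E \<otimes>\<^sub>c F) t (\<lambda>(i, j). k i * l j)" if "l \<in> T" for l
      using eq k that unfolding prod_forms_def by blast
    hence "\<forall>l\<in>T. F (G s) l = F (G t) l" using G(2) s t by simp
    hence "G s = G t" using T G(1) s t by (auto simp: separating_def lin_def)
    thus ?thesis using G(2) s t by metis
  qed
  have 2: "(E \<otimes>\<^sub>c F) s (\<lambda>(i, j). k i * l j) = (E \<otimes>\<^sub>c F) t (\<lambda>(i, j). k i * l j)" for k l
  proof -
    obtain G where G: "lin (V \<otimes> W) V G"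
      "\<forall>t\<in>vset (V \<otimes> W). \<forall>k. E (G t) k = (E \<otimes>\<^sub>c F) t (\<lambda>(i, j). k i * l j)"
      using contract_right[OF V W] by blast
    have "\<forall>k\<in>S. E (G s) k = E (G t) k" using G(2) s t 1 by auto
    hence "G s = G t" using S G(1) s t by (auto simp: separating_def lin_def)
    thus ?thesis using G(2) s t by metis
  qed
  note VW = coords_tensor[OF V W]
  show "s = t"
    by (rule coords_ext[OF VW s t], rule fin_comb_prod_ext[OF coordsD(4)[OF VW s] coordsD(4)[OF VW t] 2])
qed

section \<open>Structure maps in coordinates\<close>


text \<open>The structure maps as operators on integrands.  Off the basis they are \<open>0\<close>, so that most
  laws hold for all arguments.\<close>

definition braid_op where
  "braid_op V W \<Psi> a b k = (if a \<in> bas V \<and> b \<in> bas W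
     then (crd W \<otimes>\<^sub>c crd V) (\<Psi> (pure V W a b)) (\<lambda>(x, y). k x y) else 0)"

definition mult_op where
  "mult_op V m a b k = (if a \<in> bas V \<and> b \<in> bas V then crd V (m (pure V V a b)) k else 0)"

definition comult_op where
  "comult_op V \<Delta> a k = (if a \<in> bas V then (crd V \<otimes>\<^sub>c crd V) (\<Delta> a) (\<lambda>(x, y). k x y) else 0)"

lemma coords_bas2: "vspace V \<Longrightarrow> vspace W \<Longrightarrow>
    coords (V \<otimes> W) (bas V \<times> bas W) (tensor_basis V W (\<lambda>x. x) (\<lambda>x. x)) (crd V \<otimes>\<^sub>c crd W)"
  by (intro coords_tensor coords_bas)

lemma fin_comb_bas2: "vspace V \<Longrightarrow> vspace W \<Longrightarrow> t \<in> vset (V \<otimes> W) \<Longrightarrow>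
    fin_comb (bas V \<times> bas W) ((crd V \<otimes>\<^sub>c crd W) t)"
  by (rule coordsD(4)[OF coords_bas2])

lemma bas_in: "vspace V \<Longrightarrow> x \<in> bas V \<Longrightarrow> x \<in> vset V"
  by (rule coordsD(2)[OF coords_bas])

lemma crd_bas: "vspace V \<Longrightarrow> x \<in> bas V \<Longrightarrow> crd V x k = k x"
  by (rule coordsD(5)[OF coords_bas])

lemma lin_in: "lin V W f \<Longrightarrow> x \<in> vset V \<Longrightarrow> f x \<in> vset W"
  by (simp add: lin_def)

lemma lin_id: "lin V V id" by (simp add: lin_def)

lemma braid_crd:
  assumes "vspace V" "vspace W" "lin (V \<otimes> W) (W \<otimes> V) \<Psi>" "t \<in> vset (V \<otimes> W)"
  shows "(crd W \<otimes>\<^sub>c crd V) (\<Psi> t) k = (crd V \<otimes>\<^sub>c crd W) t (\<lambda>(a, b). braid_op V W \<Psi> a b (\<lambda>b a. k (b, a)))"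
  unfolding coords_lin[OF coords_bas2[OF assms(1,2)] coords_bas2[OF assms(2,1)] assms(3,4)]
  by (rule fin_comb_cong[OF fin_comb_bas2[OF assms(1,2,4)]]) (auto simp: braid_op_def tensor_basis_def)

lemma mult_crd:
  assumes "vspace V" "lin (V \<otimes> V) V m" "t \<in> vset (V \<otimes> V)"
  shows "crd V (m t) k = (crd V \<otimes>\<^sub>c crd V) t (\<lambda>(a, b). mult_op V m a b k)"
  unfolding coords_lin[OF coords_bas2[OF assms(1,1)] coords_bas[OF assms(1)] assms(2,3)]
  by (rule fin_comb_cong[OF fin_comb_bas2[OF assms(1,1,3)]]) (auto simp: mult_op_def tensor_basis_def)

lemma comult_crd:
  assumes "vspace V" "lin V (V \<otimes> V) \<Delta>" "v \<in> vset V"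
  shows "(crd V \<otimes>\<^sub>c crd V) (\<Delta> v) k = crd V v (\<lambda>a. comult_op V \<Delta> a (\<lambda>x y. k (x, y)))"
  unfolding coords_lin[OF coords_bas[OF assms(1)] coords_bas2[OF assms(1,1)] assms(2,3)]
  by (rule fin_comb_cong[OF coordsD(4)[OF coords_bas[OF assms(1)] assms(3)]]) (auto simp: comult_op_def)

lemma tmap_mult1_crd:
  assumes "vspace V" "vspace W" "lin (V \<otimes> V) V m" "t \<in> vset ((V \<otimes> V) \<otimes> W)"
  shows "(crd V \<otimes>\<^sub>c crd W) (tmap V W m id t) k =
    ((crd V \<otimes>\<^sub>c crd V) \<otimes>\<^sub>c crd W) t (\<lambda>((a, b), c). mult_op V m a b (\<lambda>x. k (x, c)))"
  unfolding tmap_coords[OF coords_bas2[OF assms(1,1)] coords_bas[OF assms(2)]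
      coords_bas[OF assms(1)] coords_bas[OF assms(2)] assms(3) lin_id assms(4)]
  by (rule fin_comb_cong[OF coordsD(4)[OF coords3L[OF assms(1,1,2)] assms(4)]])
    (use assms in \<open>auto simp: mult_op_def tensor_basis_def crd_bas\<close>)

lemma tmap_mult2_crd:
  assumes "vspace V" "vspace W" "lin (V \<otimes> V) V m" "t \<in> vset (W \<otimes> V \<otimes> V)"
  shows "(crd W \<otimes>\<^sub>c crd V) (tmap W V id m t) k =
    (crd W \<otimes>\<^sub>c crd V \<otimes>\<^sub>c crd V) t (\<lambda>(c, a, b). mult_op V m a b (\<lambda>x. k (c, x)))"
  unfolding tmap_coords[OF coords_bas[OF assms(2)] coords_bas2[OF assms(1,1)]
      coords_bas[OF assms(2)] coords_bas[OF assms(1)] lin_id assms(3,4)]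
  by (rule fin_comb_cong[OF coordsD(4)[OF coords3R[OF assms(2,1,1)] assms(4)]])
    (use assms in \<open>auto simp: mult_op_def tensor_basis_def crd_bas\<close>)

lemma tmap_comult1_crd:
  assumes "vspace V" "vspace W" "lin V (V \<otimes> V) \<Delta>" "t \<in> vset (V \<otimes> W)"
  shows "((crd V \<otimes>\<^sub>c crd V) \<otimes>\<^sub>c crd W) (tmap (V \<otimes> V) W \<Delta> id t) k =
    (crd V \<otimes>\<^sub>c crd W) t (\<lambda>(a, b). comult_op V \<Delta> a (\<lambda>x y. k ((x, y), b)))"
  unfolding tmap_coords[OF coords_bas[OF assms(1)] coords_bas[OF assms(2)]
      coords_bas2[OF assms(1,1)] coords_bas[OF assms(2)] assms(3) lin_id assms(4)]
  by (rule fin_comb_cong[OF fin_comb_bas2[OF assms(1,2,4)]])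
    (use assms in \<open>auto simp: comult_op_def crd_bas split_def\<close>)

lemma tmap_comult2_crd:
  assumes "vspace V" "vspace W" "lin V (V \<otimes> V) \<Delta>" "t \<in> vset (W \<otimes> V)"
  shows "(crd W \<otimes>\<^sub>c crd V \<otimes>\<^sub>c crd V) (tmap W (V \<otimes> V) id \<Delta> t) k =
    (crd W \<otimes>\<^sub>c crd V) t (\<lambda>(b, a). comult_op V \<Delta> a (\<lambda>x y. k (b, x, y)))"
  unfolding tmap_coords[OF coords_bas[OF assms(2)] coords_bas[OF assms(1)]
      coords_bas[OF assms(2)] coords_bas2[OF assms(1,1)] lin_id assms(3,4)]
  by (rule fin_comb_cong[OF fin_comb_bas2[OF assms(2,1,4)]])
    (use assms in \<open>auto simp: comult_op_def crd_bas split_def\<close>)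

lemma assoc_crd:
  assumes "vspace A" "vspace B" "vspace C" "t \<in> vset ((A \<otimes> B) \<otimes> C)"
  shows "(crd A \<otimes>\<^sub>c crd B \<otimes>\<^sub>c crd C) (assoc A B C t) k =
    ((crd A \<otimes>\<^sub>c crd B) \<otimes>\<^sub>c crd C) t (\<lambda>((i, j), l). k (i, j, l))"
  by (rule assoc_coords[OF coords_bas coords_bas coords_bas, OF assms])

lemma associ_crd:
  assumes "vspace A" "vspace B" "vspace C" "t \<in> vset (A \<otimes> B \<otimes> C)"
  shows "((crd A \<otimes>\<^sub>c crd B) \<otimes>\<^sub>c crd C) (associ A B C t) k =
    (crd A \<otimes>\<^sub>c crd B \<otimes>\<^sub>c crd C) t (\<lambda>(i, j, l). k ((i, j), l))"
  by (rule associ_coords[OF coords_bas coords_bas coords_bas, OF assms])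

lemma lin_braidL:
  assumes "vspace A" "vspace B" "vspace C" "lin (A \<otimes> B) (B \<otimes> A) \<Psi>"
  shows "lin (A \<otimes> B \<otimes> C) (B \<otimes> A \<otimes> C) (braidL A B C \<Psi>)"
  unfolding braidL_def using assms
  by (intro lin_comp[OF lin_comp[OF lin_associ lin_tmap] lin_assoc] lin_id vspace_tensor)

lemma lin_braidR:
  assumes "vspace A" "vspace B" "vspace C" "lin (B \<otimes> C) (C \<otimes> B) \<Psi>"
  shows "lin (A \<otimes> B \<otimes> C) (A \<otimes> C \<otimes> B) (braidR A B C \<Psi>)"
  unfolding braidR_def using assms by (intro lin_tmap lin_id vspace_tensor)

lemma braidL_coords:
  assumes A: "vspace A" and B: "vspace B" and C: "coords C L c G"
    and \<Psi>: "lin (A \<otimes> B) (B \<otimes> A) \<Psi>" and t: "t \<in> vset (A \<otimes> B \<otimes> C)"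
  shows "(crd B \<otimes>\<^sub>c crd A \<otimes>\<^sub>c G) (braidL A B C \<Psi> t) k =
    (crd A \<otimes>\<^sub>c crd B \<otimes>\<^sub>c G) t (\<lambda>(a, b, l). braid_op A B \<Psi> a b (\<lambda>b a. k (b, a, l)))"
proof -
  note v = A B coordsD(1)[OF C]
  define s where "s = associ A B C t"
  have s: "s \<in> vset ((A \<otimes> B) \<otimes> C)" unfolding s_def by (rule lin_in[OF lin_associ[OF v] t])
  define r where "r = tmap (B \<otimes> A) C \<Psi> id s"
  have r: "r \<in> vset ((B \<otimes> A) \<otimes> C)"
    unfolding r_def by (rule lin_in[OF lin_tmap[OF vspace_tensor v(3) \<Psi> lin_id] s])
  have "(crd B \<otimes>\<^sub>c crd A \<otimes>\<^sub>c G) (braidL A B C \<Psi> t) k =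
      ((crd B \<otimes>\<^sub>c crd A) \<otimes>\<^sub>c G) r (\<lambda>((i, j), l). k (i, j, l))"
    unfolding braidL_def s_def[symmetric] r_def[symmetric]
    by (rule assoc_coords[OF coords_bas[OF B] coords_bas[OF A] C r])
  also have "\<dots> = ((crd A \<otimes>\<^sub>c crd B) \<otimes>\<^sub>c G) s
      (\<lambda>((a, b), l). braid_op A B \<Psi> a b (\<lambda>b a. k (b, a, l)))"
    unfolding r_def tmap_coords[OF coords_bas2[OF A B] C coords_bas2[OF B A] C \<Psi> lin_id s]
    by (rule fin_comb_cong[OF coordsD(4)[OF coords_tensor[OF coords_bas2[OF A B] C] s]])
      (auto simp: braid_op_def tensor_basis_def coordsD(5)[OF C] split_def)
  also have "\<dots> = (crd A \<otimes>\<^sub>c crd B \<otimes>\<^sub>c G) t (\<lambda>(a, b, l). braid_op A B \<Psi> a b (\<lambda>b a. k (b, a, l)))"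
    unfolding s_def associ_coords[OF coords_bas[OF A] coords_bas[OF B] C t] by (simp add: split_def)
  finally show ?thesis .
qed

lemma braidL_crd:
  assumes "vspace A" "vspace B" "vspace C" "lin (A \<otimes> B) (B \<otimes> A) \<Psi>" "t \<in> vset (A \<otimes> B \<otimes> C)"
  shows "(crd B \<otimes>\<^sub>c crd A \<otimes>\<^sub>c crd C) (braidL A B C \<Psi> t) k =
    (crd A \<otimes>\<^sub>c crd B \<otimes>\<^sub>c crd C) t (\<lambda>(a, b, c). braid_op A B \<Psi> a b (\<lambda>b a. k (b, a, c)))"
  by (rule braidL_coords[OF assms(1,2) coords_bas[OF assms(3)] assms(4,5)])

lemma braidR_crd:
  assumes "vspace A" "vspace B" "vspace C" "lin (B \<otimes> C) (C \<otimes> B) \<Psi>" "t \<in> vset (A \<otimes> B \<otimes> C)"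
  shows "(crd A \<otimes>\<^sub>c crd C \<otimes>\<^sub>c crd B) (braidR A B C \<Psi> t) k =
    (crd A \<otimes>\<^sub>c crd B \<otimes>\<^sub>c crd C) t (\<lambda>(a, b, c). braid_op B C \<Psi> b c (\<lambda>c b. k (a, c, b)))"
  unfolding braidR_def tmap_coords[OF coords_bas[OF assms(1)] coords_bas2[OF assms(2,3)]
      coords_bas[OF assms(1)] coords_bas2[OF assms(3,2)] lin_id assms(4,5)]
  by (rule fin_comb_cong[OF coordsD(4)[OF coords3R[OF assms(1-3)] assms(5)]])
    (use assms in \<open>auto simp: braid_op_def tensor_basis_def crd_bas split_def\<close>)

lemma lin_braidM:
  assumes v: "vspace A" "vspace B" "vspace C" "vspace D" and \<Psi>: "lin (B \<otimes> C) (C \<otimes> B) \<Psi>"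
  shows "lin ((A \<otimes> B) \<otimes> (C \<otimes> D)) ((A \<otimes> C) \<otimes> (B \<otimes> D)) (braidM A B C D \<Psi>)"
  unfolding braidM_def using assms
  by (intro lin_comp[OF lin_comp[OF lin_assoc lin_tmap] lin_associ] lin_id vspace_tensor lin_braidL)

text \<open>The three associativity isomorphisms in \<open>id \<otimes> \<Psi> \<otimes> id\<close> disappear: in coordinates it acts by \<open>\<Psi>\<close>
  on the two middle components.\<close>

lemma braidM_crd:
  assumes v: "vspace A" "vspace B" "vspace C" "vspace D" and \<Psi>: "lin (B \<otimes> C) (C \<otimes> B) \<Psi>"
    and t: "t \<in> vset ((A \<otimes> B) \<otimes> (C \<otimes> D))"
  shows "((crd A \<otimes>\<^sub>c crd C) \<otimes>\<^sub>c (crd B \<otimes>\<^sub>c crd D)) (braidM A B C D \<Psi> t) k =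
    ((crd A \<otimes>\<^sub>c crd B) \<otimes>\<^sub>c (crd C \<otimes>\<^sub>c crd D)) t
      (\<lambda>((a, b), (c, d)). braid_op B C \<Psi> b c (\<lambda>c b. k ((a, c), (b, d))))"
proof -
  note b = v[THEN coords_bas]
  note BD = coords_bas2[OF v(2,4)] note CD = coords_bas2[OF v(3,4)]
  note BCD = coords_tensor[OF b(2) CD] note CBD = coords_tensor[OF b(3) BD]
  define s where "s = assoc A B (C \<otimes> D) t"
  have s: "s \<in> vset (A \<otimes> B \<otimes> C \<otimes> D)" unfolding s_def by (rule lin_in[OF lin_assoc[OF v(1,2) vspace_tensor] t])
  note lL = lin_braidL[OF v(2,3,4) \<Psi>]
  define r where "r = tmap A (C \<otimes> B \<otimes> D) id (braidL B C D \<Psi>) s"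
  have r: "r \<in> vset (A \<otimes> C \<otimes> B \<otimes> D)"
    unfolding r_def by (rule lin_in[OF lin_tmap[OF v(1) vspace_tensor lin_id lL] s])
  have "((crd A \<otimes>\<^sub>c crd C) \<otimes>\<^sub>c (crd B \<otimes>\<^sub>c crd D)) (braidM A B C D \<Psi> t) k =
     (crd A \<otimes>\<^sub>c crd C \<otimes>\<^sub>c (crd B \<otimes>\<^sub>c crd D)) r (\<lambda>(i, j, l). k ((i, j), l))"
    unfolding braidM_def s_def[symmetric] r_def[symmetric]
    by (rule associ_coords[OF b(1) b(3) BD r])
  also have "\<dots> = (crd A \<otimes>\<^sub>c crd B \<otimes>\<^sub>c (crd C \<otimes>\<^sub>c crd D)) s
     (\<lambda>(a, b, c, d). braid_op B C \<Psi> b c (\<lambda>c b. k ((a, c), (b, d))))"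
    unfolding r_def tmap_coords[OF b(1) BCD b(1) CBD lin_id lL s]
  proof (rule fin_comb_cong[OF coordsD(4)[OF coords_tensor[OF b(1) BCD] s]])
    fix i assume "i \<in> bas A \<times> bas B \<times> bas C \<times> bas D"
    then obtain x y z w where i: "i = (x, y, z, w)" "x \<in> bas A" "y \<in> bas B" "z \<in> bas C" "w \<in> bas D"
      by auto
    let ?p = "pure B (C \<otimes> D) y (pure C D z w)"
    have p: "?p \<in> vset (B \<otimes> C \<otimes> D)" using i v by (simp add: bas_in pure_in_tensor)
    have "(crd C \<otimes>\<^sub>c crd B \<otimes>\<^sub>c crd D) (braidL B C D \<Psi> ?p) h = braid_op B C \<Psi> y z (\<lambda>c b. h (c, b, w))" for h
      unfolding braidL_crd[OF v(2,3,4) \<Psi> p]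
      using coordsD(5)[OF BCD, of "(y,z,w)"] i by (simp add: tensor_basis_def)
    thus "(case i of (i, j) \<Rightarrow> crd A (id i) (\<lambda>i'. (crd C \<otimes>\<^sub>c crd B \<otimes>\<^sub>c crd D)
         (braidL B C D \<Psi> (tensor_basis B (C \<otimes> D) (\<lambda>x. x) (tensor_basis C D (\<lambda>x. x) (\<lambda>x. x)) j))
         (\<lambda>j'. case (i', j') of (i, j, l) \<Rightarrow> k ((i, j), l)))) =
      (case i of (a, b, c, d) \<Rightarrow> braid_op B C \<Psi> b c (\<lambda>c b. k ((a, c), b, d)))"
      using i v by (simp add: tensor_basis_def crd_bas)
  qed
  also have "\<dots> = ((crd A \<otimes>\<^sub>c crd B) \<otimes>\<^sub>c (crd C \<otimes>\<^sub>c crd D)) t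
      (\<lambda>((a, b), (c, d)). braid_op B C \<Psi> b c (\<lambda>c b. k ((a, c), (b, d))))"
    unfolding s_def assoc_coords[OF b(1,2) CD t] by (simp add: split_def)
  finally show ?thesis .
qed

lemma tmap_mults_crd:
  assumes v: "vspace V" and m: "lin (V \<otimes> V) V m" and t: "t \<in> vset ((V \<otimes> V) \<otimes> (V \<otimes> V))"
  shows "(crd V \<otimes>\<^sub>c crd V) (tmap V V m m t) k =
    ((crd V \<otimes>\<^sub>c crd V) \<otimes>\<^sub>c (crd V \<otimes>\<^sub>c crd V)) t
      (\<lambda>((a, b), (c, d)). mult_op V m a b (\<lambda>x. mult_op V m c d (\<lambda>y. k (x, y))))"
  unfolding tmap_coords[OF coords_bas2[OF v v] coords_bas2[OF v v] coords_bas[OF v] coords_bas[OF v] m m t]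
  by (rule fin_comb_cong[OF coordsD(4)[OF coords_tensor[OF coords_bas2[OF v v] coords_bas2[OF v v]] t]])
    (auto simp: mult_op_def tensor_basis_def split_def)

lemma tmap_comults_crd:
  assumes v: "vspace V" "vspace W" and m: "lin V (V \<otimes> V) \<Delta>" "lin W (W \<otimes> W) \<Delta>'" and t: "t \<in> vset (V \<otimes> W)"
  shows "((crd V \<otimes>\<^sub>c crd V) \<otimes>\<^sub>c (crd W \<otimes>\<^sub>c crd W)) (tmap (V \<otimes> V) (W \<otimes> W) \<Delta> \<Delta>' t) k =
    (crd V \<otimes>\<^sub>c crd W) t
      (\<lambda>(a, b). comult_op V \<Delta> a (\<lambda>a1 a2. comult_op W \<Delta>' b (\<lambda>b1 b2. k ((a1, a2), (b1, b2)))))"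
  unfolding tmap_coords[OF coords_bas[OF v(1)] coords_bas[OF v(2)] coords_bas2[OF v(1,1)] coords_bas2[OF v(2,2)] m t]
  by (rule fin_comb_cong[OF fin_comb_bas2[OF v t]]) (auto simp: comult_op_def split_def)

text \<open>The field as a one-dimensional space.\<close>

lemma coords_base: "coords (base :: ('k::field, 'k) vsp) {()} (\<lambda>_. 1) (\<lambda>x k. x * k ())"
  unfolding coords_def
proof (intro conjI ballI allI impI)
  show "vspace (base :: ('k, 'k) vsp)"
    unfolding vspace_def base_def
    by (auto simp: vector_space_def module.subspace_def module_def algebra_simps)
  show "lin (base :: ('k, 'k) vsp) base (\<lambda>v. v * k ())" for k by (simp add: lin_def base_def algebra_simps)
  show "fin_comb {()} (\<lambda>k. v * k ())" for v :: 'k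
    by (rule fin_comb_times[OF fin_comb_single]) simp
  show "\<phi> v = v * \<phi> 1" if "lin (base :: ('k, 'k) vsp) base \<phi>" for \<phi> and v :: 'k
  proof -
    have "\<phi> (v * 1) = v * \<phi> 1" using that unfolding lin_def base_def by (simp del: mult_1_right)
    thus ?thesis by simp
  qed
qed (simp_all add: base_def)

text \<open>By contraction \<open>(\<epsilon> \<otimes> id) t = 1 \<otimes> w\<close> for some \<open>w\<close>, and \<open>w\<close> is then the value of the unit
  isomorphism.\<close>

lemma lunit_tmap_crd:
  assumes v: "vspace V" "vspace W" and e: "lin V base \<epsilon>" and t: "t \<in> vset (V \<otimes> W)"
  shows "crd W (lunit W (tmap base W \<epsilon> id t)) k = (crd V \<otimes>\<^sub>c crd W) t (\<lambda>(a, b). \<epsilon> a * k b)"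
    "lunit W (tmap base W \<epsilon> id t) \<in> vset W"
proof -
  note V = coords_bas[OF v(1)] note W = coords_bas[OF v(2)] note VW = coords_bas2[OF v]
  note KW = coords_tensor[OF coords_base W]
  obtain G where G: "lin (V \<otimes> W) W G"
    "\<And>t l. t \<in> vset (V \<otimes> W) \<Longrightarrow> crd W (G t) l = (crd V \<otimes>\<^sub>c crd W) t (\<lambda>(i, j). \<epsilon> i * l j)"
    using contract_left[OF V W] by blast
  have 1: "(1::'a) \<in> vset base" by (simp add: base_def)
  have Gt: "G t \<in> vset W" by (rule lin_in[OF G(1) t])
  have T: "tmap base W \<epsilon> id t \<in> vset (base \<otimes> W)"
    by (rule lin_in[OF lin_tmap[OF v e lin_id] t])
  have "tmap base W \<epsilon> id t = pure base W 1 (G t)"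
  proof (rule coords_ext[OF KW T pure_in_tensor[OF 1 Gt]])
    fix k
    show "((\<lambda>x k. x * k ()) \<otimes>\<^sub>c crd W) (tmap base W \<epsilon> id t) k = ((\<lambda>x k. x * k ()) \<otimes>\<^sub>c crd W) (pure base W 1 (G t)) k"
      unfolding tmap_coords[OF V W coords_base W e lin_id t] tensor_coords_pure[OF coords_base W 1 Gt]
      using G(2)[OF t]
      by (simp, intro fin_comb_cong[OF fin_comb_bas2[OF v t]]) (auto simp: crd_bas v)
  qed
  moreover have "inj_on (pure base W 1) (vset W)"
  proof (rule inj_onI, rule coords_ext[OF W])
    fix x y k assume x: "x \<in> vset W" and y: "y \<in> vset W" and eq: "pure base W 1 x = pure base W 1 y"
    show "crd W x k = crd W y k"
      using tensor_coords_pure[OF coords_base W 1 x, of "\<lambda>(_, j). k j"] tensor_coords_pure[OF coords_base W 1 y, of "\<lambda>(_, j). k j"] eq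
      by simp
  qed
  ultimately have "lunit W (tmap base W \<epsilon> id t) = G t"
    using Gt inv_into_f_f[of "pure base W 1" "vset W" "G t"] by (simp add: lunit_def)
  thus "crd W (lunit W (tmap base W \<epsilon> id t)) k = (crd V \<otimes>\<^sub>c crd W) t (\<lambda>(a, b). \<epsilon> a * k b)"
    "lunit W (tmap base W \<epsilon> id t) \<in> vset W" using G(2)[OF t] Gt by simp_all
qed

lemma runit_tmap_crd:
  assumes v: "vspace V" "vspace W" and e: "lin V base \<epsilon>" and t: "t \<in> vset (W \<otimes> V)"
  shows "crd W (runit W (tmap W base id \<epsilon> t)) k = (crd W \<otimes>\<^sub>c crd V) t (\<lambda>(b, a). \<epsilon> a * k b)"
    "runit W (tmap W base id \<epsilon> t) \<in> vset W"
proof -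
  note V = coords_bas[OF v(1)] note W = coords_bas[OF v(2)] note VW = coords_bas2[OF v(2,1)]
  note WK = coords_tensor[OF W coords_base]
  obtain G where G: "lin (W \<otimes> V) W G"
    "\<And>t l. t \<in> vset (W \<otimes> V) \<Longrightarrow> crd W (G t) l = (crd W \<otimes>\<^sub>c crd V) t (\<lambda>(i, j). l i * \<epsilon> j)"
    using contract_right[OF W V] by blast
  have 1: "(1::'a) \<in> vset base" by (simp add: base_def)
  have Gt: "G t \<in> vset W" by (rule lin_in[OF G(1) t])
  have T: "tmap W base id \<epsilon> t \<in> vset (W \<otimes> base)"
    by (rule lin_in[OF lin_tmap[OF v(2,1) lin_id e] t])
  have "tmap W base id \<epsilon> t = pure W base (G t) 1"
  proof (rule coords_ext[OF WK T pure_in_tensor[OF Gt 1]])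
    fix k
    show "(crd W \<otimes>\<^sub>c (\<lambda>x k. x * k ())) (tmap W base id \<epsilon> t) k = (crd W \<otimes>\<^sub>c (\<lambda>x k. x * k ())) (pure W base (G t) 1) k"
      unfolding tmap_coords[OF W V W coords_base lin_id e t] tensor_coords_pure[OF W coords_base Gt 1]
      using G(2)[OF t]
      by (simp, intro fin_comb_cong[OF fin_comb_bas2[OF v(2,1) t]]) (auto simp: crd_bas v mult.commute)
  qed
  moreover have "inj_on (\<lambda>v. pure W base v 1) (vset W)"
  proof (rule inj_onI, rule coords_ext[OF W])
    fix x y k assume x: "x \<in> vset W" and y: "y \<in> vset W" and eq: "pure W base x 1 = pure W base y 1"
    show "crd W x k = crd W y k"
      using tensor_coords_pure[OF W coords_base x 1, of "\<lambda>(j, _). k j"] tensor_coords_pure[OF W coords_base y 1, of "\<lambda>(j, _). k j"] eq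
      by simp
  qed
  ultimately have "runit W (tmap W base id \<epsilon> t) = G t"
    using Gt inv_into_f_f[of "\<lambda>v. pure W base v 1" "vset W" "G t"] by (simp add: runit_def)
  thus "crd W (runit W (tmap W base id \<epsilon> t)) k = (crd W \<otimes>\<^sub>c crd V) t (\<lambda>(b, a). \<epsilon> a * k b)"
    "runit W (tmap W base id \<epsilon> t) \<in> vset W" using G(2)[OF t] Gt by (simp_all add: mult.commute)
qed

section \<open>The axioms in coordinates\<close>


text \<open>If two linear maps are given in coordinates by operators \<open>\<phi>\<close> and \<open>\<psi>\<close>, their equality can be read off
  on basis elements: for all integrands when it is assumed, and with integrands from a separating
  family when it is to be proved (\<open>coords_eq_bwd\<close>).  The first form is applied to \<open>H\<close>; the second to \<open>U\<close>,
  where the integrands are evaluations at elements of \<open>H\<close>.\<close>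

lemma coords_eq_fwd:
  assumes "coords D I b E" "\<forall>t\<in>vset D. f t = g t"
    and "\<forall>t\<in>vset D. \<forall>k. F (f t) k = E t (\<lambda>i. \<phi> i k)"
    and "\<forall>t\<in>vset D. \<forall>k. F (g t) k = E t (\<lambda>i. \<psi> i k)"
    and "i \<in> I"
  shows "\<phi> i k = \<psi> i k"
  using assms(2-4) coordsD(2,5)[OF assms(1,5)] by metis

lemma coords_eq_bwd:
  assumes "coords D I b E" "separating C F T"
    and "\<forall>t\<in>vset D. f t \<in> vset C" "\<forall>t\<in>vset D. g t \<in> vset C"
    and "\<forall>t\<in>vset D. \<forall>k. F (f t) k = E t (\<lambda>i. \<phi> i k)"
    and "\<forall>t\<in>vset D. \<forall>k. F (g t) k = E t (\<lambda>i. \<psi> i k)"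
    and "\<And>i k. i \<in> I \<Longrightarrow> k \<in> T \<Longrightarrow> \<phi> i k = \<psi> i k"
  shows "\<forall>t\<in>vset D. f t = g t"
proof
  fix t assume t: "t \<in> vset D"
  have "F (f t) k = F (g t) k" if "k \<in> T" for k
    unfolding assms(5,6)[rule_format, OF t]
    by (rule fin_comb_cong[OF coordsD(4)[OF assms(1) t]]) (rule assms(7)[OF _ that])
  thus "f t = g t" using assms(2-4) t unfolding separating_def by blast
qed

lemma separating_bas2:
  assumes "vspace V" "vspace W" "separating V (crd V) S" "separating W (crd W) T"
  shows "separating (V \<otimes> W) (crd V \<otimes>\<^sub>c crd W) (S \<otimes>\<^sub>f T)"
  by (rule separating_tensor[OF coords_bas[OF assms(1)] coords_bas[OF assms(2)] assms(3,4)])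

lemma separating_bas3:
  assumes "vspace A" "vspace B" "vspace C" "separating A (crd A) R" "separating B (crd B) S" "separating C (crd C) T"
  shows "separating (A \<otimes> B \<otimes> C) (crd A \<otimes>\<^sub>c crd B \<otimes>\<^sub>c crd C) (R \<otimes>\<^sub>f S \<otimes>\<^sub>f T)"
  by (rule separating_tensor[OF coords_bas[OF assms(1)] coords_bas2[OF assms(2,3)] assms(4) separating_bas2[OF assms(2,3,5,6)]])

text \<open>The hexagonal braid equation for three spaces with three braidings.  It contains the braid equation
  of a braided space as well as those of left and right braided spaces.\<close>

lemma triple_braid:
  assumes v: "vspace A" "vspace B" "vspace C"
    and l: "lin (A \<otimes> B) (B \<otimes> A) \<Psi>1" "lin (A \<otimes> C) (C \<otimes> A) \<Psi>2" "lin (B \<otimes> C) (C \<otimes> B) \<Psi>3"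
  defines "P \<equiv> braid_op A B \<Psi>1" and "Q \<equiv> braid_op A C \<Psi>2" and "R \<equiv> braid_op B C \<Psi>3"
  shows triple_braid_fwd: "\<forall>t\<in>vset (A \<otimes> B \<otimes> C).
        braidL B C A \<Psi>3 (braidR B A C \<Psi>2 (braidL A B C \<Psi>1 t)) =
        braidR C A B \<Psi>1 (braidL A C B \<Psi>2 (braidR A B C \<Psi>3 t)) \<Longrightarrow>
      a \<in> bas A \<Longrightarrow> b \<in> bas B \<Longrightarrow> c \<in> bas C \<Longrightarrow>
      P a b (\<lambda>b a. Q a c (\<lambda>c a. R b c (\<lambda>c b. k c b a))) =
      R b c (\<lambda>c b. Q a c (\<lambda>c a. P a b (\<lambda>b a. k c b a)))"
    and triple_braid_bwd: "separating A (crd A) S1 \<Longrightarrow> separating B (crd B) S2 \<Longrightarrow> separating C (crd C) S3 \<Longrightarrow>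
      (\<And>a b c k1 k2 k3. a \<in> bas A \<Longrightarrow> b \<in> bas B \<Longrightarrow> c \<in> bas C \<Longrightarrow> k1 \<in> S1 \<Longrightarrow> k2 \<in> S2 \<Longrightarrow> k3 \<in> S3 \<Longrightarrow>
        P a b (\<lambda>b a. Q a c (\<lambda>c a. R b c (\<lambda>c b. k3 c * (k2 b * k1 a)))) =
        R b c (\<lambda>c b. Q a c (\<lambda>c a. P a b (\<lambda>b a. k3 c * (k2 b * k1 a))))) \<Longrightarrow>
      \<forall>t\<in>vset (A \<otimes> B \<otimes> C).
        braidL B C A \<Psi>3 (braidR B A C \<Psi>2 (braidL A B C \<Psi>1 t)) =
        braidR C A B \<Psi>1 (braidL A C B \<Psi>2 (braidR A B C \<Psi>3 t))"
proof -
  let ?f = "\<lambda>t. braidL B C A \<Psi>3 (braidR B A C \<Psi>2 (braidL A B C \<Psi>1 t))"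
  let ?g = "\<lambda>t. braidR C A B \<Psi>1 (braidL A C B \<Psi>2 (braidR A B C \<Psi>3 t))"
  let ?\<phi> = "\<lambda>(a, b, c) k. P a b (\<lambda>b a. Q a c (\<lambda>c a. R b c (\<lambda>c b. k (c, b, a))))"
  let ?\<psi> = "\<lambda>(a, b, c) k. R b c (\<lambda>c b. Q a c (\<lambda>c a. P a b (\<lambda>b a. k (c, b, a))))"
  note L1 = lin_in[OF lin_braidL[OF v l(1)]] note L2 = lin_in[OF lin_braidR[OF v(2,1,3) l(2)]]
  note L3 = lin_in[OF lin_braidL[OF v(2,3,1) l(3)]] note R1 = lin_in[OF lin_braidR[OF v l(3)]]
  note R2 = lin_in[OF lin_braidL[OF v(1,3,2) l(2)]] note R3 = lin_in[OF lin_braidR[OF v(3,1,2) l(1)]]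
  have f: "\<forall>t\<in>vset (A \<otimes> B \<otimes> C). ?f t \<in> vset (C \<otimes> B \<otimes> A)" "\<forall>t\<in>vset (A \<otimes> B \<otimes> C). ?g t \<in> vset (C \<otimes> B \<otimes> A)"
    by (auto intro: L1 L2 L3 R1 R2 R3)
  have 1: "\<forall>t\<in>vset (A \<otimes> B \<otimes> C). \<forall>k. (crd C \<otimes>\<^sub>c crd B \<otimes>\<^sub>c crd A) (?f t) k = (crd A \<otimes>\<^sub>c crd B \<otimes>\<^sub>c crd C) t (\<lambda>i. ?\<phi> i k)"
    by (simp add: braidL_crd[OF v(2,3,1) l(3)] braidR_crd[OF v(2,1,3) l(2)] braidL_crd[OF v l(1)] P_def Q_def R_def L1 L2 L3 R1 R2 R3 split_def)
  have 2: "\<forall>t\<in>vset (A \<otimes> B \<otimes> C). \<forall>k. (crd C \<otimes>\<^sub>c crd B \<otimes>\<^sub>c crd A) (?g t) k = (crd A \<otimes>\<^sub>c crd B \<otimes>\<^sub>c crd C) t (\<lambda>i. ?\<psi> i k)"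
    by (simp add: braidR_crd[OF v(3,1,2) l(1)] braidL_crd[OF v(1,3,2) l(2)] braidR_crd[OF v l(3)] P_def Q_def R_def L1 L2 L3 R1 R2 R3 split_def)
  show "P a b (\<lambda>b a. Q a c (\<lambda>c a. R b c (\<lambda>c b. k c b a))) = R b c (\<lambda>c b. Q a c (\<lambda>c a. P a b (\<lambda>b a. k c b a)))"
    if "\<forall>t\<in>vset (A \<otimes> B \<otimes> C). ?f t = ?g t" "a \<in> bas A" "b \<in> bas B" "c \<in> bas C"
    using coords_eq_fwd[where f="?f" and g="?g" and F="crd C \<otimes>\<^sub>c crd B \<otimes>\<^sub>c crd A", OF coords3R[OF v], OF that(1) 1 2, of "(a, b, c)" "\<lambda>(x, y, z). k x y z"] that(2-) by simp
  show "\<forall>t\<in>vset (A \<otimes> B \<otimes> C). ?f t = ?g t"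
    if s: "separating A (crd A) S1" "separating B (crd B) S2" "separating C (crd C) S3" and
     eq: "\<And>a b c k1 k2 k3. a \<in> bas A \<Longrightarrow> b \<in> bas B \<Longrightarrow> c \<in> bas C \<Longrightarrow> k1 \<in> S1 \<Longrightarrow> k2 \<in> S2 \<Longrightarrow> k3 \<in> S3 \<Longrightarrow>
        P a b (\<lambda>b a. Q a c (\<lambda>c a. R b c (\<lambda>c b. k3 c * (k2 b * k1 a)))) =
        R b c (\<lambda>c b. Q a c (\<lambda>c a. P a b (\<lambda>b a. k3 c * (k2 b * k1 a))))"
    by (rule coords_eq_bwd[OF coords3R[OF v] separating_bas3[OF v(3,2,1) s(3,2,1)], OF f 1 2])
      (auto simp: prod_forms_def intro: eq)
qed

text \<open>This lemma and the next six translate the remaining axioms between their statement for tensors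
  and their coordinate form, in both directions.\<close>

lemma mult1_laws:
  assumes v: "vspace V" "vspace W" and m: "lin (V \<otimes> V) V m" and e: "e \<in> vset V"
    and l: "lin (V \<otimes> W) (W \<otimes> V) \<Psi>"
  defines "P \<equiv> braid_op V W \<Psi>" and "M \<equiv> mult_op V m" and "u \<equiv> crd V e"
  shows compat_mult1_fwd: "compat_mult1 V m e W \<Psi> \<Longrightarrow> a \<in> bas V \<Longrightarrow> b \<in> bas V \<Longrightarrow> c \<in> bas W \<Longrightarrow>
      M a b (\<lambda>x. P x c k) = P b c (\<lambda>c b. P a c (\<lambda>c a. M a b (\<lambda>x. k c x)))"
    and compat_mult1_unit: "compat_mult1 V m e W \<Psi> \<Longrightarrow> c \<in> bas W \<Longrightarrow> u (\<lambda>x. P x c k) = u (\<lambda>x. k c x)"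
    and compat_mult1_bwd: "separating V (crd V) S \<Longrightarrow> separating W (crd W) T \<Longrightarrow>
      (\<And>a b c k l. a \<in> bas V \<Longrightarrow> b \<in> bas V \<Longrightarrow> c \<in> bas W \<Longrightarrow> k \<in> S \<Longrightarrow> l \<in> T \<Longrightarrow>
        M a b (\<lambda>x. P x c (\<lambda>c x. l c * k x)) = P b c (\<lambda>c b. P a c (\<lambda>c a. M a b (\<lambda>x. l c * k x)))) \<Longrightarrow>
      (\<And>c k l. c \<in> bas W \<Longrightarrow> k \<in> S \<Longrightarrow> l \<in> T \<Longrightarrow>
        u (\<lambda>x. P x c (\<lambda>c x. l c * k x)) = u (\<lambda>x. l c * k x)) \<Longrightarrow> compat_mult1 V m e W \<Psi>"
proof -
  let ?f = "\<lambda>t. \<Psi> (tmap V W m id (associ V V W t))"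
  let ?g = "\<lambda>t. tmap W V id m (braidL V W V \<Psi> (braidR V V W \<Psi> t))"
  let ?\<phi> = "\<lambda>(a, b, c) k. M a b (\<lambda>x. P x c (\<lambda>c x. k (c, x)))"
  let ?\<psi> = "\<lambda>(a, b, c) k. P b c (\<lambda>c b. P a c (\<lambda>c a. M a b (\<lambda>x. k (c, x))))"
  note A = lin_in[OF lin_associ[OF v(1,1,2)]] note TM = lin_in[OF lin_tmap[OF vspace_tensor v(2) m lin_id]]
  note R1 = lin_in[OF lin_braidR[OF v(1,1,2) l]] note L2 = lin_in[OF lin_braidL[OF v(1,2,1) l]]
  note TM' = lin_in[OF lin_tmap[OF v(2) vspace_tensor lin_id m]]
  note L = lin_in[OF l]
  have f: "\<forall>t\<in>vset (V \<otimes> V \<otimes> W). ?f t \<in> vset (W \<otimes> V)" "\<forall>t\<in>vset (V \<otimes> V \<otimes> W). ?g t \<in> vset (W \<otimes> V)"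
    by (auto intro: A TM R1 L2 TM' L)
  have 1: "\<forall>t\<in>vset (V \<otimes> V \<otimes> W). \<forall>k. (crd W \<otimes>\<^sub>c crd V) (?f t) k = (crd V \<otimes>\<^sub>c crd V \<otimes>\<^sub>c crd W) t (\<lambda>i. ?\<phi> i k)"
    by (simp add: braid_crd[OF v l] tmap_mult1_crd[OF v m] associ_crd[OF v(1,1,2)] P_def M_def A TM R1 L2 TM' L split_def)
  have 2: "\<forall>t\<in>vset (V \<otimes> V \<otimes> W). \<forall>k. (crd W \<otimes>\<^sub>c crd V) (?g t) k = (crd V \<otimes>\<^sub>c crd V \<otimes>\<^sub>c crd W) t (\<lambda>i. ?\<psi> i k)"
    by (simp add: tmap_mult2_crd[OF v m] braidL_crd[OF v(1,2,1) l] braidR_crd[OF v(1,1,2) l] P_def M_def A TM R1 L2 TM' L split_def)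
  have p: "pure V W e w \<in> vset (V \<otimes> W)" "pure W V w e \<in> vset (W \<otimes> V)" if "w \<in> vset W" for w
    using that e by (auto simp: pure_in_tensor)
  have 3: "\<forall>w\<in>vset W. \<forall>k. (crd W \<otimes>\<^sub>c crd V) (\<Psi> (pure V W e w)) k = crd W w (\<lambda>c. u (\<lambda>x. P x c (\<lambda>c x. k (c, x))))" (is "\<forall>t\<in>_. \<forall>q. ?e t q")
  proof (intro ballI allI)
    fix w k assume w: "w \<in> vset W"
    show "?e w k"
      unfolding braid_crd[OF v l p(1)[OF w]] tensor_coords_pure[OF coords_bas coords_bas, OF v e w]
        fin_comb_Fubini[OF coordsD(4)[OF coords_bas[OF v(1)] e] coordsD(4)[OF coords_bas[OF v(2)] w]]
        P_def u_def by simp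
  qed
  have 4: "\<forall>w\<in>vset W. \<forall>k. (crd W \<otimes>\<^sub>c crd V) (pure W V w e) k = crd W w (\<lambda>c. u (\<lambda>x. k (c, x)))" (is "\<forall>t\<in>_. \<forall>q. ?e t q")
  proof (intro ballI allI)
    fix w k assume w: "w \<in> vset W"
    show "?e w k"
      unfolding tensor_coords_pure[OF coords_bas coords_bas, OF v(2,1) w e] u_def ..
  qed
  show "M a b (\<lambda>x. P x c k) = P b c (\<lambda>c b. P a c (\<lambda>c a. M a b (\<lambda>x. k c x)))"
    if "compat_mult1 V m e W \<Psi>" "a \<in> bas V" "b \<in> bas V" "c \<in> bas W"
    proof -
    note h = that(1)[unfolded compat_mult1_def]
    from coords_eq_fwd[where f="?f" and g="?g" and F="crd W \<otimes>\<^sub>c crd V", OF coords3R[OF v(1,1,2)], OF h[THEN conjunct1] 1 2, of "(a, b, c)" "\<lambda>(x, y). k x y"] that(2-) show ?thesis by simp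
  qed
  show "u (\<lambda>x. P x c k) = u (\<lambda>x. k c x)" if "compat_mult1 V m e W \<Psi>" "c \<in> bas W"
    proof -
    note h = that(1)[unfolded compat_mult1_def]
    from coords_eq_fwd[where f="\<lambda>w. \<Psi> (pure V W e w)" and g="\<lambda>w. pure W V w e" and F="crd W \<otimes>\<^sub>c crd V", OF coords_bas[OF v(2)], OF h[THEN conjunct2] 3 4, of c "\<lambda>(x, y). k x y"] that(2-) show ?thesis by simp
  qed
  show "compat_mult1 V m e W \<Psi>" if s: "separating V (crd V) S" "separating W (crd W) T" and
      eq: "\<And>a b c k l. a \<in> bas V \<Longrightarrow> b \<in> bas V \<Longrightarrow> c \<in> bas W \<Longrightarrow> k \<in> S \<Longrightarrow> l \<in> T \<Longrightarrow>
        M a b (\<lambda>x. P x c (\<lambda>c x. l c * k x)) = P b c (\<lambda>c b. P a c (\<lambda>c a. M a b (\<lambda>x. l c * k x)))"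
      "\<And>c k l. c \<in> bas W \<Longrightarrow> k \<in> S \<Longrightarrow> l \<in> T \<Longrightarrow>
        u (\<lambda>x. P x c (\<lambda>c x. l c * k x)) = u (\<lambda>x. l c * k x)"
    unfolding compat_mult1_def
  proof (rule conjI)
    show "\<forall>t\<in>vset (V \<otimes> V \<otimes> W). ?f t = ?g t"
      by (rule coords_eq_bwd[OF coords3R[OF v(1,1,2)] separating_bas2[OF v(2,1) s(2,1)], OF f 1 2])
        (auto simp: prod_forms_def intro: eq)
    show "\<forall>w\<in>vset W. \<Psi> (pure V W e w) = pure W V w e"
      by (rule coords_eq_bwd[OF coords_bas[OF v(2)] separating_bas2[OF v(2,1) s(2,1)], OF ballI[OF L[OF p(1)]] ballI[OF p(2)] 3 4])
        (auto simp: prod_forms_def intro: eq)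
  qed
qed

lemma mult2_laws:
  assumes v: "vspace V" "vspace W" and m: "lin (W \<otimes> W) W m" and e: "e \<in> vset W"
    and l: "lin (V \<otimes> W) (W \<otimes> V) \<Psi>"
  defines "P \<equiv> braid_op V W \<Psi>" and "M \<equiv> mult_op W m" and "u \<equiv> crd W e"
  shows compat_mult2_fwd: "compat_mult2 V W m e \<Psi> \<Longrightarrow> a \<in> bas V \<Longrightarrow> b \<in> bas W \<Longrightarrow> c \<in> bas W \<Longrightarrow>
      M b c (\<lambda>x. P a x k) = P a b (\<lambda>b a. P a c (\<lambda>c a. M b c (\<lambda>x. k x a)))"
    and compat_mult2_unit: "compat_mult2 V W m e \<Psi> \<Longrightarrow> a \<in> bas V \<Longrightarrow> u (\<lambda>x. P a x k) = u (\<lambda>x. k x a)"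
    and compat_mult2_bwd: "separating V (crd V) S \<Longrightarrow> separating W (crd W) T \<Longrightarrow>
      (\<And>a b c k l. a \<in> bas V \<Longrightarrow> b \<in> bas W \<Longrightarrow> c \<in> bas W \<Longrightarrow> k \<in> S \<Longrightarrow> l \<in> T \<Longrightarrow>
        M b c (\<lambda>x. P a x (\<lambda>x a. l x * k a)) = P a b (\<lambda>b a. P a c (\<lambda>c a. M b c (\<lambda>x. l x * k a)))) \<Longrightarrow>
      (\<And>a k l. a \<in> bas V \<Longrightarrow> k \<in> S \<Longrightarrow> l \<in> T \<Longrightarrow>
        u (\<lambda>x. P a x (\<lambda>x a. l x * k a)) = u (\<lambda>x. l x * k a)) \<Longrightarrow> compat_mult2 V W m e \<Psi>"
proof -
  let ?f = "\<lambda>t. \<Psi> (tmap V W id m t)"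
  let ?g = "\<lambda>t. tmap W V m id (associ W W V (braidR W V W \<Psi> (braidL V W W \<Psi> t)))"
  let ?\<phi> = "\<lambda>(a, b, c) k. M b c (\<lambda>x. P a x (\<lambda>x a. k (x, a)))"
  let ?\<psi> = "\<lambda>(a, b, c) k. P a b (\<lambda>b a. P a c (\<lambda>c a. M b c (\<lambda>x. k (x, a))))"
  note A = lin_in[OF lin_associ[OF v(2,2,1)]] note TM = lin_in[OF lin_tmap[OF v(1) vspace_tensor lin_id m]]
  note L1 = lin_in[OF lin_braidL[OF v(1,2,2) l]] note R2 = lin_in[OF lin_braidR[OF v(2,1,2) l]]
  note TM' = lin_in[OF lin_tmap[OF vspace_tensor v(1) m lin_id]]
  note L = lin_in[OF l]
  have f: "\<forall>t\<in>vset (V \<otimes> W \<otimes> W). ?f t \<in> vset (W \<otimes> V)" "\<forall>t\<in>vset (V \<otimes> W \<otimes> W). ?g t \<in> vset (W \<otimes> V)"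
    by (auto intro: A TM L1 R2 TM' L)
  have 1: "\<forall>t\<in>vset (V \<otimes> W \<otimes> W). \<forall>k. (crd W \<otimes>\<^sub>c crd V) (?f t) k = (crd V \<otimes>\<^sub>c crd W \<otimes>\<^sub>c crd W) t (\<lambda>i. ?\<phi> i k)"
    by (simp add: braid_crd[OF v l] tmap_mult2_crd[OF v(2,1) m] P_def M_def A TM L1 R2 TM' L split_def)
  have 2: "\<forall>t\<in>vset (V \<otimes> W \<otimes> W). \<forall>k. (crd W \<otimes>\<^sub>c crd V) (?g t) k = (crd V \<otimes>\<^sub>c crd W \<otimes>\<^sub>c crd W) t (\<lambda>i. ?\<psi> i k)"
    by (simp add: tmap_mult1_crd[OF v(2,1) m] associ_crd[OF v(2,2,1)] braidR_crd[OF v(2,1,2) l] braidL_crd[OF v(1,2,2) l] P_def M_def A TM L1 R2 TM' L split_def)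
  have p: "pure V W w e \<in> vset (V \<otimes> W)" "pure W V e w \<in> vset (W \<otimes> V)" if "w \<in> vset V" for w
    using that e by (auto simp: pure_in_tensor)
  have 3: "\<forall>w\<in>vset V. \<forall>k. (crd W \<otimes>\<^sub>c crd V) (\<Psi> (pure V W w e)) k = crd V w (\<lambda>a. u (\<lambda>x. P a x (\<lambda>x a. k (x, a))))" (is "\<forall>t\<in>_. \<forall>q. ?e t q")
  proof (intro ballI allI)
    fix w k assume w: "w \<in> vset V"
    show "?e w k"
      unfolding braid_crd[OF v l p(1)[OF w]] tensor_coords_pure[OF coords_bas coords_bas, OF v w e]
        P_def u_def by simp
  qed
  have 4: "\<forall>w\<in>vset V. \<forall>k. (crd W \<otimes>\<^sub>c crd V) (pure W V e w) k = crd V w (\<lambda>a. u (\<lambda>x. k (x, a)))" (is "\<forall>t\<in>_. \<forall>q. ?e t q")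
  proof (intro ballI allI)
    fix w k assume w: "w \<in> vset V"
    show "?e w k"
      unfolding tensor_coords_pure[OF coords_bas coords_bas, OF v(2,1) e w] u_def
      by (rule fin_comb_Fubini[OF coordsD(4)[OF coords_bas[OF v(2)] e] coordsD(4)[OF coords_bas[OF v(1)] w]])
  qed
  show "M b c (\<lambda>x. P a x k) = P a b (\<lambda>b a. P a c (\<lambda>c a. M b c (\<lambda>x. k x a)))"
    if "compat_mult2 V W m e \<Psi>" "a \<in> bas V" "b \<in> bas W" "c \<in> bas W"
    proof -
    note h = that(1)[unfolded compat_mult2_def]
    from coords_eq_fwd[where f="?f" and g="?g" and F="crd W \<otimes>\<^sub>c crd V", OF coords3R[OF v(1,2,2)], OF h[THEN conjunct1] 1 2, of "(a, b, c)" "\<lambda>(x, y). k x y"] that(2-) show ?thesis by simp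
  qed
  show "u (\<lambda>x. P a x k) = u (\<lambda>x. k x a)" if "compat_mult2 V W m e \<Psi>" "a \<in> bas V"
    proof -
    note h = that(1)[unfolded compat_mult2_def]
    from coords_eq_fwd[where f="\<lambda>w. \<Psi> (pure V W w e)" and g="\<lambda>w. pure W V e w" and F="crd W \<otimes>\<^sub>c crd V", OF coords_bas[OF v(1)], OF h[THEN conjunct2] 3 4, of a "\<lambda>(x, y). k x y"] that(2-) show ?thesis by simp
  qed
  show "compat_mult2 V W m e \<Psi>" if s: "separating V (crd V) S" "separating W (crd W) T" and
      eq: "\<And>a b c k l. a \<in> bas V \<Longrightarrow> b \<in> bas W \<Longrightarrow> c \<in> bas W \<Longrightarrow> k \<in> S \<Longrightarrow> l \<in> T \<Longrightarrow>
        M b c (\<lambda>x. P a x (\<lambda>x a. l x * k a)) = P a b (\<lambda>b a. P a c (\<lambda>c a. M b c (\<lambda>x. l x * k a)))"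
      "\<And>a k l. a \<in> bas V \<Longrightarrow> k \<in> S \<Longrightarrow> l \<in> T \<Longrightarrow>
        u (\<lambda>x. P a x (\<lambda>x a. l x * k a)) = u (\<lambda>x. l x * k a)"
    unfolding compat_mult2_def
  proof (rule conjI)
    show "\<forall>t\<in>vset (V \<otimes> W \<otimes> W). ?f t = ?g t"
      by (rule coords_eq_bwd[OF coords3R[OF v(1,2,2)] separating_bas2[OF v(2,1) s(2,1)], OF f 1 2])
        (auto simp: prod_forms_def intro: eq)
    show "\<forall>w\<in>vset V. \<Psi> (pure V W w e) = pure W V e w"
      by (rule coords_eq_bwd[OF coords_bas[OF v(1)] separating_bas2[OF v(2,1) s(2,1)], OF ballI[OF L[OF p(1)]] ballI[OF p(2)] 3 4])
        (auto simp: prod_forms_def intro: eq)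
  qed
qed

lemma comult1_laws:
  assumes v: "vspace V" "vspace W" and d: "lin V (V \<otimes> V) \<Delta>" and e: "lin V base \<epsilon>"
    and l: "lin (V \<otimes> W) (W \<otimes> V) \<Psi>"
  defines "P \<equiv> braid_op V W \<Psi>" and "D \<equiv> comult_op V \<Delta>"
  shows compat_comult1_fwd: "compat_comult1 V \<Delta> \<epsilon> W \<Psi> \<Longrightarrow> a \<in> bas V \<Longrightarrow> b \<in> bas W \<Longrightarrow>
      P a b (\<lambda>b a. D a (\<lambda>x y. k b x y)) = D a (\<lambda>x y. P y b (\<lambda>b y. P x b (\<lambda>b x. k b x y)))"
    and compat_comult1_counit: "compat_comult1 V \<Delta> \<epsilon> W \<Psi> \<Longrightarrow> a \<in> bas V \<Longrightarrow> b \<in> bas W \<Longrightarrow>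
      P a b (\<lambda>b a. \<epsilon> a * h b) = \<epsilon> a * h b"
    and compat_comult1_bwd: "separating V (crd V) S \<Longrightarrow> separating W (crd W) T \<Longrightarrow>
      (\<And>a b k1 k2 k3. a \<in> bas V \<Longrightarrow> b \<in> bas W \<Longrightarrow> k1 \<in> T \<Longrightarrow> k2 \<in> S \<Longrightarrow> k3 \<in> S \<Longrightarrow>
        P a b (\<lambda>b a. D a (\<lambda>x y. k1 b * (k2 x * k3 y))) =
        D a (\<lambda>x y. P y b (\<lambda>b y. P x b (\<lambda>b x. k1 b * (k2 x * k3 y))))) \<Longrightarrow>
      (\<And>a b h. a \<in> bas V \<Longrightarrow> b \<in> bas W \<Longrightarrow> h \<in> T \<Longrightarrow> P a b (\<lambda>b a. \<epsilon> a * h b) = \<epsilon> a * h b) \<Longrightarrow>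
      compat_comult1 V \<Delta> \<epsilon> W \<Psi>"
proof -
  let ?f = "\<lambda>t. tmap W (V \<otimes> V) id \<Delta> (\<Psi> t)"
  let ?g = "\<lambda>t. braidL V W V \<Psi> (braidR V V W \<Psi> (assoc V V W (tmap (V \<otimes> V) W \<Delta> id t)))"
  let ?\<phi> = "\<lambda>(a, b) k. P a b (\<lambda>b a. D a (\<lambda>x y. k (b, x, y)))"
  let ?\<psi> = "\<lambda>(a, b) k. D a (\<lambda>x y. P y b (\<lambda>b y. P x b (\<lambda>b x. k (b, x, y))))"
  note A = lin_in[OF lin_assoc[OF v(1,1,2)]] note TD = lin_in[OF lin_tmap[OF v(2,1) lin_id d]]
  note R1 = lin_in[OF lin_braidR[OF v(1,1,2) l]] note L2 = lin_in[OF lin_braidL[OF v(1,2,1) l]]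
  note TD' = lin_in[OF lin_tmap[OF v d lin_id]]
  note L = lin_in[OF l]
  have f: "\<forall>t\<in>vset (V \<otimes> W). ?f t \<in> vset (W \<otimes> V \<otimes> V)" "\<forall>t\<in>vset (V \<otimes> W). ?g t \<in> vset (W \<otimes> V \<otimes> V)"
    by (auto intro: A TD R1 L2 TD' L)
  have 1: "\<forall>t\<in>vset (V \<otimes> W). \<forall>k. (crd W \<otimes>\<^sub>c crd V \<otimes>\<^sub>c crd V) (?f t) k = (crd V \<otimes>\<^sub>c crd W) t (\<lambda>i. ?\<phi> i k)"
    by (simp add: tmap_comult2_crd[OF v d] braid_crd[OF v l] P_def D_def A TD R1 L2 TD' L split_def)
  have 2: "\<forall>t\<in>vset (V \<otimes> W). \<forall>k. (crd W \<otimes>\<^sub>c crd V \<otimes>\<^sub>c crd V) (?g t) k = (crd V \<otimes>\<^sub>c crd W) t (\<lambda>i. ?\<psi> i k)"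
    by (simp add: braidL_crd[OF v(1,2,1) l] braidR_crd[OF v(1,1,2) l] assoc_crd[OF v(1,1,2)] tmap_comult1_crd[OF v d] P_def D_def A TD R1 L2 TD' L split_def)
  have 3: "\<forall>t\<in>vset (V \<otimes> W). \<forall>k. crd W (runit W (tmap W base id \<epsilon> (\<Psi> t))) k =
      (crd V \<otimes>\<^sub>c crd W) t (\<lambda>i. (\<lambda>(a, b) h. P a b (\<lambda>b a. \<epsilon> a * h b)) i k)"
    by (simp add: runit_tmap_crd(1)[OF v e] braid_crd[OF v l] P_def A TD R1 L2 TD' L split_def)
  have 4: "\<forall>t\<in>vset (V \<otimes> W). \<forall>k. crd W (lunit W (tmap base W \<epsilon> id t)) k =
      (crd V \<otimes>\<^sub>c crd W) t (\<lambda>i. (\<lambda>(a, b) h. \<epsilon> a * h b) i k)"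
    by (simp add: lunit_tmap_crd(1)[OF v e] A TD R1 L2 TD' L split_def)
  show "P a b (\<lambda>b a. D a (\<lambda>x y. k b x y)) = D a (\<lambda>x y. P y b (\<lambda>b y. P x b (\<lambda>b x. k b x y)))"
    if "compat_comult1 V \<Delta> \<epsilon> W \<Psi>" "a \<in> bas V" "b \<in> bas W"
    proof -
    note h = that(1)[unfolded compat_comult1_def]
    from coords_eq_fwd[where f="?f" and g="?g" and F="crd W \<otimes>\<^sub>c crd V \<otimes>\<^sub>c crd V", OF coords_bas2[OF v], OF h[THEN conjunct1] 1 2, of "(a, b)" "\<lambda>(x, y, z). k x y z"] that(2-) show ?thesis by simp
  qed
  show "P a b (\<lambda>b a. \<epsilon> a * h b) = \<epsilon> a * h b"
    if "compat_comult1 V \<Delta> \<epsilon> W \<Psi>" "a \<in> bas V" "b \<in> bas W"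
    proof -
    note h = that(1)[unfolded compat_comult1_def]
    from coords_eq_fwd[where f="\<lambda>t. runit W (tmap W base id \<epsilon> (\<Psi> t))" and g="\<lambda>t. lunit W (tmap base W \<epsilon> id t)" and F="crd W", OF coords_bas2[OF v], OF h[THEN conjunct2] 3 4, of "(a, b)" h] that(2-) show ?thesis by simp
  qed
  show "compat_comult1 V \<Delta> \<epsilon> W \<Psi>" if s: "separating V (crd V) S" "separating W (crd W) T" and
     eq: "\<And>a b k1 k2 k3. a \<in> bas V \<Longrightarrow> b \<in> bas W \<Longrightarrow> k1 \<in> T \<Longrightarrow> k2 \<in> S \<Longrightarrow> k3 \<in> S \<Longrightarrow>
        P a b (\<lambda>b a. D a (\<lambda>x y. k1 b * (k2 x * k3 y))) =
        D a (\<lambda>x y. P y b (\<lambda>b y. P x b (\<lambda>b x. k1 b * (k2 x * k3 y))))"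
      "\<And>a b h. a \<in> bas V \<Longrightarrow> b \<in> bas W \<Longrightarrow> h \<in> T \<Longrightarrow> P a b (\<lambda>b a. \<epsilon> a * h b) = \<epsilon> a * h b"
    unfolding compat_comult1_def
  proof (rule conjI)
    show "\<forall>t\<in>vset (V \<otimes> W). ?f t = ?g t"
      by (rule coords_eq_bwd[OF coords_bas2[OF v] separating_bas3[OF v(2,1,1) s(2,1,1)], OF f 1 2])
        (auto simp: prod_forms_def intro: eq)
    show "\<forall>t\<in>vset (V \<otimes> W). runit W (tmap W base id \<epsilon> (\<Psi> t)) = lunit W (tmap base W \<epsilon> id t)"
      by (rule coords_eq_bwd[OF coords_bas2[OF v] s(2), OF ballI[OF runit_tmap_crd(2)[OF v e L]] ballI[OF lunit_tmap_crd(2)[OF v e]] 3 4])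
        (auto intro: eq)
  qed
qed

lemma comult2_laws:
  assumes v: "vspace V" "vspace W" and d: "lin W (W \<otimes> W) \<Delta>" and e: "lin W base \<epsilon>"
    and l: "lin (V \<otimes> W) (W \<otimes> V) \<Psi>"
  defines "P \<equiv> braid_op V W \<Psi>" and "D \<equiv> comult_op W \<Delta>"
  shows compat_comult2_fwd: "compat_comult2 V W \<Delta> \<epsilon> \<Psi> \<Longrightarrow> a \<in> bas V \<Longrightarrow> b \<in> bas W \<Longrightarrow>
      P a b (\<lambda>b a. D b (\<lambda>x y. k x y a)) = D b (\<lambda>x y. P a x (\<lambda>x a. P a y (\<lambda>y a. k x y a)))"
    and compat_comult2_counit: "compat_comult2 V W \<Delta> \<epsilon> \<Psi> \<Longrightarrow> a \<in> bas V \<Longrightarrow> b \<in> bas W \<Longrightarrow>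
      P a b (\<lambda>b a. \<epsilon> b * h a) = \<epsilon> b * h a"
    and compat_comult2_bwd: "separating V (crd V) S \<Longrightarrow> separating W (crd W) T \<Longrightarrow>
      (\<And>a b k1 k2 k3. a \<in> bas V \<Longrightarrow> b \<in> bas W \<Longrightarrow> k1 \<in> T \<Longrightarrow> k2 \<in> T \<Longrightarrow> k3 \<in> S \<Longrightarrow>
        P a b (\<lambda>b a. D b (\<lambda>x y. k1 x * (k2 y * k3 a))) =
        D b (\<lambda>x y. P a x (\<lambda>x a. P a y (\<lambda>y a. k1 x * (k2 y * k3 a))))) \<Longrightarrow>
      (\<And>a b h. a \<in> bas V \<Longrightarrow> b \<in> bas W \<Longrightarrow> h \<in> S \<Longrightarrow> P a b (\<lambda>b a. \<epsilon> b * h a) = \<epsilon> b * h a) \<Longrightarrow>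
      compat_comult2 V W \<Delta> \<epsilon> \<Psi>"
proof -
  let ?f = "\<lambda>t. assoc W W V (tmap (W \<otimes> W) V \<Delta> id (\<Psi> t))"
  let ?g = "\<lambda>t. braidR W V W \<Psi> (braidL V W W \<Psi> (tmap V (W \<otimes> W) id \<Delta> t))"
  let ?\<phi> = "\<lambda>(a, b) k. P a b (\<lambda>b a. D b (\<lambda>x y. k (x, y, a)))"
  let ?\<psi> = "\<lambda>(a, b) k. D b (\<lambda>x y. P a x (\<lambda>x a. P a y (\<lambda>y a. k (x, y, a))))"
  note A = lin_in[OF lin_assoc[OF v(2,2,1)]] note TD = lin_in[OF lin_tmap[OF v(2,1) d lin_id]]
  note L1 = lin_in[OF lin_braidL[OF v(1,2,2) l]] note R2 = lin_in[OF lin_braidR[OF v(2,1,2) l]]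
  note TD' = lin_in[OF lin_tmap[OF v lin_id d]]
  note L = lin_in[OF l]
  have f: "\<forall>t\<in>vset (V \<otimes> W). ?f t \<in> vset (W \<otimes> W \<otimes> V)" "\<forall>t\<in>vset (V \<otimes> W). ?g t \<in> vset (W \<otimes> W \<otimes> V)"
    by (auto intro: A TD L1 R2 TD' L)
  have 1: "\<forall>t\<in>vset (V \<otimes> W). \<forall>k. (crd W \<otimes>\<^sub>c crd W \<otimes>\<^sub>c crd V) (?f t) k = (crd V \<otimes>\<^sub>c crd W) t (\<lambda>i. ?\<phi> i k)"
    by (simp add: assoc_crd[OF v(2,2,1)] tmap_comult1_crd[OF v(2,1) d] braid_crd[OF v l] P_def D_def A TD L1 R2 TD' L split_def)
  have 2: "\<forall>t\<in>vset (V \<otimes> W). \<forall>k. (crd W \<otimes>\<^sub>c crd W \<otimes>\<^sub>c crd V) (?g t) k = (crd V \<otimes>\<^sub>c crd W) t (\<lambda>i. ?\<psi> i k)"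
    by (simp add: braidR_crd[OF v(2,1,2) l] braidL_crd[OF v(1,2,2) l] tmap_comult2_crd[OF v(2,1) d] P_def D_def A TD L1 R2 TD' L split_def)
  have 3: "\<forall>t\<in>vset (V \<otimes> W). \<forall>k. crd V (lunit V (tmap base V \<epsilon> id (\<Psi> t))) k =
      (crd V \<otimes>\<^sub>c crd W) t (\<lambda>i. (\<lambda>(a, b) h. P a b (\<lambda>b a. \<epsilon> b * h a)) i k)"
    by (simp add: lunit_tmap_crd(1)[OF v(2,1) e] braid_crd[OF v l] P_def A TD L1 R2 TD' L split_def)
  have 4: "\<forall>t\<in>vset (V \<otimes> W). \<forall>k. crd V (runit V (tmap V base id \<epsilon> t)) k =
      (crd V \<otimes>\<^sub>c crd W) t (\<lambda>i. (\<lambda>(a, b) h. \<epsilon> b * h a) i k)"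
    by (simp add: runit_tmap_crd(1)[OF v(2,1) e] A TD L1 R2 TD' L split_def)
  show "P a b (\<lambda>b a. D b (\<lambda>x y. k x y a)) = D b (\<lambda>x y. P a x (\<lambda>x a. P a y (\<lambda>y a. k x y a)))"
    if "compat_comult2 V W \<Delta> \<epsilon> \<Psi>" "a \<in> bas V" "b \<in> bas W"
    proof -
    note h = that(1)[unfolded compat_comult2_def]
    from coords_eq_fwd[where f="?f" and g="?g" and F="crd W \<otimes>\<^sub>c crd W \<otimes>\<^sub>c crd V", OF coords_bas2[OF v], OF h[THEN conjunct1] 1 2, of "(a, b)" "\<lambda>(x, y, z). k x y z"] that(2-) show ?thesis by simp
  qed
  show "P a b (\<lambda>b a. \<epsilon> b * h a) = \<epsilon> b * h a"
    if "compat_comult2 V W \<Delta> \<epsilon> \<Psi>" "a \<in> bas V" "b \<in> bas W"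
    proof -
    note h = that(1)[unfolded compat_comult2_def]
    from coords_eq_fwd[where f="\<lambda>t. lunit V (tmap base V \<epsilon> id (\<Psi> t))" and g="\<lambda>t. runit V (tmap V base id \<epsilon> t)" and F="crd V", OF coords_bas2[OF v], OF h[THEN conjunct2] 3 4, of "(a, b)" h] that(2-) show ?thesis by simp
  qed
  show "compat_comult2 V W \<Delta> \<epsilon> \<Psi>" if s: "separating V (crd V) S" "separating W (crd W) T" and
     eq: "\<And>a b k1 k2 k3. a \<in> bas V \<Longrightarrow> b \<in> bas W \<Longrightarrow> k1 \<in> T \<Longrightarrow> k2 \<in> T \<Longrightarrow> k3 \<in> S \<Longrightarrow>
        P a b (\<lambda>b a. D b (\<lambda>x y. k1 x * (k2 y * k3 a))) =
        D b (\<lambda>x y. P a x (\<lambda>x a. P a y (\<lambda>y a. k1 x * (k2 y * k3 a))))"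
      "\<And>a b h. a \<in> bas V \<Longrightarrow> b \<in> bas W \<Longrightarrow> h \<in> S \<Longrightarrow> P a b (\<lambda>b a. \<epsilon> b * h a) = \<epsilon> b * h a"
    unfolding compat_comult2_def
  proof (rule conjI)
    show "\<forall>t\<in>vset (V \<otimes> W). ?f t = ?g t"
      by (rule coords_eq_bwd[OF coords_bas2[OF v] separating_bas3[OF v(2,2,1) s(2,2,1)], OF f 1 2])
        (auto simp: prod_forms_def intro: eq)
    show "\<forall>t\<in>vset (V \<otimes> W). lunit V (tmap base V \<epsilon> id (\<Psi> t)) = runit V (tmap V base id \<epsilon> t)"
      by (rule coords_eq_bwd[OF coords_bas2[OF v] s(1), OF ballI[OF lunit_tmap_crd(2)[OF v(2,1) e L]] ballI[OF runit_tmap_crd(2)[OF v(2,1) e]] 3 4])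
        (auto intro: eq)
  qed
qed


lemma unital_algebra_laws:
  assumes v: "vspace V" and m: "lin (V \<otimes> V) V m" and e: "e \<in> vset V"
  defines "M \<equiv> mult_op V m" and "u \<equiv> crd V e"
  shows unital_algebra_fwd: "unital_algebra V m e \<Longrightarrow> a \<in> bas V \<Longrightarrow> b \<in> bas V \<Longrightarrow> c \<in> bas V \<Longrightarrow>
      M a b (\<lambda>x. M x c k) = M b c (\<lambda>x. M a x k)"
    and unital_algebra_unit1: "unital_algebra V m e \<Longrightarrow> a \<in> bas V \<Longrightarrow> u (\<lambda>x. M x a k) = k a"
    and unital_algebra_unit2: "unital_algebra V m e \<Longrightarrow> a \<in> bas V \<Longrightarrow> u (\<lambda>x. M a x k) = k a"
    and unital_algebra_bwd: "separating V (crd V) S \<Longrightarrow>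
      (\<And>a b c k. a \<in> bas V \<Longrightarrow> b \<in> bas V \<Longrightarrow> c \<in> bas V \<Longrightarrow> k \<in> S \<Longrightarrow>
        M a b (\<lambda>x. M x c k) = M b c (\<lambda>x. M a x k)) \<Longrightarrow>
      (\<And>a k. a \<in> bas V \<Longrightarrow> k \<in> S \<Longrightarrow> u (\<lambda>x. M x a k) = k a) \<Longrightarrow>
      (\<And>a k. a \<in> bas V \<Longrightarrow> k \<in> S \<Longrightarrow> u (\<lambda>x. M a x k) = k a) \<Longrightarrow> unital_algebra V m e"
proof -
  let ?f = "\<lambda>t. m (tmap V V m id (associ V V V t))"
  let ?g = "\<lambda>t. m (tmap V V id m t)"
  let ?\<phi> = "\<lambda>(a, b, c) k. M a b (\<lambda>x. M x c k)"
  let ?\<psi> = "\<lambda>(a, b, c) k. M b c (\<lambda>x. M a x k)"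
  let ?l = "\<lambda>w. m (pure V V e w)" and ?r = "\<lambda>w. m (pure V V w e)"
  note A = lin_in[OF lin_associ[OF v v v]]
  note T1 = lin_in[OF lin_tmap[OF vspace_tensor v m lin_id]]
  note T2 = lin_in[OF lin_tmap[OF v vspace_tensor lin_id m]]
  note Mi = lin_in[OF m]
  have f: "\<forall>t\<in>vset (V \<otimes> V \<otimes> V). ?f t \<in> vset V" "\<forall>t\<in>vset (V \<otimes> V \<otimes> V). ?g t \<in> vset V"
    by (auto intro: A T1 T2 Mi)
  have 1: "\<forall>t\<in>vset (V \<otimes> V \<otimes> V). \<forall>k. crd V (?f t) k = (crd V \<otimes>\<^sub>c crd V \<otimes>\<^sub>c crd V) t (\<lambda>i. ?\<phi> i k)"
    by (simp add: mult_crd[OF v m] tmap_mult1_crd[OF v v m] associ_crd[OF v v v] M_def A T1 T2 Mi split_def)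
  have 2: "\<forall>t\<in>vset (V \<otimes> V \<otimes> V). \<forall>k. crd V (?g t) k = (crd V \<otimes>\<^sub>c crd V \<otimes>\<^sub>c crd V) t (\<lambda>i. ?\<psi> i k)"
    by (simp add: mult_crd[OF v m] tmap_mult2_crd[OF v v m] M_def A T1 T2 Mi split_def)
  have p: "pure V V e w \<in> vset (V \<otimes> V)" "pure V V w e \<in> vset (V \<otimes> V)" if "w \<in> vset V" for w
    using that e by (auto simp: pure_in_tensor)
  note fe = coordsD(4)[OF coords_bas[OF v] e]
  have 3: "\<forall>w\<in>vset V. \<forall>k. crd V (?l w) k = crd V w (\<lambda>a. u (\<lambda>x. M x a k))" (is "\<forall>t\<in>_. \<forall>q. ?e t q")
  proof (intro ballI allI)
    fix w k assume w: "w \<in> vset V"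
    show "?e w k"
      unfolding mult_crd[OF v m p(1)[OF w]] tensor_coords_pure[OF coords_bas[OF v] coords_bas[OF v] e w]
        fin_comb_Fubini[OF fe coordsD(4)[OF coords_bas[OF v] w]]
        M_def u_def by simp
  qed
  have 4: "\<forall>w\<in>vset V. \<forall>k. crd V (?r w) k = crd V w (\<lambda>a. u (\<lambda>x. M a x k))" (is "\<forall>t\<in>_. \<forall>q. ?e t q")
  proof (intro ballI allI)
    fix w k assume w: "w \<in> vset V"
    show "?e w k"
      unfolding mult_crd[OF v m p(2)[OF w]] tensor_coords_pure[OF coords_bas[OF v] coords_bas[OF v] w e]
        M_def u_def by simp
  qed
  have 5: "\<forall>w\<in>vset V. \<forall>k. crd V w k = crd V w (\<lambda>a. k a)" by simp
  show "M a b (\<lambda>x. M x c k) = M b c (\<lambda>x. M a x k)"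
    if "unital_algebra V m e" "a \<in> bas V" "b \<in> bas V" "c \<in> bas V"
    proof -
    note h = that(1)[unfolded unital_algebra_def]
    have h3: "\<forall>w\<in>vset V. ?l w = w" and h4: "\<forall>w\<in>vset V. ?r w = w" using h by blast+
    from coords_eq_fwd[where f="?f" and g="?g" and F="crd V", OF coords3R[OF v v v], OF h[THEN conjunct2, THEN conjunct2, THEN conjunct2, THEN conjunct1] 1 2, of "(a, b, c)" k] that(2-) show ?thesis by simp
  qed
  show "u (\<lambda>x. M x a k) = k a" if "unital_algebra V m e" "a \<in> bas V"
    proof -
    note h = that(1)[unfolded unital_algebra_def]
    have h3: "\<forall>w\<in>vset V. ?l w = w" and h4: "\<forall>w\<in>vset V. ?r w = w" using h by blast+
    from coords_eq_fwd[where f="?l" and g="\<lambda>x. x" and F="crd V", OF coords_bas[OF v], OF h3 3 5, of a k] that(2-) show ?thesis by simp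
  qed
  show "u (\<lambda>x. M a x k) = k a" if "unital_algebra V m e" "a \<in> bas V"
    proof -
    note h = that(1)[unfolded unital_algebra_def]
    have h3: "\<forall>w\<in>vset V. ?l w = w" and h4: "\<forall>w\<in>vset V. ?r w = w" using h by blast+
    from coords_eq_fwd[where f="?r" and g="\<lambda>x. x" and F="crd V", OF coords_bas[OF v], OF h4 4 5, of a k] that(2-) show ?thesis by simp
  qed
  show "unital_algebra V m e" if s: "separating V (crd V) S" and
      eq: "\<And>a b c k. a \<in> bas V \<Longrightarrow> b \<in> bas V \<Longrightarrow> c \<in> bas V \<Longrightarrow> k \<in> S \<Longrightarrow>
        M a b (\<lambda>x. M x c k) = M b c (\<lambda>x. M a x k)"
      "\<And>a k. a \<in> bas V \<Longrightarrow> k \<in> S \<Longrightarrow> u (\<lambda>x. M x a k) = k a"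
      "\<And>a k. a \<in> bas V \<Longrightarrow> k \<in> S \<Longrightarrow> u (\<lambda>x. M a x k) = k a"
  proof -
    have "\<forall>t\<in>vset (V \<otimes> V \<otimes> V). ?f t = ?g t"
      by (rule coords_eq_bwd[OF coords3R[OF v v v] s, OF f 1 2]) (auto intro: eq)
    moreover have "\<forall>w\<in>vset V. ?l w = w"
      by (rule coords_eq_bwd[OF coords_bas[OF v] s, OF ballI[OF Mi[OF p(1)]] _ 3 5]) (auto intro: eq)
    moreover have "\<forall>w\<in>vset V. ?r w = w"
      by (rule coords_eq_bwd[OF coords_bas[OF v] s, OF ballI[OF Mi[OF p(2)]] _ 4 5]) (auto intro: eq)
    ultimately show ?thesis using v m e by (simp add: unital_algebra_def)
  qed
qed

lemma coalgebra_laws: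
  assumes v: "vspace V" and d: "lin V (V \<otimes> V) \<Delta>" and e: "lin V base \<epsilon>"
  defines "D \<equiv> comult_op V \<Delta>"
  shows coalgebra_fwd: "coalgebra V \<Delta> \<epsilon> \<Longrightarrow> a \<in> bas V \<Longrightarrow>
      D a (\<lambda>x y. D x (\<lambda>x1 x2. k x1 x2 y)) = D a (\<lambda>x y. D y (\<lambda>y1 y2. k x y1 y2))"
    and coalgebra_counit1: "coalgebra V \<Delta> \<epsilon> \<Longrightarrow> a \<in> bas V \<Longrightarrow> D a (\<lambda>x y. \<epsilon> x * h y) = h a"
    and coalgebra_counit2: "coalgebra V \<Delta> \<epsilon> \<Longrightarrow> a \<in> bas V \<Longrightarrow> D a (\<lambda>x y. \<epsilon> y * h x) = h a"
    and coalgebra_bwd: "separating V (crd V) S \<Longrightarrow>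
      (\<And>a k1 k2 k3. a \<in> bas V \<Longrightarrow> k1 \<in> S \<Longrightarrow> k2 \<in> S \<Longrightarrow> k3 \<in> S \<Longrightarrow>
        D a (\<lambda>x y. D x (\<lambda>x1 x2. k1 x1 * (k2 x2 * k3 y))) = D a (\<lambda>x y. D y (\<lambda>y1 y2. k1 x * (k2 y1 * k3 y2)))) \<Longrightarrow>
      (\<And>a h. a \<in> bas V \<Longrightarrow> h \<in> S \<Longrightarrow> D a (\<lambda>x y. \<epsilon> x * h y) = h a) \<Longrightarrow>
      (\<And>a h. a \<in> bas V \<Longrightarrow> h \<in> S \<Longrightarrow> D a (\<lambda>x y. \<epsilon> y * h x) = h a) \<Longrightarrow> coalgebra V \<Delta> \<epsilon>"
proof -
  let ?f = "\<lambda>v. assoc V V V (tmap (V \<otimes> V) V \<Delta> id (\<Delta> v))"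
  let ?g = "\<lambda>v. tmap V (V \<otimes> V) id \<Delta> (\<Delta> v)"
  let ?l = "\<lambda>x. lunit V (tmap base V \<epsilon> id (\<Delta> x))" and ?r = "\<lambda>x. runit V (tmap V base id \<epsilon> (\<Delta> x))"
  let ?\<phi> = "\<lambda>a k. D a (\<lambda>x y. D x (\<lambda>x1 x2. k (x1, x2, y)))"
  let ?\<psi> = "\<lambda>a k. D a (\<lambda>x y. D y (\<lambda>y1 y2. k (x, y1, y2)))"
  note A = lin_in[OF lin_assoc[OF v v v]] note Di = lin_in[OF d]
  note T1 = lin_in[OF lin_tmap[OF v v d lin_id]] note T2 = lin_in[OF lin_tmap[OF v v lin_id d]]
  have f: "\<forall>t\<in>vset V. ?f t \<in> vset (V \<otimes> V \<otimes> V)" "\<forall>t\<in>vset V. ?g t \<in> vset (V \<otimes> V \<otimes> V)"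
    by (auto intro: A T1 T2 Di)
  have 1: "\<forall>t\<in>vset V. \<forall>q. (crd V \<otimes>\<^sub>c crd V \<otimes>\<^sub>c crd V) (?f t) q = crd V t (\<lambda>i. ?\<phi> i q)"
    by (simp add: assoc_crd[OF v v v] tmap_comult1_crd[OF v v d] comult_crd[OF v d] D_def A Di T1 T2 split_def)
  have 2: "\<forall>t\<in>vset V. \<forall>q. (crd V \<otimes>\<^sub>c crd V \<otimes>\<^sub>c crd V) (?g t) q = crd V t (\<lambda>i. ?\<psi> i q)"
    by (simp add: tmap_comult2_crd[OF v v d] comult_crd[OF v d] D_def A Di T1 T2 split_def)
  have 3: "\<forall>t\<in>vset V. \<forall>h. crd V (?l t) h = crd V t (\<lambda>a. D a (\<lambda>x y. \<epsilon> x * h y))"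
    by (simp add: lunit_tmap_crd(1)[OF v v e] comult_crd[OF v d] D_def A Di T1 T2 split_def)
  have 4: "\<forall>t\<in>vset V. \<forall>h. crd V (?r t) h = crd V t (\<lambda>a. D a (\<lambda>x y. \<epsilon> y * h x))"
    by (simp add: runit_tmap_crd(1)[OF v v e] comult_crd[OF v d] D_def A Di T1 T2 split_def)
  have 5: "\<forall>w\<in>vset V. \<forall>k. crd V w k = crd V w (\<lambda>a. k a)" by simp
  show "D a (\<lambda>x y. D x (\<lambda>x1 x2. k x1 x2 y)) = D a (\<lambda>x y. D y (\<lambda>y1 y2. k x y1 y2))"
    if "coalgebra V \<Delta> \<epsilon>" "a \<in> bas V"
    proof -
    note h = that(1)[unfolded coalgebra_def]
    have h3: "\<forall>w\<in>vset V. ?l w = w" and h4: "\<forall>w\<in>vset V. ?r w = w" using h by blast+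
    from coords_eq_fwd[where f="?f" and g="?g" and F="crd V \<otimes>\<^sub>c crd V \<otimes>\<^sub>c crd V", OF coords_bas[OF v], OF h[THEN conjunct2, THEN conjunct2, THEN conjunct2, THEN conjunct1] 1 2, of a "\<lambda>(x, y, z). k x y z"] that(2-) show ?thesis by simp
  qed
  show "D a (\<lambda>x y. \<epsilon> x * h y) = h a" if "coalgebra V \<Delta> \<epsilon>" "a \<in> bas V"
    proof -
    note h = that(1)[unfolded coalgebra_def]
    have h3: "\<forall>w\<in>vset V. ?l w = w" and h4: "\<forall>w\<in>vset V. ?r w = w" using h by blast+
    from coords_eq_fwd[where f="?l" and g="\<lambda>x. x" and F="crd V", OF coords_bas[OF v], OF h3 3 5, of a h] that(2-) show ?thesis by simp
  qed
  show "D a (\<lambda>x y. \<epsilon> y * h x) = h a" if "coalgebra V \<Delta> \<epsilon>" "a \<in> bas V"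
    proof -
    note h = that(1)[unfolded coalgebra_def]
    have h3: "\<forall>w\<in>vset V. ?l w = w" and h4: "\<forall>w\<in>vset V. ?r w = w" using h by blast+
    from coords_eq_fwd[where f="?r" and g="\<lambda>x. x" and F="crd V", OF coords_bas[OF v], OF h4 4 5, of a h] that(2-) show ?thesis by simp
  qed
  show "coalgebra V \<Delta> \<epsilon>" if s: "separating V (crd V) S" and
      eq: "\<And>a k1 k2 k3. a \<in> bas V \<Longrightarrow> k1 \<in> S \<Longrightarrow> k2 \<in> S \<Longrightarrow> k3 \<in> S \<Longrightarrow>
        D a (\<lambda>x y. D x (\<lambda>x1 x2. k1 x1 * (k2 x2 * k3 y))) = D a (\<lambda>x y. D y (\<lambda>y1 y2. k1 x * (k2 y1 * k3 y2)))"
      "\<And>a h. a \<in> bas V \<Longrightarrow> h \<in> S \<Longrightarrow> D a (\<lambda>x y. \<epsilon> x * h y) = h a"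
      "\<And>a h. a \<in> bas V \<Longrightarrow> h \<in> S \<Longrightarrow> D a (\<lambda>x y. \<epsilon> y * h x) = h a"
  proof -
    have "\<forall>t\<in>vset V. ?f t = ?g t"
      by (rule coords_eq_bwd[OF coords_bas[OF v] separating_bas3[OF v v v s s s], OF f 1 2])
        (auto simp: prod_forms_def intro: eq)
    moreover have "\<forall>w\<in>vset V. ?l w = w"
      by (rule coords_eq_bwd[OF coords_bas[OF v] s, OF ballI[OF lunit_tmap_crd(2)[OF v v e Di]] _ 3 5]) (auto intro: eq)
    moreover have "\<forall>w\<in>vset V. ?r w = w"
      by (rule coords_eq_bwd[OF coords_bas[OF v] s, OF ballI[OF runit_tmap_crd(2)[OF v v e Di]] _ 4 5]) (auto intro: eq)
    ultimately show ?thesis using v d e by (simp add: coalgebra_def)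
  qed
qed

lemma bialgebra_laws:
  assumes v: "vspace V" and m: "lin (V \<otimes> V) V m" and d: "lin V (V \<otimes> V) \<Delta>"
    and l: "lin (V \<otimes> V) (V \<otimes> V) \<Psi>"
  defines "P \<equiv> braid_op V V \<Psi>" and "M \<equiv> mult_op V m" and "D \<equiv> comult_op V \<Delta>"
  shows comult_mult_fwd: "\<forall>t\<in>vset (V \<otimes> V). \<Delta> (m t) =
        tmap V V m m (braidM V V V V \<Psi> (tmap (V \<otimes> V) (V \<otimes> V) \<Delta> \<Delta> t)) \<Longrightarrow> a \<in> bas V \<Longrightarrow> b \<in> bas V \<Longrightarrow>
      M a b (\<lambda>x. D x k) = D a (\<lambda>a1 a2. D b (\<lambda>b1 b2. P a2 b1 (\<lambda>b1 a2. M a1 b1 (\<lambda>x. M a2 b2 (\<lambda>y. k x y)))))"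
    and comult_mult_bwd: "separating V (crd V) S \<Longrightarrow>
      (\<And>a b k l. a \<in> bas V \<Longrightarrow> b \<in> bas V \<Longrightarrow> k \<in> S \<Longrightarrow> l \<in> S \<Longrightarrow> M a b (\<lambda>x. D x (\<lambda>x y. k x * l y)) =
        D a (\<lambda>a1 a2. D b (\<lambda>b1 b2. P a2 b1 (\<lambda>b1 a2. M a1 b1 (\<lambda>x. M a2 b2 (\<lambda>y. k x * l y)))))) \<Longrightarrow>
      \<forall>t\<in>vset (V \<otimes> V). \<Delta> (m t) =
        tmap V V m m (braidM V V V V \<Psi> (tmap (V \<otimes> V) (V \<otimes> V) \<Delta> \<Delta> t))"
proof -
  let ?f = "\<lambda>t. \<Delta> (m t)"
  let ?g = "\<lambda>t. tmap V V m m (braidM V V V V \<Psi> (tmap (V \<otimes> V) (V \<otimes> V) \<Delta> \<Delta> t))"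
  let ?\<phi> = "\<lambda>(a, b) k. M a b (\<lambda>x. D x (\<lambda>x y. k (x, y)))"
  let ?\<psi> = "\<lambda>(a, b) k. D a (\<lambda>a1 a2. D b (\<lambda>b1 b2. P a2 b1 (\<lambda>b1 a2. M a1 b1 (\<lambda>x. M a2 b2 (\<lambda>y. k (x, y))))))"
  note Mi = lin_in[OF m] and Di = lin_in[OF d]
  note TD = lin_in[OF lin_tmap[OF v v d d]] note B = lin_in[OF lin_braidM[OF v v v v l]]
  note TM = lin_in[OF lin_tmap[OF vspace_tensor vspace_tensor m m]]
  have f: "\<forall>t\<in>vset (V \<otimes> V). ?f t \<in> vset (V \<otimes> V)" "\<forall>t\<in>vset (V \<otimes> V). ?g t \<in> vset (V \<otimes> V)"
    by (auto intro: Mi Di TD B TM)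
  have 1: "\<forall>t\<in>vset (V \<otimes> V). \<forall>q. (crd V \<otimes>\<^sub>c crd V) (?f t) q = (crd V \<otimes>\<^sub>c crd V) t (\<lambda>i. ?\<phi> i q)"
    by (simp add: comult_crd[OF v d] mult_crd[OF v m] M_def D_def Mi Di TD B TM split_def)
  have 2: "\<forall>t\<in>vset (V \<otimes> V). \<forall>q. (crd V \<otimes>\<^sub>c crd V) (?g t) q = (crd V \<otimes>\<^sub>c crd V) t (\<lambda>i. ?\<psi> i q)"
    by (simp add: tmap_mults_crd[OF v m] braidM_crd[OF v v v v l] tmap_comults_crd[OF v v d d] P_def M_def D_def Mi Di TD B TM split_def)
  show "M a b (\<lambda>x. D x k) = D a (\<lambda>a1 a2. D b (\<lambda>b1 b2. P a2 b1 (\<lambda>b1 a2. M a1 b1 (\<lambda>x. M a2 b2 (\<lambda>y. k x y)))))"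
    if "\<forall>t\<in>vset (V \<otimes> V). ?f t = ?g t" "a \<in> bas V" "b \<in> bas V"
    using coords_eq_fwd[where f="?f" and g="?g" and F="crd V \<otimes>\<^sub>c crd V", OF coords_bas2[OF v v], OF that(1) 1 2, of "(a, b)" "\<lambda>(x, y). k x y"] that(2-) by simp
  show "\<forall>t\<in>vset (V \<otimes> V). ?f t = ?g t" if s: "separating V (crd V) S" and
    eq: "\<And>a b k l. a \<in> bas V \<Longrightarrow> b \<in> bas V \<Longrightarrow> k \<in> S \<Longrightarrow> l \<in> S \<Longrightarrow> M a b (\<lambda>x. D x (\<lambda>x y. k x * l y)) =
        D a (\<lambda>a1 a2. D b (\<lambda>b1 b2. P a2 b1 (\<lambda>b1 a2. M a1 b1 (\<lambda>x. M a2 b2 (\<lambda>y. k x * l y)))))"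
    by (rule coords_eq_bwd[OF coords_bas2[OF v v] separating_bas2[OF v v s s], OF f 1 2])
      (auto simp: prod_forms_def intro: eq)
qed

section \<open>Braided bialgebras in coordinates\<close>


text \<open>Integrands with two arguments are kept curried, as calculations rename and permute them.\<close>

definition fin_comb2 where
  "fin_comb2 I J \<phi> \<longleftrightarrow> fin_comb (I \<times> J) (\<lambda>k. \<phi> (\<lambda>i j. k (i, j)))"

lemma fin_comb2_cong:
  assumes "fin_comb2 I J \<phi>" "\<And>i j. i \<in> I \<Longrightarrow> j \<in> J \<Longrightarrow> k i j = k' i j"
  shows "\<phi> k = \<phi> k'"
  using fin_comb_cong[OF assms(1)[unfolded fin_comb2_def], of "\<lambda>(i, j). k i j" "\<lambda>(i, j). k' i j"] assms(2) by auto

lemma fin_comb2_scale: "fin_comb2 I J \<phi> \<Longrightarrow> \<phi> (\<lambda>i j. c * k i j) = c * \<phi> k"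
  using fin_comb_scale[of "I \<times> J" "\<lambda>k. \<phi> (\<lambda>i j. k (i, j))" c "\<lambda>(i, j). k i j"] by (simp add: fin_comb2_def)

lemma fin_comb2_zero: "fin_comb2 I J \<phi> \<Longrightarrow> \<phi> (\<lambda>i j. 0) = 0"
  using fin_comb_zero[of "I \<times> J" "\<lambda>k. \<phi> (\<lambda>i j. k (i, j))"] by (simp add: fin_comb2_def)

lemma fin_comb2_Fubini22:
  assumes "fin_comb2 I J \<phi>" "fin_comb2 I' J' \<psi>"
  shows "\<phi> (\<lambda>i j. \<psi> (\<lambda>i' j'. k i j i' j')) = \<psi> (\<lambda>i' j'. \<phi> (\<lambda>i j. k i j i' j'))"
  using fin_comb_Fubini[OF assms[unfolded fin_comb2_def], of "\<lambda>(i, j) (i', j'). k i j i' j'"] by simp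

lemma fin_comb2_Fubini21:
  assumes "fin_comb2 I J \<phi>" "fin_comb I' \<psi>"
  shows "\<phi> (\<lambda>i j. \<psi> (\<lambda>i'. k i j i')) = \<psi> (\<lambda>i'. \<phi> (\<lambda>i j. k i j i'))"
  using fin_comb_Fubini[OF assms(1)[unfolded fin_comb2_def] assms(2), of "\<lambda>(i, j) i'. k i j i'"] by simp

lemma fin_comb2_bind2:
  assumes "fin_comb2 I J \<phi>" "\<And>i j. i \<in> I \<Longrightarrow> j \<in> J \<Longrightarrow> fin_comb2 I' J' (\<psi> i j)"
  shows "fin_comb2 I' J' (\<lambda>k. \<phi> (\<lambda>i j. \<psi> i j k))"
  unfolding fin_comb2_def
  using fin_comb_bind[OF assms(1)[unfolded fin_comb2_def], of "I' \<times> J'" "\<lambda>(i, j) k. \<psi> i j (\<lambda>i j. k (i, j))"] assms(2)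
  by (auto simp: fin_comb2_def)

lemma fin_comb2_bind1:
  assumes "fin_comb2 I J \<phi>" "\<And>i j. i \<in> I \<Longrightarrow> j \<in> J \<Longrightarrow> fin_comb I' (\<psi> i j)"
  shows "fin_comb I' (\<lambda>k. \<phi> (\<lambda>i j. \<psi> i j k))"
  using fin_comb_bind[OF assms(1)[unfolded fin_comb2_def], of I' "\<lambda>(i, j). \<psi> i j"] assms(2) by auto

lemma fin_comb2_flip: "fin_comb2 I J \<phi> \<Longrightarrow> fin_comb2 J I (\<lambda>k. \<phi> (\<lambda>i j. k j i))"
  unfolding fin_comb2_def
  using fin_comb_bind[of "I \<times> J" "\<lambda>k. \<phi> (\<lambda>i j. k (i, j))" "J \<times> I" "\<lambda>(i, j) k. k (j, i)"]
  by (auto simp: fin_comb_single)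

definition op_mult where "op_mult P M a b h = P a b (\<lambda>b a. M b a h)"
definition cop_comult where "cop_comult P D a k = D a (\<lambda>a b. P a b k)"

text \<open>\<open>\<Delta> m = (m \<otimes> m)(id \<otimes> \<Psi> \<otimes> id)(\<Delta> \<otimes> \<Delta>)\<close>.  It is kept apart from the other laws because, unlike them,
  it is not preserved when \<open>\<Psi>\<close> is replaced by its inverse.\<close>

definition comult_mult_law where
  "comult_mult_law P M D \<longleftrightarrow> (\<forall>a b k. M a b (\<lambda>x. D x k) =
     D a (\<lambda>p q. D b (\<lambda>r s. P q r (\<lambda>r q. M p r (\<lambda>x. M q s (\<lambda>y. k x y))))))"

text \<open>The axioms of a braided algebra and a braided coalgebra with braiding \<open>P\<close>, its inverse \<open>Q\<close>, product
  \<open>M\<close>, unit \<open>u\<close>, coproduct \<open>D\<close> and counit \<open>c\<close>.  A crossing keeps the names of the strands, so that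
  \<open>P a b (\<lambda>b a. \<dots>)\<close> is to be read as: the strands \<open>a\<close>, \<open>b\<close> have crossed.  The letters in the names of the
  laws are those of the operators involved, and the number tells which argument of the braiding is a
  product, a unit or a coproduct.\<close>

locale braided_laws =
  fixes B :: "'i set" and P Q :: "'i \<Rightarrow> 'i \<Rightarrow> ('i \<Rightarrow> 'i \<Rightarrow> 'k::field) \<Rightarrow> 'k"
    and M :: "'i \<Rightarrow> 'i \<Rightarrow> ('i \<Rightarrow> 'k) \<Rightarrow> 'k" and u :: "('i \<Rightarrow> 'k) \<Rightarrow> 'k"
    and D :: "'i \<Rightarrow> ('i \<Rightarrow> 'i \<Rightarrow> 'k) \<Rightarrow> 'k" and c :: "'i \<Rightarrow> 'k"
  assumes fP: "fin_comb2 B B (P a b)" and fQ: "fin_comb2 B B (Q a b)" and fM: "fin_comb B (M a b)"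
    and fu: "fin_comb B u" and fD: "fin_comb2 B B (D a)"
    and zP: "a \<notin> B \<or> b \<notin> B \<Longrightarrow> P a b k = 0" and zQ: "a \<notin> B \<or> b \<notin> B \<Longrightarrow> Q a b k = 0"
    and zM: "a \<notin> B \<or> b \<notin> B \<Longrightarrow> M a b h = 0" and zD: "a \<notin> B \<Longrightarrow> D a k = 0"
    and PQ: "a \<in> B \<Longrightarrow> b \<in> B \<Longrightarrow> P a b (\<lambda>b a. Q b a k) = k a b"
    and QP: "a \<in> B \<Longrightarrow> b \<in> B \<Longrightarrow> Q a b (\<lambda>b a. P b a k) = k a b"
    and YB: "P a b (\<lambda>b a. P a d (\<lambda>d a. P b d (\<lambda>d b. t d b a))) =
      P b d (\<lambda>d b. P a d (\<lambda>d a. P a b (\<lambda>b a. t d b a)))"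
    and PM1: "M a b (\<lambda>x. P x d k) = P b d (\<lambda>d b. P a d (\<lambda>d a. M a b (\<lambda>x. k d x)))"
    and PM2: "M b d (\<lambda>x. P a x k) = P a b (\<lambda>b a. P a d (\<lambda>d a. M b d (\<lambda>x. k x a)))"
    and Pu1: "b \<in> B \<Longrightarrow> u (\<lambda>x. P x b k) = u (\<lambda>x. k b x)"
    and Pu2: "a \<in> B \<Longrightarrow> u (\<lambda>x. P a x k) = u (\<lambda>x. k x a)"
    and PD1: "P a b (\<lambda>b a. D a (\<lambda>x y. t b x y)) = D a (\<lambda>x y. P y b (\<lambda>b y. P x b (\<lambda>b x. t b x y)))"
    and PD2: "P a b (\<lambda>b a. D b (\<lambda>x y. t x y a)) = D b (\<lambda>x y. P a x (\<lambda>x a. P a y (\<lambda>y a. t x y a)))"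
    and Pc1: "a \<in> B \<Longrightarrow> b \<in> B \<Longrightarrow> P a b (\<lambda>b a. c a * h b) = c a * h b"
    and Pc2: "a \<in> B \<Longrightarrow> b \<in> B \<Longrightarrow> P a b (\<lambda>b a. c b * h a) = c b * h a"
    and MM: "M a b (\<lambda>x. M x d h) = M b d (\<lambda>x. M a x h)"
    and uM1: "a \<in> B \<Longrightarrow> u (\<lambda>x. M x a h) = h a"
    and uM2: "a \<in> B \<Longrightarrow> u (\<lambda>x. M a x h) = h a"
    and DD: "D a (\<lambda>x y. D x (\<lambda>p q. t p q y)) = D a (\<lambda>x y. D y (\<lambda>p q. t x p q))"
    and cD1: "a \<in> B \<Longrightarrow> D a (\<lambda>x y. c x * h y) = h a"
    and cD2: "a \<in> B \<Longrightarrow> D a (\<lambda>x y. c y * h x) = h a"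
begin

lemma zeros [simp]: "P a b (\<lambda>x y. 0) = 0" "Q a b (\<lambda>x y. 0) = 0" "M a b (\<lambda>x. 0) = 0" "D a (\<lambda>x y. 0) = 0"
  using fin_comb2_zero[OF fP] fin_comb2_zero[OF fQ] fin_comb_zero[OF fM] fin_comb2_zero[OF fD] by auto

lemma zP' [simp]: "a \<notin> B \<Longrightarrow> P a b k = 0" "b \<notin> B \<Longrightarrow> P a b k = 0"
  and zQ' [simp]: "a \<notin> B \<Longrightarrow> Q a b k = 0" "b \<notin> B \<Longrightarrow> Q a b k = 0"
  and zM' [simp]: "a \<notin> B \<Longrightarrow> M a b h = 0" "b \<notin> B \<Longrightarrow> M a b h = 0"
  and zD' [simp]: "a \<notin> B \<Longrightarrow> D a k = 0"
  using zP zQ zM zD by auto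

lemma P_cong: "(\<And>x y. x \<in> B \<Longrightarrow> y \<in> B \<Longrightarrow> k x y = k' x y) \<Longrightarrow> P a b k = P a b k'"
  by (rule fin_comb2_cong[OF fP])
lemma Q_cong: "(\<And>x y. x \<in> B \<Longrightarrow> y \<in> B \<Longrightarrow> k x y = k' x y) \<Longrightarrow> Q a b k = Q a b k'"
  by (rule fin_comb2_cong[OF fQ])
lemma D_cong: "(\<And>x y. x \<in> B \<Longrightarrow> y \<in> B \<Longrightarrow> k x y = k' x y) \<Longrightarrow> D a k = D a k'"
  by (rule fin_comb2_cong[OF fD])
lemma M_cong: "(\<And>x. x \<in> B \<Longrightarrow> h x = h' x) \<Longrightarrow> M a b h = M a b h'"
  by (rule fin_comb_cong[OF fM])
lemma u_cong: "(\<And>x. x \<in> B \<Longrightarrow> h x = h' x) \<Longrightarrow> u h = u h'"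
  by (rule fin_comb_cong[OF fu])

lemmas congs = P_cong Q_cong D_cong M_cong u_cong

text \<open>The laws \<open>QYB\<close> to \<open>Qc2\<close> hold for the inverse braiding.  They are obtained from those for \<open>P\<close> by inserting a cancelling
  pair \<open>P\<close>, \<open>Q\<close>, which exchanges the roles of the two arguments.\<close>

lemma QYB: "Q a b (\<lambda>b a. Q a d (\<lambda>d a. Q b d (\<lambda>d b. t d b a))) =
    Q b d (\<lambda>d b. Q a d (\<lambda>d a. Q a b (\<lambda>b a. t d b a)))"
proof (cases "a \<in> B \<and> b \<in> B \<and> d \<in> B")
  case True
  have 1: "t d b a = P d b (\<lambda>b d. P d a (\<lambda>a d. P b a (\<lambda>a b. Q a b (\<lambda>b a. Q a d (\<lambda>d a. Q b d (\<lambda>d b. t d b a))))))"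
    if "d \<in> B" "b \<in> B" "a \<in> B" for d b a
    using that by (simp add: PQ cong: congs)
  have "Q b d (\<lambda>d b. Q a d (\<lambda>d a. Q a b (\<lambda>b a. t d b a))) =
    Q b d (\<lambda>d b. Q a d (\<lambda>d a. Q a b (\<lambda>b a.
      P d b (\<lambda>b d. P d a (\<lambda>a d. P b a (\<lambda>a b. Q a b (\<lambda>b a. Q a d (\<lambda>d a. Q b d (\<lambda>d b. t d b a)))))))))"
    by (intro Q_cong 1)
  also have "\<dots> = Q b d (\<lambda>d b. Q a d (\<lambda>d a. Q a b (\<lambda>b a.
      P b a (\<lambda>a b. P d a (\<lambda>a d. P d b (\<lambda>b d. Q a b (\<lambda>b a. Q a d (\<lambda>d a. Q b d (\<lambda>d b. t d b a)))))))))"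
    by (subst YB) (rule refl)
  also have "\<dots> = Q a b (\<lambda>b a. Q a d (\<lambda>d a. Q b d (\<lambda>d b. t d b a)))"
    using True by (simp add: QP cong: congs)
  finally show ?thesis by simp
qed auto

lemma QM1: "M a b (\<lambda>x. Q x d k) = Q b d (\<lambda>d b. Q a d (\<lambda>d a. M a b (\<lambda>x. k d x)))"
proof (cases "a \<in> B \<and> b \<in> B \<and> d \<in> B")
  case True
  have "Q b d (\<lambda>d b. Q a d (\<lambda>d a. M a b (\<lambda>x. k d x))) =
      Q b d (\<lambda>d b. Q a d (\<lambda>d a. M a b (\<lambda>x. P d x (\<lambda>x d. Q x d k))))"
    by (simp add: PQ cong: congs)
  also have "\<dots> = M a b (\<lambda>x. Q x d k)"
    unfolding PM2 using True by (simp add: QP cong: congs)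
  finally show ?thesis by simp
qed auto

lemma QM2: "M b d (\<lambda>x. Q a x k) = Q a b (\<lambda>b a. Q a d (\<lambda>d a. M b d (\<lambda>x. k x a)))"
proof (cases "a \<in> B \<and> b \<in> B \<and> d \<in> B")
  case True
  have "Q a b (\<lambda>b a. Q a d (\<lambda>d a. M b d (\<lambda>x. k x a))) =
      Q a b (\<lambda>b a. Q a d (\<lambda>d a. M b d (\<lambda>x. P x a (\<lambda>a x. Q a x k))))"
    by (simp add: PQ cong: congs)
  also have "\<dots> = M b d (\<lambda>x. Q a x k)"
    unfolding PM1 using True by (simp add: QP cong: congs)
  finally show ?thesis by simp
qed auto

lemma Qu1: assumes "b \<in> B" shows "u (\<lambda>x. Q x b k) = u (\<lambda>x. k b x)"
proof -
  have "u (\<lambda>x. k b x) = u (\<lambda>x. P b x (\<lambda>x b. Q x b k))"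
    using assms by (simp add: PQ cong: congs)
  also have "\<dots> = u (\<lambda>x. Q x b k)" by (rule Pu2[OF assms])
  finally show ?thesis by simp
qed

lemma Qu2: assumes "a \<in> B" shows "u (\<lambda>x. Q a x k) = u (\<lambda>x. k x a)"
proof -
  have "u (\<lambda>x. k x a) = u (\<lambda>x. P x a (\<lambda>a x. Q a x k))"
    using assms by (simp add: PQ cong: congs)
  also have "\<dots> = u (\<lambda>x. Q a x k)" by (rule Pu1[OF assms])
  finally show ?thesis by simp
qed

lemma QD1: "Q a b (\<lambda>b a. D a (\<lambda>x y. t b x y)) = D a (\<lambda>x y. Q y b (\<lambda>b y. Q x b (\<lambda>b x. t b x y)))"
proof (cases "a \<in> B \<and> b \<in> B")
  case True
  have "D a (\<lambda>x y. Q y b (\<lambda>b y. Q x b (\<lambda>b x. t b x y))) =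
    Q a b (\<lambda>b a. P b a (\<lambda>a b. D a (\<lambda>x y. Q y b (\<lambda>b y. Q x b (\<lambda>b x. t b x y)))))"
    using True by (simp add: QP)
  also have "\<dots> = Q a b (\<lambda>b a. D a (\<lambda>x y. t b x y))"
    unfolding PD2 by (simp add: PQ cong: congs)
  finally show ?thesis by simp
qed auto

lemma QD2: "Q a b (\<lambda>b a. D b (\<lambda>x y. t x y a)) = D b (\<lambda>x y. Q a x (\<lambda>x a. Q a y (\<lambda>y a. t x y a)))"
proof (cases "a \<in> B \<and> b \<in> B")
  case True
  have "D b (\<lambda>x y. Q a x (\<lambda>x a. Q a y (\<lambda>y a. t x y a))) =
    Q a b (\<lambda>b a. P b a (\<lambda>a b. D b (\<lambda>x y. Q a x (\<lambda>x a. Q a y (\<lambda>y a. t x y a)))))"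
    using True by (simp add: QP)
  also have "\<dots> = Q a b (\<lambda>b a. D b (\<lambda>x y. t x y a))"
    unfolding PD1 by (simp add: PQ cong: congs)
  finally show ?thesis by simp
qed auto

lemma Qc1: assumes "a \<in> B" "b \<in> B" shows "Q a b (\<lambda>b a. c a * h b) = c a * h b"
proof -
  have "Q a b (\<lambda>b a. c a * h b) = Q a b (\<lambda>b a. P b a (\<lambda>a b. c a * h b))"
    by (simp add: Pc2 cong: congs)
  thus ?thesis using assms by (simp add: QP)
qed

lemma Qc2: assumes "a \<in> B" "b \<in> B" shows "Q a b (\<lambda>b a. c b * h a) = c b * h a"
proof -
  have "Q a b (\<lambda>b a. c b * h a) = Q a b (\<lambda>b a. P b a (\<lambda>a b. c b * h a))"
    by (simp add: Pc1 cong: congs)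
  thus ?thesis using assms by (simp add: QP)
qed

lemma inverse_laws: "braided_laws B Q P M u D c"
  by unfold_locales
    (use QYB QM1 QM2 QD1 QD2 in \<open>auto simp: fP fQ fM fu fD PQ QP Qu1 Qu2 Qc1 Qc2 uM1 uM2 cD1 cD2 intro: MM DD\<close>)

abbreviation Mop where "Mop \<equiv> op_mult P M"
abbreviation Dcop where "Dcop \<equiv> cop_comult P D"
lemmas Mop_def = op_mult_def and Dcop_def = cop_comult_def

text \<open>All tensor products are read from right to left.\<close>

lemma flip_laws: "braided_laws B (\<lambda>a b k. P b a (\<lambda>x y. k y x)) (\<lambda>a b k. Q b a (\<lambda>x y. k y x))
    (\<lambda>a b. M b a) u (\<lambda>a k. D a (\<lambda>x y. k y x)) c"
  apply unfold_locales
  subgoal by (rule fin_comb2_flip[OF fP])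
  subgoal by (rule fin_comb2_flip[OF fQ])
  subgoal by (rule fM)
  subgoal by (rule fu)
  subgoal by (rule fin_comb2_flip[OF fD])
  subgoal by auto
  subgoal by auto
  subgoal by auto
  subgoal by auto
  subgoal by (simp add: PQ)
  subgoal by (simp add: QP)
  subgoal by (rule YB[symmetric])
  subgoal by (rule PM2)
  subgoal by (rule PM1)
  subgoal by (rule Pu2)
  subgoal by (rule Pu1)
  subgoal for a b t using PD2[of b a "\<lambda>x y a. t a y x"] by simp
  subgoal for a b t using PD1[of b a "\<lambda>a x y. t y x a"] by simp
  subgoal by (rule Pc2)
  subgoal by (rule Pc1)
  subgoal by (rule MM[symmetric])
  subgoal by (rule uM2)
  subgoal by (rule uM1)
  subgoal by (rule DD[symmetric])
  subgoal by (rule cD2)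
  subgoal by (rule cD1)
  done

text \<open>Associativity of \<open>m \<Psi>\<close> is associativity of \<open>m\<close> together with the braid equation.\<close>

lemma Mop_laws: "braided_laws B P Q Mop u D c"
proof unfold_locales
  show "fin_comb B (Mop a b)" for a b unfolding Mop_def by (rule fin_comb2_bind1[OF fP fM])
  show "Mop a b (\<lambda>x. P x d k) = P b d (\<lambda>d b. P a d (\<lambda>d a. Mop a b (\<lambda>x. k d x)))" for a b d k
    unfolding Mop_def PM1 by (rule YB)
  show "Mop b d (\<lambda>x. P a x k) = P a b (\<lambda>b a. P a d (\<lambda>d a. Mop b d (\<lambda>x. k x a)))" for a b d k
    unfolding Mop_def PM2 by (rule YB[symmetric])
  show "Mop a b (\<lambda>x. Mop x d h) = Mop b d (\<lambda>x. Mop a x h)" for a b d h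
    unfolding Mop_def PM1 PM2 MM by (rule YB)
  show "u (\<lambda>x. Mop x a h) = h a" if "a \<in> B" for a h
    using that by (simp add: Mop_def Pu1 uM2)
  show "u (\<lambda>x. Mop a x h) = h a" if "a \<in> B" for a h
    using that by (simp add: Mop_def Pu2 uM1)
qed (auto simp: fP fQ fu fD PQ QP Pu1 Pu2 Pc1 Pc2 cD1 cD2 Mop_def intro: YB PD1 PD2 DD)

lemma Dcop_laws: "braided_laws B P Q M u Dcop c"
proof unfold_locales
  show "fin_comb2 B B (Dcop a)" for a unfolding Dcop_def by (rule fin_comb2_bind2[OF fD fP])
  show "P a b (\<lambda>b a. Dcop a (\<lambda>x y. t b x y)) = Dcop a (\<lambda>x y. P y b (\<lambda>b y. P x b (\<lambda>b x. t b x y)))" for a b t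
    unfolding Dcop_def PD1 by (simp only: YB)
  show "P a b (\<lambda>b a. Dcop b (\<lambda>x y. t x y a)) = Dcop b (\<lambda>x y. P a x (\<lambda>x a. P a y (\<lambda>y a. t x y a)))" for a b t
    unfolding Dcop_def PD2 by (simp only: YB)
  show "Dcop a (\<lambda>x y. Dcop x (\<lambda>p q. t p q y)) = Dcop a (\<lambda>x y. Dcop y (\<lambda>p q. t x p q))" for a t
    unfolding Dcop_def PD1 PD2 DD by (simp only: YB)
  show "Dcop a (\<lambda>x y. c x * h y) = h a" if "a \<in> B" for a h
    using that by (simp add: Dcop_def Pc2 cD2 cong: congs)
  show "Dcop a (\<lambda>x y. c y * h x) = h a" if "a \<in> B" for a h
    using that by (simp add: Dcop_def Pc1 cD1 cong: congs)
qed (auto simp: fP fQ fu fM PQ QP Pu1 Pu2 Pc1 Pc2 uM1 uM2 Dcop_def intro: YB PM1 PM2 MM)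

lemma scale_in:
  "z * P a b k = P a b (\<lambda>x y. z * k x y)" "P a b k * z = P a b (\<lambda>x y. k x y * z)"
  "z * Q a b k = Q a b (\<lambda>x y. z * k x y)" "Q a b k * z = Q a b (\<lambda>x y. k x y * z)"
  "z * D a k = D a (\<lambda>x y. z * k x y)" "D a k * z = D a (\<lambda>x y. k x y * z)"
  "z * M a b h = M a b (\<lambda>x. z * h x)" "M a b h * z = M a b (\<lambda>x. h x * z)"
  "z * u h = u (\<lambda>x. z * h x)" "u h * z = u (\<lambda>x. h x * z)"
  using fin_comb2_scale[OF fP, of a b z k] fin_comb2_scale[OF fQ, of a b z k] fin_comb2_scale[OF fD, of a z k]
    fin_comb_scale[OF fM, of a b z h] fin_comb_scale[OF fu, of z h]
  by (simp_all add: mult.commute)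

text \<open>Here \<open>P\<close> is the inverse of the braiding \<open>Q\<close> of the given bialgebra.  Carrying \<open>P\<close> past
  \<open>m \<otimes> m\<close> gives four crossings.  The first cancels against the \<open>Q\<close> in the middle, two turn
  the coproducts into coopposite ones, and the last is the new middle crossing.\<close>

lemma cop_comult_mult:
  assumes "comult_mult_law Q M D"
  shows "comult_mult_law P M Dcop"
  unfolding comult_mult_law_def
proof (intro allI)
  fix a b k
  have MMP: "M p r (\<lambda>x. M q s (\<lambda>y. P x y k)) =
      P r q (\<lambda>q r. P p q (\<lambda>q p. P r s (\<lambda>s r. P p s (\<lambda>s p. M q s (\<lambda>y. M p r (\<lambda>x. k y x))))))" for p q r s
  proof -
    have "M p r (\<lambda>x. M q s (\<lambda>y. P x y k)) =
      P r q (\<lambda>q r. P p q (\<lambda>q p. P r s (\<lambda>s r. P p s (\<lambda>s p. M p r (\<lambda>x. M q s (\<lambda>y. k y x))))))"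
      unfolding PM2 unfolding PM1 ..
    also have "\<dots> = P r q (\<lambda>q r. P p q (\<lambda>q p. P r s (\<lambda>s r. P p s (\<lambda>s p. M q s (\<lambda>y. M p r (\<lambda>x. k y x))))))"
      by (intro P_cong fin_comb_Fubini[OF fM fM])
    finally show ?thesis .
  qed
  have "M a b (\<lambda>x. Dcop x k) =
      D a (\<lambda>p q. D b (\<lambda>r s. Q q r (\<lambda>r q. M p r (\<lambda>x. M q s (\<lambda>y. P x y k)))))"
    unfolding cop_comult_def using assms by (simp only: comult_mult_law_def)
  also have "\<dots> = D a (\<lambda>p q. D b (\<lambda>r s. P p q (\<lambda>q p. P r s (\<lambda>s r. P p s (\<lambda>s p. M q s (\<lambda>y. M p r (\<lambda>x. k y x)))))))"
    unfolding MMP by (simp add: QP cong: congs)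
  also have "\<dots> = D a (\<lambda>p q. P p q (\<lambda>q p. D b (\<lambda>r s. P r s (\<lambda>s r. P p s (\<lambda>s p. M q s (\<lambda>y. M p r (\<lambda>x. k y x)))))))"
    by (intro D_cong fin_comb2_Fubini22[OF fD fP])
  finally show "M a b (\<lambda>x. Dcop x k) =
     Dcop a (\<lambda>p q. Dcop b (\<lambda>r s. P q r (\<lambda>r q. M p r (\<lambda>x. M q s (\<lambda>y. k x y)))))"
    unfolding cop_comult_def .
qed

text \<open>The dual of the preceding argument, with \<open>P\<close> carried past \<open>\<Delta> \<otimes> \<Delta>\<close>.\<close>

lemma op_comult_mult:
  assumes "comult_mult_law Q M D"
  shows "comult_mult_law P Mop D"
  unfolding comult_mult_law_def
proof (intro allI)
  fix a b k
  have "Mop a b (\<lambda>x. D x k) =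
      P a b (\<lambda>b a. D b (\<lambda>p q. D a (\<lambda>r s. Q q r (\<lambda>r q. M p r (\<lambda>x. M q s (\<lambda>y. k x y))))))"
    unfolding op_mult_def using assms by (simp only: comult_mult_law_def)
  also have "\<dots> = D b (\<lambda>p q. D a (\<lambda>r s. P s p (\<lambda>p s. P r p (\<lambda>p r. P s q (\<lambda>q s. P r q (\<lambda>q r.
      Q q r (\<lambda>r q. M p r (\<lambda>x. M q s (\<lambda>y. k x y)))))))))"
    unfolding PD2 PD1 ..
  also have "\<dots> = D b (\<lambda>p q. D a (\<lambda>r s. P s p (\<lambda>p s. P r p (\<lambda>p r. P s q (\<lambda>q s.
      M p r (\<lambda>x. M q s (\<lambda>y. k x y)))))))"
    by (simp add: PQ cong: congs)
  also have "\<dots> = D a (\<lambda>r s. D b (\<lambda>p q. P s p (\<lambda>p s. P r p (\<lambda>p r. P s q (\<lambda>q s.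
      M p r (\<lambda>x. M q s (\<lambda>y. k x y)))))))"
    by (rule fin_comb2_Fubini22[OF fD fD])
  also have "\<dots> = D a (\<lambda>r s. D b (\<lambda>p q. P s p (\<lambda>p s. P r p (\<lambda>p r. M p r (\<lambda>x. P s q (\<lambda>q s.
      M q s (\<lambda>y. k x y)))))))"
    by (intro D_cong P_cong fin_comb2_Fubini21[OF fP fM])
  finally show "Mop a b (\<lambda>x. D x k) =
     D a (\<lambda>p q. D b (\<lambda>r s. P q r (\<lambda>r q. Mop p r (\<lambda>x. Mop q s (\<lambda>y. k x y)))))"
    unfolding op_mult_def .
qed

end

text \<open>First the coopposite coproduct for the inverse braiding, then the opposite product for the braiding
  itself.\<close>

lemma (in braided_laws) op_cop_laws:
  "braided_laws B P Q (op_mult P M) u (cop_comult Q D) c"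
proof -
  interpret i: braided_laws B Q P M u D c by (rule inverse_laws)
  interpret j: braided_laws B Q P M u "cop_comult Q D" c by (rule i.Dcop_laws)
  interpret k: braided_laws B P Q M u "cop_comult Q D" c by (rule j.inverse_laws)
  show ?thesis by (rule k.Mop_laws)
qed

lemma (in braided_laws) op_cop_comult_mult:
  assumes "comult_mult_law P M D"
  shows "comult_mult_law P (op_mult P M) (cop_comult Q D)"
proof -
  interpret i: braided_laws B Q P M u D c by (rule inverse_laws)
  interpret j: braided_laws B Q P M u "cop_comult Q D" c by (rule i.Dcop_laws)
  interpret k: braided_laws B P Q M u "cop_comult Q D" c by (rule j.inverse_laws)
  show ?thesis by (rule k.op_comult_mult[OF i.cop_comult_mult[OF assms]])
qed

section \<open>The antipode commutes with the braiding\<close>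

locale antipode_laws = braided_laws +
  fixes S :: "'a \<Rightarrow> ('a \<Rightarrow> 'b) \<Rightarrow> 'b"
  assumes fS: "fin_comb B (S a)" and zS: "a \<notin> B \<Longrightarrow> S a h = 0"
    and SL: "a \<in> B \<Longrightarrow> D a (\<lambda>x y. S x (\<lambda>x. M x y h)) = c a * u h"
    and SR: "a \<in> B \<Longrightarrow> D a (\<lambda>x y. S y (\<lambda>y. M x y h)) = c a * u h"
begin

lemma S_cong: "(\<And>x. x \<in> B \<Longrightarrow> h x = h' x) \<Longrightarrow> S a h = S a h'"
  by (rule fin_comb_cong[OF fS])

lemma S_zero [simp]: "S a (\<lambda>x. 0) = 0" by (rule fin_comb_zero[OF fS])

lemma S_scale: "S a (\<lambda>x. z * h x) = z * S a h" by (rule fin_comb_scale[OF fS])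
lemma P_scale: "P a b (\<lambda>x y. z * k x y) = z * P a b k" by (rule fin_comb2_scale[OF fP])

text \<open>For linear maps \<open>F, G : H \<otimes> W \<rightarrow> W \<otimes> H\<close>, where \<open>W = H\<close>, there is the convolution product
  \<open>F * G = (id \<otimes> m)(F \<otimes> id)(id \<otimes> G)(\<Delta> \<otimes> id)\<close>.  By the compatibility of \<open>\<Psi>\<close> with the coproduct,
  \<open>(id \<otimes> S) \<Psi>\<close> is a left inverse of \<open>\<Psi>\<close>, and by the compatibility with the product, \<open>\<Psi> (S \<otimes> id)\<close> is
  a right inverse.  Hence both coincide.  In the proof, \<open>T x y z\<close> is the integrand of the product of
  these three maps, and the two ways of bracketing it are compared by coassociativity.\<close>

lemma SP1: "S a (\<lambda>a. P a b k) = P a b (\<lambda>b a. S a (\<lambda>a. k b a))"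
proof (cases "a \<in> B \<and> b \<in> B")
  case True
  define T where "T x y z = S z (\<lambda>z. P z b (\<lambda>b z. P y b (\<lambda>b y. P x b (\<lambda>b x. S x (\<lambda>x.
    M x y (\<lambda>w. M w z (\<lambda>v. k b v)))))))" for x y z
  have 1: "D r (\<lambda>x y. T x y z) = c r * S z (\<lambda>z. P z b k)" if "r \<in> B" "z \<in> B" for r z
  proof -
    have "D r (\<lambda>x y. T x y z) = S z (\<lambda>z. D r (\<lambda>x y. P z b (\<lambda>b z. P y b (\<lambda>b y. P x b (\<lambda>b x. S x (\<lambda>x.
        M x y (\<lambda>w. M w z (\<lambda>v. k b v))))))))"
      unfolding T_def by (rule fin_comb2_Fubini21[OF fD fS])
    also have "\<dots> = S z (\<lambda>z. P z b (\<lambda>b z. D r (\<lambda>x y. P y b (\<lambda>b y. P x b (\<lambda>b x. S x (\<lambda>x.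
        M x y (\<lambda>w. M w z (\<lambda>v. k b v))))))))"
      by (intro S_cong fin_comb2_Fubini22[OF fD fP])
    also have "\<dots> = S z (\<lambda>z. P z b (\<lambda>b z. P r b (\<lambda>b r. D r (\<lambda>x y. S x (\<lambda>x.
        M x y (\<lambda>w. M w z (\<lambda>v. k b v)))))))"
      unfolding PD1 ..
    also have "\<dots> = S z (\<lambda>z. P z b (\<lambda>b z. c r * k b z))"
      using that by (simp add: SL uM1 Pc1 cong: congs S_cong)
    finally show ?thesis by (simp add: P_scale S_scale)
  qed
  have 2: "D r (\<lambda>y z. T x y z) = c r * P x b (\<lambda>b x. S x (\<lambda>x. k b x))" if "r \<in> B" "x \<in> B" for r x
  proof -
    define h where "h b w = P x b (\<lambda>b x. S x (\<lambda>x. M x w (\<lambda>v. k b v)))" for b w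
    have "T x y z = S z (\<lambda>z. M y z (\<lambda>w. P w b (\<lambda>b w. h b w)))" for y z
    proof -
      have "T x y z = S z (\<lambda>z. P z b (\<lambda>b z. P y b (\<lambda>b y. P x b (\<lambda>b x. S x (\<lambda>x.
          M y z (\<lambda>w. M x w (\<lambda>v. k b v)))))))"
        unfolding T_def MM ..
      also have "\<dots> = S z (\<lambda>z. P z b (\<lambda>b z. P y b (\<lambda>b y. P x b (\<lambda>b x.
          M y z (\<lambda>w. S x (\<lambda>x. M x w (\<lambda>v. k b v)))))))"
        by (intro S_cong P_cong fin_comb_Fubini[OF fS fM])
      also have "\<dots> = S z (\<lambda>z. P z b (\<lambda>b z. P y b (\<lambda>b y. M y z (\<lambda>w. h b w))))"
        unfolding h_def by (intro S_cong P_cong fin_comb2_Fubini21[OF fP fM])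
      finally show ?thesis unfolding PM1 .
    qed
    hence "D r (\<lambda>y z. T x y z) = c r * u (\<lambda>w. P w b (\<lambda>b w. h b w))"
      using that by (simp add: SR)
    also have "u (\<lambda>w. P w b (\<lambda>b w. h b w)) = u (\<lambda>w. h b w)"
      using True by (simp add: Pu1)
    also have "\<dots> = P x b (\<lambda>b x. u (\<lambda>w. S x (\<lambda>x. M x w (\<lambda>v. k b v))))"
      unfolding h_def by (rule fin_comb2_Fubini21[OF fP fu, symmetric])
    also have "\<dots> = P x b (\<lambda>b x. S x (\<lambda>x. u (\<lambda>w. M x w (\<lambda>v. k b v))))"
      by (intro P_cong fin_comb_Fubini[OF fu fS])
    also have "\<dots> = P x b (\<lambda>b x. S x (\<lambda>x. k b x))"
      by (simp add: uM2 cong: P_cong S_cong)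
    finally show ?thesis .
  qed
  have "S a (\<lambda>a. P a b k) = D a (\<lambda>r z. D r (\<lambda>x y. T x y z))"
    using True by (simp add: 1 cD1 cong: D_cong)
  also have "\<dots> = D a (\<lambda>x r. D r (\<lambda>y z. T x y z))" by (rule DD)
  also have "\<dots> = P a b (\<lambda>b a. S a (\<lambda>a. k b a))"
    using True by (simp add: 2 cD2 cong: D_cong)
  finally show ?thesis .
qed (auto simp: zS)

lemma inverse_antipode: "antipode_laws B Q P M u D c S"
  by (intro antipode_laws.intro inverse_laws antipode_laws_axioms.intro fS zS SL SR)

text \<open>This is \<open>SP1\<close> for the inverse braiding.\<close>

lemma SP2: "S b (\<lambda>b. P a b k) = P a b (\<lambda>b a. S b (\<lambda>b. k b a))"
proof (cases "a \<in> B \<and> b \<in> B")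
  case True
  interpret i: antipode_laws B Q P M u D c S by (rule inverse_antipode)
  have "P a b (\<lambda>b a. S b (\<lambda>b. k b a)) = P a b (\<lambda>b a. S b (\<lambda>b. Q b a (\<lambda>a b. P a b k)))"
    by (simp add: QP cong: P_cong S_cong)
  also have "\<dots> = S b (\<lambda>b. P a b k)"
    unfolding i.SP1 using True by (simp add: PQ)
  finally show ?thesis by simp
qed (auto simp: zS)

text \<open>\<open>m \<Psi> (S \<otimes> id) \<Psi>\<^sup>-\<^sup>1 \<Delta> = m (id \<otimes> S) \<Psi> \<Psi>\<^sup>-\<^sup>1 \<Delta>\<close>, and likewise with the factors exchanged.\<close>

lemma op_cop_antipode: "antipode_laws B P Q (op_mult P M) u (cop_comult Q D) c S"
proof (intro antipode_laws.intro op_cop_laws antipode_laws_axioms.intro fS zS)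
  fix a h assume a: "a \<in> B"
  show "cop_comult Q D a (\<lambda>x y. S x (\<lambda>x. op_mult P M x y h)) = c a * u h"
    unfolding cop_comult_def op_mult_def SP1 using a by (simp add: QP SR cong: D_cong)
  show "cop_comult Q D a (\<lambda>x y. S y (\<lambda>y. op_mult P M x y h)) = c a * u h"
    unfolding cop_comult_def op_mult_def SP2 using a by (simp add: QP SL cong: D_cong)
qed

end

section \<open>Transposed structures\<close>


text \<open>Operators \<open>PU\<close>, \<open>MU\<close>, \<open>uU\<close>, \<open>DU\<close> on another index set \<open>A\<close> which are the transposes of \<open>P\<close>, \<open>D\<close>, \<open>c\<close>, \<open>M\<close>
  with respect to a kernel \<open>p\<close>.  The order of the factors is reversed: \<open>f \<otimes> g\<close> is paired with \<open>x \<otimes> y\<close> as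
  \<open>p f y * p g x\<close>.\<close>

locale transposed_laws = braided_laws B P Q M u D c
  for B :: "'i set" and P Q :: "'i \<Rightarrow> 'i \<Rightarrow> ('i \<Rightarrow> 'i \<Rightarrow> 'k::field) \<Rightarrow> 'k"
    and M :: "'i \<Rightarrow> 'i \<Rightarrow> ('i \<Rightarrow> 'k) \<Rightarrow> 'k" and u :: "('i \<Rightarrow> 'k) \<Rightarrow> 'k"
    and D :: "'i \<Rightarrow> ('i \<Rightarrow> 'i \<Rightarrow> 'k) \<Rightarrow> 'k" and c :: "'i \<Rightarrow> 'k" +
  fixes A :: "'u set" and p :: "'u \<Rightarrow> 'i \<Rightarrow> 'k"
    and PU :: "'u \<Rightarrow> 'u \<Rightarrow> ('u \<Rightarrow> 'u \<Rightarrow> 'k) \<Rightarrow> 'k"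
    and MU :: "'u \<Rightarrow> 'u \<Rightarrow> ('u \<Rightarrow> 'k) \<Rightarrow> 'k" and uU :: "('u \<Rightarrow> 'k) \<Rightarrow> 'k"
    and DU :: "'u \<Rightarrow> ('u \<Rightarrow> 'u \<Rightarrow> 'k) \<Rightarrow> 'k"
  assumes fPU: "fin_comb2 A A (PU f g)" and fMU: "fin_comb A (MU f g)"
    and fuU: "fin_comb A uU" and fDU: "fin_comb2 A A (DU f)"
    and pB: "x \<notin> B \<Longrightarrow> p f x = 0"
    and PU: "PU f g (\<lambda>g f. p g y * p f x) = P x y (\<lambda>y x. p f x * p g y)"
    and MU: "MU f g (\<lambda>h. p h x) = D x (\<lambda>x y. p f y * p g x)"
    and DU: "DU f (\<lambda>g h. p g y * p h x) = M x y (\<lambda>z. p f z)"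
    and uU: "x \<in> B \<Longrightarrow> uU (\<lambda>f. p f x) = c x"
begin

definition cU where "cU f = u (\<lambda>x. p f x)"

lemma U_consts:
  "PU f g (\<lambda>x y. z * k x y) = z * PU f g k" "PU f g (\<lambda>x y. k x y * z) = PU f g k * z"
  "DU f (\<lambda>x y. z * k x y) = z * DU f k" "DU f (\<lambda>x y. k x y * z) = DU f k * z"
  "MU f g (\<lambda>x. z * h x) = z * MU f g h" "MU f g (\<lambda>x. h x * z) = MU f g h * z"
  "uU (\<lambda>x. z * h x) = z * uU h" "uU (\<lambda>x. h x * z) = uU h * z"
  using fin_comb2_scale[OF fPU, of f g z k] fin_comb2_scale[OF fDU, of f z k]
    fin_comb_scale[OF fMU, of f g z h] fin_comb_scale[OF fuU, of z h]
  by (simp_all add: mult.commute)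

lemma fin_comb2_Fubini12:
  assumes "fin_comb I \<phi>" "fin_comb2 I' J' \<psi>"
  shows "\<phi> (\<lambda>i. \<psi> (\<lambda>i' j'. k i i' j')) = \<psi> (\<lambda>i' j'. \<phi> (\<lambda>i. k i i' j'))"
  by (rule fin_comb2_Fubini21[OF assms(2,1), symmetric])

lemmas push_in =
  fin_comb2_Fubini22[OF fPU fP] fin_comb2_Fubini22[OF fPU fQ] fin_comb2_Fubini22[OF fPU fD] fin_comb2_Fubini21[OF fPU fM] fin_comb2_Fubini21[OF fPU fu]
  fin_comb2_Fubini22[OF fDU fP] fin_comb2_Fubini22[OF fDU fQ] fin_comb2_Fubini22[OF fDU fD] fin_comb2_Fubini21[OF fDU fM] fin_comb2_Fubini21[OF fDU fu]
  fin_comb2_Fubini12[OF fMU fP] fin_comb2_Fubini12[OF fMU fQ] fin_comb2_Fubini12[OF fMU fD] fin_comb_Fubini[OF fMU fM] fin_comb_Fubini[OF fMU fu]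
  fin_comb2_Fubini12[OF fuU fP] fin_comb2_Fubini12[OF fuU fQ] fin_comb2_Fubini12[OF fuU fD] fin_comb_Fubini[OF fuU fM] fin_comb_Fubini[OF fuU fu]

text \<open>Variants of the transposition rules for simplification, for all positions of a constant
  factor in a product of three.\<close>

lemma PU_forms:
  "PU f g (\<lambda>g f. p g y * p f x) = P x y (\<lambda>y x. p f x * p g y)"
  "PU f g (\<lambda>g f. p f x * p g y) = P x y (\<lambda>y x. p f x * p g y)"
  "PU f g (\<lambda>g f. p g y * (z * p f x)) = P x y (\<lambda>y x. z * (p f x * p g y))"
  "PU f g (\<lambda>g f. p f x * (z * p g y)) = P x y (\<lambda>y x. z * (p f x * p g y))"
  "PU f g (\<lambda>g f. p g y * (p f x * z)) = P x y (\<lambda>y x. z * (p f x * p g y))"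
  "PU f g (\<lambda>g f. p f x * (p g y * z)) = P x y (\<lambda>y x. z * (p f x * p g y))"
  using arg_cong[OF PU[of f g y x], of "\<lambda>r. z * r"]
  unfolding U_consts(1)[symmetric] scale_in by (simp_all only: PU mult.commute mult.left_commute)

lemma DU_forms:
  "DU f (\<lambda>g h. p g y * p h x) = M x y (\<lambda>z. p f z)"
  "DU f (\<lambda>g h. p h x * p g y) = M x y (\<lambda>z. p f z)"
  "DU f (\<lambda>g h. p g y * (z * p h x)) = M x y (\<lambda>w. z * p f w)"
  "DU f (\<lambda>g h. p h x * (z * p g y)) = M x y (\<lambda>w. z * p f w)"
  "DU f (\<lambda>g h. p g y * (p h x * z)) = M x y (\<lambda>w. z * p f w)"
  "DU f (\<lambda>g h. p h x * (p g y * z)) = M x y (\<lambda>w. z * p f w)"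
  using arg_cong[OF DU[of f y x], of "\<lambda>r. z * r"]
  unfolding U_consts(3)[symmetric] scale_in by (simp_all only: DU mult.commute mult.left_commute)

text \<open>With these rules simplification moves the operators of \<open>H\<close> outwards and those of \<open>U\<close> inwards until
  the latter meet their kernels and are replaced by their transposes.  What is left of a law for \<open>U\<close> is
  a law for \<open>H\<close>.\<close>

lemmas transpose_rules = U_consts push_in PU_forms DU_forms MU scale_in cU_def mult.assoc

lemma U_braid:
  "PU f g (\<lambda>g f. PU f h (\<lambda>h f. PU g h (\<lambda>h g. p h z * (p g y * p f x)))) =
   PU g h (\<lambda>h g. PU f h (\<lambda>h f. PU f g (\<lambda>g f. p h z * (p g y * p f x))))"
  by (simp only: transpose_rules) (simp only: YB mult_ac)

lemma U_mult1:
  "MU f g (\<lambda>q. PU q h (\<lambda>h q. p h y * p q x)) = PU g h (\<lambda>h g. PU f h (\<lambda>h f. MU f g (\<lambda>q. p h y * p q x)))"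
  by (simp only: transpose_rules) (simp only: PD1 PD2 mult_ac)

lemma U_unit1: "uU (\<lambda>q. PU q h (\<lambda>h q. p h y * p q x)) = uU (\<lambda>q. p h y * p q x)"
proof (cases "x \<in> B \<and> y \<in> B")
  case True
  have "uU (\<lambda>q. PU q h (\<lambda>h q. p h y * p q x)) = P x y (\<lambda>y x. uU (\<lambda>q. p q x) * p h y)"
    by (simp only: transpose_rules)
  also have "\<dots> = P x y (\<lambda>y x. c x * p h y)"
    by (intro P_cong) (simp add: uU)
  also have "\<dots> = p h y * c x" using True by (simp add: Pc1)
  finally show ?thesis using True by (simp add: U_consts uU)
next
  case False
  have "uU (\<lambda>q. PU q h (\<lambda>h q. p h y * p q x)) = P x y (\<lambda>y x. uU (\<lambda>q. p q x) * p h y)"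
    by (simp only: transpose_rules)
  thus ?thesis using False fin_comb_zero[OF fuU] by (auto simp: pB)
qed

lemma U_comult1:
  "PU f g (\<lambda>g f. DU f (\<lambda>d e. p g z * (p d y * p e x))) =
   DU f (\<lambda>d e. PU e g (\<lambda>g e. PU d g (\<lambda>g d. p g z * (p d y * p e x))))"
  by (simp only: transpose_rules) (simp only: PM1 PM2 mult_ac)

lemma U_counit1: "PU f g (\<lambda>g f. cU f * p g x) = cU f * p g x"
proof (cases "x \<in> B")
  case True
  thus ?thesis by (simp only: transpose_rules Pu1)
next
  case False
  thus ?thesis using fin_comb2_zero[OF fPU] by (simp add: pB)
qed

lemma U_assoc: "MU f g (\<lambda>x. MU x h (\<lambda>q. p q z)) = MU g h (\<lambda>x. MU f x (\<lambda>q. p q z))"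
  by (simp only: transpose_rules) (simp only: DD mult_ac)

lemma U_assoc_unit1: "uU (\<lambda>x. MU x f (\<lambda>q. p q z)) = p f z"
proof (cases "z \<in> B")
  case True
  have "uU (\<lambda>x. MU x f (\<lambda>q. p q z)) = D z (\<lambda>x y. uU (\<lambda>q. p q y) * p f x)"
    by (simp only: transpose_rules)
  also have "\<dots> = D z (\<lambda>x y. c y * p f x)"
    by (intro D_cong) (simp add: uU)
  finally show ?thesis using True by (simp add: cD2)
next
  case False
  thus ?thesis by (simp add: pB fin_comb_zero[OF fMU] fin_comb_zero[OF fuU])
qed

lemma U_coassoc:
  "DU f (\<lambda>d e. DU d (\<lambda>a b. p a z * (p b y * p e x))) = DU f (\<lambda>d e. DU e (\<lambda>a b. p d z * (p a y * p b x)))"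
  by (simp only: transpose_rules) (simp only: MM mult_ac)

lemma U_coassoc_counit1: "DU f (\<lambda>d e. cU d * p e z) = p f z"
proof (cases "z \<in> B")
  case True
  thus ?thesis by (simp only: transpose_rules uM2)
next
  case False
  thus ?thesis using fin_comb2_zero[OF fDU] by (simp add: pB)
qed

text \<open>The law is its own transpose.  With four kernels in one product, the order of evaluation is
  prescribed by hand.\<close>

lemma U_comult_mult:
  assumes "comult_mult_law P M D"
  shows "MU f g (\<lambda>q. DU q (\<lambda>d e. p d y * p e x)) =
   DU f (\<lambda>f f'. DU g (\<lambda>g g'. PU f' g (\<lambda>g f'. MU f g (\<lambda>q. MU f' g' (\<lambda>r. p q y * p r x)))))"
proof -
  have 1: "MU f g (\<lambda>q. MU f' g' (\<lambda>r. p q y * p r x)) =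
      D x (\<lambda>x x'. D y (\<lambda>y y'. p f y' * (p g y * (p f' x' * p g' x))))" for f f' g g'
    by (simp only: transpose_rules)
  have 2: "PU f' g (\<lambda>g f'. p f y' * (p g y * (p f' x' * p g' x))) =
      P x' y (\<lambda>y x'. p f' x' * (p f y' * (p g y * p g' x)))" for f f' g g' x x' y y'
    using arg_cong[OF PU[of f' g y x'], of "\<lambda>r. p f y' * p g' x * r"]
    unfolding U_consts(1)[symmetric] scale_in by (simp only: mult_ac)
  have 3: "DU g (\<lambda>g g'. p f' x' * (p f y' * (p g y * p g' x))) = M x y (\<lambda>v. p f' x' * (p f y' * p g v))"
    for f f' g x x' y y'
    by (simp only: transpose_rules)
  have "DU f (\<lambda>f f'. DU g (\<lambda>g g'. PU f' g (\<lambda>g f'. MU f g (\<lambda>q. MU f' g' (\<lambda>r. p q y * p r x))))) =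
     D x (\<lambda>x x'. D y (\<lambda>y y'. P x' y (\<lambda>y x'. M x y (\<lambda>v. M x' y' (\<lambda>w. p f w * p g v)))))"
    unfolding 1 by (simp only: push_in 2 3) (simp only: transpose_rules mult.commute)
  also have "\<dots> = M x y (\<lambda>z. D z (\<lambda>v w. p f w * p g v))"
    using assms by (simp only: comult_mult_law_def)
  finally show ?thesis by (simp only: transpose_rules)
qed

end

text \<open>Transposition reverses the order of factors and therefore commutes with the reversal of all tensor
  products.  Through this the laws with number 2 follow from those with number 1.\<close>

lemma (in transposed_laws) flip_transposed:
  "transposed_laws B (\<lambda>a b k. P b a (\<lambda>x y. k y x)) (\<lambda>a b k. Q b a (\<lambda>x y. k y x))
    (\<lambda>a b. M b a) u (\<lambda>a k. D a (\<lambda>x y. k y x)) c A p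
    (\<lambda>f g k. PU g f (\<lambda>x y. k y x)) (\<lambda>f g. MU g f) uU (\<lambda>f k. DU f (\<lambda>x y. k y x))"
  by (intro transposed_laws.intro flip_laws transposed_laws_axioms.intro fin_comb2_flip[OF fPU] fin_comb2_flip[OF fDU]
      fMU fuU pB uU) (assumption | simp only: PU_forms MU DU_forms mult.commute)+

context transposed_laws
begin

interpretation flip: transposed_laws B "\<lambda>a b k. P b a (\<lambda>x y. k y x)" "\<lambda>a b k. Q b a (\<lambda>x y. k y x)"
    "\<lambda>a b. M b a" u "\<lambda>a k. D a (\<lambda>x y. k y x)" c A p
    "\<lambda>f g k. PU g f (\<lambda>x y. k y x)" "\<lambda>f g. MU g f" uU "\<lambda>f k. DU f (\<lambda>x y. k y x)"
  by (rule flip_transposed)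

lemma U_mult2:
  "MU g h (\<lambda>q. PU f q (\<lambda>q f. p q y * p f x)) = PU f g (\<lambda>g f. PU f h (\<lambda>h f. MU g h (\<lambda>q. p q y * p f x)))"
  using flip.U_mult1[where f=h and g=g and h=f and x=y and y=x] by (simp only: mult.commute)

lemma U_unit2: "uU (\<lambda>q. PU h q (\<lambda>q h. p q x * p h y)) = uU (\<lambda>q. p q x * p h y)"
  using flip.U_unit1[where h=h and x=x and y=y] by (simp only: mult.commute)

lemma U_comult2:
  "PU f g (\<lambda>g f. DU g (\<lambda>d e. p d z * (p e y * p f x))) =
   DU g (\<lambda>d e. PU f d (\<lambda>d f. PU f e (\<lambda>e f. p d z * (p e y * p f x))))"
  using flip.U_comult1[where f=g and g=f and x=z and y=y and z=x] by (simp only: mult_ac)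

lemma U_counit2: "PU f g (\<lambda>g f. cU g * p f x) = cU g * p f x"
  using flip.U_counit1[where f=g and g=f and x=x] by (simp only: flip.cU_def cU_def)

lemma U_assoc_unit2: "uU (\<lambda>x. MU f x (\<lambda>q. p q z)) = p f z"
  by (rule flip.U_assoc_unit1)

lemma U_coassoc_counit2: "DU f (\<lambda>d e. cU e * p d z) = p f z"
  using flip.U_coassoc_counit1[where f=f and z=z] by (simp only: flip.cU_def cU_def)

end

locale transposed_antipode = transposed_laws + antipode_laws +
  fixes SU :: "'c \<Rightarrow> ('c \<Rightarrow> 'b) \<Rightarrow> 'b"
  assumes fSU: "fin_comb A (SU f)"
    and SU: "SU f (\<lambda>g. p g x) = S x (\<lambda>x. p f x)"
begin

lemma U_antipode1: 
  assumes "z \<in> B" shows "DU f (\<lambda>d e. SU d (\<lambda>d. MU d e (\<lambda>q. p q z))) = cU f * uU (\<lambda>q. p q z)"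
proof -
  have "DU f (\<lambda>d e. SU d (\<lambda>d. MU d e (\<lambda>q. p q z))) = D z (\<lambda>x y. DU f (\<lambda>d e. SU d (\<lambda>d. p d y) * p e x))"
    by (simp only: MU fin_comb2_Fubini12[OF fSU fD] fin_comb2_Fubini22[OF fDU fD] fin_comb_scale[OF fSU] mult.commute)
  also have "\<dots> = D z (\<lambda>x y. S y (\<lambda>y. DU f (\<lambda>d e. p d y * p e x)))"
    unfolding SU by (simp only: fin_comb2_Fubini21[OF fDU fS] fin_comb_scale[OF fS, symmetric] mult.commute)
  also have "\<dots> = D z (\<lambda>x y. S y (\<lambda>y. M x y (\<lambda>w. p f w)))"
    by (simp only: DU)
  finally show ?thesis using assms by (simp add: SR uU cU_def)
qed

lemma U_antipode2: 
  assumes "z \<in> B" shows "DU f (\<lambda>d e. SU e (\<lambda>e. MU d e (\<lambda>q. p q z))) = cU f * uU (\<lambda>q. p q z)"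
proof -
  have "DU f (\<lambda>d e. SU e (\<lambda>e. MU d e (\<lambda>q. p q z))) = D z (\<lambda>x y. DU f (\<lambda>d e. p d y * SU e (\<lambda>e. p e x)))"
    by (simp only: MU fin_comb2_Fubini12[OF fSU fD] fin_comb2_Fubini22[OF fDU fD] fin_comb_scale[OF fSU])
  also have "\<dots> = D z (\<lambda>x y. S x (\<lambda>x. DU f (\<lambda>d e. p d y * p e x)))"
    unfolding SU by (simp only: fin_comb2_Fubini21[OF fDU fS] fin_comb_scale[OF fS, symmetric])
  also have "\<dots> = D z (\<lambda>x y. S x (\<lambda>x. M x y (\<lambda>w. p f w)))"
    by (simp only: DU)
  finally show ?thesis using assms by (simp add: SL uU cU_def)
qed

end

section \<open>Mixed braidings\<close>

text \<open>\<open>Y\<close> is the mixed braiding \<open>\<Upsilon> : U \<otimes> H \<rightarrow> H \<otimes> U\<close>.  Its law evaluates the second component at \<open>y\<close>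
  while the first is tested by an arbitrary function \<open>k\<close>; the crossing of \<open>f\<close> and \<open>x\<close> becomes an inverse
  crossing of \<open>x\<close> and \<open>y\<close>.\<close>

locale rotated_laws = braided_laws B P Q M u D c
  for B :: "'i set" and P Q :: "'i \<Rightarrow> 'i \<Rightarrow> ('i \<Rightarrow> 'i \<Rightarrow> 'k::field) \<Rightarrow> 'k"
    and M :: "'i \<Rightarrow> 'i \<Rightarrow> ('i \<Rightarrow> 'k) \<Rightarrow> 'k" and u :: "('i \<Rightarrow> 'k) \<Rightarrow> 'k"
    and D :: "'i \<Rightarrow> ('i \<Rightarrow> 'i \<Rightarrow> 'k) \<Rightarrow> 'k" and c :: "'i \<Rightarrow> 'k" +
  fixes A :: "'u set" and p :: "'u \<Rightarrow> 'i \<Rightarrow> 'k"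
    and Y :: "'u \<Rightarrow> 'i \<Rightarrow> ('i \<Rightarrow> 'u \<Rightarrow> 'k) \<Rightarrow> 'k"
  assumes fY: "fin_comb2 B A (Y f x)"
    and pB: "x \<notin> B \<Longrightarrow> p f x = 0"
    and Y: "Y f x (\<lambda>x f. k x * p f y) = Q x y (\<lambda>y x. k x * p f y)"
begin

lemma Y_cong: "(\<And>x f. x \<in> B \<Longrightarrow> f \<in> A \<Longrightarrow> k x f = k' x f) \<Longrightarrow> Y f a k = Y f a k'"
  by (rule fin_comb2_cong[OF fY])

lemma Y_scale: "Y f x (\<lambda>x f. z * k x f) = z * Y f x k" "Y f x (\<lambda>x f. k x f * z) = Y f x k * z"
  using fin_comb2_scale[OF fY, of f x z k] by (simp_all add: mult.commute)

text \<open>Mixed braid equations.  Inserting \<open>Q\<close> and \<open>P\<close> at the end of one side makes the braid equation for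
  \<open>Q\<close> applicable.\<close>

lemma QP_braid1:
  "Q a x (\<lambda>x a. Q a y (\<lambda>y a. P x y (\<lambda>y x. t y x a))) = P x y (\<lambda>y x. Q a y (\<lambda>y a. Q a x (\<lambda>x a. t y x a)))"
proof (cases "a \<in> B \<and> x \<in> B \<and> y \<in> B")
  case True
  have "P x y (\<lambda>y x. Q a y (\<lambda>y a. Q a x (\<lambda>x a. t y x a))) =
      P x y (\<lambda>y x. Q a y (\<lambda>y a. Q a x (\<lambda>x a. Q y x (\<lambda>x y. P x y (\<lambda>y x. t y x a)))))"
    by (simp add: QP cong: congs)
  also have "\<dots> = P x y (\<lambda>y x. Q y x (\<lambda>x y. Q a x (\<lambda>x a. Q a y (\<lambda>y a. P x y (\<lambda>y x. t y x a)))))"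
    by (intro P_cong QYB)
  finally show ?thesis using True by (simp add: PQ)
qed auto

lemma QP_braid2:
  "Q d z (\<lambda>z d. Q b z (\<lambda>z b. P b d (\<lambda>d b. t d b z))) = P b d (\<lambda>d b. Q b z (\<lambda>z b. Q d z (\<lambda>z d. t d b z)))"
proof (cases "b \<in> B \<and> d \<in> B \<and> z \<in> B")
  case True
  have "P b d (\<lambda>d b. Q b z (\<lambda>z b. Q d z (\<lambda>z d. t d b z))) =
      P b d (\<lambda>d b. Q b z (\<lambda>z b. Q d z (\<lambda>z d. Q d b (\<lambda>b d. P b d (\<lambda>d b. t d b z)))))"
    by (simp add: QP cong: congs)
  also have "\<dots> = P b d (\<lambda>d b. Q d b (\<lambda>b d. Q d z (\<lambda>z d. Q b z (\<lambda>z b. P b d (\<lambda>d b. t d b z)))))"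
    by (intro P_cong QYB[symmetric])
  finally show ?thesis using True by (simp add: PQ)
qed auto

lemmas Y_push = fin_comb2_Fubini22[OF fY fP] fin_comb2_Fubini22[OF fY fQ] fin_comb2_Fubini22[OF fY fD] fin_comb2_Fubini21[OF fY fM]
  fin_comb2_Fubini21[OF fY fu]

lemmas Y_eval = mult.assoc[symmetric] Y_scale Y

text \<open>The laws that involve only the mixed braiding and \<open>H\<close>.  Both sides are evaluated by the law \<open>Y\<close>, in
  which the product in front of \<open>p f y\<close> has to be independent of \<open>f\<close> but may contain further operators
  applied to \<open>x\<close>; hence the explicit bracketing of integrands.\<close>

lemma Y_right_braid:
  "Y f b (\<lambda>b f. Y f d (\<lambda>d f. P b d (\<lambda>d b. k d * (l b * p f z)))) =
   P b d (\<lambda>d b. Y f d (\<lambda>d f. Y f b (\<lambda>b f. k d * (l b * p f z))))" (is "?L = ?R")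
proof -
  have "?L = Y f b (\<lambda>b f. Y f d (\<lambda>d f. P b d (\<lambda>d b. k d * l b) * p f z))"
    by (simp only: scale_in mult.assoc)
  also have "\<dots> = Y f b (\<lambda>b f. Q d z (\<lambda>z d. P b d (\<lambda>d b. k d * l b) * p f z))"
    by (simp only: Y)
  also have "\<dots> = Q d z (\<lambda>z d. Q b z (\<lambda>z b. P b d (\<lambda>d b. k d * l b) * p f z))"
    by (simp only: Y_push Y)
  finally have L: "?L = Q d z (\<lambda>z d. Q b z (\<lambda>z b. P b d (\<lambda>d b. k d * l b * p f z)))"
    by (simp only: scale_in)
  have "?R = P b d (\<lambda>d b. Y f d (\<lambda>d f. Q b z (\<lambda>z b. k d * l b * p f z)))"
    by (simp only: Y mult.assoc[symmetric])
  also have "\<dots> = P b d (\<lambda>d b. Q b z (\<lambda>z b. Q d z (\<lambda>z d. k d * l b * p f z)))"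
    by (simp only: Y_push Y)
  finally show ?thesis unfolding L QP_braid2 by simp
qed

lemma Y_mult2:
  "M b d (\<lambda>x. Y f x (\<lambda>x f. k x * p f z)) = Y f b (\<lambda>b f. Y f d (\<lambda>d f. M b d (\<lambda>x. k x * p f z)))" (is "?L = ?R")
proof -
  have "?R = Y f b (\<lambda>b f. Q d z (\<lambda>z d. M b d k * p f z))"
    unfolding scale_in(8)[symmetric] Y ..
  also have "\<dots> = Q d z (\<lambda>z d. Q b z (\<lambda>z b. M b d k * p f z))"
    by (simp only: Y_push Y)
  also have "\<dots> = M b d (\<lambda>x. Q x z (\<lambda>z x. k x * p f z))"
    unfolding QM1 scale_in(8) ..
  finally show ?thesis unfolding Y by simp
qed

lemma Y_unit2:
  assumes "z \<in> B"
  shows "u (\<lambda>x. Y f x (\<lambda>x f. k x * p f z)) = u (\<lambda>x. k x * p f z)"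
  unfolding Y by (rule Qu1[OF assms])

lemma Y_comult2:
  "Y f b (\<lambda>b f. D b (\<lambda>x y. k x * (l y * p f z))) = D b (\<lambda>x y. Y f x (\<lambda>x f. Y f y (\<lambda>y f. k x * (l y * p f z))))"
  (is "?L = ?R")
proof -
  have "?L = Y f b (\<lambda>b f. D b (\<lambda>x y. k x * l y) * p f z)"
    by (simp only: scale_in mult.assoc)
  also have "\<dots> = Q b z (\<lambda>z b. D b (\<lambda>x y. k x * l y) * p f z)"
    by (simp only: Y)
  also have "\<dots> = Q b z (\<lambda>z b. D b (\<lambda>x y. k x * l y * p f z))"
    by (simp only: scale_in)
  also have "\<dots> = D b (\<lambda>x y. Q y z (\<lambda>z y. Q x z (\<lambda>z x. k x * l y * p f z)))"
    by (rule QD1)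
  also have "\<dots> = D b (\<lambda>x y. Q y z (\<lambda>z y. Y f x (\<lambda>x f. k x * l y * p f z)))"
    by (simp only: Y)
  also have "\<dots> = D b (\<lambda>x y. Y f x (\<lambda>x f. Q y z (\<lambda>z y. k x * l y * p f z)))"
    by (simp only: Y_push)
  also have "\<dots> = ?R"
    by (simp only: Y mult.assoc[symmetric])
  finally show ?thesis .
qed

lemma Y_counit2:
  assumes "b \<in> B" "z \<in> B"
  shows "Y f b (\<lambda>b f. c b * p f z) = c b * p f z"
  unfolding Y by (rule Qc1[OF assms])

end

text \<open>The laws that involve the structure of \<open>U\<close>.  The transposes here are those of the opposite and
  coopposite structure, to which \<open>P\<close>, \<open>M\<close>, \<open>D\<close> refer.\<close>

locale rotated_transposed_laws = transposed_laws + rotated_laws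
begin

lemma Y_left_braid:
  "PU f g (\<lambda>g f. Y f a (\<lambda>a f. Y g a (\<lambda>a g. k a * (p g y * p f x)))) =
   Y g a (\<lambda>a g. Y f a (\<lambda>a f. PU f g (\<lambda>g f. k a * (p g y * p f x))))" (is "?L = ?R")
proof -
  have "?L = PU f g (\<lambda>g f. Q a x (\<lambda>x a. Q a y (\<lambda>y a. k a * p g y) * p f x))"
    by (simp only: Y_eval)
  also have "\<dots> = Q a x (\<lambda>x a. Q a y (\<lambda>y a. P x y (\<lambda>y x. k a * (p f x * p g y))))"
    by (simp only: transpose_rules)
  finally have L: "?L = \<dots>" .
  have "?R = P x y (\<lambda>y x. Y g a (\<lambda>a g. Y f a (\<lambda>a f. k a * p f x * p g y)))"
    by (simp only: U_consts PU_forms scale_in Y_push mult.assoc)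
  also have "\<dots> = P x y (\<lambda>y x. Q a y (\<lambda>y a. Q a x (\<lambda>x a. k a * p f x) * p g y))"
    by (simp only: Y_eval)
  finally show ?thesis unfolding L QP_braid1 by (simp only: scale_in mult.assoc)
qed

lemma Y_mult1:
  "MU f g (\<lambda>q. Y q a (\<lambda>a q. k a * p q y)) = Y g a (\<lambda>a g. Y f a (\<lambda>a f. MU f g (\<lambda>q. k a * p q y)))"
  (is "?L = ?R")
proof -
  have "?L = Q a y (\<lambda>y a. D y (\<lambda>r s. k a * (p f s * p g r)))"
    unfolding Y by (simp only: transpose_rules)
  also have "\<dots> = D y (\<lambda>r s. Q a r (\<lambda>r a. Q a s (\<lambda>s a. k a * (p f s * p g r))))"
    by (rule QD2)
  also have "\<dots> = D y (\<lambda>r s. Q a r (\<lambda>r a. Q a s (\<lambda>s a. k a * p f s) * p g r))"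
    by (simp only: scale_in mult.assoc)
  also have "\<dots> = D y (\<lambda>r s. Y g a (\<lambda>a g. Y f a (\<lambda>a f. k a * p f s * p g r)))"
    by (simp only: Y_eval)
  also have "\<dots> = ?R"
    by (simp only: U_consts MU scale_in Y_push mult.assoc)
  finally show ?thesis .
qed

lemma Y_unit1:
  assumes "a \<in> B" "y \<in> B"
  shows "uU (\<lambda>q. Y q a (\<lambda>a q. k a * p q y)) = uU (\<lambda>q. k a * p q y)"
proof -
  have "uU (\<lambda>q. Y q a (\<lambda>a q. k a * p q y)) = Q a y (\<lambda>y a. k a * uU (\<lambda>q. p q y))"
    unfolding Y by (simp only: push_in U_consts)
  also have "\<dots> = Q a y (\<lambda>y a. c y * k a)"
    by (intro Q_cong) (simp add: uU)
  finally show ?thesis using assms by (simp add: Qc2 U_consts uU)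
qed

lemma Y_comult1:
  "Y f a (\<lambda>a f. DU f (\<lambda>d e. k a * (p d y * p e x))) =
   DU f (\<lambda>d e. Y e a (\<lambda>a e. Y d a (\<lambda>a d. k a * (p d y * p e x))))" (is "?L = ?R")
proof -
  have "?R = DU f (\<lambda>d e. Q a x (\<lambda>x a. Q a y (\<lambda>y a. k a * p d y) * p e x))"
    by (simp only: Y_eval)
  also have "\<dots> = Q a x (\<lambda>x a. Q a y (\<lambda>y a. M x y (\<lambda>w. k a * p f w)))"
    by (simp only: transpose_rules)
  also have "\<dots> = M x y (\<lambda>w. Q a w (\<lambda>w a. k a * p f w))"
    by (rule QM2[symmetric])
  also have "\<dots> = M x y (\<lambda>w. Y f a (\<lambda>a f. k a * p f w))"
    by (simp only: Y)
  also have "\<dots> = ?L"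
    by (simp only: U_consts DU_forms scale_in Y_push)
  finally show ?thesis by simp
qed

lemma Y_counit1:
  assumes "a \<in> B"
  shows "Y f a (\<lambda>a f. cU f * h a) = cU f * h a"
proof -
  have "Y f a (\<lambda>a f. cU f * h a) = u (\<lambda>x. Y f a (\<lambda>a f. h a * p f x))"
    unfolding cU_def by (simp only: scale_in Y_push mult.commute)
  also have "\<dots> = u (\<lambda>x. h a * p f x)"
    unfolding Y by (rule Qu2[OF assms])
  finally show ?thesis unfolding cU_def by (simp only: scale_in mult.commute)
qed

end

section \<open>A braided bialgebra and a subspace of its dual\<close>


lemma tens_eval:
  assumes v: "vspace V" "vspace W" and t: "t \<in> vset (V \<otimes> W)" and b: "\<beta> \<in> bil V W"
  shows "t \<beta> = (crd V \<otimes>\<^sub>c crd W) t (\<lambda>(i, j). \<beta> i j)"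
  unfolding coordsD(6)[OF coords_bas2[OF v] lin_eval_form t, of \<beta>]
  by (rule fin_comb_cong[OF fin_comb_bas2[OF v t]]) (use b in \<open>auto simp: tensor_basis_def pure_def\<close>)

lemma lin_inverse:
  assumes "vspace V" "bij_lin V W f"
  shows "lin W V (inv_into (vset V) f)"
proof -
  have l: "lin V W f" and bij: "bij_betw f (vset V) (vset W)" using assms(2) by (auto simp: bij_lin_def)
  have inj: "inj_on f (vset V)" and im: "f ` vset V = vset W" using bij by (auto simp: bij_betw_def)
  have inI: "inv_into (vset V) f y = x" if "x \<in> vset V" "f x = y" for x y
    using inv_into_f_f[OF inj that(1)] that(2) by simp
  have ob: "\<exists>x\<in>vset V. f x = y \<and> inv_into (vset V) f y = x" if "y \<in> vset W" for y
    using that im inI by (metis imageE)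
  show ?thesis unfolding lin_def
  proof (intro conjI ballI allI)
    fix y c assume y: "y \<in> vset W"
    obtain x where x: "x \<in> vset V" "f x = y" "inv_into (vset V) f y = x" using ob[OF y] by blast
    show "inv_into (vset V) f y \<in> vset V" using x by simp
    show "inv_into (vset V) f (vscale W c y) = vscale V c (inv_into (vset V) f y)"
      by (rule inI) (use x vspace_closed(2)[OF assms(1)] linD(3)[OF l] in auto)
    fix z assume z: "z \<in> vset W"
    obtain w where w: "w \<in> vset V" "f w = z" "inv_into (vset V) f z = w" using ob[OF z] by blast
    show "inv_into (vset V) f (y + z) = inv_into (vset V) f y + inv_into (vset V) f z"
      by (rule inI) (use x w vspace_closed(1)[OF assms(1)] linD(2)[OF l] in auto)
  qed
qed

text \<open>A bijection onto the image of an embedding \<open>emb\<close>, followed by the inverse of \<open>emb\<close>: the form in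
  which the braidings of \<open>U\<close> are given.\<close>

lemma bij_via_embedding:
  fixes emb :: "'w::ab_group_add \<Rightarrow> 'z \<Rightarrow> 'k::field"
  assumes V: "vspace V" and W: "vspace W" and inj: "inj_on emb (vset W)"
    and emb: "\<And>x y. emb (x + y) = emb x + emb y" "\<And>c x. emb (vscale W c x) = fscale c (emb x)"
    and \<Phi>: "\<And>x y. x \<in> vset V \<Longrightarrow> y \<in> vset V \<Longrightarrow> \<Phi> (x + y) = \<Phi> x + \<Phi> y"
      "\<And>c x. x \<in> vset V \<Longrightarrow> \<Phi> (vscale V c x) = fscale c (\<Phi> x)"
    and bij: "bij_betw \<Phi> (vset V) (emb ` vset W)"
  shows "bij_lin V W (\<lambda>t. inv_into (vset W) emb (\<Phi> t))"
    "t \<in> vset V \<Longrightarrow> emb (inv_into (vset W) emb (\<Phi> t)) = \<Phi> t"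
proof -
  let ?f = "\<lambda>t. inv_into (vset W) emb (\<Phi> t)"
  have im: "\<Phi> t \<in> emb ` vset W" if "t \<in> vset V" for t using bij that by (auto simp: bij_betw_def)
  have in': "?f t \<in> vset W" and eq: "emb (?f t) = \<Phi> t" if "t \<in> vset V" for t
    using inv_into_into[OF im[OF that]] f_inv_into_f[OF im[OF that]] by auto
  show "t \<in> vset V \<Longrightarrow> emb (?f t) = \<Phi> t" by (rule eq)
  have "lin V W ?f" unfolding lin_def
  proof (intro conjI ballI allI)
    fix x c assume x: "x \<in> vset V"
    show "?f x \<in> vset W" by (rule in'[OF x])
    have cx: "vscale V c x \<in> vset V" by (rule vspace_closed(2)[OF V x x])
    show "?f (vscale V c x) = vscale W c (?f x)"
      by (rule inj_onD[OF inj]) (use eq[OF cx] eq[OF x] in'[OF cx] vspace_closed(2)[OF W in'[OF x] in'[OF x]] in \<open>simp_all only: emb \<Phi>(2)[OF x]\<close>)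
    fix y assume y: "y \<in> vset V"
    have xy: "x + y \<in> vset V" by (rule vspace_closed(1)[OF V x y])
    show "?f (x + y) = ?f x + ?f y"
      by (rule inj_onD[OF inj]) (use eq[OF xy] eq[OF x] eq[OF y] in'[OF xy] vspace_closed(1)[OF W in'[OF x] in'[OF y]] in \<open>simp_all only: emb \<Phi>(1)[OF x y]\<close>)
  qed
  moreover have "bij_betw ?f (vset V) (vset W)"
    using bij_betw_trans[OF bij bij_betw_inv_into[OF inj_on_imp_bij_betw[OF inj]]] by (simp add: o_def)
  ultimately show "bij_lin V W ?f" by (simp add: bij_lin_def)
qed

locale dual_setting =
  fixes H :: "('k::field, 'h::ab_group_add) vsp" and m e \<Delta> \<epsilon> \<Psi> and U :: "('k, 'h \<Rightarrow> 'k) vsp"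
  assumes bialg: "braided_bialgebra H m e \<Delta> \<epsilon> \<Psi>"
    and U_dual: "subsp U (dual H)"
    and U_subalg: "unital_subalgebra_dual H \<Delta> \<epsilon> \<Psi> U"
    and U_comult: "\<forall>f\<in>vset U. \<exists>t. is_dual_comult H m \<Psi> U f t"
begin

lemma H_alg: "unital_algebra H m e" and H_space: "braided_space H \<Psi>"
  and H_m1: "compat_mult1 H m e H \<Psi>" and H_m2: "compat_mult2 H H m e \<Psi>"
  and H_coalg: "coalgebra H \<Delta> \<epsilon>" and H_d1: "compat_comult1 H \<Delta> \<epsilon> H \<Psi>"
  and H_d2: "compat_comult2 H H \<Delta> \<epsilon> \<Psi>"
  and H_bi: "\<forall>t\<in>vset (H \<otimes> H). \<Delta> (m t) = tmap H H m m (braidM H H H H \<Psi> (tmap (H \<otimes> H) (H \<otimes> H) \<Delta> \<Delta> t))"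
  using bialg unfolding braided_bialgebra_def braided_algebra_def braided_coalgebra_def by blast+

lemma H_vsp: "vspace H" and m_lin: "lin (H \<otimes> H) H m" and e_in_H: "e \<in> vset H"
  and Delta_lin: "lin H (H \<otimes> H) \<Delta>" and eps_lin: "lin H base \<epsilon>"
  and Psi_bij: "bij_lin (H \<otimes> H) (H \<otimes> H) \<Psi>"
  and Psi_YB: "\<forall>t\<in>vset (H \<otimes> H \<otimes> H).
        braidL H H H \<Psi> (braidR H H H \<Psi> (braidL H H H \<Psi> t)) =
        braidR H H H \<Psi> (braidL H H H \<Psi> (braidR H H H \<Psi> t))"
  using H_alg H_coalg H_space unfolding unital_algebra_def coalgebra_def braided_space_def by blast+

lemma Psi_lin: "lin (H \<otimes> H) (H \<otimes> H) \<Psi>" using Psi_bij by (simp add: bij_lin_def)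

lemma Psi_inv_lin: "lin (H \<otimes> H) (H \<otimes> H) (tinv H \<Psi>)"
  unfolding tinv_def by (rule lin_inverse[OF vspace_tensor Psi_bij])

lemma U_vsp: "vspace U"
  using U_dual vspace_dual[of H] by (auto simp: subsp_def vspace_def)

lemma U_scale: "vscale U = fscale" using U_dual by (simp add: subsp_def dual_def)

lemma U_sub: "f \<in> vset U \<Longrightarrow> f \<in> vset (dual H)" using U_dual by (auto simp: subsp_def)

lemma dual_scale: "vscale (dual H) = fscale" by (simp add: dual_def)

lemma dual_lin: "f \<in> vset (dual H) \<Longrightarrow> lin H base f" by (simp add: dual_def)

abbreviation "P \<equiv> braid_op H H \<Psi>"
abbreviation "Q \<equiv> braid_op H H (tinv H \<Psi>)"
abbreviation "M \<equiv> mult_op H m"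
abbreviation "u \<equiv> crd H e"
abbreviation "D \<equiv> comult_op H \<Delta>"
abbreviation "M' \<equiv> op_mult P M"
abbreviation "D' \<equiv> cop_comult Q D"
abbreviation "B \<equiv> bas H"
abbreviation "A \<equiv> bas U"
abbreviation "PU \<equiv> braid_op U U (braid_UU H \<Psi> U)"
abbreviation "MU \<equiv> mult_op U (dual_mult H \<Delta> \<Psi>)"
abbreviation "uU \<equiv> crd U (zext H \<epsilon>)"
abbreviation "DU \<equiv> comult_op U (dual_comult H m \<Psi> U)"

text \<open>The pairing of basis elements.  It is \<open>0\<close> off the bases, as the operators are, so that the laws of
  transposition hold for all indices.\<close>

definition bracket :: "('h \<Rightarrow> 'k) \<Rightarrow> 'h \<Rightarrow> 'k" where
  "bracket f x = (if f \<in> A \<and> x \<in> B then f x else 0)"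

end

lemma fin_comb2_braid_op:
  assumes "vspace V" "vspace W" "lin (V \<otimes> W) (W \<otimes> V) \<Psi>"
  shows "fin_comb2 (bas W) (bas V) (braid_op V W \<Psi> a b)"
proof (cases "a \<in> bas V \<and> b \<in> bas W")
  case True
  have "\<Psi> (pure V W a b) \<in> vset (W \<otimes> V)"
    using True assms by (intro lin_in[OF assms(3)] pure_in_tensor bas_in) auto
  from fin_comb_bas2[OF assms(2,1) this] show ?thesis
    using True by (simp add: fin_comb2_def braid_op_def[abs_def])
qed (auto simp: fin_comb2_def braid_op_def fin_comb.zero)

lemma fin_comb_mult_op:
  assumes "vspace V" "lin (V \<otimes> V) V m"
  shows "fin_comb (bas V) (mult_op V m a b)"
proof (cases "a \<in> bas V \<and> b \<in> bas V")
  case True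
  have "m (pure V V a b) \<in> vset V"
    using True assms by (intro lin_in[OF assms(2)] pure_in_tensor bas_in) auto
  from coordsD(4)[OF coords_bas[OF assms(1)] this] show ?thesis
    using True by (simp add: mult_op_def[abs_def])
qed (auto simp: mult_op_def[abs_def] fin_comb.zero)

lemma fin_comb2_comult_op:
  assumes "vspace V" "lin V (V \<otimes> V) \<Delta>"
  shows "fin_comb2 (bas V) (bas V) (comult_op V \<Delta> a)"
proof (cases "a \<in> bas V")
  case True
  have "\<Delta> a \<in> vset (V \<otimes> V)"
    using True assms by (intro lin_in[OF assms(2)] bas_in) auto
  from fin_comb_bas2[OF assms(1,1) this] show ?thesis
    using True by (simp add: fin_comb2_def comult_op_def[abs_def])
qed (auto simp: fin_comb2_def comult_op_def fin_comb.zero)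

lemma braid_op_inverse:
  assumes v: "vspace V" "vspace W" and l: "lin (V \<otimes> W) (W \<otimes> V) \<Psi>" "lin (W \<otimes> V) (V \<otimes> W) \<Psi>'"
    and inv: "\<And>t. t \<in> vset (V \<otimes> W) \<Longrightarrow> \<Psi>' (\<Psi> t) = t" and ab: "a \<in> bas V" "b \<in> bas W"
  shows "braid_op V W \<Psi> a b (\<lambda>b a. braid_op W V \<Psi>' b a k) = k a b"
proof -
  let ?t = "pure V W a b"
  have t: "?t \<in> vset (V \<otimes> W)" using ab v by (simp add: pure_in_tensor bas_in)
  have "braid_op V W \<Psi> a b (\<lambda>b a. braid_op W V \<Psi>' b a k) = (crd V \<otimes>\<^sub>c crd W) (\<Psi>' (\<Psi> ?t)) (\<lambda>(a, b). k a b)"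
    unfolding braid_crd[OF v(2,1) l(2) lin_in[OF l(1) t]] using ab by (simp add: braid_op_def[of V])
  thus ?thesis unfolding inv[OF t] tensor_coords_pure[OF coords_bas coords_bas, OF v bas_in[OF v(1) ab(1)] bas_in[OF v(2) ab(2)]]
    using ab v by (simp add: crd_bas)
qed

context dual_setting
begin

lemma Psi_inverse: "t \<in> vset (H \<otimes> H) \<Longrightarrow> tinv H \<Psi> (\<Psi> t) = t" "t \<in> vset (H \<otimes> H) \<Longrightarrow> \<Psi> (tinv H \<Psi> t) = t"
  using Psi_bij unfolding bij_lin_def tinv_def
  by (auto simp: bij_betw_inv_into_left bij_betw_inv_into_right)

lemma H_laws: "braided_laws B P Q M u D \<epsilon>"
proof
  note f = fin_comb2_braid_op[OF H_vsp H_vsp Psi_lin] fin_comb2_braid_op[OF H_vsp H_vsp Psi_inv_lin] fin_comb_mult_op[OF H_vsp m_lin]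
    fin_comb2_comult_op[OF H_vsp Delta_lin] coordsD(4)[OF coords_bas[OF H_vsp] e_in_H]
  note z0[simp] = fin_comb2_zero[OF f(1)] fin_comb2_zero[OF f(2)] fin_comb_zero[OF f(3)] fin_comb2_zero[OF f(4)]
  show zP: "P a b k = 0" if "a \<notin> B \<or> b \<notin> B" for a b k using that by (auto simp: braid_op_def)
  show zQ: "Q a b k = 0" if "a \<notin> B \<or> b \<notin> B" for a b k using that by (auto simp: braid_op_def)
  show zM: "M a b k = 0" if "a \<notin> B \<or> b \<notin> B" for a b k using that by (auto simp: mult_op_def)
  show zD: "D a k = 0" if "a \<notin> B" for a k using that by (auto simp: comult_op_def)
  have zs: "a \<notin> B \<Longrightarrow> P a b k = 0" "b \<notin> B \<Longrightarrow> P a b k = 0"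
    "a \<notin> B \<Longrightarrow> M a b h = 0" "b \<notin> B \<Longrightarrow> M a b h = 0" "a \<notin> B \<Longrightarrow> D a k = 0" for a b k h
    by (simp_all add: zP zM zD)
  show "P a b (\<lambda>b a. Q b a k) = k a b" if "a \<in> B" "b \<in> B" for a b k
    by (rule braid_op_inverse[OF H_vsp H_vsp Psi_lin Psi_inv_lin, OF Psi_inverse(1) that])
  show "Q a b (\<lambda>b a. P b a k) = k a b" if "a \<in> B" "b \<in> B" for a b k
    by (rule braid_op_inverse[OF H_vsp H_vsp Psi_inv_lin Psi_lin, OF Psi_inverse(2) that])
  show "P a b (\<lambda>b a. P a d (\<lambda>d a. P b d (\<lambda>d b. t d b a))) =
      P b d (\<lambda>d b. P a d (\<lambda>d a. P a b (\<lambda>b a. t d b a)))" for a b d t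
  proof (cases "a \<in> B \<and> b \<in> B \<and> d \<in> B")
    case True
    show ?thesis by (rule triple_braid_fwd[OF H_vsp H_vsp H_vsp Psi_lin Psi_lin Psi_lin, OF Psi_YB]) (use True in auto)
  next
    case False
    thus ?thesis by (auto simp: zs)
  qed
  show "M a b (\<lambda>x. P x d k) = P b d (\<lambda>d b. P a d (\<lambda>d a. M a b (\<lambda>x. k d x)))" for a b d k
  proof (cases "a \<in> B \<and> b \<in> B \<and> d \<in> B")
    case True
    show ?thesis by (rule compat_mult1_fwd[OF H_vsp H_vsp m_lin e_in_H Psi_lin H_m1]) (use True in auto)
  next
    case False
    thus ?thesis by (auto simp: zs)
  qed
  show "M b d (\<lambda>x. P a x k) = P a b (\<lambda>b a. P a d (\<lambda>d a. M b d (\<lambda>x. k x a)))" for a b d k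
  proof (cases "a \<in> B \<and> b \<in> B \<and> d \<in> B")
    case True
    show ?thesis by (rule compat_mult2_fwd[OF H_vsp H_vsp m_lin e_in_H Psi_lin H_m2]) (use True in auto)
  next
    case False
    thus ?thesis by (auto simp: zs)
  qed
  show "P a b (\<lambda>b a. D a (\<lambda>x y. t b x y)) = D a (\<lambda>x y. P y b (\<lambda>b y. P x b (\<lambda>b x. t b x y)))" for a b t
  proof (cases "a \<in> B \<and> b \<in> B")
    case True
    show ?thesis by (rule compat_comult1_fwd[OF H_vsp H_vsp Delta_lin eps_lin Psi_lin H_d1]) (use True in auto)
  next
    case False
    thus ?thesis by (auto simp: zs)
  qed
  show "P a b (\<lambda>b a. D b (\<lambda>x y. t x y a)) = D b (\<lambda>x y. P a x (\<lambda>x a. P a y (\<lambda>y a. t x y a)))" for a b t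
  proof (cases "a \<in> B \<and> b \<in> B")
    case True
    show ?thesis by (rule compat_comult2_fwd[OF H_vsp H_vsp Delta_lin eps_lin Psi_lin H_d2]) (use True in auto)
  next
    case False
    thus ?thesis by (auto simp: zs)
  qed
  show "M a b (\<lambda>x. M x d h) = M b d (\<lambda>x. M a x h)" for a b d h
  proof (cases "a \<in> B \<and> b \<in> B \<and> d \<in> B")
    case True
    show ?thesis by (rule unital_algebra_fwd[OF H_vsp m_lin e_in_H H_alg]) (use True in auto)
  next
    case False
    thus ?thesis by (auto simp: zs)
  qed
  show "D a (\<lambda>x y. D x (\<lambda>p q. t p q y)) = D a (\<lambda>x y. D y (\<lambda>p q. t x p q))" for a t
  proof (cases "a \<in> B")
    case True
    show ?thesis by (rule coalgebra_fwd[OF H_vsp Delta_lin eps_lin H_coalg]) (use True in auto)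
  next
    case False
    thus ?thesis by (auto simp: zs)
  qed
qed (auto intro: fin_comb2_braid_op[OF H_vsp H_vsp Psi_lin] fin_comb2_braid_op[OF H_vsp H_vsp Psi_inv_lin] fin_comb_mult_op[OF H_vsp m_lin]
    fin_comb2_comult_op[OF H_vsp Delta_lin] coordsD(4)[OF coords_bas[OF H_vsp] e_in_H]
    compat_mult1_unit[OF H_vsp H_vsp m_lin e_in_H Psi_lin H_m1] compat_mult2_unit[OF H_vsp H_vsp m_lin e_in_H Psi_lin H_m2]
    compat_comult1_counit[OF H_vsp H_vsp Delta_lin eps_lin Psi_lin H_d1] compat_comult2_counit[OF H_vsp H_vsp Delta_lin eps_lin Psi_lin H_d2]
    unital_algebra_unit1[OF H_vsp m_lin e_in_H H_alg] unital_algebra_unit2[OF H_vsp m_lin e_in_H H_alg]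
    coalgebra_counit1[OF H_vsp Delta_lin eps_lin H_coalg] coalgebra_counit2[OF H_vsp Delta_lin eps_lin H_coalg])

sublocale L: braided_laws B P Q M u D \<epsilon> by (rule H_laws)

lemma H_comult_mult: "comult_mult_law P M D"
  unfolding comult_mult_law_def
proof (intro allI)
  fix a b k
  show "M a b (\<lambda>x. D x k) = D a (\<lambda>p q. D b (\<lambda>r s. P q r (\<lambda>r q. M p r (\<lambda>x. M q s (\<lambda>y. k x y)))))"
  proof (cases "a \<in> B \<and> b \<in> B")
    case True
    show ?thesis by (rule comult_mult_fwd[OF H_vsp m_lin Delta_lin Psi_lin, OF H_bi]) (use True in auto)
  next
    case False
    thus ?thesis by auto
  qed
qed

sublocale L': braided_laws B P Q M' u D' \<epsilon> by (rule L.op_cop_laws)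

lemma L'_comult_mult: "comult_mult_law P M' D'"
  by (rule L.op_cop_comult_mult[OF H_comult_mult])

end

section \<open>Bilinear families and embeddings into duals\<close>


lemma bil_cong:
  assumes "vspace V" "vspace W" "\<beta> \<in> bil V W"
    and "\<And>v w. v \<in> vset V \<Longrightarrow> w \<in> vset W \<Longrightarrow> \<beta>' v w = \<beta> v w"
  shows "\<beta>' \<in> bil V W"
  using assms(3,4) vspace_closed[OF assms(1)] vspace_closed[OF assms(2)]
  by (auto simp: bil_def lin_base_iff)

lemma tens_cong:
  assumes "s \<in> vset (V \<otimes> W)" "\<beta> \<in> bil V W" "\<beta>' \<in> bil V W"
    and "\<And>v w. v \<in> vset V \<Longrightarrow> w \<in> vset W \<Longrightarrow> \<beta>' v w = \<beta> v w"
  shows "s \<beta>' = s \<beta>"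
  using tensor_form_linear[OF assms(1) assms(3) assms(2) assms(2), of 1 0] assms(4) by simp

text \<open>\<open>\<kappa> x y v w\<close> is linear in each of its four arguments.  Such a form induces a map from \<open>V \<otimes> W\<close> to the
  dual of \<open>X \<otimes> Y\<close>, and the three maps \<open>\<Psi>\<^bsub>UU\<^esub>\<close>, \<open>\<Psi>\<^bsub>UH\<^esub>\<degree>\<close>, \<open>\<Psi>\<^bsub>HU\<^esub>\<degree>\<close> are all of this kind.\<close>

definition bil_family where
  "bil_family X Y V W \<kappa> \<longleftrightarrow> vspace X \<and> vspace Y \<and> vspace V \<and> vspace W \<and>
    (\<forall>x\<in>vset X. \<forall>y\<in>vset Y. \<kappa> x y \<in> bil V W) \<and>
    (\<forall>v\<in>vset V. \<forall>w\<in>vset W. (\<lambda>x y. \<kappa> x y v w) \<in> bil X Y)"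

lemma bil_familyD:
  assumes "bil_family X Y V W \<kappa>"
  shows "vspace X" "vspace Y" "vspace V" "vspace W" "x \<in> vset X \<Longrightarrow> y \<in> vset Y \<Longrightarrow> \<kappa> x y \<in> bil V W"
    "v \<in> vset V \<Longrightarrow> w \<in> vset W \<Longrightarrow> (\<lambda>x y. \<kappa> x y v w) \<in> bil X Y"
  using assms by (auto simp: bil_family_def)

lemma bil_family_cong:
  assumes "bil_family X Y V W \<kappa>"
    and eq: "\<And>x y v w. x \<in> vset X \<Longrightarrow> y \<in> vset Y \<Longrightarrow> v \<in> vset V \<Longrightarrow> w \<in> vset W \<Longrightarrow> \<kappa>' x y v w = \<kappa> x y v w"
  shows "bil_family X Y V W \<kappa>'"
  unfolding bil_family_def
proof (intro conjI ballI)
  note D = bil_familyD[OF assms(1)]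
  fix x y assume "x \<in> vset X" "y \<in> vset Y"
  thus "\<kappa>' x y \<in> bil V W" using eq by (intro bil_cong[OF D(3,4) D(5)]) auto
next
  note D = bil_familyD[OF assms(1)]
  fix x y assume "x \<in> vset V" "y \<in> vset W"
  thus "(\<lambda>a b. \<kappa>' a b x y) \<in> bil X Y" using eq by (intro bil_cong[OF D(1,2) D(6)]) auto
qed (use bil_familyD[OF assms(1)] in auto)

lemma bil_family_form:
  assumes "bil_family X Y V W \<kappa>" and t: "t \<in> vset (V \<otimes> W)"
  shows "(\<lambda>x y. t (\<kappa> x y)) \<in> bil X Y"
proof (rule bilI)
  note D = bil_familyD[OF assms(1)]
  note cX = vspace_closed[OF D(1)] and cY = vspace_closed[OF D(2)]
  fix x y c assume x: "x \<in> vset X" and y: "y \<in> vset Y"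
  show "t (\<kappa> x (vscale Y c y)) = c * t (\<kappa> x y)"
    using tensor_form_linear[OF t D(5)[OF x cY(2)[OF y y]] D(5)[OF x y] D(5)[OF x y], of c c 0]
      bilD(2)[OF D(6) x y] by simp
  show "t (\<kappa> (vscale X c x) y) = c * t (\<kappa> x y)"
    using tensor_form_linear[OF t D(5)[OF cX(2)[OF x x] y] D(5)[OF x y] D(5)[OF x y], of c c 0]
      bilD(4)[OF D(6) x y] by simp
  fix z assume z: "z \<in> vset Y"
  show "t (\<kappa> x (y + z)) = t (\<kappa> x y) + t (\<kappa> x z)"
    using tensor_form_linear[OF t D(5)[OF x cY(1)[OF y z]] D(5)[OF x y] D(5)[OF x z], of 1 1]
      bilD(1)[OF D(6) x y z] by simp
next
  note D = bil_familyD[OF assms(1)]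
  fix x z y assume x: "x \<in> vset X" and z: "z \<in> vset X" and y: "y \<in> vset Y"
  show "t (\<kappa> (x + z) y) = t (\<kappa> x y) + t (\<kappa> z y)"
    using tensor_form_linear[OF t D(5)[OF vspace_closed(1)[OF D(1) x z] y] D(5)[OF x y] D(5)[OF z y], of 1 1]
      bilD(3)[OF D(6) x z y] by simp
qed

definition transposed_map where
  "transposed_map X Y \<kappa> t = zext (X \<otimes> Y) (\<lambda>s. s (\<lambda>x y. t (\<kappa> x y)))"

lemma transposed_map_linear:
  assumes "bil_family X Y V W \<kappa>" and s: "s \<in> vset (V \<otimes> W)"
  shows "t \<in> vset (V \<otimes> W) \<Longrightarrow> transposed_map X Y \<kappa> (s + t) = transposed_map X Y \<kappa> s + transposed_map X Y \<kappa> t"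
    "transposed_map X Y \<kappa> (fscale c s) = fscale c (transposed_map X Y \<kappa> s)"
proof -
  note cl = vspace_closed[OF vspace_tensor[of V W], unfolded vscale_tensor]
  note b = bil_family_form[OF assms(1)]
  show "transposed_map X Y \<kappa> (s + t) = transposed_map X Y \<kappa> s + transposed_map X Y \<kappa> t" if t: "t \<in> vset (V \<otimes> W)"
  proof
    fix r
    show "transposed_map X Y \<kappa> (s + t) r = (transposed_map X Y \<kappa> s + transposed_map X Y \<kappa> t) r"
      using tensor_form_linear[of r X Y, OF _ b[OF cl(1)[OF s t]] b[OF s] b[OF t], of 1 1]
      by (simp add: transposed_map_def zext_def)
  qed
  show "transposed_map X Y \<kappa> (fscale c s) = fscale c (transposed_map X Y \<kappa> s)"
  proof
    fix r
    show "transposed_map X Y \<kappa> (fscale c s) r = fscale c (transposed_map X Y \<kappa> s) r"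
      using tensor_form_linear[of r X Y, OF _ b[OF cl(2)[OF s s]] b[OF s] b[OF s], of c c 0]
      by (simp add: transposed_map_def zext_def fscale_def)
  qed
qed

lemma transposed_map_pure:
  assumes "bil_family X Y V W \<kappa>" "v \<in> vset V" "w \<in> vset W" "x \<in> vset X" "y \<in> vset Y"
  shows "transposed_map X Y \<kappa> (pure V W v w) (pure X Y x y) = \<kappa> x y v w"
proof -
  note D = bil_familyD[OF assms(1)]
  have "transposed_map X Y \<kappa> (pure V W v w) (pure X Y x y) = pure V W v w (\<kappa> x y)"
    using bil_family_form[OF assms(1) pure_in_tensor[OF assms(2,3)]] pure_in_tensor[OF assms(4,5)]
    by (simp add: transposed_map_def zext_def pure_def)
  also have "\<dots> = \<kappa> x y v w" using D(5)[OF assms(4,5)] by (simp add: pure_def)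
  finally show ?thesis .
qed

lemma temb_linear:
  "temb X Y p q (s + t) = temb X Y p q s + temb X Y p q t"
  "temb X Y p q (fscale c s) = fscale c (temb X Y p q s)"
  by (auto simp: temb_def zext_def fscale_def fun_eq_iff)

lemma bil_prod:
  assumes "vspace X" "vspace Y" "lin X base f" "lin Y base g"
  shows "(\<lambda>x y. f x * g y) \<in> bil X Y"
  using assms(3,4) by (auto simp: bil_def lin_base_iff algebra_simps)

lemma temb_pure:
  assumes v: "vspace V" "vspace W" "vspace X" "vspace Y" and T: "T \<in> vset (V \<otimes> W)"
    and p: "p \<in> bil V X" and q: "q \<in> bil W Y" and x: "x \<in> vset X" and y: "y \<in> vset Y"
  shows "temb X Y p q T (pure X Y x y) = (crd V \<otimes>\<^sub>c crd W) T (\<lambda>(i, j). p i x * q j y)"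
proof -
  have b: "(\<lambda>\<xi> \<eta>. p \<xi> x * q \<eta> y) \<in> bil V W"
    using p q x y v by (intro bil_prod) (auto simp: bil_def)
  have b': "(\<lambda>x y. p \<xi> x * q \<eta> y) \<in> bil X Y" if "\<xi> \<in> vset V" "\<eta> \<in> vset W" for \<xi> \<eta>
    using p q that v by (intro bil_prod) (auto simp: bil_def)
  have e: "pure X Y x y (\<lambda>x y. p \<xi> x * q \<eta> y) = p \<xi> x * q \<eta> y" if "\<xi> \<in> vset V" "\<eta> \<in> vset W" for \<xi> \<eta>
    using b'[OF that] by (simp add: pure_def)
  have "temb X Y p q T (pure X Y x y) = T (\<lambda>\<xi> \<eta>. pure X Y x y (\<lambda>x y. p \<xi> x * q \<eta> y))"
    using pure_in_tensor[OF x y] by (simp add: temb_def zext_def)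
  also have "\<dots> = T (\<lambda>\<xi> \<eta>. p \<xi> x * q \<eta> y)"
    by (rule tens_cong[OF T b bil_cong[OF v(1,2) b e] e])
  also have "\<dots> = (crd V \<otimes>\<^sub>c crd W) T (\<lambda>(i, j). p i x * q j y)"
    by (rule tens_eval[OF v(1,2) T b])
  finally show ?thesis .
qed

text \<open>The images of \<open>S\<close> and \<open>T\<close> agree on pure tensors, so \<open>S\<close> and \<open>T\<close> agree on the products of the two
  separating families of evaluations.\<close>

lemma temb_inj:
  assumes v: "vspace V" "vspace W" "vspace X" "vspace Y"
    and p: "p \<in> bil V X" and q: "q \<in> bil W Y"
    and s: "separating V (crd V) {\<lambda>i. p i x | x. x \<in> vset X}" "separating W (crd W) {\<lambda>j. q j y | y. y \<in> vset Y}"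
  shows "inj_on (temb X Y p q) (vset (V \<otimes> W))"
proof (rule inj_onI)
  fix S T assume S: "S \<in> vset (V \<otimes> W)" and T: "T \<in> vset (V \<otimes> W)" and eq: "temb X Y p q S = temb X Y p q T"
  have "(crd V \<otimes>\<^sub>c crd W) S k = (crd V \<otimes>\<^sub>c crd W) T k"
    if k: "k \<in> {\<lambda>i. p i x | x. x \<in> vset X} \<otimes>\<^sub>f {\<lambda>j. q j y | y. y \<in> vset Y}" for k
  proof -
    obtain x y where x: "x \<in> vset X" "y \<in> vset Y" and kk: "k = (\<lambda>(i, j). p i x * q j y)"
      using k by (auto simp: prod_forms_def)
    show ?thesis unfolding kk using eq temb_pure[OF v S p q x] temb_pure[OF v T p q x] by simp
  qed
  thus "S = T" using separating_bas2[OF v(1,2) s] S T unfolding separating_def by blast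
qed

context dual_setting
begin

lemma U_lin_at: "lin U base (\<lambda>f. f x)"
  by (auto simp: lin_base_iff U_scale fscale_def)

lemma dual_lin_at: "lin (dual H) base (\<lambda>f. f x)"
  by (auto simp: lin_base_iff dual_scale fscale_def)

lemma crd_U_at: "F \<in> vset U \<Longrightarrow> crd U F (\<lambda>f. f x) = F x"
  using coordsD(6)[OF coords_bas[OF U_vsp] U_lin_at, of F x] by simp

lemma crd_U_bracket:
  assumes "F \<in> vset U" "x \<in> B" shows "crd U F (\<lambda>f. bracket f x) = F x"
proof -
  have "crd U F (\<lambda>f. bracket f x) = crd U F (\<lambda>f. f x)"
    by (rule fin_comb_cong[OF coordsD(4)[OF coords_bas[OF U_vsp] assms(1)]]) (simp add: bracket_def assms)
  thus ?thesis by (simp add: crd_U_at assms)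
qed

lemma crd_H_dual: "f \<in> vset (dual H) \<Longrightarrow> v \<in> vset H \<Longrightarrow> crd H v (\<lambda>x. f x) = f v"
  using coordsD(6)[OF coords_bas[OF H_vsp] dual_lin, of f v] by simp

lemma crd_H_bracket:
  assumes "f \<in> A" "v \<in> vset H" shows "crd H v (\<lambda>x. bracket f x) = f v"
proof -
  have "crd H v (\<lambda>x. bracket f x) = crd H v (\<lambda>x. f x)"
    by (rule fin_comb_cong[OF coordsD(4)[OF coords_bas[OF H_vsp] assms(2)]]) (simp add: bracket_def assms)
  thus ?thesis by (simp add: crd_H_dual U_sub bas_in[OF U_vsp] assms)
qed

lemma dual_eqI:
  assumes "f \<in> vset (dual H)" "g \<in> vset (dual H)" "\<And>x. x \<in> vset H \<Longrightarrow> f x = g x"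
  shows "f = g"
proof
  fix x
  have "zext H f x = zext H g x" using assms(3) by (simp add: zext_def)
  thus "f x = g x" using assms(1,2) by (simp add: dual_def)
qed

lemma separating_U: "separating U (crd U) {\<lambda>f. bracket f x | x. x \<in> B}"
  unfolding separating_def
proof (intro ballI impI)
  fix F G assume F: "F \<in> vset U" and G: "G \<in> vset U"
    and eq: "\<forall>k\<in>{\<lambda>f. bracket f x | x. x \<in> B}. crd U F k = crd U G k"
  have "F x = G x" if "x \<in> B" for x using eq crd_U_bracket[OF F that] crd_U_bracket[OF G that] that by auto
  hence "crd H v F = crd H v G" if "v \<in> vset H" for v
    by (intro fin_comb_cong[OF coordsD(4)[OF coords_bas[OF H_vsp] that]])
  thus "F = G" using crd_H_dual U_sub F G by (intro dual_eqI) auto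
qed

lemma separating_U_ev: "separating U (crd U) {\<lambda>f. ev f x | x. x \<in> vset H}"
  unfolding separating_def
proof (intro ballI impI)
  fix F G assume F: "F \<in> vset U" and G: "G \<in> vset U"
    and eq: "\<forall>k\<in>{\<lambda>f. ev f x | x. x \<in> vset H}. crd U F k = crd U G k"
  have "F x = G x" if "x \<in> vset H" for x
    using eq crd_U_at[OF F, of x] crd_U_at[OF G, of x] that by (auto simp: ev_def)
  thus "F = G" using F G U_sub by (intro dual_eqI) auto
qed

lemma zext_dual: "lin H base f \<Longrightarrow> zext H f \<in> vset (dual H)"
  using vspace_closed[OF H_vsp] by (auto simp: dual_def lin_base_iff zext_def fun_eq_iff)

lemma separating_H_ve: "separating H (crd H) {\<lambda>a. ve a f | f. f \<in> vset (dual H)}"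
  unfolding separating_def
proof (intro ballI impI)
  fix v w assume v: "v \<in> vset H" and w: "w \<in> vset H"
    and eq: "\<forall>k\<in>{\<lambda>a. ve a f | f. f \<in> vset (dual H)}. crd H v k = crd H w k"
  show "v = w"
  proof (rule coords_ext[OF coords_bas[OF H_vsp] v w])
    fix k
    let ?f = "zext H (\<lambda>v. crd H v k)"
    have f: "?f \<in> vset (dual H)" by (rule zext_dual[OF coordsD(3)[OF coords_bas[OF H_vsp]]])
    have "crd H v ?f = crd H w ?f" using eq f by (auto simp: ve_def)
    hence "?f v = ?f w" using crd_H_dual[OF f] v w by simp
    thus "crd H v k = crd H w k" using v w by (simp add: zext_def)
  qed
qed

lemma ev_bil: "ev \<in> bil U H"
  using dual_lin U_sub U_lin_at by (auto simp: bil_def ev_def[abs_def])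

lemma ve_bil: "ve \<in> bil H (dual H)"
  using dual_lin dual_lin_at by (auto simp: bil_def ve_def[abs_def])

lemma ve_bil_U: "ve \<in> bil H U"
  using dual_lin U_sub U_lin_at by (auto simp: bil_def ve_def[abs_def])

text \<open>The common integrand of the three maps, with \<open>F\<close> equal to \<open>\<Psi>\<close> or to its inverse:
  \<open>\<langle>\<langle>f \<otimes> g, F(a \<otimes> b)\<rangle>\<rangle>\<close>.\<close>

definition braid_form where "braid_form F a b f g = F (pure H H a b) (\<lambda>x y. f y * g x)"

lemma form_bil:
  assumes "f \<in> vset (dual H)" "g \<in> vset (dual H)" shows "(\<lambda>x y. f y * g x) \<in> bil H H"
  using bil_prod[OF H_vsp H_vsp dual_lin[OF assms(2)] dual_lin[OF assms(1)]] by (simp add: mult.commute)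

lemma subsp_dualD:
  assumes "subsp V (dual H)"
  shows "vspace V" "vscale V = fscale" "f \<in> vset V \<Longrightarrow> f \<in> vset (dual H)"
  using assms vspace_dual[of H] by (auto simp: subsp_def vspace_def dual_scale)

lemma subsp_dual_dual: "subsp (dual H) (dual H)"
  using vspace_dual[of H] by (simp add: subsp_def vspace_def)

lemma tens_form_lin:
  assumes X: "X \<in> vset (H \<otimes> H)" and V: "subsp V (dual H)" and g: "g \<in> vset (dual H)"
  shows "lin V base (\<lambda>f. X (\<lambda>x y. f y * g x))" "lin V base (\<lambda>f. X (\<lambda>x y. g y * f x))"
proof -
  note D = subsp_dualD[OF V]
  note cl = vspace_closed[OF D(1)]
  have b: "(\<lambda>x y. f y * g x) \<in> bil H H" "(\<lambda>x y. g y * f x) \<in> bil H H" if "f \<in> vset V" for f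
    using form_bil[OF D(3)[OF that] g] form_bil[OF g D(3)[OF that]] by auto
  show "lin V base (\<lambda>f. X (\<lambda>x y. f y * g x))"
    unfolding lin_base_iff
  proof (intro conjI ballI allI)
    fix f f' assume f: "f \<in> vset V" "f' \<in> vset V"
    show "X (\<lambda>x y. (f + f') y * g x) = X (\<lambda>x y. f y * g x) + X (\<lambda>x y. f' y * g x)"
      using tensor_form_linear[OF X b(1)[OF cl(1)[OF f]] b(1)[OF f(1)] b(1)[OF f(2)], of 1 1]
      by (simp add: algebra_simps)
  next
    fix c f assume f: "f \<in> vset V"
    show "X (\<lambda>x y. vscale V c f y * g x) = c * X (\<lambda>x y. f y * g x)"
      using tensor_form_linear[OF X b(1)[OF cl(2)[OF f f]] b(1)[OF f] b(1)[OF f], of c c 0]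
      by (simp add: D(2) fscale_def algebra_simps)
  qed
  show "lin V base (\<lambda>f. X (\<lambda>x y. g y * f x))"
    unfolding lin_base_iff
  proof (intro conjI ballI allI)
    fix f f' assume f: "f \<in> vset V" "f' \<in> vset V"
    show "X (\<lambda>x y. g y * (f + f') x) = X (\<lambda>x y. g y * f x) + X (\<lambda>x y. g y * f' x)"
      using tensor_form_linear[OF X b(2)[OF cl(1)[OF f]] b(2)[OF f(1)] b(2)[OF f(2)], of 1 1]
      by (simp add: algebra_simps)
  next
    fix c f assume f: "f \<in> vset V"
    show "X (\<lambda>x y. g y * vscale V c f x) = c * X (\<lambda>x y. g y * f x)"
      using tensor_form_linear[OF X b(2)[OF cl(2)[OF f f]] b(2)[OF f] b(2)[OF f], of c c 0]
      by (simp add: D(2) fscale_def algebra_simps)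
  qed
qed

lemma braid_form_lin:
  assumes F: "lin (H \<otimes> H) (H \<otimes> H) F" and V: "subsp V (dual H)"
  shows "b \<in> vset H \<Longrightarrow> lin H base (\<lambda>a. braid_form F a b f g)" "a \<in> vset H \<Longrightarrow> lin H base (\<lambda>b. braid_form F a b f g)"
    "a \<in> vset H \<Longrightarrow> b \<in> vset H \<Longrightarrow> g \<in> vset (dual H) \<Longrightarrow> lin V base (\<lambda>f. braid_form F a b f g)"
    "a \<in> vset H \<Longrightarrow> b \<in> vset H \<Longrightarrow> f \<in> vset (dual H) \<Longrightarrow> lin V base (\<lambda>g. braid_form F a b f g)"
proof -
  have FF: "F (pure H H a b) \<in> vset (H \<otimes> H)" if "a \<in> vset H" "b \<in> vset H" for a b
    by (rule lin_in[OF F pure_in_tensor[OF that]])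
  show "a \<in> vset H \<Longrightarrow> b \<in> vset H \<Longrightarrow> g \<in> vset (dual H) \<Longrightarrow> lin V base (\<lambda>f. braid_form F a b f g)"
    "a \<in> vset H \<Longrightarrow> b \<in> vset H \<Longrightarrow> f \<in> vset (dual H) \<Longrightarrow> lin V base (\<lambda>g. braid_form F a b f g)"
    unfolding braid_form_def using tens_form_lin[OF FF V] by auto
  note FD = linD[OF F, unfolded vscale_tensor]
  show "lin H base (\<lambda>a. braid_form F a b f g)" if "b \<in> vset H"
    using that FD by (auto simp: lin_base_iff braid_form_def pure_bilinear pure_in_tensor fscale_def)
  show "lin H base (\<lambda>b. braid_form F a b f g)" if "a \<in> vset H"
    using that FD by (auto simp: lin_base_iff braid_form_def pure_bilinear pure_in_tensor fscale_def)
qed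

lemma dpair_pure:
  assumes V: "subsp V (dual H)" and W: "subsp W (dual H)" and f: "f \<in> vset V" and g: "g \<in> vset W"
    and X: "X \<in> vset (H \<otimes> H)"
  shows "dpair (pure V W f g) X = X (\<lambda>x y. f y * g x)"
proof -
  have "(\<lambda>\<xi> \<eta>. X (\<lambda>a b. \<xi> b * \<eta> a)) \<in> bil V W"
    using tens_form_lin(1)[OF X V] tens_form_lin(2)[OF X W] subsp_dualD(3)[OF V] subsp_dualD(3)[OF W]
    by (auto simp: bil_def)
  thus ?thesis by (simp add: dpair_def pure_def)
qed

lemma braid_form_op:
  assumes F: "lin (H \<otimes> H) (H \<otimes> H) F" and a: "a \<in> B" and b: "b \<in> B"
    and f: "f \<in> vset (dual H)" and g: "g \<in> vset (dual H)"
  shows "braid_form F a b f g = braid_op H H F a b (\<lambda>x y. f y * g x)"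
  using tens_eval[OF H_vsp H_vsp lin_in[OF F pure_in_tensor[OF bas_in[OF H_vsp a] bas_in[OF H_vsp b]]] form_bil[OF f g]] a b
  by (simp add: braid_form_def braid_op_def)

lemma fam_UU: "bil_family H H U U (\<lambda>b a \<xi> \<eta>. \<Psi> (pure H H a b) (\<lambda>x y. \<xi> y * \<eta> x))"
  using braid_form_lin[OF Psi_lin U_dual] U_sub H_vsp U_vsp by (auto simp: bil_family_def bil_def braid_form_def[symmetric])

lemma fam_UH: "bil_family (dual H) H U H (\<lambda>f b g a. dpair (pure (dual H) U f g) (tinv H \<Psi> (pure H H a b)))"
proof (rule bil_family_cong)
  show "bil_family (dual H) H U H (\<lambda>f b g a. braid_form (tinv H \<Psi>) a b f g)"
    using braid_form_lin[OF Psi_inv_lin U_dual] braid_form_lin[OF Psi_inv_lin subsp_dual_dual] U_sub H_vsp U_vsp vspace_dual[of H]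
    by (auto simp: bil_family_def bil_def)
  show "dpair (pure (dual H) U f g) (tinv H \<Psi> (pure H H a b)) = braid_form (tinv H \<Psi>) a b f g"
    if "f \<in> vset (dual H)" "b \<in> vset H" "g \<in> vset U" "a \<in> vset H" for f b g a
    unfolding braid_form_def using that
    by (intro dpair_pure[OF subsp_dual_dual U_dual] lin_in[OF Psi_inv_lin] pure_in_tensor) auto
qed

lemma fam_HU: "bil_family H (dual H) H U (\<lambda>a g b f. dpair (pure U (dual H) f g) (tinv H \<Psi> (pure H H a b)))"
proof (rule bil_family_cong)
  show "bil_family H (dual H) H U (\<lambda>a g b f. braid_form (tinv H \<Psi>) a b f g)"
    using braid_form_lin[OF Psi_inv_lin U_dual] braid_form_lin[OF Psi_inv_lin subsp_dual_dual] U_sub H_vsp U_vsp vspace_dual[of H]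
    by (auto simp: bil_family_def bil_def)
  show "dpair (pure U (dual H) f g) (tinv H \<Psi> (pure H H a b)) = braid_form (tinv H \<Psi>) a b f g"
    if "a \<in> vset H" "g \<in> vset (dual H)" "b \<in> vset H" "f \<in> vset U" for f b g a
    unfolding braid_form_def using that
    by (intro dpair_pure[OF U_dual subsp_dual_dual] lin_in[OF Psi_inv_lin] pure_in_tensor) auto
qed

lemma Psi_as_transposed_map:
  "Psi_UU H \<Psi> = transposed_map H H (\<lambda>b a \<xi> \<eta>. \<Psi> (pure H H a b) (\<lambda>x y. \<xi> y * \<eta> x))"
  "Psi_UH H \<Psi> U = transposed_map (dual H) H (\<lambda>f b g a. dpair (pure (dual H) U f g) (tinv H \<Psi> (pure H H a b)))"
  "Psi_HU H \<Psi> U = transposed_map H (dual H) (\<lambda>a g b f. dpair (pure U (dual H) f g) (tinv H \<Psi> (pure H H a b)))"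
  by (auto simp: fun_eq_iff Psi_UU_def Psi_UH_def Psi_HU_def transposed_map_def dpair_def)

lemma emb_inj:
  "inj_on (emb_UU H) (vset (U \<otimes> U))" "inj_on (emb_HU H) (vset (H \<otimes> U))" "inj_on (emb_UH H) (vset (U \<otimes> H))"
  unfolding emb_UU_def emb_HU_def emb_UH_def
  by (intro temb_inj U_vsp H_vsp vspace_dual ev_bil ve_bil separating_U_ev separating_H_ve)+

lemma braid_UU_bij:
  assumes "Psi_UU_bij H \<Psi> U"
  shows "bij_lin (U \<otimes> U) (U \<otimes> U) (braid_UU H \<Psi> U)"
    "t \<in> vset (U \<otimes> U) \<Longrightarrow> emb_UU H (braid_UU H \<Psi> U t) = Psi_UU H \<Psi> t"
  using bij_via_embedding[OF vspace_tensor vspace_tensor emb_inj(1) _ _ _ _ assms[unfolded Psi_UU_bij_def]]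
    temb_linear[of H H ev ev] transposed_map_linear[OF fam_UU]
  unfolding braid_UU_def[abs_def] vscale_tensor Psi_as_transposed_map(1) emb_UU_def by blast+

lemma braid_UH_bij:
  assumes "Psi_UH_bij H \<Psi> U"
  shows "bij_lin (U \<otimes> H) (H \<otimes> U) (braid_UH H \<Psi> U)"
    "t \<in> vset (U \<otimes> H) \<Longrightarrow> emb_HU H (braid_UH H \<Psi> U t) = Psi_UH H \<Psi> U t"
  using bij_via_embedding[OF vspace_tensor vspace_tensor emb_inj(2) _ _ _ _ assms[unfolded Psi_UH_bij_def]]
    temb_linear[of "dual H" H ve ev] transposed_map_linear[OF fam_UH]
  unfolding braid_UH_def[abs_def] vscale_tensor Psi_as_transposed_map(2) emb_HU_def by blast+

lemma braid_HU_bij: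
  assumes "Psi_HU_bij H \<Psi> U"
  shows "bij_lin (H \<otimes> U) (U \<otimes> H) (braid_HU H \<Psi> U)"
    "t \<in> vset (H \<otimes> U) \<Longrightarrow> emb_UH H (braid_HU H \<Psi> U t) = Psi_HU H \<Psi> U t"
  using bij_via_embedding[OF vspace_tensor vspace_tensor emb_inj(3) _ _ _ _ assms[unfolded Psi_HU_bij_def]]
    temb_linear[of H "dual H" ev ve] transposed_map_linear[OF fam_HU]
  unfolding braid_HU_def[abs_def] vscale_tensor Psi_as_transposed_map(3) emb_UH_def by blast+

end

section \<open>The braided bialgebra structure on the subspace\<close>


context dual_setting
begin

lemma zext_eps_U: "zext H \<epsilon> \<in> vset U"
  using U_subalg by (simp add: unital_subalgebra_dual_def)

lemma dual_mult_pure: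
  assumes "subsp V (dual H)" "subsp W (dual H)" "f \<in> vset V" "g \<in> vset W"
  shows "dual_mult H \<Delta> \<Psi> (pure V W f g) = zext H (\<lambda>a. tinv H \<Psi> (\<Delta> a) (\<lambda>x y. f y * g x))"
  by (auto simp: dual_mult_def zext_def fun_eq_iff intro!: dpair_pure[OF assms] lin_in[OF Psi_inv_lin] lin_in[OF Delta_lin])

lemma lin_dual_mult: "lin (U \<otimes> U) U (dual_mult H \<Delta> \<Psi>)"
proof (rule lin_on_basis[OF coords_bas2[OF U_vsp U_vsp] U_vsp])
  fix i assume "i \<in> A \<times> A"
  then obtain f g where i: "i = (f, g)" "f \<in> vset U" "g \<in> vset U" using bas_in[OF U_vsp] by auto
  have "dual_mult H \<Delta> \<Psi> (pure U U f g) = dual_mult H \<Delta> \<Psi> (pure (dual H) (dual H) f g)"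
    unfolding dual_mult_pure[OF U_dual U_dual i(2,3)]
      dual_mult_pure[OF subsp_dual_dual subsp_dual_dual U_sub[OF i(2)] U_sub[OF i(3)]] ..
  thus "dual_mult H \<Delta> \<Psi> (tensor_basis U U (\<lambda>x. x) (\<lambda>x. x) i) \<in> vset U"
    using U_subalg i by (simp add: tensor_basis_def unital_subalgebra_dual_def)
qed (auto simp: dual_mult_def zext_def fun_eq_iff dpair_def vscale_tensor U_scale fscale_def)

lemma dpair_at:
  assumes t: "t \<in> vset (U \<otimes> U)" and ab: "a \<in> vset H" "b \<in> vset H"
  shows "dpair t (pure H H a b) = (crd U \<otimes>\<^sub>c crd U) t (\<lambda>(f, g). f b * g a)"
proof -
  have b1: "(\<lambda>\<xi> \<eta>. \<xi> b * \<eta> a) \<in> bil U U"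
    using bil_prod[OF U_vsp U_vsp U_lin_at U_lin_at] .
  have e: "pure H H a b (\<lambda>x y. \<xi> y * \<eta> x) = \<xi> b * \<eta> a" if "\<xi> \<in> vset U" "\<eta> \<in> vset U" for \<xi> \<eta>
    using form_bil[OF U_sub[OF that(1)] U_sub[OF that(2)]] by (simp add: pure_def)
  have b2: "(\<lambda>\<xi> \<eta>. pure H H a b (\<lambda>x y. \<xi> y * \<eta> x)) \<in> bil U U"
    by (rule bil_cong[OF U_vsp U_vsp b1]) (rule e)
  have "dpair t (pure H H a b) = t (\<lambda>\<xi> \<eta>. \<xi> b * \<eta> a)"
    unfolding dpair_def by (rule tens_cong[OF t b1 b2]) (rule e)
  thus ?thesis using tens_eval[OF U_vsp U_vsp t b1] by simp
qed

lemma dpair_at_bas: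
  assumes t: "t \<in> vset (U \<otimes> U)" and ab: "a \<in> B" "b \<in> B"
  shows "dpair t (pure H H a b) = (crd U \<otimes>\<^sub>c crd U) t (\<lambda>(f, g). bracket f b * bracket g a)"
  unfolding dpair_at[OF t bas_in[OF H_vsp ab(1)] bas_in[OF H_vsp ab(2)]]
  by (rule fin_comb_cong[OF fin_comb_bas2[OF U_vsp U_vsp t]]) (auto simp: bracket_def ab)

text \<open>Evaluations at basis elements of \<open>H\<close> separate \<open>U\<close>, so a coproduct is determined by the
  functional that it is to represent.\<close>

lemma dual_comult_eqI:
  assumes t: "is_dual_comult H m \<Psi> U f t"
  shows "dual_comult H m \<Psi> U f = t"
  unfolding dual_comult_def
proof (rule the_equality[of "is_dual_comult H m \<Psi> U f", OF t])
  fix s assume s: "is_dual_comult H m \<Psi> U f s"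
  have "(crd U \<otimes>\<^sub>c crd U) s k = (crd U \<otimes>\<^sub>c crd U) t k"
    if k: "k \<in> {\<lambda>f. bracket f x | x. x \<in> B} \<otimes>\<^sub>f {\<lambda>f. bracket f x | x. x \<in> B}" for k
  proof -
    obtain x y where x: "x \<in> B" "y \<in> B" and kk: "k = (\<lambda>(f, g). bracket f x * bracket g y)"
      using k by (auto simp: prod_forms_def)
    have "dpair s (pure H H y x) = dpair t (pure H H y x)"
      using s t x bas_in[OF H_vsp] by (simp add: is_dual_comult_def)
    thus ?thesis using s t dpair_at_bas[OF _ x(2,1)] unfolding kk is_dual_comult_def by metis
  qed
  thus "s = t" using separating_bas2[OF U_vsp U_vsp separating_U separating_U] s t unfolding separating_def is_dual_comult_def by blast
qed

lemma dual_comult_spec: "f \<in> vset U \<Longrightarrow> is_dual_comult H m \<Psi> U f (dual_comult H m \<Psi> U f)"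
  using U_comult dual_comult_eqI by metis

lemma lin_dual_comult: "lin U (U \<otimes> U) (dual_comult H m \<Psi> U)"
  unfolding lin_def
proof (intro conjI ballI allI)
  note cl = vspace_closed[OF vspace_tensor[of U U], unfolded vscale_tensor]
  fix f c assume f: "f \<in> vset U"
  show "dual_comult H m \<Psi> U f \<in> vset (U \<otimes> U)"
    using dual_comult_spec[OF f] by (simp add: is_dual_comult_def)
  show "dual_comult H m \<Psi> U (vscale U c f) = vscale (U \<otimes> U) c (dual_comult H m \<Psi> U f)"
    by (rule dual_comult_eqI)
      (use dual_comult_spec[OF f] cl in \<open>auto simp: is_dual_comult_def vscale_tensor U_scale fscale_def[abs_def] dpair_def\<close>)
  fix g assume g: "g \<in> vset U"
  show "dual_comult H m \<Psi> U (f + g) = dual_comult H m \<Psi> U f + dual_comult H m \<Psi> U g"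
  proof (rule dual_comult_eqI)
    have "dual_comult H m \<Psi> U f + dual_comult H m \<Psi> U g \<in> vset (U \<otimes> U)"
      using dual_comult_spec[OF f] dual_comult_spec[OF g] cl(1) by (simp only: is_dual_comult_def)
    thus "is_dual_comult H m \<Psi> U (f + g) (dual_comult H m \<Psi> U f + dual_comult H m \<Psi> U g)"
      using dual_comult_spec[OF f] dual_comult_spec[OF g] by (simp add: is_dual_comult_def dpair_def)
  qed
qed

lemma lin_dual_counit: "lin U base (dual_counit e)"
  unfolding dual_counit_def[abs_def] by (rule U_lin_at)

text \<open>The three lemmas \<open>dual_mult_transposed\<close>, \<open>dual_comult_transposed\<close> and \<open>braid_UU_transposed\<close> identify
  the structure of \<open>U\<close> as transposes of the coopposite coproduct, the opposite product and the
  braiding.  With the convention that \<open>bracket\<close> vanishes off the bases they hold for all indices.\<close>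

lemma dual_mult_transposed: "MU f g (\<lambda>h. bracket h x) = D' x (\<lambda>x y. bracket f y * bracket g x)"
proof (cases "f \<in> A \<and> g \<in> A \<and> x \<in> B")
  case True
  hence f: "f \<in> vset U" "g \<in> vset U" and x: "x \<in> vset H" using bas_in[OF U_vsp] bas_in[OF H_vsp] by auto
  have p: "pure U U f g \<in> vset (U \<otimes> U)" using f by (simp add: pure_in_tensor)
  have "MU f g (\<lambda>h. bracket h x) = dual_mult H \<Delta> \<Psi> (pure U U f g) x"
    using True crd_U_bracket[OF lin_in[OF lin_dual_mult p]] by (simp add: mult_op_def)
  also have "\<dots> = tinv H \<Psi> (\<Delta> x) (\<lambda>x y. f y * g x)"
    using x by (simp add: dual_mult_pure[OF U_dual U_dual f] zext_def)
  also have "\<dots> = (crd H \<otimes>\<^sub>c crd H) (tinv H \<Psi> (\<Delta> x)) (\<lambda>(x, y). f y * g x)"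
    by (rule tens_eval[OF H_vsp H_vsp lin_in[OF Psi_inv_lin lin_in[OF Delta_lin x]] form_bil[OF U_sub[OF f(1)] U_sub[OF f(2)]]])
  also have "\<dots> = D' x (\<lambda>x y. f y * g x)"
    unfolding braid_crd[OF H_vsp H_vsp Psi_inv_lin lin_in[OF Delta_lin x]] using True by (simp add: cop_comult_def comult_op_def)
  also have "\<dots> = D' x (\<lambda>x y. bracket f y * bracket g x)"
    by (rule L'.D_cong) (simp add: bracket_def True)
  finally show ?thesis .
qed (auto simp: bracket_def mult_op_def cop_comult_def fin_comb_zero[OF coordsD(4)[OF coords_bas[OF U_vsp] lin_in[OF lin_dual_mult pure_in_tensor]]] bas_in[OF U_vsp])

lemma dual_comult_transposed: "DU f (\<lambda>g h. bracket g y * bracket h x) = M' x y (\<lambda>z. bracket f z)"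
proof (cases "f \<in> A \<and> x \<in> B \<and> y \<in> B")
  case True
  hence f: "f \<in> vset U" and x: "x \<in> vset H" "y \<in> vset H" using bas_in[OF U_vsp] bas_in[OF H_vsp] by auto
  note s = dual_comult_spec[OF f, unfolded is_dual_comult_def]
  have p: "\<Psi> (pure H H x y) \<in> vset (H \<otimes> H)" by (rule lin_in[OF Psi_lin pure_in_tensor[OF x]])
  have "DU f (\<lambda>g h. bracket g y * bracket h x) = dpair (dual_comult H m \<Psi> U f) (pure H H x y)"
    using True s dpair_at_bas by (simp add: comult_op_def)
  also have "\<dots> = f (m (\<Psi> (pure H H x y)))" using s x by simp
  also have "\<dots> = crd H (m (\<Psi> (pure H H x y))) (\<lambda>z. bracket f z)"
    using True crd_H_bracket[OF _ lin_in[OF m_lin p]] by simp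
  also have "\<dots> = M' x y (\<lambda>z. bracket f z)"
    unfolding mult_crd[OF H_vsp m_lin p] using True by (simp add: op_mult_def braid_op_def)
  finally show ?thesis .
next
  case False
  note z = fin_comb2_zero[OF fin_comb2_comult_op[OF U_vsp lin_dual_comult]]
  show ?thesis
  proof (cases "f \<in> A")
    case True thus ?thesis using False z by (auto simp: bracket_def)
  next
    case f: False thus ?thesis by (simp add: bracket_def comult_op_def)
  qed
qed

end

locale dual_setting_braided = dual_setting H m e \<Delta> \<epsilon> \<Psi> U
  for H :: "('k::field, 'h::ab_group_add) vsp" and m e \<Delta> \<epsilon> \<Psi> and U :: "('k, 'h \<Rightarrow> 'k) vsp" +
  assumes UU_bij: "Psi_UU_bij H \<Psi> U"
begin

lemma braid_UU_lin: "lin (U \<otimes> U) (U \<otimes> U) (braid_UU H \<Psi> U)"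
  using braid_UU_bij(1)[OF UU_bij] by (simp add: bij_lin_def)

lemma braid_UU_transposed: "PU f g (\<lambda>g f. bracket g y * bracket f x) = P x y (\<lambda>y x. bracket f x * bracket g y)"
proof (cases "f \<in> A \<and> g \<in> A \<and> x \<in> B \<and> y \<in> B")
  case True
  hence f: "f \<in> vset U" "g \<in> vset U" and x: "x \<in> vset H" "y \<in> vset H" using bas_in[OF U_vsp] bas_in[OF H_vsp] by auto
  have p: "pure U U f g \<in> vset (U \<otimes> U)" using f by (simp add: pure_in_tensor)
  have T: "braid_UU H \<Psi> U (pure U U f g) \<in> vset (U \<otimes> U)" by (rule lin_in[OF braid_UU_lin p])
  have "PU f g (\<lambda>g f. bracket g y * bracket f x) =
      (crd U \<otimes>\<^sub>c crd U) (braid_UU H \<Psi> U (pure U U f g)) (\<lambda>(i, j). ev i y * ev j x)"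
    using True by (simp add: braid_op_def)
      (rule fin_comb_cong[OF fin_comb_bas2[OF U_vsp U_vsp T]], auto simp: bracket_def ev_def)
  also have "\<dots> = emb_UU H (braid_UU H \<Psi> U (pure U U f g)) (pure H H y x)"
    unfolding emb_UU_def by (rule temb_pure[OF U_vsp U_vsp H_vsp H_vsp T ev_bil ev_bil x(2,1), symmetric])
  also have "\<dots> = \<Psi> (pure H H x y) (\<lambda>x y. f y * g x)"
    unfolding braid_UU_bij(2)[OF UU_bij p] Psi_as_transposed_map(1) by (rule transposed_map_pure[OF fam_UU f x(2,1)])
  also have "\<dots> = P x y (\<lambda>x y. f y * g x)"
    using braid_form_op[OF Psi_lin _ _ U_sub[OF f(1)] U_sub[OF f(2)]] True by (simp add: braid_form_def)
  also have "\<dots> = P x y (\<lambda>y x. bracket f x * bracket g y)"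
    by (rule L.P_cong) (simp add: bracket_def True)
  finally show ?thesis .
next
  case False
  note z = fin_comb2_zero[OF fin_comb2_braid_op[OF U_vsp U_vsp braid_UU_lin]]
  show ?thesis
  proof (cases "f \<in> A \<and> g \<in> A")
    case True thus ?thesis using False z by (auto simp: bracket_def)
  next
    case f: False
    hence "PU f g k = 0" for k by (auto simp: braid_op_def)
    thus ?thesis using f by (auto simp: bracket_def)
  qed
qed

sublocale T: transposed_laws B P Q M' u D' \<epsilon> A bracket PU MU uU DU
proof unfold_locales
  show "fin_comb2 A A (PU f g)" for f g by (rule fin_comb2_braid_op[OF U_vsp U_vsp braid_UU_lin])
  show "fin_comb A (MU f g)" for f g by (rule fin_comb_mult_op[OF U_vsp lin_dual_mult])
  show "fin_comb A uU" by (rule coordsD(4)[OF coords_bas[OF U_vsp] zext_eps_U])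
  show "fin_comb2 A A (DU f)" for f by (rule fin_comb2_comult_op[OF U_vsp lin_dual_comult])
  show "bracket f x = 0" if "x \<notin> B" for f x using that by (simp add: bracket_def)
  show "uU (\<lambda>f. bracket f x) = \<epsilon> x" if "x \<in> B" for x
    unfolding crd_U_bracket[OF zext_eps_U that] using that by (simp add: zext_def bas_in[OF H_vsp])
qed (rule braid_UU_transposed dual_mult_transposed dual_comult_transposed)+

lemma cU_dual_counit: "f \<in> A \<Longrightarrow> T.cU f = dual_counit e f"
  unfolding T.cU_def dual_counit_def by (rule crd_H_bracket[OF _ e_in_H])

lemma U_algebra: "unital_algebra U (dual_mult H \<Delta> \<Psi>) (zext H \<epsilon>)"
  by (rule unital_algebra_bwd[OF U_vsp lin_dual_mult zext_eps_U, OF separating_U])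
    (auto intro: T.U_assoc T.U_assoc_unit1 T.U_assoc_unit2)

lemma U_counits:
  "f \<in> A \<Longrightarrow> DU f (\<lambda>d e'. dual_counit e d * bracket e' z) = bracket f z"
  "f \<in> A \<Longrightarrow> DU f (\<lambda>d e'. dual_counit e e' * bracket d z) = bracket f z"
  "f \<in> A \<Longrightarrow> g \<in> A \<Longrightarrow> PU f g (\<lambda>g f. dual_counit e f * bracket g x) = dual_counit e f * bracket g x"
  "f \<in> A \<Longrightarrow> g \<in> A \<Longrightarrow> PU f g (\<lambda>g f. dual_counit e g * bracket f x) = dual_counit e g * bracket f x"
  using T.U_coassoc_counit1[of f z] T.U_coassoc_counit2[of f z] T.U_counit1[of f g x] T.U_counit2[of f g x]
  by (simp_all add: cU_dual_counit cong: fin_comb2_cong[OF T.fDU] fin_comb2_cong[OF T.fPU])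

lemma U_coalgebra: "coalgebra U (dual_comult H m \<Psi> U) (dual_counit e)"
  by (rule coalgebra_bwd[OF U_vsp lin_dual_comult lin_dual_counit, OF separating_U])
    (auto intro: T.U_coassoc U_counits)

lemma U_space: "braided_space U (braid_UU H \<Psi> U)"
  unfolding braided_space_def
  by (intro conjI U_vsp braid_UU_bij(1)[OF UU_bij]
      triple_braid_bwd[OF U_vsp U_vsp U_vsp braid_UU_lin braid_UU_lin braid_UU_lin, OF separating_U separating_U separating_U])
    (auto intro: T.U_braid)

text \<open>Each axiom is tested on evaluations at basis elements of \<open>H\<close>, where it is one of the transposed laws.\<close>

theorem U_bialgebra: "braided_bialgebra U (dual_mult H \<Delta> \<Psi>) (zext H \<epsilon>)
    (dual_comult H m \<Psi> U) (dual_counit e) (braid_UU H \<Psi> U)"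
  unfolding braided_bialgebra_def braided_algebra_def braided_coalgebra_def
proof (intro conjI U_algebra U_space U_coalgebra)
  show "compat_mult1 U (dual_mult H \<Delta> \<Psi>) (zext H \<epsilon>) U (braid_UU H \<Psi> U)"
    by (rule compat_mult1_bwd[OF U_vsp U_vsp lin_dual_mult zext_eps_U braid_UU_lin, OF separating_U separating_U])
      (auto intro: T.U_mult1 T.U_unit1)
  show "compat_mult2 U U (dual_mult H \<Delta> \<Psi>) (zext H \<epsilon>) (braid_UU H \<Psi> U)"
    by (rule compat_mult2_bwd[OF U_vsp U_vsp lin_dual_mult zext_eps_U braid_UU_lin, OF separating_U separating_U])
      (auto intro: T.U_mult2 T.U_unit2)
  show "compat_comult1 U (dual_comult H m \<Psi> U) (dual_counit e) U (braid_UU H \<Psi> U)"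
    by (rule compat_comult1_bwd[OF U_vsp U_vsp lin_dual_comult lin_dual_counit braid_UU_lin, OF separating_U separating_U])
      (auto intro: T.U_comult1 U_counits)
  show "compat_comult2 U U (dual_comult H m \<Psi> U) (dual_counit e) (braid_UU H \<Psi> U)"
    by (rule compat_comult2_bwd[OF U_vsp U_vsp lin_dual_comult lin_dual_counit braid_UU_lin, OF separating_U separating_U])
      (auto intro: T.U_comult2 U_counits)
  show "\<forall>t\<in>vset (U \<otimes> U). dual_comult H m \<Psi> U (dual_mult H \<Delta> \<Psi> t) =
      tmap U U (dual_mult H \<Delta> \<Psi>) (dual_mult H \<Delta> \<Psi>) (braidM U U U U (braid_UU H \<Psi> U)
        (tmap (U \<otimes> U) (U \<otimes> U) (dual_comult H m \<Psi> U) (dual_comult H m \<Psi> U) t))"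
    by (rule comult_mult_bwd[OF U_vsp lin_dual_mult lin_dual_comult braid_UU_lin, OF separating_U])
      (auto intro: T.U_comult_mult[OF L'_comult_mult])
qed

end

section \<open>Dual pairings\<close>


lemma tmap_id_comult_coords:
  assumes Z: "coords Z I b E" and v: "vspace V" and d: "lin V (V \<otimes> V) \<Delta>" and t: "t \<in> vset (Z \<otimes> V)"
  shows "(E \<otimes>\<^sub>c crd V \<otimes>\<^sub>c crd V) (tmap Z (V \<otimes> V) id \<Delta> t) k =
    (E \<otimes>\<^sub>c crd V) t (\<lambda>(i, a). comult_op V \<Delta> a (\<lambda>x y. k (i, x, y)))"
  unfolding tmap_coords[OF Z coords_bas[OF v] Z coords_bas2[OF v v] lin_id d t]
  by (rule fin_comb_cong[OF coordsD(4)[OF coords_tensor[OF Z coords_bas[OF v]] t]])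
    (auto simp: comult_op_def split_def coordsD(5)[OF Z])

lemma tmap_comult_id_coords:
  assumes Z: "coords Z I b E" and v: "vspace V" and d: "lin V (V \<otimes> V) \<Delta>" and t: "t \<in> vset (V \<otimes> Z)"
  shows "((crd V \<otimes>\<^sub>c crd V) \<otimes>\<^sub>c E) (tmap (V \<otimes> V) Z \<Delta> id t) k =
    (crd V \<otimes>\<^sub>c E) t (\<lambda>(a, i). comult_op V \<Delta> a (\<lambda>x y. k ((x, y), i)))"
  unfolding tmap_coords[OF coords_bas[OF v] Z coords_bas2[OF v v] Z d lin_id t]
  by (rule fin_comb_cong[OF coordsD(4)[OF coords_tensor[OF coords_bas[OF v] Z] t]])
    (auto simp: comult_op_def split_def coordsD(5)[OF Z])

lemma pairing_square_eval:
  assumes v: "vspace V" "vspace W" and q: "q \<in> bil V W" and T: "T \<in> vset ((V \<otimes> W) \<otimes> (V \<otimes> W))"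
  shows "T (\<lambda>s s'. s q * s' q) =
    ((crd V \<otimes>\<^sub>c crd W) \<otimes>\<^sub>c (crd V \<otimes>\<^sub>c crd W)) T (\<lambda>((f, x), (g, y)). q f x * q g y)"
proof -
  note VW = coords_bas2[OF v]
  have b: "(\<lambda>s s'. s q * s' q) \<in> bil (V \<otimes> W) (V \<otimes> W)"
    by (rule bil_prod[OF vspace_tensor vspace_tensor lin_eval_form lin_eval_form])
  show ?thesis
    unfolding coordsD(6)[OF coords_tensor[OF VW VW] lin_eval_form T, of "\<lambda>s s'. s q * s' q"]
    by (rule fin_comb_cong[OF coordsD(4)[OF coords_tensor[OF VW VW] T]])
      (use b q in \<open>auto simp: tensor_basis_def pure_def[of "V \<otimes> W" "V \<otimes> W"] pure_def[of V W]\<close>)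
qed

context dual_setting
begin

lemma ev_eval:
  assumes "t \<in> vset (U \<otimes> H)" shows "t ev = (crd U \<otimes>\<^sub>c crd H) t (\<lambda>(f, x). bracket f x)"
  unfolding tens_eval[OF U_vsp H_vsp assms ev_bil]
  by (rule fin_comb_cong[OF fin_comb_bas2[OF U_vsp H_vsp assms]]) (auto simp: bracket_def ev_def)

lemma ve_eval:
  assumes "t \<in> vset (H \<otimes> U)" shows "t ve = (crd H \<otimes>\<^sub>c crd U) t (\<lambda>(x, f). bracket f x)"
  unfolding tens_eval[OF H_vsp U_vsp assms ve_bil_U]
  by (rule fin_comb_cong[OF fin_comb_bas2[OF H_vsp U_vsp assms]]) (auto simp: bracket_def ve_def)

lemma ev_square_eval:
  assumes T: "T \<in> vset ((U \<otimes> H) \<otimes> (U \<otimes> H))"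
  shows "T (\<lambda>s s'. pair_UH s * pair_UH s') =
    ((crd U \<otimes>\<^sub>c crd H) \<otimes>\<^sub>c (crd U \<otimes>\<^sub>c crd H)) T (\<lambda>((f, x), (g, y)). bracket f x * bracket g y)"
  unfolding pair_UH_def pairing_square_eval[OF U_vsp H_vsp ev_bil T]
  by (rule fin_comb_cong[OF coordsD(4)[OF coords_tensor[OF coords_bas2[OF U_vsp H_vsp] coords_bas2[OF U_vsp H_vsp]] T]])
    (auto simp: bracket_def ev_def)

lemma ve_square_eval:
  assumes T: "T \<in> vset ((H \<otimes> U) \<otimes> (H \<otimes> U))"
  shows "T (\<lambda>s s'. pair_HU s * pair_HU s') =
    ((crd H \<otimes>\<^sub>c crd U) \<otimes>\<^sub>c (crd H \<otimes>\<^sub>c crd U)) T (\<lambda>((x, f), (y, g)). bracket f x * bracket g y)"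
  unfolding pair_HU_def pairing_square_eval[OF H_vsp U_vsp ve_bil_U T]
  by (rule fin_comb_cong[OF coordsD(4)[OF coords_tensor[OF coords_bas2[OF H_vsp U_vsp] coords_bas2[OF H_vsp U_vsp]] T]])
    (auto simp: bracket_def ve_def)

lemma pair_pure: "f \<in> vset U \<Longrightarrow> x \<in> vset H \<Longrightarrow> pair_UH (pure U H f x) = f x"
  "f \<in> vset U \<Longrightarrow> x \<in> vset H \<Longrightarrow> pair_HU (pure H U x f) = f x"
  using ev_bil ve_bil_U by (auto simp: pair_UH_def pair_HU_def pure_def ev_def ve_def)

lemma nondegenerate_pairings:
  assumes "separates_points U H"
  shows "nondegenerate U H pair_UH" "nondegenerate H U pair_HU"
proof -
  have z: "0 \<in> vset H"
    using vspace_diff[OF H_vsp e_in_H e_in_H] by simp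
  have z': "0 \<in> vset (dual H)"
    using vspace_diff[OF vspace_dual zext_dual[OF eps_lin] zext_dual[OF eps_lin]] by (simp add: fun_eq_iff zero_fun_def fun_diff_def)
  have 1: "f = 0" if "f \<in> vset U" "\<forall>x\<in>vset H. f x = 0" for f
    using that by (intro dual_eqI[OF U_sub z']) auto
  have 2: "x = 0" if x: "x \<in> vset H" "\<forall>f\<in>vset U. f x = 0" for x
  proof (rule ccontr)
    assume "x \<noteq> 0"
    then obtain f where f: "f \<in> vset U" "f x \<noteq> f 0" using assms x z unfolding separates_points_def by blast
    have "f (x - x) = f x - f x" by (rule lin_diff[OF H_vsp dual_lin[OF U_sub[OF f(1)]] x(1) x(1)])
    thus False using f x by simp
  qed
  show "nondegenerate U H pair_UH" "nondegenerate H U pair_HU"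
    using 1 2 by (auto simp: nondegenerate_def pair_pure)
qed

text \<open>An arbitrary function on the basis is the restriction of a functional on \<open>H\<close>, so the test
  functionals \<open>f \<in> H'\<close> in the definition of the mixed braidings amount to arbitrary integrands.\<close>

lemma extend_form: "\<exists>\<phi>\<in>vset (dual H). \<forall>x\<in>B. \<phi> x = k x"
proof
  show "zext H (\<lambda>v. crd H v k) \<in> vset (dual H)"
    by (rule zext_dual[OF coordsD(3)[OF coords_bas[OF H_vsp]]])
  show "\<forall>x\<in>B. zext H (\<lambda>v. crd H v k) x = k x"
    using bas_in[OF H_vsp] by (simp add: zext_def crd_bas[OF H_vsp])
qed

lemma rotated_braid_UH:
  assumes "Psi_UH_bij H \<Psi> U"
  shows "braid_op U H (braid_UH H \<Psi> U) f x (\<lambda>x f. k x * bracket f y) = Q x y (\<lambda>y x. k x * bracket f y)"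
proof (cases "f \<in> A \<and> x \<in> B \<and> y \<in> B")
  case True
  note l = braid_UH_bij(1)[OF assms, unfolded bij_lin_def, THEN conjunct1]
  have f: "f \<in> vset U" and x: "x \<in> vset H" "y \<in> vset H" using True bas_in[OF U_vsp] bas_in[OF H_vsp] by auto
  obtain \<phi> where phi: "\<phi> \<in> vset (dual H)" "\<forall>x\<in>B. \<phi> x = k x" using extend_form by blast
  have p: "pure U H f x \<in> vset (U \<otimes> H)" using f x by (simp add: pure_in_tensor)
  have T: "braid_UH H \<Psi> U (pure U H f x) \<in> vset (H \<otimes> U)" by (rule lin_in[OF l p])
  have "braid_op U H (braid_UH H \<Psi> U) f x (\<lambda>x f. k x * bracket f y) =
      (crd H \<otimes>\<^sub>c crd U) (braid_UH H \<Psi> U (pure U H f x)) (\<lambda>(i, j). ve i \<phi> * ev j y)"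
    using True by (simp add: braid_op_def)
      (rule fin_comb_cong[OF fin_comb_bas2[OF H_vsp U_vsp T]], auto simp: bracket_def ev_def ve_def phi)
  also have "\<dots> = emb_HU H (braid_UH H \<Psi> U (pure U H f x)) (pure (dual H) H \<phi> y)"
    unfolding emb_HU_def by (rule temb_pure[OF H_vsp U_vsp vspace_dual H_vsp T ve_bil ev_bil phi(1) x(2), symmetric])
  also have "\<dots> = dpair (pure (dual H) U \<phi> f) (tinv H \<Psi> (pure H H x y))"
    unfolding braid_UH_bij(2)[OF assms p] Psi_as_transposed_map(2) by (rule transposed_map_pure[OF fam_UH f x(1) phi(1) x(2)])
  also have "\<dots> = braid_form (tinv H \<Psi>) x y \<phi> f"
    unfolding braid_form_def by (rule dpair_pure[OF subsp_dual_dual U_dual phi(1) f lin_in[OF Psi_inv_lin pure_in_tensor[OF x]]])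
  also have "\<dots> = Q x y (\<lambda>x y. \<phi> y * f x)"
    using braid_form_op[OF Psi_inv_lin _ _ phi(1) U_sub[OF f]] True by simp
  also have "\<dots> = Q x y (\<lambda>y x. k x * bracket f y)"
    by (rule L.Q_cong) (simp add: bracket_def True phi)
  finally show ?thesis .
next
  case False
  note l = braid_UH_bij(1)[OF assms, unfolded bij_lin_def, THEN conjunct1]
  note z = fin_comb2_zero[OF fin_comb2_braid_op[OF U_vsp H_vsp l]]
  show ?thesis
  proof (cases "f \<in> A \<and> x \<in> B")
    case True thus ?thesis using False z by (auto simp: bracket_def)
  next
    case f: False
    hence "braid_op U H (braid_UH H \<Psi> U) f x h = 0" for h by (auto simp: braid_op_def)
    thus ?thesis using f by (auto simp: bracket_def)
  qed
qed

lemma rotated_braid_HU: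
  assumes "Psi_HU_bij H \<Psi> U"
  shows "braid_op H U (braid_HU H \<Psi> U) b f (\<lambda>f b. k b * bracket f a) = Q a b (\<lambda>b a. k b * bracket f a)"
proof (cases "f \<in> A \<and> a \<in> B \<and> b \<in> B")
  case True
  note l = braid_HU_bij(1)[OF assms, unfolded bij_lin_def, THEN conjunct1]
  have f: "f \<in> vset U" and x: "a \<in> vset H" "b \<in> vset H" using True bas_in[OF U_vsp] bas_in[OF H_vsp] by auto
  obtain \<phi> where phi: "\<phi> \<in> vset (dual H)" "\<forall>x\<in>B. \<phi> x = k x" using extend_form by blast
  have p: "pure H U b f \<in> vset (H \<otimes> U)" using f x by (simp add: pure_in_tensor)
  have T: "braid_HU H \<Psi> U (pure H U b f) \<in> vset (U \<otimes> H)" by (rule lin_in[OF l p])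
  have "braid_op H U (braid_HU H \<Psi> U) b f (\<lambda>f b. k b * bracket f a) =
      (crd U \<otimes>\<^sub>c crd H) (braid_HU H \<Psi> U (pure H U b f)) (\<lambda>(i, j). ev i a * ve j \<phi>)"
    using True by (simp add: braid_op_def)
      (rule fin_comb_cong[OF fin_comb_bas2[OF U_vsp H_vsp T]], auto simp: bracket_def ev_def ve_def phi)
  also have "\<dots> = emb_UH H (braid_HU H \<Psi> U (pure H U b f)) (pure H (dual H) a \<phi>)"
    unfolding emb_UH_def by (rule temb_pure[OF U_vsp H_vsp H_vsp vspace_dual T ev_bil ve_bil x(1) phi(1), symmetric])
  also have "\<dots> = dpair (pure U (dual H) f \<phi>) (tinv H \<Psi> (pure H H a b))"
    unfolding braid_HU_bij(2)[OF assms p] Psi_as_transposed_map(3) by (rule transposed_map_pure[OF fam_HU x(2) f x(1) phi(1)])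
  also have "\<dots> = braid_form (tinv H \<Psi>) a b f \<phi>"
    unfolding braid_form_def by (rule dpair_pure[OF U_dual subsp_dual_dual f phi(1) lin_in[OF Psi_inv_lin pure_in_tensor[OF x]]])
  also have "\<dots> = Q a b (\<lambda>x y. f y * \<phi> x)"
    using braid_form_op[OF Psi_inv_lin _ _ U_sub[OF f] phi(1)] True by simp
  also have "\<dots> = Q a b (\<lambda>b a. k b * bracket f a)"
    by (rule L.Q_cong) (simp add: bracket_def True phi)
  finally show ?thesis .
next
  case False
  note l = braid_HU_bij(1)[OF assms, unfolded bij_lin_def, THEN conjunct1]
  note z = fin_comb2_zero[OF fin_comb2_braid_op[OF H_vsp U_vsp l]]
  show ?thesis
  proof (cases "f \<in> A \<and> b \<in> B")
    case True thus ?thesis using False z by (auto simp: bracket_def)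
  next
    case f: False
    hence "braid_op H U (braid_HU H \<Psi> U) b f h = 0" for h by (auto simp: braid_op_def)
    thus ?thesis using f by (auto simp: bracket_def)
  qed
qed

end

lemma coords_cong:
  assumes "coords Z I b E" "t \<in> vset Z" "\<And>i. i \<in> I \<Longrightarrow> k i = l i"
  shows "E t k = E t l"
  by (rule fin_comb_cong[OF coordsD(4)[OF assms(1,2)] assms(3)])

context dual_setting_braided
begin

text \<open>In the axioms for \<open>\<Upsilon>\<close> the components in \<open>H\<close> are tested by arbitrary functions and those in \<open>U\<close>
  by evaluations.  In the two pairing equations the evaluation of \<open>\<Upsilon>\<close> produces the factor \<open>\<Psi>\<^sup>-\<^sup>1\<close>
  in the product of \<open>U\<close>, and respectively cancels the factor \<open>\<Psi>\<close> in its coproduct.\<close>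

theorem left_dual_pairing:
  assumes UH: "Psi_UH_bij H \<Psi> U"
  shows "dual_pairing U (dual_mult H \<Delta> \<Psi>) (zext H \<epsilon>)
     (dual_comult H m \<Psi> U) (dual_counit e) (braid_UU H \<Psi> U)
     H m e \<Delta> \<epsilon> \<Psi> (braid_UH H \<Psi> U) pair_UH"
proof -
  let ?\<Upsilon> = "braid_UH H \<Psi> U"
  let ?Y = "braid_op U H ?\<Upsilon>"
  have bij: "bij_lin (U \<otimes> H) (H \<otimes> U) ?\<Upsilon>" by (rule braid_UH_bij(1)[OF UH])
  hence l: "lin (U \<otimes> H) (H \<otimes> U) ?\<Upsilon>" by (simp add: bij_lin_def)
  interpret R: rotated_laws B P Q M u D \<epsilon> A bracket ?Y
    by unfold_locales (use fin_comb2_braid_op[OF U_vsp H_vsp l] rotated_braid_UH[OF UH] in \<open>auto simp: bracket_def[of _ x for x]\<close>)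
  interpret R': rotated_transposed_laws B P Q M' u D' \<epsilon> A bracket PU MU uU DU ?Y
    by unfold_locales (use fin_comb2_braid_op[OF U_vsp H_vsp l] rotated_braid_UH[OF UH] in \<open>auto simp: bracket_def[of _ x for x]\<close>)
  note sH = separating_UNIV[OF coords_bas[OF H_vsp]]
  note U_HH = coords_tensor[OF coords_bas[OF U_vsp] coords_bas2[OF H_vsp H_vsp]]
  show ?thesis
    unfolding dual_pairing_def
  proof (intro conjI U_bialgebra bialg)
    show "left_braided U (braid_UU H \<Psi> U) H ?\<Upsilon>"
      unfolding left_braided_def
      by (intro conjI U_space H_vsp bij triple_braid_bwd[OF U_vsp U_vsp H_vsp braid_UU_lin l l, OF separating_U separating_U sH])
        (auto intro: R'.Y_left_braid)
    have "\<forall>t\<in>vset (U \<otimes> H \<otimes> H).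
        braidL H H U \<Psi> (braidR H U H ?\<Upsilon> (braidL U H H ?\<Upsilon> t)) =
        braidR H U H ?\<Upsilon> (braidL U H H ?\<Upsilon> (braidR U H H \<Psi> t))"
      by (rule triple_braid_bwd[OF U_vsp H_vsp H_vsp l l Psi_lin, OF separating_U sH sH]) (auto intro: R.Y_right_braid)
    thus "right_braided U H \<Psi> ?\<Upsilon>"
      unfolding right_braided_def using H_space U_vsp bij by auto
    show "compat_mult1 U (dual_mult H \<Delta> \<Psi>) (zext H \<epsilon>) H ?\<Upsilon>"
      by (rule compat_mult1_bwd[OF U_vsp H_vsp lin_dual_mult zext_eps_U l, OF separating_U sH])
        (auto intro: R'.Y_mult1 R'.Y_unit1)
    show "compat_mult2 U H m e ?\<Upsilon>"
      by (rule compat_mult2_bwd[OF U_vsp H_vsp m_lin e_in_H l, OF separating_U sH]) (auto intro: R.Y_mult2 R.Y_unit2)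
    have cu: "?Y f a (\<lambda>a f. dual_counit e f * h a) = dual_counit e f * h a" if "f \<in> A" "a \<in> B" for f a h
      using R'.Y_counit1[OF that(2), of f h] that by (simp add: cU_dual_counit cong: R.Y_cong)
    show "compat_comult1 U (dual_comult H m \<Psi> U) (dual_counit e) H ?\<Upsilon>"
      by (rule compat_comult1_bwd[OF U_vsp H_vsp lin_dual_comult lin_dual_counit l, OF separating_U sH])
        (auto intro: R'.Y_comult1 cu)
    show "compat_comult2 U H \<Delta> \<epsilon> ?\<Upsilon>"
      by (rule compat_comult2_bwd[OF U_vsp H_vsp Delta_lin eps_lin l, OF separating_U sH]) (auto intro: R.Y_comult2 R.Y_counit2)
    show "lin (U \<otimes> H) base pair_UH"
      unfolding pair_UH_def[abs_def] by (rule lin_eval_form)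
    show "\<forall>a\<in>vset H. pair_UH (pure U H (zext H \<epsilon>) a) = \<epsilon> a"
      using zext_eps_U by (simp add: pair_pure zext_def)
    show "\<forall>h\<in>vset U. pair_UH (pure U H h e) = dual_counit e h"
      using e_in_H by (simp add: pair_pure dual_counit_def)
    show "\<forall>t\<in>vset ((U \<otimes> U) \<otimes> H). pair_UH (tmap U H (dual_mult H \<Delta> \<Psi>) id t) =
        braidM U U H H ?\<Upsilon> (tmap (U \<otimes> U) (H \<otimes> H) id \<Delta> t) (\<lambda>s s'. pair_UH s * pair_UH s')"
    proof
      fix t assume t: "t \<in> vset ((U \<otimes> U) \<otimes> H)"
      note T = lin_in[OF lin_tmap[OF vspace_tensor H_vsp lin_dual_mult lin_id] t]
      note T' = lin_in[OF lin_tmap[OF vspace_tensor H_vsp lin_id Delta_lin] t]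
      note Br = lin_in[OF lin_braidM[OF U_vsp U_vsp H_vsp H_vsp l] T']
      have "pair_UH (tmap U H (dual_mult H \<Delta> \<Psi>) id t) =
          ((crd U \<otimes>\<^sub>c crd U) \<otimes>\<^sub>c crd H) t (\<lambda>((f, g), x). MU f g (\<lambda>q. bracket q x))"
        unfolding pair_UH_def ev_eval[OF T] tmap_mult1_crd[OF U_vsp H_vsp lin_dual_mult t] by (simp add: split_def)
      also have "\<dots> = ((crd U \<otimes>\<^sub>c crd U) \<otimes>\<^sub>c crd H) t
          (\<lambda>((f, g), x). D x (\<lambda>x y. ?Y g x (\<lambda>x g. bracket f x * bracket g y)))"
        unfolding R.Y T.MU cop_comult_def by (simp add: split_def)
      also have "\<dots> = braidM U U H H ?\<Upsilon> (tmap (U \<otimes> U) (H \<otimes> H) id \<Delta> t) (\<lambda>s s'. pair_UH s * pair_UH s')"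
        unfolding ev_square_eval[OF Br] braidM_crd[OF U_vsp U_vsp H_vsp H_vsp l T']
          tmap_id_comult_coords[OF coords_bas2[OF U_vsp U_vsp] H_vsp Delta_lin t] by (simp add: split_def)
      finally show "pair_UH (tmap U H (dual_mult H \<Delta> \<Psi>) id t) =
        braidM U U H H ?\<Upsilon> (tmap (U \<otimes> U) (H \<otimes> H) id \<Delta> t) (\<lambda>s s'. pair_UH s * pair_UH s')" .
    qed
    show "\<forall>t\<in>vset (U \<otimes> H \<otimes> H). pair_UH (tmap U H id m t) =
        braidM U U H H ?\<Upsilon> (tmap (U \<otimes> U) (H \<otimes> H) (dual_comult H m \<Psi> U) id t) (\<lambda>s s'. pair_UH s * pair_UH s')"
    proof
      fix t assume t: "t \<in> vset (U \<otimes> H \<otimes> H)"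
      note T = lin_in[OF lin_tmap[OF U_vsp vspace_tensor lin_id m_lin] t]
      note T' = lin_in[OF lin_tmap[OF U_vsp vspace_tensor lin_dual_comult lin_id] t]
      note Br = lin_in[OF lin_braidM[OF U_vsp U_vsp H_vsp H_vsp l] T']
      have eq: "M x y (\<lambda>z. bracket f z) = DU f (\<lambda>f g. ?Y g x (\<lambda>x g. bracket f x * bracket g y))"
        if "x \<in> B" "y \<in> B" for f x y
      proof -
        have "DU f (\<lambda>f g. ?Y g x (\<lambda>x g. bracket f x * bracket g y)) = Q x y (\<lambda>y x. M' y x (\<lambda>z. bracket f z))"
          unfolding R.Y by (simp only: T.push_in T.DU_forms)
        thus ?thesis using that by (simp add: op_mult_def L.QP)
      qed
      have "pair_UH (tmap U H id m t) =
          (crd U \<otimes>\<^sub>c crd H \<otimes>\<^sub>c crd H) t (\<lambda>(f, x, y). M x y (\<lambda>z. bracket f z))"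
        unfolding pair_UH_def ev_eval[OF T] tmap_mult2_crd[OF H_vsp U_vsp m_lin t] by (simp add: split_def)
      also have "\<dots> = (crd U \<otimes>\<^sub>c crd H \<otimes>\<^sub>c crd H) t
          (\<lambda>(f, x, y). DU f (\<lambda>f g. ?Y g x (\<lambda>x g. bracket f x * bracket g y)))"
        by (rule coords_cong[OF U_HH t]) (auto simp: eq)
      also have "\<dots> = braidM U U H H ?\<Upsilon> (tmap (U \<otimes> U) (H \<otimes> H) (dual_comult H m \<Psi> U) id t)
          (\<lambda>s s'. pair_UH s * pair_UH s')"
        unfolding ev_square_eval[OF Br] braidM_crd[OF U_vsp U_vsp H_vsp H_vsp l T']
          tmap_comult_id_coords[OF coords_bas2[OF H_vsp H_vsp] U_vsp lin_dual_comult t] by (simp add: split_def)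
      finally show "pair_UH (tmap U H id m t) =
        braidM U U H H ?\<Upsilon> (tmap (U \<otimes> U) (H \<otimes> H) (dual_comult H m \<Psi> U) id t) (\<lambda>s s'. pair_UH s * pair_UH s')" .
    qed
  qed
qed

text \<open>With all tensor products reversed, \<open>\<Psi>\<^bsub>HU\<^esub>\<degree>\<close> satisfies the law that characterizes \<open>\<Psi>\<^bsub>UH\<^esub>\<degree>\<close>, so
  the laws of the mixed braiding apply to the reversed structures.\<close>

theorem right_dual_pairing:
  assumes HU: "Psi_HU_bij H \<Psi> U"
  shows "dual_pairing H m e \<Delta> \<epsilon> \<Psi> U (dual_mult H \<Delta> \<Psi>) (zext H \<epsilon>)
     (dual_comult H m \<Psi> U) (dual_counit e) (braid_UU H \<Psi> U) (braid_HU H \<Psi> U) pair_HU"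
proof -
  let ?\<Upsilon> = "braid_HU H \<Psi> U"
  let ?Y = "braid_op H U ?\<Upsilon>"
  have bij: "bij_lin (H \<otimes> U) (U \<otimes> H) ?\<Upsilon>" by (rule braid_HU_bij(1)[OF HU])
  hence l: "lin (H \<otimes> U) (U \<otimes> H) ?\<Upsilon>" by (simp add: bij_lin_def)
  have fY: "fin_comb2 B A (\<lambda>k. ?Y x f (\<lambda>f x. k x f))" for f x
    by (rule fin_comb2_flip[OF fin_comb2_braid_op[OF H_vsp U_vsp l]])
  interpret FH: braided_laws B "\<lambda>a b k. P b a (\<lambda>x y. k y x)" "\<lambda>a b k. Q b a (\<lambda>x y. k y x)"
    "\<lambda>a b. M b a" u "\<lambda>a k. D a (\<lambda>x y. k y x)" \<epsilon>
    by (rule L.flip_laws)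
  interpret FT: transposed_laws B "\<lambda>a b k. P b a (\<lambda>x y. k y x)" "\<lambda>a b k. Q b a (\<lambda>x y. k y x)"
    "\<lambda>a b. M' b a" u "\<lambda>a k. D' a (\<lambda>x y. k y x)" \<epsilon> A bracket
    "\<lambda>f g k. PU g f (\<lambda>x y. k y x)" "\<lambda>f g. MU g f" uU "\<lambda>f k. DU f (\<lambda>x y. k y x)"
    by (rule T.flip_transposed)
  interpret R: rotated_laws B "\<lambda>a b k. P b a (\<lambda>x y. k y x)" "\<lambda>a b k. Q b a (\<lambda>x y. k y x)"
    "\<lambda>a b. M b a" u "\<lambda>a k. D a (\<lambda>x y. k y x)" \<epsilon> A bracket "\<lambda>f x k. ?Y x f (\<lambda>f x. k x f)"
    by unfold_locales (use fY rotated_braid_HU[OF HU] in \<open>auto simp: bracket_def[of _ x for x]\<close>)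
  interpret R': rotated_transposed_laws B "\<lambda>a b k. P b a (\<lambda>x y. k y x)" "\<lambda>a b k. Q b a (\<lambda>x y. k y x)"
    "\<lambda>a b. M' b a" u "\<lambda>a k. D' a (\<lambda>x y. k y x)" \<epsilon> A bracket
    "\<lambda>f g k. PU g f (\<lambda>x y. k y x)" "\<lambda>f g. MU g f" uU "\<lambda>f k. DU f (\<lambda>x y. k y x)"
    "\<lambda>f x k. ?Y x f (\<lambda>f x. k x f)"
    by unfold_locales (use fY rotated_braid_HU[OF HU] in \<open>auto simp: bracket_def[of _ x for x]\<close>)
  have Y: "?Y b f (\<lambda>f b. k b * bracket f a) = Q a b (\<lambda>b a. k b * bracket f a)" for b f k a by (rule rotated_braid_HU[OF HU])
  note sH = separating_UNIV[OF coords_bas[OF H_vsp]]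
  note HH_U = coords_tensor[OF coords_bas2[OF H_vsp H_vsp] coords_bas[OF U_vsp]]
  show ?thesis
    unfolding dual_pairing_def
  proof (intro conjI U_bialgebra bialg)
    show "left_braided H \<Psi> U ?\<Upsilon>"
      unfolding left_braided_def
    proof (intro conjI H_space U_vsp bij triple_braid_bwd[OF H_vsp H_vsp U_vsp Psi_lin l l, OF sH sH separating_U])
      fix a b f and k1 k2 :: "'h \<Rightarrow> 'k" and k3
      assume "k3 \<in> {\<lambda>f. bracket f x | x. x \<in> B}"
      then obtain z where "k3 = (\<lambda>f. bracket f z)" by blast
      thus "P a b (\<lambda>b a. ?Y a f (\<lambda>f a. ?Y b f (\<lambda>f b. k3 f * (k2 b * k1 a)))) =
          ?Y b f (\<lambda>f b. ?Y a f (\<lambda>f a. P a b (\<lambda>b a. k3 f * (k2 b * k1 a))))"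
        using R.Y_right_braid[where f=f and b=b and d=a and k=k1 and l=k2 and z=z] by (simp only: mult_ac)
    qed
    have "\<forall>t\<in>vset (H \<otimes> U \<otimes> U).
        braidL U U H (braid_UU H \<Psi> U) (braidR U H U ?\<Upsilon> (braidL H U U ?\<Upsilon> t)) =
        braidR U H U ?\<Upsilon> (braidL H U U ?\<Upsilon> (braidR H U U (braid_UU H \<Psi> U) t))"
    proof (rule triple_braid_bwd[OF H_vsp U_vsp U_vsp l l braid_UU_lin, OF sH separating_U separating_U])
      fix a f g and k1 :: "'h \<Rightarrow> 'k" and k2 k3
      assume "k3 \<in> {\<lambda>f. bracket f x | x. x \<in> B}" "k2 \<in> {\<lambda>f. bracket f x | x. x \<in> B}"
      then obtain y z where "k3 = (\<lambda>f. bracket f z)" "k2 = (\<lambda>f. bracket f y)" by blast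
      thus "?Y a f (\<lambda>f a. ?Y a g (\<lambda>g a. PU f g (\<lambda>g f. k3 g * (k2 f * k1 a)))) =
          PU f g (\<lambda>g f. ?Y a g (\<lambda>g a. ?Y a f (\<lambda>f a. k3 g * (k2 f * k1 a))))"
        using R'.Y_left_braid[where f=g and g=f and a=a and k=k1 and x=z and y=y] by (simp only: mult_ac)
    qed
    thus "right_braided H U (braid_UU H \<Psi> U) ?\<Upsilon>"
      unfolding right_braided_def using U_space H_vsp bij by auto
    show "compat_mult1 H m e U ?\<Upsilon>"
    proof (rule compat_mult1_bwd[OF H_vsp U_vsp m_lin e_in_H l, OF sH separating_U])
      fix a b f and k :: "'h \<Rightarrow> 'k" and l assume "l \<in> {\<lambda>f. bracket f x | x. x \<in> B}"
      then obtain z where z: "z \<in> B" "l = (\<lambda>f. bracket f z)" by blast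
      show "M a b (\<lambda>x. ?Y x f (\<lambda>f x. l f * k x)) = ?Y b f (\<lambda>f b. ?Y a f (\<lambda>f a. M a b (\<lambda>x. l f * k x)))"
        unfolding z using R.Y_mult2[where f=f and b=b and d=a and k=k and z=z] by (simp only: mult_ac)
      show "u (\<lambda>x. ?Y x f (\<lambda>f x. l f * k x)) = u (\<lambda>x. l f * k x)"
        unfolding z using R.Y_unit2[OF z(1), where f=f and k=k] by (simp only: mult_ac)
    qed
    show "compat_mult2 H U (dual_mult H \<Delta> \<Psi>) (zext H \<epsilon>) ?\<Upsilon>"
    proof (rule compat_mult2_bwd[OF H_vsp U_vsp lin_dual_mult zext_eps_U l, OF sH separating_U])
      fix a f g and k :: "'h \<Rightarrow> 'k" and l assume a: "a \<in> B" and "l \<in> {\<lambda>f. bracket f x | x. x \<in> B}"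
      then obtain z where z: "z \<in> B" "l = (\<lambda>f. bracket f z)" by blast
      show "MU f g (\<lambda>x. ?Y a x (\<lambda>x a. l x * k a)) = ?Y a f (\<lambda>f a. ?Y a g (\<lambda>g a. MU f g (\<lambda>x. l x * k a)))"
        unfolding z using R'.Y_mult1[where f=g and g=f and a=a and k=k and y=z] by (simp only: mult_ac)
      show "uU (\<lambda>x. ?Y a x (\<lambda>x a. l x * k a)) = uU (\<lambda>x. l x * k a)"
        unfolding z using R'.Y_unit1[OF a z(1), where k=k] by (simp only: mult_ac)
    qed
    show "compat_comult1 H \<Delta> \<epsilon> U ?\<Upsilon>"
    proof (rule compat_comult1_bwd[OF H_vsp U_vsp Delta_lin eps_lin l, OF sH separating_U])
      fix b f k1 and k2 k3 :: "'h \<Rightarrow> 'k" assume "k1 \<in> {\<lambda>f. bracket f x | x. x \<in> B}"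
      then obtain z where "k1 = (\<lambda>f. bracket f z)" by blast
      thus "?Y b f (\<lambda>f b. D b (\<lambda>x y. k1 f * (k2 x * k3 y))) =
          D b (\<lambda>x y. ?Y y f (\<lambda>f y. ?Y x f (\<lambda>f x. k1 f * (k2 x * k3 y))))"
        using R.Y_comult2[where f=f and b=b and k=k3 and l=k2 and z=z] by (simp only: mult_ac)
    next
      fix b f h assume b: "b \<in> B" and "h \<in> {\<lambda>f. bracket f x | x. x \<in> B}"
      then obtain z where "z \<in> B" "h = (\<lambda>f. bracket f z)" by blast
      thus "?Y b f (\<lambda>f b. \<epsilon> b * h f) = \<epsilon> b * h f"
        using R.Y_counit2[OF b, of z f] by simp
    qed
    have cu: "?Y a f (\<lambda>f a. dual_counit e f * h a) = dual_counit e f * h a" if "f \<in> A" "a \<in> B" for f a h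
      using R'.Y_counit1[OF that(2), of f h] that
      by (simp add: cU_dual_counit cong: fin_comb2_cong[OF fin_comb2_braid_op[OF H_vsp U_vsp l]])
    show "compat_comult2 H U (dual_comult H m \<Psi> U) (dual_counit e) ?\<Upsilon>"
    proof (rule compat_comult2_bwd[OF H_vsp U_vsp lin_dual_comult lin_dual_counit l, OF sH separating_U])
      fix a f k1 k2 and k3 :: "'h \<Rightarrow> 'k"
      assume "k1 \<in> {\<lambda>f. bracket f x | x. x \<in> B}" "k2 \<in> {\<lambda>f. bracket f x | x. x \<in> B}"
      then obtain y z where "k1 = (\<lambda>f. bracket f z)" "k2 = (\<lambda>f. bracket f y)" by blast
      thus "?Y a f (\<lambda>f a. DU f (\<lambda>x y. k1 x * (k2 y * k3 a))) =
          DU f (\<lambda>x y. ?Y a x (\<lambda>x a. ?Y a y (\<lambda>y a. k1 x * (k2 y * k3 a))))"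
        using R'.Y_comult1[where f=f and a=a and k=k3 and x=z and y=y] by (simp only: mult_ac)
    qed (rule cu)
    show "lin (H \<otimes> U) base pair_HU"
      unfolding pair_HU_def[abs_def] by (rule lin_eval_form)
    show "\<forall>a\<in>vset U. pair_HU (pure H U e a) = dual_counit e a"
      using e_in_H by (simp add: pair_pure dual_counit_def)
    show "\<forall>h\<in>vset H. pair_HU (pure H U h (zext H \<epsilon>)) = \<epsilon> h"
      using zext_eps_U by (simp add: pair_pure zext_def)
    show "\<forall>t\<in>vset ((H \<otimes> H) \<otimes> U). pair_HU (tmap H U m id t) =
        braidM H H U U ?\<Upsilon> (tmap (H \<otimes> H) (U \<otimes> U) id (dual_comult H m \<Psi> U) t) (\<lambda>s s'. pair_HU s * pair_HU s')"
    proof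
      fix t assume t: "t \<in> vset ((H \<otimes> H) \<otimes> U)"
      note T = lin_in[OF lin_tmap[OF vspace_tensor U_vsp m_lin lin_id] t]
      note T' = lin_in[OF lin_tmap[OF vspace_tensor U_vsp lin_id lin_dual_comult] t]
      note Br = lin_in[OF lin_braidM[OF H_vsp H_vsp U_vsp U_vsp l] T']
      have eq: "M x y (\<lambda>z. bracket f z) = DU f (\<lambda>f g. ?Y y f (\<lambda>f y. bracket f x * bracket g y))"
        if "x \<in> B" "y \<in> B" for f x y
      proof -
        have "?Y y f (\<lambda>f y. bracket f x * bracket g y) = Q x y (\<lambda>y x. bracket g y * bracket f x)" for f g
          using Y[of y f "bracket g" x] by (simp only: mult.commute)
        hence "DU f (\<lambda>f g. ?Y y f (\<lambda>f y. bracket f x * bracket g y)) = DU f (\<lambda>f g. Q x y (\<lambda>y x. bracket g y * bracket f x))"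
          by simp
        also have "\<dots> = Q x y (\<lambda>y x. M' y x (\<lambda>z. bracket f z))"
          by (simp only: T.push_in T.DU_forms)
        finally show ?thesis using that by (simp add: op_mult_def L.QP)
      qed
      have "pair_HU (tmap H U m id t) =
          ((crd H \<otimes>\<^sub>c crd H) \<otimes>\<^sub>c crd U) t (\<lambda>((x, y), f). M x y (\<lambda>z. bracket f z))"
        unfolding pair_HU_def ve_eval[OF T] tmap_mult1_crd[OF H_vsp U_vsp m_lin t] by (simp add: split_def)
      also have "\<dots> = ((crd H \<otimes>\<^sub>c crd H) \<otimes>\<^sub>c crd U) t
          (\<lambda>((x, y), f). DU f (\<lambda>f g. ?Y y f (\<lambda>f y. bracket f x * bracket g y)))"
        by (rule coords_cong[OF HH_U t]) (auto simp: eq)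
      also have "\<dots> = braidM H H U U ?\<Upsilon> (tmap (H \<otimes> H) (U \<otimes> U) id (dual_comult H m \<Psi> U) t)
          (\<lambda>s s'. pair_HU s * pair_HU s')"
        unfolding ve_square_eval[OF Br] braidM_crd[OF H_vsp H_vsp U_vsp U_vsp l T']
          tmap_id_comult_coords[OF coords_bas2[OF H_vsp H_vsp] U_vsp lin_dual_comult t] by (simp add: split_def)
      finally show "pair_HU (tmap H U m id t) =
        braidM H H U U ?\<Upsilon> (tmap (H \<otimes> H) (U \<otimes> U) id (dual_comult H m \<Psi> U) t) (\<lambda>s s'. pair_HU s * pair_HU s')" .
    qed
    show "\<forall>t\<in>vset (H \<otimes> U \<otimes> U). pair_HU (tmap H U id (dual_mult H \<Delta> \<Psi>) t) =
        braidM H H U U ?\<Upsilon> (tmap (H \<otimes> H) (U \<otimes> U) \<Delta> id t) (\<lambda>s s'. pair_HU s * pair_HU s')"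
    proof
      fix t assume t: "t \<in> vset (H \<otimes> U \<otimes> U)"
      note T = lin_in[OF lin_tmap[OF H_vsp vspace_tensor lin_id lin_dual_mult] t]
      note T' = lin_in[OF lin_tmap[OF H_vsp vspace_tensor Delta_lin lin_id] t]
      note Br = lin_in[OF lin_braidM[OF H_vsp H_vsp U_vsp U_vsp l] T']
      have eq: "MU f g (\<lambda>q. bracket q x) = D x (\<lambda>x y. ?Y y f (\<lambda>f y. bracket f x * bracket g y))" for f g x
      proof -
        have "D x (\<lambda>x y. ?Y y f (\<lambda>f y. bracket f x * bracket g y)) = D x (\<lambda>x y. ?Y y f (\<lambda>f y. bracket g y * bracket f x))"
          by (simp only: mult.commute)
        also have "\<dots> = MU f g (\<lambda>q. bracket q x)"
          unfolding Y T.MU cop_comult_def by (simp only: mult.commute)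
        finally show ?thesis by simp
      qed
      have "pair_HU (tmap H U id (dual_mult H \<Delta> \<Psi>) t) =
          (crd H \<otimes>\<^sub>c crd U \<otimes>\<^sub>c crd U) t (\<lambda>(x, f, g). MU f g (\<lambda>q. bracket q x))"
        unfolding pair_HU_def ve_eval[OF T] tmap_mult2_crd[OF U_vsp H_vsp lin_dual_mult t] by (simp add: split_def)
      also have "\<dots> = braidM H H U U ?\<Upsilon> (tmap (H \<otimes> H) (U \<otimes> U) \<Delta> id t) (\<lambda>s s'. pair_HU s * pair_HU s')"
        unfolding ve_square_eval[OF Br] braidM_crd[OF H_vsp H_vsp U_vsp U_vsp l T']
          tmap_comult_id_coords[OF coords_bas2[OF U_vsp U_vsp] H_vsp Delta_lin t] eq by (simp add: split_def)
      finally show "pair_HU (tmap H U id (dual_mult H \<Delta> \<Psi>) t) =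
        braidM H H U U ?\<Upsilon> (tmap (H \<otimes> H) (U \<otimes> U) \<Delta> id t) (\<lambda>s s'. pair_HU s * pair_HU s')" .
    qed
  qed
qed


section \<open>The antipode of the subspace and the duality theorem\<close>

text \<open>\<open>f \<mapsto> f \<circ> S\<close> is the transpose of \<open>S\<close>, which is an antipode for the opposite product and the coopposite
  coproduct.\<close>

theorem U_hopf_algebra:
  assumes hopf: "braided_hopf_algebra H m e \<Delta> \<epsilon> \<Psi> S" and S_U: "\<forall>f\<in>vset U. zext H (f \<circ> S) \<in> vset U"
  shows "braided_hopf_algebra U (dual_mult H \<Delta> \<Psi>) (zext H \<epsilon>)
     (dual_comult H m \<Psi> U) (dual_counit e) (braid_UU H \<Psi> U) (\<lambda>f. zext H (f \<circ> S))"
proof -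
  have lS: "lin H H S" and SL: "\<And>a. a \<in> vset H \<Longrightarrow> m (tmap H H S id (\<Delta> a)) = vscale H (\<epsilon> a) e"
    and SR: "\<And>a. a \<in> vset H \<Longrightarrow> m (tmap H H id S (\<Delta> a)) = vscale H (\<epsilon> a) e"
    using hopf unfolding braided_hopf_algebra_def antipode_def by auto
  define s where "s a h = (if a \<in> B then crd H (S a) h else 0)" for a h
  have Sin: "S x \<in> vset H" if "x \<in> vset H" for x by (rule lin_in[OF lS that])
  have fs: "fin_comb B (s a)" for a
    using coordsD(4)[OF coords_bas[OF H_vsp] Sin[OF bas_in[OF H_vsp]], of a]
    by (cases "a \<in> B") (simp_all add: s_def[abs_def] fin_comb.zero)
  have scale: "crd H (vscale H c e) h = c * u h" for c h
    using coordsD(3)[OF coords_bas[OF H_vsp], of h] e_in_H by (simp add: lin_base_iff)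
  interpret X: antipode_laws B P Q M u D \<epsilon> s
  proof unfold_locales
    show "fin_comb B (s a)" for a by (rule fs)
    show "s a h = 0" if "a \<notin> B" for a h using that by (simp add: s_def)
    fix a h assume a: "a \<in> B"
    note aH = bas_in[OF H_vsp a] and d = lin_in[OF Delta_lin bas_in[OF H_vsp a]]
    have "\<epsilon> a * u h = crd H (m (tmap H H S id (\<Delta> a))) h" by (simp add: SL[OF aH] scale)
    also have "\<dots> = (crd H \<otimes>\<^sub>c crd H) (\<Delta> a) (\<lambda>(x, y). s x (\<lambda>x. M x y h))"
      unfolding mult_crd[OF H_vsp m_lin lin_in[OF lin_tmap[OF H_vsp H_vsp lS lin_id] d]]
        tmap_coords[OF coords_bas[OF H_vsp] coords_bas[OF H_vsp] coords_bas[OF H_vsp] coords_bas[OF H_vsp] lS lin_id d]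
      by (rule fin_comb_cong[OF fin_comb_bas2[OF H_vsp H_vsp d]]) (auto simp: s_def crd_bas[OF H_vsp])
    finally show "D a (\<lambda>x y. s x (\<lambda>x. M x y h)) = \<epsilon> a * u h" using a by (simp add: comult_op_def)
    have "\<epsilon> a * u h = crd H (m (tmap H H id S (\<Delta> a))) h" by (simp add: SR[OF aH] scale)
    also have "\<dots> = (crd H \<otimes>\<^sub>c crd H) (\<Delta> a) (\<lambda>(x, y). s y (\<lambda>y. M x y h))"
      unfolding mult_crd[OF H_vsp m_lin lin_in[OF lin_tmap[OF H_vsp H_vsp lin_id lS] d]]
        tmap_coords[OF coords_bas[OF H_vsp] coords_bas[OF H_vsp] coords_bas[OF H_vsp] coords_bas[OF H_vsp] lin_id lS d]
      by (rule fin_comb_cong[OF fin_comb_bas2[OF H_vsp H_vsp d]]) (auto simp: s_def crd_bas[OF H_vsp])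
    finally show "D a (\<lambda>x y. s y (\<lambda>y. M x y h)) = \<epsilon> a * u h" using a by (simp add: comult_op_def)
  qed
  let ?S = "\<lambda>f. zext H (f \<circ> S)"
  have lSU: "lin U U ?S"
    using S_U by (auto simp: lin_def zext_def fun_eq_iff U_scale fscale_def)
  define sU where "sU f h = (if f \<in> A then crd U (?S f) h else 0)" for f h
  interpret Z: transposed_antipode B P Q M' u D' \<epsilon> A bracket PU MU uU DU s sU
  proof (intro transposed_antipode.intro T.transposed_laws_axioms X.op_cop_antipode transposed_antipode_axioms.intro)
    show "fin_comb A (sU f)" for f
      using coordsD(4)[OF coords_bas[OF U_vsp] lin_in[OF lSU bas_in[OF U_vsp]], of f]
      by (cases "f \<in> A") (simp_all add: sU_def[abs_def] fin_comb.zero)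
    show "sU f (\<lambda>g. bracket g x) = s x (\<lambda>x. bracket f x)" for f x
    proof (cases "f \<in> A \<and> x \<in> B")
      case True
      have "sU f (\<lambda>g. bracket g x) = ?S f x"
        using True crd_U_bracket[OF lin_in[OF lSU bas_in[OF U_vsp]]] by (simp add: sU_def)
      also have "\<dots> = f (S x)" using True bas_in[OF H_vsp] by (simp add: zext_def)
      also have "\<dots> = s x (\<lambda>x. bracket f x)"
        using True crd_H_bracket[OF _ Sin[OF bas_in[OF H_vsp]]] by (simp add: s_def)
      finally show ?thesis .
    next
      case False
      show ?thesis
      proof (cases "f \<in> A")
        case f: True
        thus ?thesis using False fin_comb_zero[OF coordsD(4)[OF coords_bas[OF U_vsp] lin_in[OF lSU bas_in[OF U_vsp f]]]]
          by (simp add: sU_def s_def bracket_def)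
      next
        case f: False
        thus ?thesis using fin_comb_zero[OF fs] by (simp add: sU_def bracket_def)
      qed
    qed
  qed
  have scaleU: "crd U (vscale U c (zext H \<epsilon>)) h = c * uU h" for c h
    using coordsD(3)[OF coords_bas[OF U_vsp], of h] zext_eps_U by (simp add: lin_base_iff)
  note Di = lin_in[OF lin_dual_comult]
  note inR = vspace_closed(2)[OF U_vsp zext_eps_U zext_eps_U]
  have R: "\<forall>f\<in>vset U. \<forall>k. crd U (vscale U (dual_counit e f) (zext H \<epsilon>)) k =
      crd U f (\<lambda>f. dual_counit e f * uU k)"
  proof (intro ballI allI)
    fix f k assume f: "f \<in> vset U"
    have "crd U f (\<lambda>f. uU k * dual_counit e f) = uU k * dual_counit e f"
      unfolding fin_comb_scale[OF coordsD(4)[OF coords_bas[OF U_vsp] f]]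
        coordsD(6)[OF coords_bas[OF U_vsp] lin_dual_counit f, symmetric] ..
    thus "crd U (vscale U (dual_counit e f) (zext H \<epsilon>)) k = crd U f (\<lambda>f. dual_counit e f * uU k)"
      by (simp add: scaleU mult.commute)
  qed
  have L1: "\<forall>f\<in>vset U. \<forall>k. crd U (dual_mult H \<Delta> \<Psi> (tmap U U ?S id (dual_comult H m \<Psi> U f))) k =
      crd U f (\<lambda>f. DU f (\<lambda>d e. sU d (\<lambda>d. MU d e k)))"
  proof (intro ballI allI)
    fix f k assume f: "f \<in> vset U"
    have "crd U (dual_mult H \<Delta> \<Psi> (tmap U U ?S id (dual_comult H m \<Psi> U f))) k =
       (crd U \<otimes>\<^sub>c crd U) (dual_comult H m \<Psi> U f) (\<lambda>(d, e). sU d (\<lambda>d. MU d e k))"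
      unfolding mult_crd[OF U_vsp lin_dual_mult lin_in[OF lin_tmap[OF U_vsp U_vsp lSU lin_id] Di[OF f]]]
        tmap_coords[OF coords_bas[OF U_vsp] coords_bas[OF U_vsp] coords_bas[OF U_vsp] coords_bas[OF U_vsp] lSU lin_id Di[OF f]]
      by (rule fin_comb_cong[OF fin_comb_bas2[OF U_vsp U_vsp Di[OF f]]]) (auto simp: sU_def crd_bas[OF U_vsp])
    thus "crd U (dual_mult H \<Delta> \<Psi> (tmap U U ?S id (dual_comult H m \<Psi> U f))) k =
      crd U f (\<lambda>f. DU f (\<lambda>d e. sU d (\<lambda>d. MU d e k)))"
      unfolding comult_crd[OF U_vsp lin_dual_comult f] by simp
  qed
  have L2: "\<forall>f\<in>vset U. \<forall>k. crd U (dual_mult H \<Delta> \<Psi> (tmap U U id ?S (dual_comult H m \<Psi> U f))) k =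
      crd U f (\<lambda>f. DU f (\<lambda>d e. sU e (\<lambda>e. MU d e k)))"
  proof (intro ballI allI)
    fix f k assume f: "f \<in> vset U"
    have "crd U (dual_mult H \<Delta> \<Psi> (tmap U U id ?S (dual_comult H m \<Psi> U f))) k =
       (crd U \<otimes>\<^sub>c crd U) (dual_comult H m \<Psi> U f) (\<lambda>(d, e). sU e (\<lambda>e. MU d e k))"
      unfolding mult_crd[OF U_vsp lin_dual_mult lin_in[OF lin_tmap[OF U_vsp U_vsp lin_id lSU] Di[OF f]]]
        tmap_coords[OF coords_bas[OF U_vsp] coords_bas[OF U_vsp] coords_bas[OF U_vsp] coords_bas[OF U_vsp] lin_id lSU Di[OF f]]
      by (rule fin_comb_cong[OF fin_comb_bas2[OF U_vsp U_vsp Di[OF f]]]) (auto simp: sU_def crd_bas[OF U_vsp])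
    thus "crd U (dual_mult H \<Delta> \<Psi> (tmap U U id ?S (dual_comult H m \<Psi> U f))) k =
      crd U f (\<lambda>f. DU f (\<lambda>d e. sU e (\<lambda>e. MU d e k)))"
      unfolding comult_crd[OF U_vsp lin_dual_comult f] by simp
  qed
  have m1: "\<forall>f\<in>vset U. dual_mult H \<Delta> \<Psi> (tmap U U ?S id (dual_comult H m \<Psi> U f)) \<in> vset U"
    using lin_in[OF lin_dual_mult lin_in[OF lin_tmap[OF U_vsp U_vsp lSU lin_id] Di]] by blast
  have m2: "\<forall>f\<in>vset U. dual_mult H \<Delta> \<Psi> (tmap U U id ?S (dual_comult H m \<Psi> U f)) \<in> vset U"
    using lin_in[OF lin_dual_mult lin_in[OF lin_tmap[OF U_vsp U_vsp lin_id lSU] Di]] by blast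
  have m3: "\<forall>f\<in>vset U. vscale U (dual_counit e f) (zext H \<epsilon>) \<in> vset U" using inR by blast
  have "\<forall>f\<in>vset U. dual_mult H \<Delta> \<Psi> (tmap U U ?S id (dual_comult H m \<Psi> U f)) = vscale U (dual_counit e f) (zext H \<epsilon>)"
    by (rule coords_eq_bwd[OF coords_bas[OF U_vsp] separating_U, OF m1 m3 L1 R])
      (auto simp: Z.U_antipode1 cU_dual_counit)
  moreover have "\<forall>f\<in>vset U. dual_mult H \<Delta> \<Psi> (tmap U U id ?S (dual_comult H m \<Psi> U f)) = vscale U (dual_counit e f) (zext H \<epsilon>)"
    by (rule coords_eq_bwd[OF coords_bas[OF U_vsp] separating_U, OF m2 m3 L2 R])
      (auto simp: Z.U_antipode2 cU_dual_counit)
  ultimately show ?thesis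
    using U_bialgebra lSU unfolding braided_hopf_algebra_def antipode_def by blast
qed

end

theorem theorem4p5:
  fixes H :: "('k::field, 'h::ab_group_add) vsp"
    and U :: "('k, 'h \<Rightarrow> 'k) vsp"
  assumes "braided_bialgebra H m e \<Delta> \<epsilon> \<Psi>"
    and "subsp U (dual H)"
    and "separates_points U H"
    and "unital_subalgebra_dual H \<Delta> \<epsilon> \<Psi> U"
    and "subcoalgebra_H_circ H m e \<Psi> U"
  shows
    "(Psi_UU_bij H \<Psi> U \<and> Psi_UH_bij H \<Psi> U \<longrightarrow>
       braided_bialgebra U (dual_mult H \<Delta> \<Psi>) (zext H \<epsilon>)
         (dual_comult H m \<Psi> U) (dual_counit e) (braid_UU H \<Psi> U) \<and>
       dual_pairing U (dual_mult H \<Delta> \<Psi>) (zext H \<epsilon>)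
         (dual_comult H m \<Psi> U) (dual_counit e) (braid_UU H \<Psi> U)
         H m e \<Delta> \<epsilon> \<Psi> (braid_UH H \<Psi> U) pair_UH \<and>
       nondegenerate U H pair_UH)
    \<and> (Psi_UU_bij H \<Psi> U \<and> Psi_HU_bij H \<Psi> U \<longrightarrow>
       braided_bialgebra U (dual_mult H \<Delta> \<Psi>) (zext H \<epsilon>)
         (dual_comult H m \<Psi> U) (dual_counit e) (braid_UU H \<Psi> U) \<and>
       dual_pairing H m e \<Delta> \<epsilon> \<Psi>
         U (dual_mult H \<Delta> \<Psi>) (zext H \<epsilon>)
         (dual_comult H m \<Psi> U) (dual_counit e) (braid_UU H \<Psi> U)
         (braid_HU H \<Psi> U) pair_HU \<and>
       nondegenerate H U pair_HU)
    \<and> (\<forall>S. Psi_UU_bij H \<Psi> U \<and> (Psi_UH_bij H \<Psi> U \<or> Psi_HU_bij H \<Psi> U) \<and>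
       braided_hopf_algebra H m e \<Delta> \<epsilon> \<Psi> S \<and> (\<forall>f\<in>vset U. zext H (f \<circ> S) \<in> vset U) \<longrightarrow>
       braided_hopf_algebra U (dual_mult H \<Delta> \<Psi>) (zext H \<epsilon>)
         (dual_comult H m \<Psi> U) (dual_counit e) (braid_UU H \<Psi> U) (\<lambda>f. zext H (f \<circ> S)))"
proof -
  have s: "dual_setting H m e \<Delta> \<epsilon> \<Psi> U"
    using assms by unfold_locales (auto simp: subcoalgebra_H_circ_def)
  have b: "dual_setting_braided H m e \<Delta> \<epsilon> \<Psi> U" if "Psi_UU_bij H \<Psi> U"
    by (intro dual_setting_braided.intro s dual_setting_braided_axioms.intro that)
  note nondeg = dual_setting.nondegenerate_pairings[OF s assms(3)]
  show ?thesis
    using nondeg dual_setting_braided.U_bialgebra[OF b] dual_setting_braided.left_dual_pairing[OF b]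
      dual_setting_braided.right_dual_pairing[OF b] dual_setting_braided.U_hopf_algebra[OF b]
    by blast
qed

end
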